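(* Let $\gamma>3/4$ and let $q$ be a real-valued function on $(0,\infty)$ with $|q(t)|\lesssim t^{-\gamma}$. For $k\in\mathbb{R}$ let $\psi(t,\theta,k)$ be the solution of $$\psi_t=ik\psi_{\theta\theta}+iq(t)\cos(\theta)\psi,\qquad \psi(0,\theta,k)=1,\qquad \theta\in\mathbb{T}.$$ Then: 1. For a.e. $k$, $$\sup_{t>0}\|\psi(t,\theta,k)\|_{H^s(\mathbb{T})}<\infty,\quad s\in\mathbb{Z}^+,$$ and $\psi(t,\theta,k)$ is real analytic in $\theta$ for any $t$. 2. For any finite interval $(a,b)$ not containing zero, and any $s\ge1$, $$\sup_{t>0}\|\psi(t,\theta,k)\|^2_{H^{s/2}(\mathbb{T})}\in L^{2/s}((a,b),dk).$$ 3. If $S_N(T,k)=\|P_{|n|\ge N}\psi(T,\theta,k)\|^2_{L^2(\mathbb{T})}$, $N>1$, then $$\|S_N(T,k)\|_{L^p(\mathbb{R},dk)}\lesssim N^{-2+2p^{-1}}\left(\int_0^T|q(t)|dt\right)^{2-2/p}\left(\int_0^Tq^2(\tau)d\tau\right)^{1/p},\qquad 2\le p\le\infty.$$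
   Context: $\mathbb{T}=\mathbb{R}/2\pi\mathbb{Z}$. $P_{|n|\ge N}$ is the orthogonal projection in $L^2(\mathbb{T})$ onto the closed span of $e^{in\theta}$, $|n|\ge N$. For nonnegative $f_1,f_2$, $f_1\lesssim f_2$ means $f_1\le Cf_2$ for some constant $C$; in part 3 $C$ does not depend on $N$ and $T$. Here $q$ is locally integrable on $[0,\infty)$ and solutions are understood in the weak (Duhamel) sense: $\psi(t)=e^{ikt\partial_\theta^2}1+i\int_0^te^{ik(t-\tau)\partial_\theta^2}q(\tau)\cos(\theta)\psi(\tau)d\tau$ in $L^2(\mathbb{T})$. *)

theory Defs
  imports "HOL-Analysis.Analysis" "HOL-Probability.Essential_Supremum"
begin

section \<open>The space \<open>L\<^sup>2\<close> of the circle\<close>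

text \<open>
  Functions on the circle are \<open>2\<pi>\<close>-periodic functions on the real line.  There is no quotient by
  a.e. equality: elements of \<open>L\<^sup>2\<close> are represented by functions, and equality in \<open>L\<^sup>2\<close> is written
  as equality a.e.
\<close>

definition L2T :: "(real \<Rightarrow> complex) set" where
  "L2T = {f. f \<in> borel_measurable lebesgue \<and> (\<forall>\<theta>. f (\<theta> + 2 * pi) = f \<theta>) \<and>
             set_integrable lebesgue {0..2 * pi} (\<lambda>\<theta>. (cmod (f \<theta>))\<^sup>2)}"

definition L2T_inner :: "(real \<Rightarrow> complex) \<Rightarrow> (real \<Rightarrow> complex) \<Rightarrow> complex" where
  "L2T_inner f g = (LINT \<theta>:{0..2 * pi}|lebesgue. f \<theta> * cnj (g \<theta>))"

definition L2T_norm :: "(real \<Rightarrow> complex) \<Rightarrow> real" where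
  "L2T_norm f = sqrt (LINT \<theta>:{0..2 * pi}|lebesgue. (cmod (f \<theta>))\<^sup>2)"

definition fourier_coeff :: "(real \<Rightarrow> complex) \<Rightarrow> int \<Rightarrow> complex" where
  "fourier_coeff f n = (LINT \<theta>:{0..2 * pi}|lebesgue. f \<theta> * cis (- of_int n * \<theta>)) / (2 * pi)"

text \<open>The closed span of the \<open>e\<^sup>i\<^sup>n\<^sup>\<theta>\<close>, \<open>n \<in> A\<close>, and the orthogonal projection onto a closed subspace
  (determined up to a.e. equality).\<close>

definition trig_closed_span :: "int set \<Rightarrow> (real \<Rightarrow> complex) set" where
  "trig_closed_span A = {f \<in> L2T. \<forall>\<epsilon>>0. \<exists>F c. finite F \<and> F \<subseteq> A \<and>
     L2T_norm (\<lambda>\<theta>. f \<theta> - (\<Sum>n\<in>F. c n * cis (of_int n * \<theta>))) < \<epsilon>}"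

definition L2T_proj :: "(real \<Rightarrow> complex) set \<Rightarrow> (real \<Rightarrow> complex) \<Rightarrow> real \<Rightarrow> complex" where
  "L2T_proj V f = (SOME g. g \<in> V \<and> (\<forall>h\<in>V. L2T_inner (\<lambda>\<theta>. f \<theta> - g \<theta>) h = 0))"

definition high_freq_proj :: "nat \<Rightarrow> (real \<Rightarrow> complex) \<Rightarrow> real \<Rightarrow> complex" where
  "high_freq_proj N = L2T_proj (trig_closed_span {n. \<bar>n\<bar> \<ge> int N})"

section \<open>Mild solutions\<close>

text \<open>The unitary group \<open>e\<^sup>i\<^sup>r\<^sup>\<Delta>\<close>, \<open>\<Delta> = \<partial>\<^sub>\<theta>\<^sup>2\<close>, as the Fourier multiplier \<open>e\<^sup>-\<^sup>i\<^sup>r\<^sup>n\<^sup>2\<close>.  For \<open>f \<in> L\<^sup>2\<close> the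
  function chosen exists by the Riesz--Fischer theorem and is unique up to a.e. equality.\<close>

definition free_evol :: "real \<Rightarrow> (real \<Rightarrow> complex) \<Rightarrow> real \<Rightarrow> complex" where
  "free_evol r f = (SOME g. g \<in> L2T \<and>
     (\<forall>n. fourier_coeff g n = cis (- r * (of_int n)\<^sup>2) * fourier_coeff f n))"

text \<open>Integral of an \<open>L\<^sup>2\<close>-valued function \<open>F\<close> over \<open>S\<close>.  As \<open>L\<^sup>2\<close> of the circle is separable, weak
  measurability is strong measurability (Pettis), so with the integrability of the norm this is
  the Bochner integral.\<close>

definition has_L2T_integral ::
    "(real \<Rightarrow> real \<Rightarrow> complex) \<Rightarrow> real set \<Rightarrow> (real \<Rightarrow> complex) \<Rightarrow> bool" where
  "has_L2T_integral F S I \<longleftrightarrow>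
     I \<in> L2T \<and> (\<forall>\<tau>\<in>S. F \<tau> \<in> L2T) \<and>
     set_integrable lebesgue S (\<lambda>\<tau>. L2T_norm (F \<tau>)) \<and>
     (\<forall>\<phi>\<in>L2T. set_integrable lebesgue S (\<lambda>\<tau>. L2T_inner (F \<tau>) \<phi>) \<and>
        L2T_inner I \<phi> = (LINT \<tau>:S|lebesgue. L2T_inner (F \<tau>) \<phi>))"

text \<open>\<open>u t \<theta>\<close> solves \<open>u\<^sub>t = i k u\<^sub>\<theta>\<^sub>\<theta> + i q(t) cos(\<theta>) u\<close>, \<open>u(0) = 1\<close>, in the Duhamel sense, and is
  continuous in time with values in \<open>L\<^sup>2\<close>.\<close>

definition mild_solution :: "(real \<Rightarrow> real) \<Rightarrow> real \<Rightarrow> (real \<Rightarrow> real \<Rightarrow> complex) \<Rightarrow> bool" where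
  "mild_solution q k u \<longleftrightarrow>
     (\<forall>t\<ge>0. u t \<in> L2T) \<and>
     (\<forall>t\<ge>0. ((\<lambda>s. L2T_norm (\<lambda>\<theta>. u s \<theta> - u t \<theta>)) \<longlongrightarrow> 0) (at t within {0..})) \<and>
     (\<forall>t\<ge>0. \<exists>I.
        has_L2T_integral
          (\<lambda>\<tau>. free_evol (k * (t - \<tau>))
                 (\<lambda>\<theta>. complex_of_real (q \<tau> * cos \<theta>) * u \<tau> \<theta>)) {0..t} I \<and>
        (AE \<theta> in lebesgue. u t \<theta> = free_evol (k * t) (\<lambda>_. 1) \<theta> + \<i> * I \<theta>))"

section \<open>Norms with values in the extended nonnegative reals\<close>

text \<open>Powers with exponent \<open>a \<ge> 0\<close>, with \<open>x\<^sup>0 = 1\<close> also for \<open>x = 0\<close> and \<open>x = \<infinity>\<close> (unlike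
  \<open>0 powr 0 = 0\<close>).\<close>

definition ennpow :: "ennreal \<Rightarrow> real \<Rightarrow> ennreal" where
  "ennpow x a = (if a = 0 then 1 else if x = \<infinity> then \<infinity> else ennreal (enn2real x powr a))"

definition sobolev_norm :: "real \<Rightarrow> (real \<Rightarrow> complex) \<Rightarrow> ennreal" where
  "sobolev_norm s f = ennpow (\<Sum>\<^sub>\<infinity>n::int\<in>UNIV.
     ennreal ((1 + (of_int n)\<^sup>2) powr s * (cmod (fourier_coeff f n))\<^sup>2)) (1 / 2)"

text \<open>The \<open>L\<^sup>p\<close> norm for \<open>0 < p \<le> \<infinity>\<close> (a quasi-norm if \<open>p < 1\<close>) of a nonnegative function; like
  \<^const>\<open>esssup\<close> it is \<open>\<infinity>\<close> for non-measurable functions, so that it is finite iff the function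
  belongs to \<open>L\<^sup>p\<close>.\<close>

definition Lp_norm :: "'a measure \<Rightarrow> ennreal \<Rightarrow> ('a \<Rightarrow> ennreal) \<Rightarrow> ennreal" where
  "Lp_norm M p f =
     (if f \<notin> borel_measurable M then \<infinity>
      else if p = \<infinity> then esssup M f
      else ennpow (\<integral>\<^sup>+x. ennpow (f x) (enn2real p) \<partial>M) (1 / enn2real p))"

section \<open>Real analyticity\<close>

definition real_analytic :: "(real \<Rightarrow> complex) \<Rightarrow> bool" where
  "real_analytic g \<longleftrightarrow> (\<forall>x. \<exists>r>0. \<exists>a::nat \<Rightarrow> complex. \<forall>y. \<bar>y - x\<bar> < r \<longrightarrow>
     (\<lambda>n. a n * complex_of_real (y - x) ^ n) sums g y)"

end

theory Submission
  imports Defs "HOL-Complex_Analysis.Complex_Analysis" "HOL-Probability.Probability" "HOL-Real_Asymp.Real_Asymp"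
begin

text \<open>
  Expanded in Fourier modes, \<open>\<psi> = \<Sum>\<^sub>n c\<^sub>n(t) e\<^sup>i\<^sup>n\<^sup>\<theta>\<close>, the equation becomes an infinite system in which the
  potential couples neighbouring frequencies only.  The amplitudes \<open>a\<^sub>n = exp(i k n\<^sup>2 t) c\<^sub>n\<close> satisfy
  \<open>a\<^sub>n' = (i q / 2) (e\<^sup>i\<^sup>k\<^sup>(\<^sup>2\<^sup>n\<^sup>-\<^sup>1\<^sup>)\<^sup>t a\<^sub>n\<^sub>-\<^sub>1 + e\<^sup>-\<^sup>i\<^sup>k\<^sup>(\<^sup>2\<^sup>n\<^sup>+\<^sup>1\<^sup>)\<^sup>t a\<^sub>n\<^sub>+\<^sub>1)\<close>, \<open>a\<^sub>n(0) = \<delta>\<^sub>n\<^sub>0\<close>.  Picard iteration gives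
  \<open>|c\<^sub>n(t)| \<lesssim> (\<integral>|q|)\<^sup>|\<^sup>n\<^sup>|\<^sup>-\<^sup>1 / (|n| - 1)!\<close> (\<open>coeff_decay\<close>); so \<open>\<psi>\<close> is analytic in \<open>\<theta>\<close> for every \<open>k\<close>, and
  \<open>\<Sum>|c\<^sub>n|\<^sup>2 = 1\<close> is conserved (\<open>square_sum_conserved\<close>).

  \<^bold>\<open>The bound on the high-frequency mass\<close> interpolates between \<open>L\<^sup>\<infinity>\<close> and \<open>L\<^sup>1\<close> in \<open>k\<close>.  The energy
  \<open>\<Sum> min(|n|, N)\<^sup>2 |c\<^sub>n|\<^sup>2\<close> starts at \<open>0\<close> and grows at the rate of at most \<open>2 |q|\<close> times its square root,
  so the mass beyond \<open>N\<close> is \<open>O(N\<^sup>-\<^sup>2 (\<integral>|q|)\<^sup>2)\<close> for each \<open>k\<close> (\<open>high_freq_bound\<close>).  On the other hand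
  it is at most \<open>1 - |c\<^sub>0|\<^sup>2 \<le> 2 (1 - Re c\<^sub>0)\<close>, a linear quantity, whose integral over all \<open>k\<close> is at most
  \<open>\<pi> \<integral>q\<^sup>2\<close> (\<open>vacuum_L1\<close>).  To see this, average over \<open>k\<close> with the Cauchy kernel \<open>y\<^sup>2 / (y\<^sup>2 + k\<^sup>2)\<close>: as a
  function of \<open>k\<close> every Picard iterate is a superposition of phases \<open>e\<^sup>-\<^sup>i\<^sup>k\<^sup>l\<close> with \<open>l \<ge> 0\<close>, and the
  kernel turns \<open>e\<^sup>-\<^sup>i\<^sup>k\<^sup>l\<close> into \<open>\<pi> y e\<^sup>-\<^sup>y\<^sup>l\<close>.  The average of the Schroedinger evolution is thus a heat
  evolution with diffusivity \<open>y\<close>.  As \<open>y\<close> grows it stays near the constant function \<open>1\<close>, with an error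
  of the order \<open>1/y\<close> that the factor \<open>\<pi> y\<close> turns into \<open>\<pi> \<integral>q\<^sup>2\<close>.

  \<^bold>\<open>The Sobolev bounds\<close> compare the weighted energy \<open>E\<close> with weights \<open>min(|n| + 1, M + 1)\<^sup>m\<close>, its
  maximum being written as \<open>X\<^sup>m\<close>, with \<open>X\<^sup>m\<^sup>-\<^sup>1\<close>.  Estimating \<open>E'\<close> by absolute values gives
  \<open>X \<lesssim> 1 + \<integral>|q|\<close> (\<open>penergy_growth\<close>), which may diverge in time.  Integrating by parts with the
  oscillating integrals \<open>Q\<^sub>n(t) = \<integral>\<^sub>t\<^sup>R q(s) e\<^sup>i\<^sup>k\<^sup>(\<^sup>2\<^sup>n\<^sup>-\<^sup>1\<^sup>)\<^sup>s ds\<close> replaces \<open>\<integral>|q|\<close> by \<open>\<integral>|q| |Q|\<close>,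
  \<open>|Q|\<^sup>2 = \<Sum>|Q\<^sub>n|\<^sup>2\<close> (\<open>penergy_oscillation_bound\<close>).  For \<open>k\<close> in a dyadic shell, Plancherel's theorem and
  the change of variable \<open>k \<mapsto> (2n-1) k\<close> bound the integral of \<open>|Q(t)|\<^sup>2\<close> over \<open>k\<close> by
  \<open>\<integral>\<^sub>t\<^sup>\<infinity> q\<^sup>2 = O(t\<^sup>1\<^sup>-\<^sup>2\<^sup>\<gamma>)\<close>; after a weighted Cauchy--Schwarz inequality the square of \<open>\<integral>|q| |Q|\<close> over
  \<open>[2\<^sup>j, \<infinity>)\<close> has a \<open>k\<close>-integral \<open>O(2\<^sup>j\<^sup>(\<^sup>3\<^sup>-\<^sup>4\<^sup>\<gamma>\<^sup>))\<close>, small precisely because \<open>\<gamma> > 3/4\<close>.  Up to the time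
  \<open>2\<^sup>j\<close>, where \<open>2\<^sup>-\<^sup>j\<close> is the size of \<open>k\<close>, the crude bound is used.  Summation over the shells produces a
  function \<open>Z\<close> of \<open>k\<close>, integrable on bounded sets, such that \<open>\<surd>(Z + 1)\<close> bounds the relevant frequencies
  for all times (\<open>uniform_frequency_bound\<close>).  Finiteness of \<open>Z\<close> a.e. gives the pointwise bounds, and its
  integrability gives the \<open>L\<^sup>2\<^sup>/\<^sup>s\<close> bounds.

  All integrals by parts are carried out for functions that are indefinite integrals, which
  covers potentials that are merely integrable.
\<close>

section \<open>Square integrable functions on the circle\<close>

abbreviation circ :: "real measure" where
  "circ \<equiv> lebesgue_on {0..2 * pi}"

lemma set_integral_circ:
  fixes f :: "real \<Rightarrow> 'a::{banach,second_countable_topology}"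
  shows "set_integrable lebesgue {0..2 * pi} f \<longleftrightarrow> integrable circ f"
    and "(LINT x:{0..2 * pi}|lebesgue. f x) = (LINT x|circ. f x)"
  by (simp_all add: set_integrable_def set_lebesgue_integral_def integrable_restrict_space
      integral_restrict_space)

lemma emeasure_circ: "emeasure circ {0..2 * pi} = ennreal (2 * pi)"
  by (simp add: emeasure_restrict_space)

lemma finite_measure_circ: "finite_measure circ"
  by (rule finite_measureI) (simp add: emeasure_circ)

lemma measurable_circI: "f \<in> borel_measurable borel \<Longrightarrow> f \<in> borel_measurable circ"
  by (intro measurable_restrict_space1 measurable_completion) simp

text \<open>The fundamental domain carries all of \<open>L\<^sup>2\<close>; differences, products with bounded functions and limits
  are formed there, where periodicity need not be carried along.\<close>

definition sqint :: "(real \<Rightarrow> complex) \<Rightarrow> bool" where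
  "sqint f \<longleftrightarrow> f \<in> borel_measurable circ \<and> integrable circ (\<lambda>x. (cmod (f x))\<^sup>2)"

lemma L2T_sqint: "f \<in> L2T \<Longrightarrow> sqint f"
  by (simp add: L2T_def sqint_def set_integral_circ measurable_restrict_space1)

lemma L2T_I:
  assumes "f \<in> borel_measurable borel" "\<And>\<theta>. f (\<theta> + 2 * pi) = f \<theta>" "sqint f"
  shows "f \<in> L2T"
  using assms by (auto simp: L2T_def sqint_def set_integral_circ intro: measurable_completion)

lemma norm_sq_sum_le: "(cmod (a + b))\<^sup>2 \<le> 2 * (cmod a)\<^sup>2 + 2 * (cmod b)\<^sup>2"
proof -
  have "(cmod (a + b))\<^sup>2 \<le> (cmod a + cmod b)\<^sup>2"
    by (intro power_mono norm_triangle_ineq) simp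
  also have "\<dots> \<le> 2 * (cmod a)\<^sup>2 + 2 * (cmod b)\<^sup>2"
    using sum_squares_bound[of "cmod a" "cmod b"] by (simp add: power2_sum)
  finally show ?thesis .
qed

lemma sqint_add:
  assumes f: "sqint f" and g: "sqint g"
  shows "sqint (\<lambda>x. f x + g x)"
  unfolding sqint_def
proof
  show [measurable]: "(\<lambda>x. f x + g x) \<in> borel_measurable circ"
    using f g by (auto simp: sqint_def)
  show "integrable circ (\<lambda>x. (cmod (f x + g x))\<^sup>2)"
  proof (rule Bochner_Integration.integrable_bound)
    show "integrable circ (\<lambda>x. 2 * (cmod (f x))\<^sup>2 + 2 * (cmod (g x))\<^sup>2)"
      using f g by (auto simp: sqint_def)
  qed (use norm_sq_sum_le in auto)
qed

lemma sqint_mult_bounded: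
  assumes f: "sqint f" and [measurable]: "b \<in> borel_measurable circ" and b: "\<And>x. cmod (b x) \<le> B"
  shows "sqint (\<lambda>x. b x * f x)"
  unfolding sqint_def
proof
  have [measurable]: "f \<in> borel_measurable circ" using f by (simp add: sqint_def)
  show "(\<lambda>x. b x * f x) \<in> borel_measurable circ"
    by measurable
  show "integrable circ (\<lambda>x. (cmod (b x * f x))\<^sup>2)"
  proof (rule Bochner_Integration.integrable_bound)
    show "integrable circ (\<lambda>x. B\<^sup>2 * (cmod (f x))\<^sup>2)"
      using f by (auto simp: sqint_def)
    have "(cmod (b x * f x))\<^sup>2 \<le> B\<^sup>2 * (cmod (f x))\<^sup>2" for x
      unfolding norm_mult power_mult_distrib
      by (intro mult_right_mono power_mono b) auto
    then show "AE x in circ. norm ((cmod (b x * f x))\<^sup>2) \<le> norm (B\<^sup>2 * (cmod (f x))\<^sup>2)"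
      by simp
  qed measurable
qed

lemma sqint_cmult: "sqint f \<Longrightarrow> sqint (\<lambda>x. c * f x)"
  by (rule sqint_mult_bounded[where B = "cmod c"]) auto

lemma sqint_const: "sqint (\<lambda>x. c)"
  using finite_measure.integrable_const[OF finite_measure_circ] by (simp add: sqint_def)

lemma sqint_diff: "sqint f \<Longrightarrow> sqint g \<Longrightarrow> sqint (\<lambda>x. f x - g x)"
  using sqint_add[of f "\<lambda>x. -1 * g x"] sqint_cmult[of g "-1"] by simp

lemma measurable_cis [measurable]: "(\<lambda>x. cis (a * x)) \<in> borel_measurable borel"
  by (intro borel_measurable_continuous_onI continuous_intros)

lemma sqint_cis: "sqint (\<lambda>x. cis (a * x))"
  using sqint_mult_bounded[OF sqint_const[of 1] measurable_circI[OF measurable_cis], where B=1]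
  by simp

lemma sqint_sum: "(\<And>i. i \<in> F \<Longrightarrow> sqint (f i)) \<Longrightarrow> sqint (\<lambda>x. \<Sum>i\<in>F. f i x)"
  by (induction F rule: infinite_finite_induct) (auto intro: sqint_add simp: sqint_const)

lemma L2T_norm_sq: "(L2T_norm f)\<^sup>2 = (LINT x|circ. (cmod (f x))\<^sup>2)"
  unfolding L2T_norm_def set_integral_circ by simp

lemma L2T_norm_nonneg: "0 \<le> L2T_norm f"
  by (simp add: L2T_norm_def set_integral_circ)

lemma nn_integral_sqint:
  "sqint f \<Longrightarrow> (\<integral>\<^sup>+x. ennreal ((cmod (f x))\<^sup>2) \<partial>circ) = ennreal ((L2T_norm f)\<^sup>2)"
  unfolding L2T_norm_sq by (subst nn_integral_eq_integral) (auto simp: sqint_def)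

lemma measurable_cnj [measurable]: "cnj \<in> borel_measurable borel"
  by (intro borel_measurable_continuous_onI continuous_intros)

lemma sqint_product_integrable:
  assumes f: "sqint f" and g: "sqint g"
  shows "integrable circ (\<lambda>x. f x * cnj (g x))"
proof (rule Bochner_Integration.integrable_bound)
  have [measurable]: "f \<in> borel_measurable circ" "g \<in> borel_measurable circ"
    using f g by (auto simp: sqint_def)
  show "integrable circ (\<lambda>x. (cmod (f x))\<^sup>2 + (cmod (g x))\<^sup>2)"
    using f g by (auto simp: sqint_def)
  show "(\<lambda>x. f x * cnj (g x)) \<in> borel_measurable circ"
    by measurable
  have "cmod a * cmod b \<le> (cmod a)\<^sup>2 + (cmod b)\<^sup>2" for a b
    using sum_squares_bound[of "cmod a" "cmod b"] mult_nonneg_nonneg[of "cmod a" "cmod b"]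
    by (simp del: mult_nonneg_nonneg)
  then show "AE x in circ. norm (f x * cnj (g x)) \<le> norm ((cmod (f x))\<^sup>2 + (cmod (g x))\<^sup>2)"
    by (simp add: norm_mult)
qed

lemma sqint_integrable: "sqint f \<Longrightarrow> integrable circ f"
  using sqint_product_integrable[of f "\<lambda>_. 1"] sqint_const by simp

lemma L2T_inner_circ: "L2T_inner f g = (LINT x|circ. f x * cnj (g x))"
  by (simp add: L2T_inner_def set_integral_circ)

lemma L2T_inner_diff_left:
  "sqint f \<Longrightarrow> sqint g \<Longrightarrow> sqint h \<Longrightarrow>
    L2T_inner (\<lambda>x. f x - g x) h = L2T_inner f h - L2T_inner g h"
  unfolding L2T_inner_circ
  by (simp add: left_diff_distrib sqint_product_integrable Bochner_Integration.integral_diff)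

lemma L2T_inner_diff_right:
  "sqint f \<Longrightarrow> sqint g \<Longrightarrow> sqint h \<Longrightarrow>
    L2T_inner h (\<lambda>x. f x - g x) = L2T_inner h f - L2T_inner h g"
  unfolding L2T_inner_circ
  by (simp add: right_diff_distrib sqint_product_integrable Bochner_Integration.integral_diff)

lemma L2T_Cauchy_Schwarz:
  assumes f: "sqint f" and g: "sqint g"
  shows "cmod (L2T_inner f g) \<le> L2T_norm f * L2T_norm g"
proof -
  have [measurable]: "f \<in> borel_measurable circ" "g \<in> borel_measurable circ"
    using f g by (auto simp: sqint_def)
  have int: "integrable circ (\<lambda>x. cmod (f x) * cmod (g x))"
    using integrable_norm[OF sqint_product_integrable[OF f g]] by (simp add: norm_mult)
  define J where "J = (LINT x|circ. cmod (f x) * cmod (g x))"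
  have J0: "0 \<le> J" unfolding J_def by simp
  have J: "(\<integral>\<^sup>+x. ennreal (cmod (f x)) * ennreal (cmod (g x)) \<partial>circ) = ennreal J"
    unfolding J_def using int by (subst nn_integral_eq_integral[symmetric]) (auto simp: ennreal_mult)
  have "(\<integral>\<^sup>+x. ennreal (cmod (f x)) * ennreal (cmod (g x)) \<partial>circ)\<^sup>2
      \<le> (\<integral>\<^sup>+x. (ennreal (cmod (f x)))\<^sup>2 \<partial>circ) * (\<integral>\<^sup>+x. (ennreal (cmod (g x)))\<^sup>2 \<partial>circ)"
    by (rule Cauchy_Schwarz_nn_integral) measurable
  then have "(ennreal J)\<^sup>2 \<le> ennreal ((L2T_norm f)\<^sup>2) * ennreal ((L2T_norm g)\<^sup>2)"
    unfolding J by (simp add: ennreal_power nn_integral_sqint f g)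
  then have "J\<^sup>2 \<le> (L2T_norm f * L2T_norm g)\<^sup>2"
    by (simp add: ennreal_power J0 power_mult_distrib flip: ennreal_mult)
  then have "J \<le> L2T_norm f * L2T_norm g"
    by (rule power2_le_imp_le) (simp add: L2T_norm_nonneg)
  moreover have "cmod (L2T_inner f g) \<le> J"
    unfolding L2T_inner_circ J_def
    using integral_norm_bound[of circ "\<lambda>x. f x * cnj (g x)"] by (simp add: norm_mult)
  ultimately show ?thesis by simp
qed

section \<open>Fourier coefficients\<close>

lemma fourier_coeff_inner: "fourier_coeff f n = L2T_inner f (\<lambda>\<theta>. cis (of_int n * \<theta>)) / (2 * pi)"
  by (simp add: fourier_coeff_def L2T_inner_def cis_cnj)

lemma fourier_coeff_diff:
  "sqint f \<Longrightarrow> sqint g \<Longrightarrow>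
    fourier_coeff (\<lambda>x. f x - g x) n = fourier_coeff f n - fourier_coeff g n"
  by (simp add: fourier_coeff_inner L2T_inner_diff_left sqint_cis diff_divide_distrib)

lemma fourier_coeff_add:
  "sqint f \<Longrightarrow> sqint g \<Longrightarrow>
    fourier_coeff (\<lambda>x. f x + g x) n = fourier_coeff f n + fourier_coeff g n"
  unfolding fourier_coeff_inner L2T_inner_circ
  by (simp add: distrib_right sqint_product_integrable Bochner_Integration.integral_add sqint_cis
      add_divide_distrib)

lemma fourier_coeff_cmult:
  "fourier_coeff (\<lambda>x. c * f x) n = c * fourier_coeff f n"
  unfolding fourier_coeff_inner L2T_inner_circ by (simp add: mult.assoc)

lemma fourier_coeff_sum:
  assumes "\<And>i. i \<in> F \<Longrightarrow> sqint (f i)"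
  shows "fourier_coeff (\<lambda>x. \<Sum>i\<in>F. f i x) n = (\<Sum>i\<in>F. fourier_coeff (f i) n)"
  using assms
proof (induction F rule: infinite_finite_induct)
  case (insert x F)
  then show ?case by (simp add: fourier_coeff_add sqint_sum)
qed (simp_all add: fourier_coeff_def)

lemma fourier_coeff_cong_AE:
  assumes "AE \<theta> in lebesgue. f \<theta> = g \<theta>" "f \<in> borel_measurable lebesgue" "g \<in> borel_measurable lebesgue"
  shows "fourier_coeff f n = fourier_coeff g n"
proof -
  note [measurable] = measurable_restrict_space1[OF assms(2), of "{0..2*pi}"]
    measurable_restrict_space1[OF assms(3), of "{0..2*pi}"]
    measurable_circI[OF measurable_cis]
  have meas: "(\<lambda>\<theta>. f \<theta> * cis (- of_int n * \<theta>)) \<in> borel_measurable circ"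
      "(\<lambda>\<theta>. g \<theta> * cis (- of_int n * \<theta>)) \<in> borel_measurable circ"
    by measurable
  have "AE x in circ. f x = g x"
    using assms(1) by (subst AE_restrict_space_iff) auto
  then have "(LINT \<theta>|circ. f \<theta> * cis (- of_int n * \<theta>)) = (LINT \<theta>|circ. g \<theta> * cis (- of_int n * \<theta>))"
    by (intro integral_cong_AE) (use meas in \<open>auto elim: eventually_mono\<close>)
  then show ?thesis by (simp only: fourier_coeff_def set_integral_circ)
qed

lemma integral_cis_period:
  assumes "j \<noteq> 0"
  shows "(LINT x|circ. cis (of_int j * x)) = 0"
proof -
  have der: "((\<lambda>x. cis (of_int j * x) / (\<i> * of_int j)) has_vector_derivative cis (of_int j * x))
      (at x within {0..2*pi})" for x
  proof -
    have "((\<lambda>z. exp (\<i> * of_int j * z) / (\<i> * of_int j)) has_field_derivative exp (\<i> * of_int j * of_real x))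
        (at (of_real x))"
      using assms by (auto intro!: derivative_eq_intros)
    from has_vector_derivative_real_field[OF this] show ?thesis
      by (simp add: cis_conv_exp mult.assoc)
  qed
  have "((\<lambda>x. cis (of_int j * x)) has_integral
      (cis (of_int j * (2 * pi)) / (\<i> * of_int j) - cis (of_int j * 0) / (\<i> * of_int j))) {0..2*pi}"
    by (rule fundamental_theorem_of_calculus) (use der in auto)
  moreover have "cis (of_int j * (2 * pi)) = 1"
    using cis_multiple_2pi[of "of_int j"] by (simp add: mult.commute)
  ultimately have "((\<lambda>x. cis (of_int j * x)) has_integral 0) {0..2*pi}"
    by simp
  then show ?thesis
    using lebesgue_integral_eq_integral[OF sqint_integrable[OF sqint_cis[of "of_int j"]]]
    by (simp add: integral_unique)
qed

lemma fourier_coeff_cis: "fourier_coeff (\<lambda>\<theta>. cis (of_int m * \<theta>)) n = (if m = n then 1 else 0)"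
proof -
  have "cis (of_int m * x) * cis (- of_int n * x) = cis (of_int (m - n) * x)" for x
    by (simp add: cis_mult algebra_simps)
  then have "fourier_coeff (\<lambda>\<theta>. cis (of_int m * \<theta>)) n = (LINT x|circ. cis (of_int (m - n) * x)) / (2 * pi)"
    by (simp only: fourier_coeff_def set_integral_circ)
  also have "\<dots> = (if m = n then 1 else 0)"
    using integral_cis_period[of "m - n"] emeasure_circ
    by (auto simp: measure_def scaleR_conv_of_real simp del: of_int_diff)
  finally show ?thesis .
qed

lemma fourier_coeff_bound:
  assumes "sqint f"
  shows "cmod (fourier_coeff f n) \<le> L2T_norm f / sqrt (2 * pi)"
proof -
  have "(L2T_norm (\<lambda>\<theta>. cis (of_int n * \<theta>)))\<^sup>2 = 2 * pi"
    unfolding L2T_norm_sq using emeasure_circ by (simp add: measure_def)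
  then have "L2T_norm (\<lambda>\<theta>. cis (of_int n * \<theta>)) = sqrt (2 * pi)"
    by (metis L2T_norm_nonneg real_sqrt_unique)
  then have "cmod (fourier_coeff f n) \<le> L2T_norm f * sqrt (2 * pi) / (2 * pi)"
    unfolding fourier_coeff_inner
    using L2T_Cauchy_Schwarz[OF assms sqint_cis[of "of_int n"]] by (simp add: norm_divide divide_right_mono)
  also have "\<dots> = L2T_norm f / sqrt (2 * pi)"
    by (simp add: field_simps flip: power2_eq_square)
  finally show ?thesis .
qed

lemma fourier_coeff_trig_sum:
  assumes "finite F"
  shows "fourier_coeff (\<lambda>\<theta>. \<Sum>n\<in>F. c n * cis (of_int n * \<theta>)) m = (if m \<in> F then c m else 0)"
proof -
  have "fourier_coeff (\<lambda>\<theta>. \<Sum>n\<in>F. c n * cis (of_int n * \<theta>)) m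
      = (\<Sum>n\<in>F. if n = m then c m else 0)"
    by (subst fourier_coeff_sum)
      (auto intro!: sqint_cmult sqint_cis sum.cong simp: fourier_coeff_cmult fourier_coeff_cis)
  then show ?thesis using assms by simp
qed

text \<open>The expansion of the square behind both Bessel's inequality (take \<open>c\<^sub>n\<close> to be the coefficients) and
  Parseval's identity.\<close>

lemma L2T_norm_minus_trig_sum:
  assumes "finite F" and f: "sqint f"
  shows "(L2T_norm (\<lambda>\<theta>. f \<theta> - (\<Sum>n\<in>F. c n * cis (of_int n * \<theta>))))\<^sup>2
    = (L2T_norm f)\<^sup>2 + 2 * pi * (\<Sum>n\<in>F. (cmod (c n))\<^sup>2 - 2 * Re (cnj (c n) * fourier_coeff f n))"
  using assms(1)
proof (induction F)
  case (insert m F)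
  define h where "h = (\<lambda>\<theta>. f \<theta> - (\<Sum>n\<in>F. c n * cis (of_int n * \<theta>)))"
  have h: "sqint h"
    unfolding h_def by (intro sqint_diff f sqint_sum sqint_cmult sqint_cis)
  have "fourier_coeff h m = fourier_coeff f m"
    unfolding h_def using insert
    by (subst fourier_coeff_diff)
      (auto intro!: f sqint_sum sqint_cmult sqint_cis simp: fourier_coeff_trig_sum)
  then have hm: "(LINT x|circ. h x * cnj (cis (of_int m * x))) = 2 * pi * fourier_coeff f m"
    by (simp add: fourier_coeff_inner L2T_inner_circ)
  have I1: "integrable circ (\<lambda>x. h x * cnj (cis (of_int m * x)))"
    by (intro sqint_product_integrable h sqint_cis)
  have I2: "integrable circ (\<lambda>x. Re (cnj (c m) * (h x * cnj (cis (of_int m * x)))))"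
    by (intro integrable_bounded_linear[OF bounded_linear_Re] integrable_mult_right I1)
  have eq: "(cmod (h x - c m * cis (of_int m * x)))\<^sup>2
      = (cmod (h x))\<^sup>2 + (cmod (c m))\<^sup>2 - 2 * Re (cnj (c m) * (h x * cnj (cis (of_int m * x))))" for x
  proof -
    have 1: "(cmod (u - v))\<^sup>2 = (cmod u)\<^sup>2 + (cmod v)\<^sup>2 - 2 * Re (u * cnj v)" for u v :: complex
      unfolding cmod_power2 by (simp add: power2_eq_square algebra_simps)
    show ?thesis by (simp only: 1 norm_mult norm_cis) (simp add: mult_ac)
  qed
  have "(L2T_norm (\<lambda>\<theta>. h \<theta> - c m * cis (of_int m * \<theta>)))\<^sup>2
     = (LINT x|circ. (cmod (h x))\<^sup>2 + (cmod (c m))\<^sup>2 - 2 * Re (cnj (c m) * (h x * cnj (cis (of_int m * x)))))"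
    unfolding L2T_norm_sq eq ..
  also have "\<dots> = (LINT x|circ. (cmod (h x))\<^sup>2) + (LINT x|circ. (cmod (c m))\<^sup>2)
      - 2 * (LINT x|circ. Re (cnj (c m) * (h x * cnj (cis (of_int m * x)))))"
  proof -
    have split: "(LINT x|circ. u x + k - 2 * w x) = (LINT x|circ. u x) + (LINT x|circ. k) - 2 * (LINT x|circ. w x)"
      if "integrable circ u" "integrable circ w" for u w :: "real \<Rightarrow> real" and k
      using that finite_measure.integrable_const[OF finite_measure_circ] by simp
    show ?thesis
      by (rule split) (use h I2 in \<open>simp_all only: sqint_def\<close>)
  qed
  also have "(LINT x|circ. Re (cnj (c m) * (h x * cnj (cis (of_int m * x))))) = Re (cnj (c m) * (2 * pi * fourier_coeff f m))"
    using hm integral_bounded_linear[OF bounded_linear_Re integrable_mult_right[OF I1, of "cnj (c m)"]]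
    by simp
  also have "(LINT x|circ. (cmod (c m))\<^sup>2) = 2 * pi * (cmod (c m))\<^sup>2"
    using emeasure_circ by (simp add: measure_def)
  finally have *: "(L2T_norm (\<lambda>\<theta>. h \<theta> - c m * cis (of_int m * \<theta>)))\<^sup>2 = (L2T_norm h)\<^sup>2
      + 2 * pi * ((cmod (c m))\<^sup>2 - 2 * Re (cnj (c m) * fourier_coeff f m))"
    by (simp add: L2T_norm_sq algebra_simps)
  have "(\<lambda>\<theta>. f \<theta> - (\<Sum>n\<in>insert m F. c n * cis (of_int n * \<theta>))) = (\<lambda>\<theta>. h \<theta> - c m * cis (of_int m * \<theta>))"
    using insert by (auto simp: h_def)
  then show ?case
    using insert * by (simp add: h_def distrib_left)
qed simp

lemma L2T_norm_zero: "L2T_norm (\<lambda>_. 0) = 0"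
  by (simp add: L2T_norm_def)

lemma L2T_norm_trig_sum:
  assumes "finite F"
  shows "(L2T_norm (\<lambda>\<theta>. \<Sum>n\<in>F. c n * cis (of_int n * \<theta>)))\<^sup>2 = 2 * pi * (\<Sum>n\<in>F. (cmod (c n))\<^sup>2)"
proof -
  have "(L2T_norm (\<lambda>\<theta>. 0 - (\<Sum>n\<in>F. c n * cis (of_int n * \<theta>))))\<^sup>2 = 2 * pi * (\<Sum>n\<in>F. (cmod (c n))\<^sup>2)"
    using L2T_norm_minus_trig_sum[OF assms sqint_const[of 0], of c]
    by (simp add: L2T_norm_zero fourier_coeff_def)
  then show ?thesis by (simp add: L2T_norm_sq)
qed

lemma L2T_Bessel:
  assumes "finite F" "sqint f"
  shows "2 * pi * (\<Sum>n\<in>F. (cmod (fourier_coeff f n))\<^sup>2) \<le> (L2T_norm f)\<^sup>2"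
proof -
  have sq: "(cmod z)\<^sup>2 - 2 * Re (cnj z * z) = - (cmod z)\<^sup>2" for z
    unfolding cmod_power2 by (simp add: power2_eq_square)
  have "0 \<le> (L2T_norm (\<lambda>\<theta>. f \<theta> - (\<Sum>n\<in>F. fourier_coeff f n * cis (of_int n * \<theta>))))\<^sup>2" by simp
  also have "\<dots> = (L2T_norm f)\<^sup>2 - 2 * pi * (\<Sum>n\<in>F. (cmod (fourier_coeff f n))\<^sup>2)"
    unfolding L2T_norm_minus_trig_sum[OF assms] sq sum_negf by simp
  finally show ?thesis by simp
qed

lemma Cauchy_dominating_subsequence:
  fixes \<sigma> :: "nat \<Rightarrow> real"
  assumes "Cauchy \<sigma>"
  obtains r :: "nat \<Rightarrow> nat" where "mono r" "\<And>j m n. m \<ge> r j \<Longrightarrow> n \<ge> r j \<Longrightarrow> \<bar>\<sigma> m - \<sigma> n\<bar> < (1 / 4) ^ j"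
proof -
  have "\<exists>N. \<forall>m\<ge>N. \<forall>n\<ge>N. \<bar>\<sigma> m - \<sigma> n\<bar> < (1 / 4) ^ j" for j :: nat
    using metric_CauchyD[OF assms, of "(1 / 4) ^ j"] by (auto simp: dist_real_def)
  then obtain r0 where r0: "\<And>j m n. m \<ge> r0 j \<Longrightarrow> n \<ge> r0 j \<Longrightarrow> \<bar>\<sigma> m - \<sigma> n\<bar> < (1 / 4) ^ j"
    by metis
  define r where "r j = (\<Sum>i\<le>j. r0 i)" for j
  have "mono r" by (intro monoI) (auto simp: r_def intro!: sum_mono2)
  moreover have "r0 j \<le> r j" for j
    unfolding r_def by (rule member_le_sum) auto
  ultimately show ?thesis using r0 that[of r] by (meson order_trans)
qed

text \<open>Completeness: along partial sums chosen so that the tails of the square sum decay like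
  \<open>4\<^sup>-\<^sup>j\<close>, the weighted increments \<open>2\<^sup>j |d\<^sub>j|\<^sup>2\<close> have a finite integral, so the partial sums
  converge a.e.; Fatou's lemma then turns the limit into an \<open>L\<^sup>2\<close> limit.\<close>

theorem Riesz_Fischer:
  fixes c :: "int \<Rightarrow> complex"
  assumes bound: "\<And>F. finite F \<Longrightarrow> (\<Sum>n\<in>F. (cmod (c n))\<^sup>2) \<le> B"
  obtains g where "g \<in> L2T"
    "(\<lambda>N. L2T_norm (\<lambda>\<theta>. g \<theta> - (\<Sum>n\<in>{-int N..int N}. c n * cis (of_int n * \<theta>)))) \<longlonglongrightarrow> 0"
proof -
  define s where "s N \<theta> = (\<Sum>n\<in>{-int N..int N}. c n * cis (of_int n * \<theta>))" for N :: nat and \<theta>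
  define \<sigma> where "\<sigma> N = (\<Sum>n\<in>{-int N..int N}. (cmod (c n))\<^sup>2)" for N :: nat
  have "incseq \<sigma>"
    unfolding \<sigma>_def by (intro monoI sum_mono2) auto
  then have "convergent \<sigma>"
    by (rule incseq_convergent[of _ B]) (auto simp: \<sigma>_def intro: bound convergentI)
  then have "Cauchy \<sigma>" by (rule convergent_Cauchy)
  then obtain r where r: "mono r"
    "\<And>j m n. m \<ge> r j \<Longrightarrow> n \<ge> r j \<Longrightarrow> \<bar>\<sigma> m - \<sigma> n\<bar> < (1 / 4) ^ j"
    using Cauchy_dominating_subsequence[OF \<open>Cauchy \<sigma>\<close>] by blast
  have [measurable]: "s N \<in> borel_measurable borel" for N
    unfolding s_def[abs_def] by measurable
  then have [measurable]: "s N \<in> borel_measurable circ" for N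
    by (rule measurable_circI)
  have sq_s: "sqint (s N)" for N
    unfolding s_def[abs_def] by (intro sqint_sum sqint_cmult sqint_cis)
  have s_diff: "(L2T_norm (\<lambda>\<theta>. s M \<theta> - s N \<theta>))\<^sup>2 = 2 * pi * \<bar>\<sigma> M - \<sigma> N\<bar>" for M N
  proof -
    have *: "(L2T_norm (\<lambda>\<theta>. s M \<theta> - s N \<theta>))\<^sup>2 = 2 * pi * (\<sigma> M - \<sigma> N)" if "N \<le> M" for M N
    proof -
      have sub: "{-int N..int N} \<subseteq> {-int M..int M}" using that by auto
      have eq: "(\<lambda>\<theta>. s M \<theta> - s N \<theta>)
          = (\<lambda>\<theta>. \<Sum>n\<in>{-int M..int M} - {-int N..int N}. c n * cis (of_int n * \<theta>))"
        unfolding s_def by (simp add: sum_diff[OF _ sub])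
      show ?thesis
        unfolding eq by (subst L2T_norm_trig_sum) (auto simp: \<sigma>_def sum_diff[OF _ sub])
    qed
    have sym: "L2T_norm (\<lambda>\<theta>. s M \<theta> - s N \<theta>) = L2T_norm (\<lambda>\<theta>. s N \<theta> - s M \<theta>)"
      by (simp add: L2T_norm_def norm_minus_commute)
    have mono: "N \<le> M \<Longrightarrow> \<sigma> N \<le> \<sigma> M" for M N using \<open>incseq \<sigma>\<close> by (rule monoD)
    show ?thesis
    proof (cases "N \<le> M")
      case True then show ?thesis using * mono by simp
    next
      case False then show ?thesis using *[of M N] mono[of M N] sym by simp
    qed
  qed
  define d where "d j \<theta> = s (r (Suc j)) \<theta> - s (r j) \<theta>" for j \<theta>
  have [measurable]: "d j \<in> borel_measurable circ" for j unfolding d_def by measurable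
  have sq_d: "sqint (d j)" for j
    unfolding d_def[abs_def] by (intro sqint_diff sq_s)
  have norm_d: "(L2T_norm (d j))\<^sup>2 = 2 * pi * \<bar>\<sigma> (r (Suc j)) - \<sigma> (r j)\<bar>" for j
    unfolding d_def[abs_def] by (rule s_diff)
  have d_int: "(\<integral>\<^sup>+x. ennreal (2 ^ j * (cmod (d j x))\<^sup>2) \<partial>circ) \<le> ennreal (2 * pi * (1 / 2) ^ j)" for j
  proof -
    have "\<bar>\<sigma> (r (Suc j)) - \<sigma> (r j)\<bar> \<le> (1 / 4) ^ j"
      using r(2)[of j "r (Suc j)" "r j"] monoD[OF r(1), of j "Suc j"] by simp
    then have "2 ^ j * (2 * pi * \<bar>\<sigma> (r (Suc j)) - \<sigma> (r j)\<bar>) \<le> 2 ^ j * (2 * pi * (1 / 4) ^ j)"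
      by (intro mult_left_mono) auto
    also have "\<dots> = 2 * pi * (2 * (1 / 4)) ^ j"
      unfolding power_mult_distrib by simp
    finally have *: "2 ^ j * (2 * pi * \<bar>\<sigma> (r (Suc j)) - \<sigma> (r j)\<bar>) \<le> 2 * pi * (1 / 2) ^ j" by simp
    have "(\<integral>\<^sup>+x. ennreal (K * (cmod (d j x))\<^sup>2) \<partial>circ)
        = ennreal K * ennreal ((L2T_norm (d j))\<^sup>2)" if "K \<ge> 0" for K
      unfolding nn_integral_sqint[OF sq_d, symmetric] ennreal_mult'[OF that]
      by (rule nn_integral_cmult) measurable
    also have "ennreal K * ennreal ((L2T_norm (d j))\<^sup>2) = ennreal (K * (L2T_norm (d j))\<^sup>2)" if "K \<ge> 0" for K
      using ennreal_mult'[OF that] by simp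
    finally have "(\<integral>\<^sup>+x. ennreal (2 ^ j * (cmod (d j x))\<^sup>2) \<partial>circ)
        = ennreal (2 ^ j * (2 * pi * \<bar>\<sigma> (r (Suc j)) - \<sigma> (r j)\<bar>))"
      unfolding norm_d[symmetric] by simp
    also have "\<dots> \<le> ennreal (2 * pi * (1 / 2) ^ j)"
      using * by (rule ennreal_leI)
    finally show ?thesis .
  qed
  have "(\<integral>\<^sup>+x. (\<Sum>j. ennreal (2 ^ j * (cmod (d j x))\<^sup>2)) \<partial>circ)
      = (\<Sum>j. \<integral>\<^sup>+x. ennreal (2 ^ j * (cmod (d j x))\<^sup>2) \<partial>circ)"
    by (rule nn_integral_suminf) measurable
  also have "\<dots> \<le> (\<Sum>j. ennreal (2 * pi * (1 / 2) ^ j))"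
    by (intro suminf_le d_int) auto
  also have "\<dots> < \<top>"
    by (subst suminf_ennreal2) (auto intro!: summable_mult summable_geometric)
  finally have "AE x in circ. (\<Sum>j. ennreal (2 ^ j * (cmod (d j x))\<^sup>2)) \<noteq> \<infinity>"
    by (intro nn_integral_noteq_infinite) auto
  then have conv: "AE x in circ. convergent (\<lambda>j. s (r j) x)"
  proof (rule AE_mp, intro AE_I2 impI)
    fix x assume "(\<Sum>j. ennreal (2 ^ j * (cmod (d j x))\<^sup>2)) \<noteq> \<infinity>"
    then have "summable (\<lambda>j. 2 ^ j * (cmod (d j x))\<^sup>2)"
      by (intro summable_suminf_not_top) auto
    then have "(\<lambda>j. 2 ^ j * (cmod (d j x))\<^sup>2) \<longlonglongrightarrow> 0" by (rule summable_LIMSEQ_zero)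
    then have "\<forall>\<^sub>F j in sequentially. 2 ^ j * (cmod (d j x))\<^sup>2 < 1"
      by (rule order_tendstoD) simp
    then have "\<forall>\<^sub>F j in sequentially. norm (d j x) \<le> (1 / sqrt 2) ^ j"
    proof (rule eventually_mono)
      fix j assume "2 ^ j * (cmod (d j x))\<^sup>2 < 1"
      have sq2: "(sqrt 2 ^ j)\<^sup>2 = 2 ^ j"
        by (metis mult.commute power_mult real_sqrt_pow2 zero_le_numeral)
      from \<open>2 ^ j * (cmod (d j x))\<^sup>2 < 1\<close>
      have "(sqrt 2 ^ j * cmod (d j x))\<^sup>2 \<le> 1\<^sup>2"
        by (simp add: power_mult_distrib sq2)
      then have "sqrt 2 ^ j * cmod (d j x) \<le> 1"
        by (rule power2_le_imp_le) simp
      then show "norm (d j x) \<le> (1 / sqrt 2) ^ j"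
        by (simp add: power_divide field_simps)
    qed
    then have "summable (\<lambda>j. d j x)"
      by (rule summable_comparison_test_ev) (auto intro!: summable_geometric)
    then have "convergent (\<lambda>m. \<Sum>j<m. d j x)"
      by (simp add: summable_iff_convergent)
    moreover have "(\<Sum>j<m. d j x) = s (r m) x - s (r 0) x" for m
      unfolding d_def by (rule sum_lessThan_telescope)
    ultimately have "convergent (\<lambda>m. s (r m) x - s (r 0) x)" by simp
    from convergent_add[OF this convergent_const[of "s (r 0) x"]]
    show "convergent (\<lambda>j. s (r j) x)" by simp
  qed
  define g where "g \<theta> = lim (\<lambda>j. s (r j) \<theta>)" for \<theta>
  have [measurable]: "g \<in> borel_measurable borel"
    unfolding g_def by (rule borel_measurable_lim_metric) measurable
  then have [measurable]: "g \<in> borel_measurable circ"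
    by (rule measurable_circI)
  have tail: "(\<integral>\<^sup>+x. ennreal ((cmod (g x - s N x))\<^sup>2) \<partial>circ) \<le> ennreal (2 * pi * (1 / 4) ^ i)"
    if "N \<ge> r i" for N i
  proof -
    have "(\<integral>\<^sup>+x. ennreal ((cmod (g x - s N x))\<^sup>2) \<partial>circ)
        = (\<integral>\<^sup>+x. liminf (\<lambda>j. ennreal ((cmod (s (r j) x - s N x))\<^sup>2)) \<partial>circ)"
    proof (rule nn_integral_cong_AE, rule AE_mp[OF conv], intro AE_I2 impI)
      fix x assume "convergent (\<lambda>j. s (r j) x)"
      then have "(\<lambda>j. s (r j) x) \<longlonglongrightarrow> g x"
        unfolding g_def by (rule convergent_LIMSEQ_iff[THEN iffD1])
      then have "(\<lambda>j. ennreal ((cmod (s (r j) x - s N x))\<^sup>2)) \<longlonglongrightarrow> ennreal ((cmod (g x - s N x))\<^sup>2)"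
        by (intro tendsto_intros)
      then show "ennreal ((cmod (g x - s N x))\<^sup>2) = liminf (\<lambda>j. ennreal ((cmod (s (r j) x - s N x))\<^sup>2))"
        by (rule lim_imp_Liminf[symmetric, rotated]) simp
    qed
    also have "\<dots> \<le> liminf (\<lambda>j. \<integral>\<^sup>+x. ennreal ((cmod (s (r j) x - s N x))\<^sup>2) \<partial>circ)"
      by (rule nn_integral_liminf) measurable
    also have "\<dots> \<le> ennreal (2 * pi * (1 / 4) ^ i)"
    proof (rule Liminf_le)
      show "\<forall>\<^sub>F j in sequentially. (\<integral>\<^sup>+x. ennreal ((cmod (s (r j) x - s N x))\<^sup>2) \<partial>circ)
          \<le> ennreal (2 * pi * (1 / 4) ^ i)"
        using eventually_ge_at_top[of i]
      proof (rule eventually_mono)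
        fix j assume "i \<le> j"
        then have "\<bar>\<sigma> (r j) - \<sigma> N\<bar> \<le> (1 / 4) ^ i"
          using r(2)[of i "r j" N] monoD[OF r(1)] that by (auto intro: less_imp_le)
        then have "2 * pi * \<bar>\<sigma> (r j) - \<sigma> N\<bar> \<le> 2 * pi * (1 / 4) ^ i"
          by (intro mult_left_mono) auto
        then show "(\<integral>\<^sup>+x. ennreal ((cmod (s (r j) x - s N x))\<^sup>2) \<partial>circ) \<le> ennreal (2 * pi * (1 / 4) ^ i)"
          by (subst nn_integral_sqint) (auto intro: sqint_diff sq_s ennreal_leI simp: s_diff)
      qed
    qed simp
    finally show ?thesis .
  qed
  have sq_diff: "sqint (\<lambda>x. g x - s N x)" if "N \<ge> r 0" for N
    unfolding sqint_def
  proof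
    have "(\<integral>\<^sup>+x. ennreal (norm ((cmod (g x - s N x))\<^sup>2)) \<partial>circ) < \<infinity>"
      using tail[OF that] by (auto intro: le_less_trans)
    then show "integrable circ (\<lambda>x. (cmod (g x - s N x))\<^sup>2)"
      by (intro integrableI_bounded) auto
  qed measurable
  have "sqint g"
    using sqint_add[OF sq_diff[of "r 0"] sq_s[of "r 0"]] by simp
  moreover have "g (\<theta> + 2 * pi) = g \<theta>" for \<theta>
  proof -
    have "cis (of_int n * (\<theta> + 2 * pi)) = cis (of_int n * \<theta>)" for n
      using cis_multiple_2pi[of "of_int n"] by (simp add: distrib_left mult_ac flip: cis_mult)
    then show ?thesis by (simp add: g_def s_def)
  qed
  ultimately have g: "g \<in> L2T" by (intro L2T_I) auto
  have "(\<lambda>N. L2T_norm (\<lambda>\<theta>. g \<theta> - s N \<theta>)) \<longlonglongrightarrow> 0"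
  proof (rule LIMSEQ_I)
    fix e :: real assume "0 < e"
    have "(\<lambda>i. 2 * pi * (1 / 4 :: real) ^ i) \<longlonglongrightarrow> 0"
      by (intro tendsto_mult_right_zero LIMSEQ_power_zero) auto
    then have "\<forall>\<^sub>F i in sequentially. 2 * pi * (1 / 4 :: real) ^ i < e\<^sup>2"
      by (rule order_tendstoD) (use \<open>0 < e\<close> in auto)
    then obtain i where i: "2 * pi * (1 / 4 :: real) ^ i < e\<^sup>2"
      by (auto simp: eventually_sequentially)
    have "norm (L2T_norm (\<lambda>\<theta>. g \<theta> - s N \<theta>) - 0) < e" if N: "N \<ge> r i" for N
    proof -
      have "N \<ge> r 0" using N monoD[OF r(1), of 0 i] by simp
      then have "ennreal ((L2T_norm (\<lambda>\<theta>. g \<theta> - s N \<theta>))\<^sup>2) \<le> ennreal (2 * pi * (1 / 4) ^ i)"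
        using tail[OF N] by (simp only: nn_integral_sqint[OF sq_diff])
      moreover have "0 \<le> 2 * pi * (1 / 4 :: real) ^ i" by simp
      ultimately have "(L2T_norm (\<lambda>\<theta>. g \<theta> - s N \<theta>))\<^sup>2 \<le> 2 * pi * (1 / 4) ^ i"
        using ennreal_le_iff by blast
      then have "(L2T_norm (\<lambda>\<theta>. g \<theta> - s N \<theta>))\<^sup>2 < e\<^sup>2"
        using i by simp
      then show ?thesis
        using \<open>0 < e\<close> by (simp add: L2T_norm_nonneg power2_less_imp_less)
    qed
    then show "\<exists>no. \<forall>N\<ge>no. norm (L2T_norm (\<lambda>\<theta>. g \<theta> - s N \<theta>) - 0) < e" by blast
  qed
  with g show ?thesis using that unfolding s_def[abs_def] by blast
qed

text \<open>Each coefficient is continuous in the \<open>L\<^sup>2\<close> norm, and those of the partial sums are eventually constant.\<close>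

lemma fourier_coeff_of_limit:
  assumes g: "sqint g"
    and lim: "(\<lambda>N. L2T_norm (\<lambda>\<theta>. g \<theta> - (\<Sum>n\<in>{-int N..int N}. c n * cis (of_int n * \<theta>)))) \<longlonglongrightarrow> 0"
  shows "fourier_coeff g m = c m"
proof -
  define s where "s N \<theta> = (\<Sum>n\<in>{-int N..int N}. c n * cis (of_int n * \<theta>))" for N :: nat and \<theta>
  have sq: "sqint (s N)" for N unfolding s_def[abs_def] by (intro sqint_sum sqint_cmult sqint_cis)
  have "cmod (fourier_coeff g m - c m) \<le> L2T_norm (\<lambda>\<theta>. g \<theta> - s N \<theta>) / sqrt (2 * pi)"
    if "N \<ge> nat \<bar>m\<bar>" for N
  proof -
    have "fourier_coeff (s N) m = c m"
      using that unfolding s_def[abs_def] by (subst fourier_coeff_trig_sum) auto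
    then show ?thesis
      using fourier_coeff_bound[OF sqint_diff[OF g sq[of N]], of m] by (simp add: fourier_coeff_diff g sq)
  qed
  moreover have "(\<lambda>N. L2T_norm (\<lambda>\<theta>. g \<theta> - s N \<theta>) / sqrt (2 * pi)) \<longlonglongrightarrow> 0"
    using tendsto_divide[OF lim tendsto_const[of "sqrt (2 * pi)"]] by (simp add: s_def)
  ultimately have "cmod (fourier_coeff g m - c m) \<le> 0"
    by (meson LIMSEQ_le_const)
  then show ?thesis by simp
qed

section \<open>Completeness of the exponentials\<close>

inductive_set trig_polys :: "(real \<Rightarrow> complex) set" where
  cis: "(\<lambda>\<theta>. cis (of_int n * \<theta>)) \<in> trig_polys"
| add: "p \<in> trig_polys \<Longrightarrow> r \<in> trig_polys \<Longrightarrow> (\<lambda>\<theta>. p \<theta> + r \<theta>) \<in> trig_polys"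
| cmult: "p \<in> trig_polys \<Longrightarrow> (\<lambda>\<theta>. c * p \<theta>) \<in> trig_polys"

lemma trig_polys_const: "(\<lambda>\<theta>. c) \<in> trig_polys"
  using trig_polys.cmult[OF trig_polys.cis[of 0], of c] by simp

lemma trig_polys_mult:
  assumes "p \<in> trig_polys" "r \<in> trig_polys"
  shows "(\<lambda>\<theta>. p \<theta> * r \<theta>) \<in> trig_polys"
  using assms(1)
proof induction
  case (cis n)
  show ?case using assms(2)
  proof induction
    case (cis m)
    show ?case using trig_polys.cis[of "n + m"] by (simp add: cis_mult algebra_simps)
  next
    case (add p r)
    then show ?case using trig_polys.add by (simp add: distrib_left)
  next
    case (cmult p c)
    then show ?case using trig_polys.cmult[of "\<lambda>\<theta>. cis (of_int n * \<theta>) * p \<theta>" c] by (simp add: mult_ac)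
  qed
next
  case (add p r)
  then show ?case using trig_polys.add by (simp add: distrib_right)
next
  case (cmult p c)
  then show ?case using trig_polys.cmult[of "\<lambda>\<theta>. p \<theta> * r \<theta>" c] by (simp add: mult_ac)
qed

text \<open>The coordinate functions of \<open>e\<^sup>i\<^sup>\<theta>\<close> are combinations of \<open>e\<^sup>i\<^sup>\<theta>\<close> and \<open>e\<^sup>-\<^sup>i\<^sup>\<theta>\<close>; so polynomials in them,
  which Stone--Weierstrass supplies, are trigonometric polynomials.\<close>

lemma trig_polys_real_polynomial:
  fixes p :: "complex \<Rightarrow> real"
  assumes "real_polynomial_function p"
  shows "(\<lambda>\<theta>. complex_of_real (p (cis \<theta>))) \<in> trig_polys"
  using assms
proof induction
  case (linear f)
  interpret bounded_linear f by fact
  have "complex_of_real (f (cis \<theta>))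
      = (f 1 / 2 - \<i> * f \<i> / 2) * cis (of_int 1 * \<theta>) + (f 1 / 2 + \<i> * f \<i> / 2) * cis (of_int (-1) * \<theta>)" for \<theta>
  proof -
    have "cis \<theta> = cos \<theta> *\<^sub>R 1 + sin \<theta> *\<^sub>R \<i>" by (simp add: complex_eq_iff)
    then have "f (cis \<theta>) = cos \<theta> * f 1 + sin \<theta> * f \<i>" by (simp only: add scale) simp
    then show ?thesis by (simp add: complex_eq_iff algebra_simps)
  qed
  moreover have "(\<lambda>\<theta>. (f 1 / 2 - \<i> * f \<i> / 2) * cis (of_int 1 * \<theta>) + (f 1 / 2 + \<i> * f \<i> / 2) * cis (of_int (-1) * \<theta>)) \<in> trig_polys"
    by (intro trig_polys.intros)
  ultimately show ?case by simp
qed (auto intro: trig_polys_const trig_polys.add trig_polys_mult)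

lemma trig_polys_polynomial:
  fixes p :: "complex \<Rightarrow> complex"
  assumes "polynomial_function p"
  shows "(\<lambda>\<theta>. p (cis \<theta>)) \<in> trig_polys"
proof -
  have "real_polynomial_function (Re \<circ> p)" "real_polynomial_function (Im \<circ> p)"
    using assms bounded_linear_Re bounded_linear_Im by (auto simp: polynomial_function_def)
  from this[THEN trig_polys_real_polynomial]
  have "(\<lambda>\<theta>. complex_of_real (Re (p (cis \<theta>))) + \<i> * complex_of_real (Im (p (cis \<theta>)))) \<in> trig_polys"
    by (intro trig_polys.intros) (simp_all add: o_def)
  then show ?thesis by (simp flip: complex_eq)
qed

lemma integral_trig_polys_eq_0:
  assumes f: "sqint f" and coeff: "\<And>n. fourier_coeff f n = 0" and "p \<in> trig_polys"
  shows "integrable circ (\<lambda>x. f x * p x) \<and> (LINT x|circ. f x * p x) = 0"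
  using assms(3)
proof induction
  case (cis n)
  have "(LINT x|circ. f x * cis (of_int n * x)) = 0"
    using coeff[of "- n"] by (simp add: fourier_coeff_def set_integral_circ)
  moreover have "integrable circ (\<lambda>x. f x * cnj (cis (of_int (- n) * x)))"
    by (intro sqint_product_integrable f sqint_cis)
  ultimately show ?case by (simp add: cis_cnj)
next
  case (add p r)
  then show ?case by (simp add: distrib_left)
next
  case (cmult p c)
  then show ?case by (simp add: mult.left_commute)
qed

text \<open>The factor vanishing at \<open>1\<close> removes the jump of \<^const>\<open>Arg2pi\<close>, so that \<open>\<phi>\<close> becomes a
  continuous function on the unit circle, to which Stone--Weierstrass applies.\<close>

lemma integral_cutoff_eq_0:
  assumes f: "sqint f" and coeff: "\<And>n. fourier_coeff f n = 0"
    and g: "continuous_on UNIV g" and g1: "\<And>x. cmod (g x) \<le> 1"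
  shows "(LINT x|circ. f x * (of_real (min 1 (real j * cmod (cis x - 1))) * g x)) = 0"
proof -
  define cut where "cut z = min 1 (real j * cmod (z - 1))" for z :: complex
  define \<Phi> where "\<Phi> z = complex_of_real (cut z) * g (Arg2pi z)" for z
  have chi: "continuous_on UNIV cut" unfolding cut_def by (intro continuous_intros)
  have "continuous_on (sphere 0 1) \<Phi>"
  proof (rule continuous_at_imp_continuous_on, rule ballI)
    fix z :: complex assume z: "z \<in> sphere 0 1"
    show "isCont \<Phi> z"
    proof (cases "z = 1")
      case False
      have "z \<notin> \<real>\<^sub>\<ge>\<^sub>0"
      proof
        assume "z \<in> \<real>\<^sub>\<ge>\<^sub>0"
        then obtain x where "z = of_real x" "x \<ge> 0" by (auto simp: nonneg_Reals_def)
        with z False show False by auto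
      qed
      then have "isCont Arg2pi z" by (rule continuous_at_Arg2pi)
      moreover have "isCont g (Arg2pi z)" using g by (simp add: continuous_on_eq_continuous_at)
      ultimately have "isCont (\<lambda>z. g (Arg2pi z)) z" by (rule isCont_o2)
      moreover have "isCont cut z" using chi by (simp add: continuous_on_eq_continuous_at)
      ultimately show ?thesis unfolding \<Phi>_def by (intro continuous_intros)
    next
      case True
      have 0: "\<Phi> 1 = 0" by (simp add: \<Phi>_def cut_def)
      have "(cut \<longlongrightarrow> cut 1) (at 1)"
        using chi by (simp add: continuous_on_eq_continuous_at isCont_def)
      then have lim: "(cut \<longlongrightarrow> 0) (at 1)" by (simp add: cut_def)
      have "cmod (\<Phi> w) \<le> cut w" for w
      proof -
        have "0 \<le> cut w" by (simp add: cut_def)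
        then show ?thesis using mult_left_mono[OF g1, of "cut w"] by (simp add: \<Phi>_def norm_mult)
      qed
      then have "(\<Phi> \<longlongrightarrow> 0) (at 1)"
        by (intro Lim_null_comparison[OF _ lim]) auto
      then show ?thesis using True 0 by (simp add: isCont_def)
    qed
  qed
  have Phi_eq: "\<Phi> (cis x) = of_real (min 1 (real j * cmod (cis x - 1))) * g x" if "x \<in> {0..2*pi}" for x
  proof (cases "x = 2 * pi")
    case False
    then have "Arg2pi (cis x) = x"
      using that by (intro Arg2pi_unique[of 1]) (auto simp: cis_conv_exp)
    then show ?thesis by (simp add: \<Phi>_def cut_def)
  qed (simp add: \<Phi>_def cut_def)
  define J where "J = (LINT x|circ. f x * \<Phi> (cis x))"
  have intf: "integrable circ f" by (rule sqint_integrable[OF f])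
  have "cmod J \<le> e * (LINT x|circ. cmod (f x))" if "e > 0" for e
  proof -
    obtain p where p: "polynomial_function p" "\<And>z. z \<in> sphere 0 1 \<Longrightarrow> cmod (\<Phi> z - p z) < e"
      using Stone_Weierstrass_polynomial_function[of "sphere 0 1" \<Phi> e]
        \<open>continuous_on (sphere 0 1) \<Phi>\<close> \<open>e > 0\<close> by auto
    have P: "integrable circ (\<lambda>x. f x * p (cis x))" "(LINT x|circ. f x * p (cis x)) = 0"
      using integral_trig_polys_eq_0[OF f coeff trig_polys_polynomial[OF p(1)]] by auto
    have b: "cmod (\<Phi> (cis x) - p (cis x)) \<le> e" for x
      using p(2)[of "cis x"] by (simp add: less_imp_le)
    have cg: "continuous_on UNIV (\<lambda>x. \<Phi> (cis x))"
      by (rule continuous_on_compose2[OF \<open>continuous_on (sphere 0 1) \<Phi>\<close>]) (auto intro!: continuous_intros)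
    have cp: "continuous_on UNIV (\<lambda>x. p (cis x))"
      by (rule continuous_on_compose2[OF continuous_on_polymonial_function[OF p(1)]])
         (auto intro!: continuous_intros)
    have [measurable]: "(\<lambda>x. \<Phi> (cis x) - p (cis x)) \<in> borel_measurable circ"
      by (intro measurable_circI borel_measurable_continuous_onI continuous_intros cg cp)
    have [measurable]: "f \<in> borel_measurable circ" using f by (simp add: sqint_def)
    have le: "cmod (f x * (\<Phi> (cis x) - p (cis x))) \<le> e * cmod (f x)" for x
      using mult_left_mono[OF b, of "cmod (f x)" x] by (simp add: norm_mult mult.commute)
    have D: "integrable circ (\<lambda>x. f x * (\<Phi> (cis x) - p (cis x)))"
    proof (rule Bochner_Integration.integrable_bound)
      show "integrable circ (\<lambda>x. e * cmod (f x))" using intf by auto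
      show "AE x in circ. norm (f x * (\<Phi> (cis x) - p (cis x))) \<le> norm (e * cmod (f x))"
        using le \<open>e > 0\<close> by (intro AE_I2) simp
    qed measurable
    have "J = (LINT x|circ. f x * (\<Phi> (cis x) - p (cis x)) + f x * p (cis x))"
      unfolding J_def by (simp add: algebra_simps)
    also have "\<dots> = (LINT x|circ. f x * (\<Phi> (cis x) - p (cis x)))"
      using D P by simp
    finally have "cmod J \<le> (LINT x|circ. cmod (f x * (\<Phi> (cis x) - p (cis x))))" by simp
    also have "\<dots> \<le> (LINT x|circ. e * cmod (f x))"
      using D intf le by (intro integral_mono) (auto intro!: integrable_norm)
    finally show ?thesis by simp
  qed
  then have le: "cmod J \<le> e * (LINT x|circ. cmod (f x))" if "e > 0" for e using that by blast
  have "cmod J \<le> 0"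
  proof (rule field_le_epsilon)
    fix e :: real assume "e > 0"
    define I where "I = (LINT x|circ. cmod (f x))"
    have "I \<ge> 0" unfolding I_def by simp
    have "cmod J \<le> (e / (1 + I)) * I" unfolding I_def
      by (rule le, fold I_def) (use \<open>e > 0\<close> \<open>I \<ge> 0\<close> in simp)
    also have "\<dots> \<le> e" using \<open>e > 0\<close> \<open>I \<ge> 0\<close> by (simp add: field_simps)
    finally show "cmod J \<le> 0 + e" by simp
  qed
  then have "J = 0" by simp
  moreover have "J = (LINT x|circ. f x * (of_real (min 1 (real j * cmod (cis x - 1))) * g x))"
    unfolding J_def by (rule Bochner_Integration.integral_cong) (auto simp: Phi_eq)
  ultimately show ?thesis by simp
qed

text \<open>If all coefficients vanish, then \<open>f\<close> is orthogonal to continuous functions vanishing at the end points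
  of the period, hence by dominated convergence to bounded measurable functions.  Testing against the conjugate of \<open>sgn f\<close> gives \<open>\<integral>|f| = 0\<close>.\<close>

theorem fourier_coeff_zero_imp_AE_zero_circ:
  assumes f: "f \<in> L2T" and coeff: "\<And>n. fourier_coeff f n = 0"
  shows "AE x in circ. f x = 0"
proof -
  have sq: "sqint f" by (rule L2T_sqint[OF f])
  have fm [measurable]: "f \<in> borel_measurable lebesgue" using f by (simp add: L2T_def)
  have fc [measurable]: "f \<in> borel_measurable circ" using sq by (simp add: sqint_def)
  have int: "integrable circ f" by (rule sqint_integrable[OF sq])
  define h where "h x = cnj (sgn (f x))" for x
  have sgn_m: "(sgn :: complex \<Rightarrow> complex) \<in> borel_measurable borel"
    unfolding sgn_div_norm by measurable
  have "h \<in> borel_measurable lebesgue"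
    unfolding h_def by (intro measurable_compose[OF measurable_compose[OF fm sgn_m] measurable_cnj])
  from lebesgue_measurable_imp_measurable_on[OF this, of UNIV]
  obtain N g where N: "negligible N" and g: "\<And>n. continuous_on UNIV (g n)"
    and lim: "\<And>x. x \<notin> N \<Longrightarrow> (\<lambda>n. g n x) \<longlonglongrightarrow> h x"
    by (auto simp: Equivalence_Measurable_On_Borel.measurable_on_def)
  \<comment> \<open>truncation to the unit disc: it keeps the limit, which lies in the disc, and gives a dominating function\<close>
  define G where "G n x = g n x /\<^sub>R max 1 (cmod (g n x))" for n and x :: real
  have G1: "cmod (G n x) \<le> 1" for n x
    by (simp add: G_def max_def divide_simps)
  have Gc: "continuous_on UNIV (G n)" for n
    unfolding G_def by (intro continuous_intros g) auto
  have hn: "cmod (h x) \<le> 1" for x by (simp add: h_def norm_sgn)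
  define \<phi> where "\<phi> j x = complex_of_real (min 1 (real j * cmod (cis x - 1))) * G j x" for j x
  have phi_c: "continuous_on UNIV (\<phi> j)" for j
    unfolding \<phi>_def by (intro continuous_intros Gc)
  have phi_m: "\<phi> j \<in> borel_measurable circ" for j
    by (intro measurable_circI borel_measurable_continuous_onI phi_c)
  have phi1: "cmod (\<phi> j x) \<le> 1" for j x
  proof -
    define m where "m = min 1 (real j * cmod (cis x - 1))"
    have "0 \<le> m" "m \<le> 1" by (simp_all add: m_def)
    then show ?thesis
      unfolding \<phi>_def norm_mult m_def[symmetric] using G1[of j x] by (intro mult_le_one) auto
  qed
  have lim_phi: "(\<lambda>j. \<phi> j x) \<longlonglongrightarrow> h x" if x: "x \<notin> N" "0 < x" "x < 2 * pi" for x
  proof -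
    have "(\<lambda>j. G j x) \<longlonglongrightarrow> h x /\<^sub>R max 1 (cmod (h x))"
      unfolding G_def by (intro tendsto_intros lim x) auto
    also have "h x /\<^sub>R max 1 (cmod (h x)) = h x" using hn[of x] by (simp add: max_def)
    finally have 1: "(\<lambda>j. G j x) \<longlonglongrightarrow> h x" .
    have "cis x \<noteq> 1"
    proof
      assume "cis x = 1"
      then have "cos x = 1" by (simp add: complex_eq_iff)
      then obtain n :: int where n: "x = of_int n * 2 * pi" by (auto simp: cos_one_2pi_int)
      have "0 < n" using x(2) n by (simp add: zero_less_mult_iff)
      moreover have "real_of_int n < 1" using x(3) n by simp
      ultimately show False by linarith
    qed
    then have pos: "cmod (cis x - 1) > 0" by simp
    obtain j0 :: nat where "1 / cmod (cis x - 1) < j0" using reals_Archimedean2 by blast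
    then have "\<forall>\<^sub>F j in sequentially. complex_of_real (min 1 (real j * cmod (cis x - 1))) = 1"
      unfolding eventually_sequentially using pos
      by (intro exI[of _ j0]) (auto simp: min_def divide_simps intro: order_trans[OF less_imp_le mult_right_mono])
    then have "(\<lambda>j. complex_of_real (min 1 (real j * cmod (cis x - 1)))) \<longlonglongrightarrow> 1"
      by (rule tendsto_eventually)
    from tendsto_mult[OF this 1] show ?thesis by (simp add: \<phi>_def)
  qed
  have "AE x in lebesgue. x \<notin> N \<union> {0, 2 * pi}"
    using N by (intro AE_not_in) (simp add: negligible_iff_null_sets)
  then have AE: "AE x in circ. x \<notin> N \<union> {0, 2 * pi}"
    by (subst AE_restrict_space_iff) auto
  have "(\<lambda>j. LINT x|circ. f x * \<phi> j x) \<longlonglongrightarrow> (LINT x|circ. f x * h x)"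
  proof (rule integral_dominated_convergence[where w = "\<lambda>x. cmod (f x)"])
    show "AE x in circ. (\<lambda>j. f x * \<phi> j x) \<longlonglongrightarrow> f x * h x"
      using AE by (rule AE_mp) (auto intro!: AE_I2 tendsto_intros lim_phi simp: less_le)
    show "AE x in circ. cmod (f x * \<phi> j x) \<le> cmod (f x)" for j
      using mult_left_mono[OF phi1, of "cmod (f _)"] by (intro AE_I2) (simp add: norm_mult)
    show "(\<lambda>x. f x * h x) \<in> borel_measurable circ"
      unfolding h_def by (intro borel_measurable_times fc measurable_compose[OF measurable_compose[OF fc sgn_m] measurable_cnj])
    show "(\<lambda>x. f x * \<phi> j x) \<in> borel_measurable circ" for j
      by (intro borel_measurable_times fc phi_m)
  qed (use int in auto)
  moreover have "(LINT x|circ. f x * \<phi> j x) = 0" for j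
    unfolding \<phi>_def by (rule integral_cutoff_eq_0[OF sq coeff Gc G1])
  ultimately have "(LINT x|circ. f x * h x) = 0" by (simp add: LIMSEQ_const_iff)
  moreover have "f x * h x = of_real (cmod (f x))" for x
  proof (cases "f x = 0")
    case False
    have "f x * h x = complex_of_real ((cmod (f x))\<^sup>2) /\<^sub>R cmod (f x)"
      by (simp only: h_def sgn_div_norm complex_cnj_scaleR mult_scaleR_right complex_norm_square)
    also have "\<dots> = of_real (cmod (f x))"
      using False by (simp add: scaleR_conv_of_real power2_eq_square)
    finally show ?thesis .
  qed (simp add: h_def)
  ultimately have "(LINT x|circ. complex_of_real (cmod (f x))) = 0" by (simp only:)
  then have "(LINT x|circ. cmod (f x)) = 0"
    by (simp only: integral_complex_of_real of_real_eq_0_iff)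
  then have "AE x in circ. cmod (f x) = 0"
    using integral_nonneg_eq_0_iff_AE[of circ "\<lambda>x. cmod (f x)"] integrable_norm[OF int] by simp
  then show ?thesis by simp
qed

lemma AE_lebesgue_of_circ:
  fixes P :: "real \<Rightarrow> bool"
  assumes per: "\<And>\<theta>. P (\<theta> + 2 * pi) = P \<theta>" and AE: "AE x in circ. P x"
  shows "AE x in lebesgue. P x"
proof -
  have nat: "P (\<theta> + 2 * pi * real n) = P \<theta>" for \<theta> n
  proof (induction n)
    case (Suc n)
    then show ?case using per[of "\<theta> + 2 * pi * real n"] by (simp add: algebra_simps)
  qed simp
  have int: "P (\<theta> + 2 * pi * of_int j) = P \<theta>" for \<theta> and j :: int
  proof (cases "j \<ge> 0")
    case True
    then show ?thesis using nat[of \<theta> "nat j"] by simp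
  next
    case False
    then show ?thesis using nat[of "\<theta> + 2 * pi * of_int j" "nat (- j)"] by (simp add: algebra_simps)
  qed
  have "AE x in lebesgue. x \<in> {0..2*pi} \<longrightarrow> P x"
    using AE by (subst (asm) AE_restrict_space_iff) auto
  then obtain N where N: "{x. \<not> (x \<in> {0..2*pi} \<longrightarrow> P x)} \<subseteq> N" "N \<in> null_sets lebesgue"
    by (auto elim!: AE_E simp: null_sets_def)
  define S where "S = (\<Union>j::int. (+) (2 * pi * of_int j) ` N)"
  have "negligible S"
    unfolding S_def by (rule negligible_countable_Union)
      (use N(2) in \<open>auto simp: negligible_iff_null_sets[symmetric] intro: negligible_translation\<close>)
  have "P x" if "x \<notin> S" for x
  proof (rule ccontr)
    assume np: "\<not> P x"
    define j where "j = \<lfloor>x / (2 * pi)\<rfloor>"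
    define y where "y = x - 2 * pi * of_int j"
    have "of_int j \<le> x / (2 * pi)" "x / (2 * pi) < of_int j + 1"
      unfolding j_def by linarith+
    then have "y \<in> {0..2*pi}" by (auto simp: y_def field_simps)
    moreover have "\<not> P y" using np int[of y j] by (simp add: y_def)
    ultimately have "y \<in> N" using N(1) by auto
    then have "x \<in> S" unfolding S_def y_def by (auto intro!: exI[of _ j] image_eqI[of _ _ y] simp: y_def)
    with that show False by simp
  qed
  moreover have "AE x in lebesgue. x \<notin> S"
    using \<open>negligible S\<close> by (intro AE_not_in) (simp add: negligible_iff_null_sets)
  ultimately show ?thesis by (auto elim!: eventually_mono)
qed

lemma L2T_diff: "f \<in> L2T \<Longrightarrow> g \<in> L2T \<Longrightarrow> (\<lambda>\<theta>. f \<theta> - g \<theta>) \<in> L2T"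
  using sqint_diff[OF L2T_sqint L2T_sqint, of f g]
  by (auto simp: L2T_def sqint_def set_integral_circ)

lemma cis_in_L2T: "(\<lambda>\<theta>. cis (of_int n * \<theta>)) \<in> L2T"
proof (rule L2T_I[OF measurable_cis _ sqint_cis])
  show "cis (of_int n * (\<theta> + 2 * pi)) = cis (of_int n * \<theta>)" for \<theta>
    using cis_multiple_2pi[of "of_int n"] by (simp add: distrib_left mult_ac flip: cis_mult)
qed

text \<open>Periodicity spreads the equality from one period to the whole line.\<close>

theorem L2T_eq_if_fourier_coeff_eq:
  assumes f: "f \<in> L2T" and g: "g \<in> L2T" and eq: "\<And>n. fourier_coeff f n = fourier_coeff g n"
  shows "AE \<theta> in lebesgue. f \<theta> = g \<theta>"
proof (rule AE_lebesgue_of_circ)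
  show "(f (\<theta> + 2 * pi) = g (\<theta> + 2 * pi)) = (f \<theta> = g \<theta>)" for \<theta>
    using f g by (simp add: L2T_def)
  have "AE \<theta> in circ. f \<theta> - g \<theta> = 0"
    by (rule fourier_coeff_zero_imp_AE_zero_circ[OF L2T_diff[OF f g]])
      (simp add: fourier_coeff_diff L2T_sqint f g eq)
  then show "AE \<theta> in circ. f \<theta> = g \<theta>" by simp
qed

lemma L2T_norm_cong_AE:
  assumes f: "f \<in> L2T" and g: "g \<in> L2T" and eq: "AE \<theta> in lebesgue. f \<theta> = g \<theta>"
  shows "L2T_norm f = L2T_norm g"
proof -
  have "AE \<theta> in circ. f \<theta> = g \<theta>"
    using eq by (subst AE_restrict_space_iff) auto
  moreover have [measurable]: "f \<in> borel_measurable circ" "g \<in> borel_measurable circ"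
    using L2T_sqint[OF f] L2T_sqint[OF g] by (auto simp: sqint_def)
  ultimately have "(L2T_norm f)\<^sup>2 = (L2T_norm g)\<^sup>2"
    unfolding L2T_norm_sq by (intro integral_cong_AE) auto
  then show ?thesis by (simp add: L2T_norm_nonneg)
qed

lemma fourier_coeff_square_sum_bounded:
  assumes "f \<in> L2T" "finite F"
  shows "(\<Sum>n\<in>F. (cmod (fourier_coeff f n))\<^sup>2) \<le> (L2T_norm f)\<^sup>2 / (2 * pi)"
  using L2T_Bessel[OF assms(2) L2T_sqint[OF assms(1)]] by (simp add: field_simps)

text \<open>The multiplier has modulus \<open>1\<close>, so the multiplied coefficients are again square summable and
  Riesz--Fischer provides the function whose existence the choice in the definition presupposes.\<close>

lemma
  assumes f: "f \<in> L2T"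
  shows free_evol_L2T: "free_evol r f \<in> L2T"
    and fourier_coeff_free_evol:
      "fourier_coeff (free_evol r f) n = cis (- r * (of_int n)\<^sup>2) * fourier_coeff f n"
proof -
  obtain g where g: "g \<in> L2T" "(\<lambda>N. L2T_norm (\<lambda>\<theta>. g \<theta>
      - (\<Sum>n\<in>{-int N..int N}. cis (- r * (of_int n)\<^sup>2) * fourier_coeff f n * cis (of_int n * \<theta>)))) \<longlonglongrightarrow> 0"
    by (rule Riesz_Fischer[of "\<lambda>n. cis (- r * (of_int n)\<^sup>2) * fourier_coeff f n" "(L2T_norm f)\<^sup>2 / (2 * pi)"])
      (use fourier_coeff_square_sum_bounded[OF f] in \<open>auto simp: norm_mult\<close>)
  have "\<forall>n. fourier_coeff g n = cis (- r * (of_int n)\<^sup>2) * fourier_coeff f n"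
    using fourier_coeff_of_limit[OF L2T_sqint[OF g(1)] g(2)] by blast
  with g(1) have "\<exists>g. g \<in> L2T \<and> (\<forall>n. fourier_coeff g n = cis (- r * (of_int n)\<^sup>2) * fourier_coeff f n)"
    by blast
  then have "free_evol r f \<in> L2T \<and>
      (\<forall>n. fourier_coeff (free_evol r f) n = cis (- r * (of_int n)\<^sup>2) * fourier_coeff f n)"
    unfolding free_evol_def by (rule someI_ex)
  then show "free_evol r f \<in> L2T"
    "fourier_coeff (free_evol r f) n = cis (- r * (of_int n)\<^sup>2) * fourier_coeff f n" by auto
qed

lemma trig_closed_spanE:
  assumes "h \<in> trig_closed_span A" "\<epsilon> > 0"
  obtains F c where "finite F" "F \<subseteq> A" "L2T_norm (\<lambda>\<theta>. h \<theta> - (\<Sum>n\<in>F. c n * cis (of_int n * \<theta>))) < \<epsilon>"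
proof -
  have "\<forall>\<epsilon>>0. \<exists>F c. finite F \<and> F \<subseteq> A \<and> L2T_norm (\<lambda>\<theta>. h \<theta> - (\<Sum>n\<in>F. c n * cis (of_int n * \<theta>))) < \<epsilon>"
    using assms(1) unfolding trig_closed_span_def mem_Collect_eq by (rule conjunct2)
  from this[rule_format, OF assms(2)] show ?thesis using that by (elim exE conjE)
qed

text \<open>The projection is characterized by its coefficients: those of high frequency are the ones of \<open>f\<close> by
  orthogonality, the others vanish on the closed span.  A function with these coefficients is
  constructed by Riesz--Fischer, and its norm is computed by Parseval.\<close>

theorem L2T_norm_high_freq_proj:
  assumes f: "f \<in> L2T"
  shows "(\<lambda>M. 2 * pi * (\<Sum>n\<in>{-int M..int M}. if \<bar>n\<bar> \<ge> int N then (cmod (fourier_coeff f n))\<^sup>2 else 0))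
    \<longlonglongrightarrow> (L2T_norm (high_freq_proj N f))\<^sup>2"
proof -
  define c where "c n = (if \<bar>n\<bar> \<ge> int N then fourier_coeff f n else 0)" for n
  define s where "s M \<theta> = (\<Sum>n\<in>{-int M..int M}. c n * cis (of_int n * \<theta>))" for M :: nat and \<theta>
  define V where "V = trig_closed_span {n. \<bar>n\<bar> \<ge> int N}"
  have cle: "(cmod (c n))\<^sup>2 \<le> (cmod (fourier_coeff f n))\<^sup>2" for n by (simp add: c_def)
  obtain g where g: "g \<in> L2T" and lim: "(\<lambda>M. L2T_norm (\<lambda>\<theta>. g \<theta> - s M \<theta>)) \<longlonglongrightarrow> 0"
    unfolding s_def
    by (rule Riesz_Fischer[of c "(L2T_norm f)\<^sup>2 / (2 * pi)"])
      (use order_trans[OF sum_mono[OF cle] fourier_coeff_square_sum_bounded[OF f]] in auto)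
  have cg: "fourier_coeff g n = c n" for n
    by (rule fourier_coeff_of_limit[OF L2T_sqint[OF g] lim[unfolded s_def]])
  have sqg: "sqint g" and sqf: "sqint f" using f g by (auto intro: L2T_sqint)
  have gV: "g \<in> V"
    unfolding V_def trig_closed_span_def
  proof (intro CollectI conjI allI impI g)
    fix e :: real assume "e > 0"
    then have "\<forall>\<^sub>F M in sequentially. L2T_norm (\<lambda>\<theta>. g \<theta> - s M \<theta>) < e"
      using order_tendstoD(2)[OF lim] by blast
    then obtain M where M: "L2T_norm (\<lambda>\<theta>. g \<theta> - s M \<theta>) < e"
      by (auto simp: eventually_sequentially)
    have "s M = (\<lambda>\<theta>. \<Sum>n\<in>{-int M..int M} \<inter> {n. \<bar>n\<bar> \<ge> int N}. c n * cis (of_int n * \<theta>))"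
      unfolding s_def by (intro ext sum.mono_neutral_right) (auto simp: c_def)
    with M show "\<exists>F c. finite F \<and> F \<subseteq> {n. \<bar>n\<bar> \<ge> int N} \<and>
        L2T_norm (\<lambda>\<theta>. g \<theta> - (\<Sum>n\<in>F. c n * cis (of_int n * \<theta>))) < e"
      by (intro exI[of _ "{-int M..int M} \<inter> {n. \<bar>n\<bar> \<ge> int N}"] exI[of _ c]) auto
  qed
  have coeff_V: "fourier_coeff h n = 0" if h: "h \<in> V" and n: "\<bar>n\<bar> < int N" for h n
  proof -
    have hL: "h \<in> L2T" using h by (simp add: V_def trig_closed_span_def)
    have "cmod (fourier_coeff h n) \<le> e" if "e > 0" for e
    proof -
      have pos: "e * sqrt (2 * pi) > 0" using that by simp
      obtain F d where F: "finite F" "F \<subseteq> {n. \<bar>n\<bar> \<ge> int N}"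
        "L2T_norm (\<lambda>\<theta>. h \<theta> - (\<Sum>n\<in>F. d n * cis (of_int n * \<theta>))) < e * sqrt (2 * pi)"
        by (rule trig_closed_spanE[OF h[unfolded V_def] pos])
      let ?p = "\<lambda>\<theta>. \<Sum>n\<in>F. d n * cis (of_int n * \<theta>)"
      have sqp: "sqint ?p" by (intro sqint_sum sqint_cmult sqint_cis)
      have "fourier_coeff (\<lambda>\<theta>. h \<theta> - ?p \<theta>) n = fourier_coeff h n"
        using F n by (subst fourier_coeff_diff[OF L2T_sqint[OF hL] sqp]) (auto simp: fourier_coeff_trig_sum)
      then have "cmod (fourier_coeff h n) \<le> L2T_norm (\<lambda>\<theta>. h \<theta> - ?p \<theta>) / sqrt (2 * pi)"
        using fourier_coeff_bound[OF sqint_diff[OF L2T_sqint[OF hL] sqp], of n] by simp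
      also have "\<dots> \<le> e" using F(3) by (simp add: field_simps)
      finally show ?thesis .
    qed
    then have "cmod (fourier_coeff h n) \<le> 0" by (rule field_le_epsilon) simp
    then show ?thesis by simp
  qed
  have orth: "L2T_inner (\<lambda>\<theta>. f \<theta> - g \<theta>) h = 0" if h: "h \<in> V" for h
  proof -
    have hL: "h \<in> L2T" using h by (simp add: V_def trig_closed_span_def)
    define r where "r = (\<lambda>\<theta>. f \<theta> - g \<theta>)"
    have sqr: "sqint r" unfolding r_def by (rule sqint_diff[OF sqf sqg])
    have "cmod (L2T_inner r h) \<le> e" if "e > 0" for e
    proof -
      define \<delta> where "\<delta> = e / (1 + L2T_norm r)"
      have "\<delta> > 0" using that L2T_norm_nonneg[of r] by (simp add: \<delta>_def)
      then obtain F d where F: "finite F" "F \<subseteq> {n. \<bar>n\<bar> \<ge> int N}"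
        "L2T_norm (\<lambda>\<theta>. h \<theta> - (\<Sum>n\<in>F. d n * cis (of_int n * \<theta>))) < \<delta>"
        by (rule trig_closed_spanE[OF h[unfolded V_def]])
      let ?p = "\<lambda>\<theta>. \<Sum>n\<in>F. d n * cis (of_int n * \<theta>)"
      have sqp: "sqint ?p" by (intro sqint_sum sqint_cmult sqint_cis)
      have zero: "L2T_inner r (\<lambda>\<theta>. cis (of_int n * \<theta>)) = 0" if "n \<in> F" for n
      proof -
        have "fourier_coeff r n = 0"
          using that F(2) by (auto simp: r_def fourier_coeff_diff sqf sqg cg c_def)
        then show ?thesis by (simp add: fourier_coeff_inner)
      qed
      have "L2T_inner r ?p = (\<Sum>n\<in>F. cnj (d n) * L2T_inner r (\<lambda>\<theta>. cis (of_int n * \<theta>)))"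
      proof -
        have "L2T_inner r ?p = (LINT x|circ. (\<Sum>n\<in>F. cnj (d n) * (r x * cnj (cis (of_int n * x)))))"
          unfolding L2T_inner_circ by (simp add: sum_distrib_left mult_ac)
        also have "\<dots> = (\<Sum>n\<in>F. LINT x|circ. cnj (d n) * (r x * cnj (cis (of_int n * x))))"
          by (intro Bochner_Integration.integral_sum integrable_mult_right sqint_product_integrable sqr sqint_cis)
        finally show ?thesis by (simp add: L2T_inner_circ)
      qed
      then have "L2T_inner r ?p = 0" using zero by simp
      then have "L2T_inner r h = L2T_inner r (\<lambda>\<theta>. h \<theta> - ?p \<theta>)"
        by (subst L2T_inner_diff_right[OF L2T_sqint[OF hL] sqp sqr]) simp
      then have "cmod (L2T_inner r h) \<le> L2T_norm r * L2T_norm (\<lambda>\<theta>. h \<theta> - ?p \<theta>)"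
        using L2T_Cauchy_Schwarz[OF sqr sqint_diff[OF L2T_sqint[OF hL] sqp]] by simp
      also have "\<dots> \<le> (1 + L2T_norm r) * \<delta>"
        using F(3) L2T_norm_nonneg \<open>\<delta> > 0\<close> by (intro mult_mono) auto
      also have "\<dots> = e" using L2T_norm_nonneg[of r] by (simp add: \<delta>_def add_nonneg_eq_0_iff)
      finally show ?thesis .
    qed
    then have "cmod (L2T_inner r h) \<le> 0" by (rule field_le_epsilon) simp
    then show ?thesis by (simp add: r_def)
  qed
  define p where "p = high_freq_proj N f"
  have p: "p \<in> V \<and> (\<forall>h\<in>V. L2T_inner (\<lambda>\<theta>. f \<theta> - p \<theta>) h = 0)"
    unfolding p_def high_freq_proj_def L2T_proj_def V_def[symmetric]
    by (rule someI[of _ g]) (use gV orth in auto)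
  have pL: "p \<in> L2T" using p by (simp add: V_def trig_closed_span_def)
  have "fourier_coeff p n = c n" for n
  proof (cases "\<bar>n\<bar> \<ge> int N")
    case True
    have "(\<lambda>\<theta>. cis (of_int n * \<theta>)) \<in> V"
      unfolding V_def trig_closed_span_def using True
      by (auto intro!: cis_in_L2T exI[of _ "{n}"] exI[of _ "\<lambda>_. 1"] simp: L2T_norm_zero)
    then have "L2T_inner (\<lambda>\<theta>. f \<theta> - p \<theta>) (\<lambda>\<theta>. cis (of_int n * \<theta>)) = 0" using p by blast
    then have "fourier_coeff (\<lambda>\<theta>. f \<theta> - p \<theta>) n = 0" by (simp add: fourier_coeff_inner)
    then show ?thesis using True by (simp add: fourier_coeff_diff sqf L2T_sqint[OF pL] c_def)
  next
    case False
    then show ?thesis using coeff_V[of p n] p by (simp add: c_def)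
  qed
  then have "AE \<theta> in lebesgue. p \<theta> = g \<theta>"
    by (intro L2T_eq_if_fourier_coeff_eq pL g) (simp add: cg)
  then have norm: "L2T_norm p = L2T_norm g" by (rule L2T_norm_cong_AE[OF pL g])
  have "(L2T_norm (\<lambda>\<theta>. g \<theta> - s M \<theta>))\<^sup>2 = (L2T_norm g)\<^sup>2 - 2 * pi * (\<Sum>n\<in>{-int M..int M}. (cmod (c n))\<^sup>2)" for M
  proof -
    have sq: "(cmod z)\<^sup>2 - 2 * Re (cnj z * z) = - (cmod z)\<^sup>2" for z
      unfolding cmod_power2 by (simp add: power2_eq_square)
    show ?thesis
      unfolding s_def by (subst L2T_norm_minus_trig_sum) (auto simp only: sqg cg sq sum_negf finite_atLeastAtMost_int)
  qed
  then have eq: "2 * pi * (\<Sum>n\<in>{-int M..int M}. (cmod (c n))\<^sup>2)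
      = (L2T_norm g)\<^sup>2 - (L2T_norm (\<lambda>\<theta>. g \<theta> - s M \<theta>))\<^sup>2" for M by simp
  have "(\<lambda>M. (L2T_norm g)\<^sup>2 - (L2T_norm (\<lambda>\<theta>. g \<theta> - s M \<theta>))\<^sup>2) \<longlonglongrightarrow> (L2T_norm g)\<^sup>2 - 0\<^sup>2"
    by (intro tendsto_intros lim)
  then have "(\<lambda>M. 2 * pi * (\<Sum>n\<in>{-int M..int M}. (cmod (c n))\<^sup>2)) \<longlonglongrightarrow> (L2T_norm p)\<^sup>2"
    unfolding eq norm by simp
  moreover have "(cmod (c n))\<^sup>2 = (if \<bar>n\<bar> \<ge> int N then (cmod (fourier_coeff f n))\<^sup>2 else 0)" for n
    by (simp add: c_def)
  ultimately show ?thesis unfolding p_def by (simp only:)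
qed

section \<open>The coefficients of a mild solution\<close>

lemma cos_mult_L2T:
  assumes "f \<in> L2T"
  shows "(\<lambda>\<theta>. complex_of_real (a * cos \<theta>) * f \<theta>) \<in> L2T"
proof -
  have [measurable]: "f \<in> borel_measurable lebesgue" using assms by (simp add: L2T_def)
  have cm: "(\<lambda>\<theta>. complex_of_real (a * cos \<theta>)) \<in> borel_measurable borel"
    by (intro borel_measurable_continuous_onI continuous_intros)
  have [measurable]: "(\<lambda>\<theta>. complex_of_real (a * cos \<theta>)) \<in> borel_measurable lebesgue"
    using cm by (intro measurable_completion) simp
  have "sqint (\<lambda>\<theta>. complex_of_real (a * cos \<theta>) * f \<theta>)"
    by (rule sqint_mult_bounded[OF L2T_sqint[OF assms] measurable_circI[OF cm], of "\<bar>a\<bar>"])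
      (use mult_left_mono[OF abs_cos_le_one, of "\<bar>a\<bar>"] in \<open>simp add: norm_mult abs_mult\<close>)
  moreover have "(\<lambda>\<theta>. complex_of_real (a * cos \<theta>) * f \<theta>) \<in> borel_measurable lebesgue"
    by measurable
  ultimately show ?thesis using assms by (simp add: L2T_def sqint_def set_integral_circ)
qed

text \<open>\<open>cos \<theta> = (e\<^sup>i\<^sup>\<theta> + e\<^sup>-\<^sup>i\<^sup>\<theta>) / 2\<close> shifts frequencies by \<open>\<plusminus>1\<close>.\<close>

lemma fourier_coeff_cos_mult:
  assumes "f \<in> L2T"
  shows "fourier_coeff (\<lambda>\<theta>. complex_of_real (a * cos \<theta>) * f \<theta>) n
    = a * ((fourier_coeff f (n - 1) + fourier_coeff f (n + 1)) / 2)"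
proof -
  have cosm: "complex_of_real (cos \<theta>) = (cis \<theta> + cis (- \<theta>)) / 2" for \<theta>
    by (simp add: complex_eq_iff)
  have eq: "complex_of_real (a * cos \<theta>) * f \<theta> * cis (- of_int n * \<theta>)
      = (a / 2) * (f \<theta> * cnj (cis (of_int (n - 1) * \<theta>)) + f \<theta> * cnj (cis (of_int (n + 1) * \<theta>)))" for \<theta>
  proof -
    have "cis \<theta> * cis (- of_int n * \<theta>) = cnj (cis (of_int (n - 1) * \<theta>))"
      "cis (- \<theta>) * cis (- of_int n * \<theta>) = cnj (cis (of_int (n + 1) * \<theta>))"
      by (simp_all add: cis_mult cis_cnj algebra_simps)
    note this[symmetric]
    then show ?thesis by (simp only: of_real_mult cosm) (simp add: algebra_simps)
  qed
  have I: "integrable circ (\<lambda>x. f x * cnj (cis (of_int j * x)))" for j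
    by (intro sqint_product_integrable L2T_sqint assms sqint_cis)
  have "fourier_coeff (\<lambda>\<theta>. complex_of_real (a * cos \<theta>) * f \<theta>) n
      = (a / 2) * ((LINT x|circ. f x * cnj (cis (of_int (n - 1) * x))) + (LINT x|circ. f x * cnj (cis (of_int (n + 1) * x)))) / (2 * pi)"
    unfolding fourier_coeff_def set_integral_circ eq
    using I[of "n - 1"] I[of "n + 1"] by (simp only: integral_mult_right_zero Bochner_Integration.integral_add)
  also have "\<dots> = a * ((fourier_coeff f (n - 1) + fourier_coeff f (n + 1)) / 2)"
    by (simp add: fourier_coeff_inner L2T_inner_circ field_simps)
  finally show ?thesis .
qed

lemma mild_solution_L2T: "mild_solution q k u \<Longrightarrow> 0 \<le> t \<Longrightarrow> u t \<in> L2T"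
  by (simp add: mild_solution_def)

lemma mild_solution_continuous:
  assumes "mild_solution q k u" "0 \<le> t"
  shows "continuous (at t within {0..}) (\<lambda>s. L2T_norm (\<lambda>\<theta>. u s \<theta> - u t \<theta>))"
  using assms by (simp add: mild_solution_def continuous_within L2T_norm_zero)

lemma mild_solution_norm_bounded:
  assumes mild: "mild_solution q k u"
  obtains K where "\<And>t. 0 \<le> t \<Longrightarrow> t \<le> T \<Longrightarrow> (L2T_norm (u t))\<^sup>2 \<le> K"
proof (rule ccontr)
  assume "\<not> thesis"
  then have "\<exists>t. 0 \<le> t \<and> t \<le> T \<and> real j < (L2T_norm (u t))\<^sup>2" for j :: nat
    using that[of "real j"] by (meson not_le)
  then obtain t where t: "\<And>j. 0 \<le> t j" "\<And>j. t j \<le> T" "\<And>j. real j < (L2T_norm (u (t j)))\<^sup>2"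
    by metis
  have "seq_compact {0..T}" by (simp add: compact_imp_seq_compact)
  then obtain l r where l: "l \<in> {0..T}" and r: "strict_mono r" "(t \<circ> r) \<longlonglongrightarrow> l"
    using t(1,2) unfolding seq_compact_def by (metis atLeastAtMost_iff)
  have "(\<lambda>j. L2T_norm (\<lambda>\<theta>. u ((t \<circ> r) j) \<theta> - u l \<theta>)) \<longlonglongrightarrow> L2T_norm (\<lambda>\<theta>. u l \<theta> - u l \<theta>)"
    by (rule continuous_within_tendsto_compose'[OF mild_solution_continuous[OF mild] _ r(2)])
      (use l t(1) in auto)
  then have "(\<lambda>j. L2T_norm (\<lambda>\<theta>. u (t (r j)) \<theta> - u l \<theta>)) \<longlonglongrightarrow> 0"
    by (simp add: L2T_norm_zero o_def)
  then have "\<forall>\<^sub>F j in sequentially. L2T_norm (\<lambda>\<theta>. u (t (r j)) \<theta> - u l \<theta>) < 1"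
    by (rule order_tendstoD) simp
  moreover obtain m :: nat where m: "2 + 2 * (L2T_norm (u l))\<^sup>2 < m" using reals_Archimedean2 by blast
  ultimately obtain j where j: "L2T_norm (\<lambda>\<theta>. u (t (r j)) \<theta> - u l \<theta>) < 1" "j \<ge> m"
    unfolding eventually_sequentially by (meson linear)
  have sq: "sqint (u (t (r j)))" "sqint (u l)"
    using mild_solution_L2T[OF mild] t(1) l by (auto intro: L2T_sqint)
  have sqd: "sqint (\<lambda>\<theta>. u (t (r j)) \<theta> - u l \<theta>)" by (intro sqint_diff sq)
  have "(L2T_norm (u (t (r j))))\<^sup>2 \<le> 2 * (L2T_norm (\<lambda>\<theta>. u (t (r j)) \<theta> - u l \<theta>))\<^sup>2 + 2 * (L2T_norm (u l))\<^sup>2"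
  proof -
    have "(LINT x|circ. (cmod (u (t (r j)) x))\<^sup>2)
        \<le> (LINT x|circ. 2 * (cmod (u (t (r j)) x - u l x))\<^sup>2 + 2 * (cmod (u l x))\<^sup>2)"
    proof (rule integral_mono)
      show "(cmod (u (t (r j)) x))\<^sup>2 \<le> 2 * (cmod (u (t (r j)) x - u l x))\<^sup>2 + 2 * (cmod (u l x))\<^sup>2" for x
        using norm_sq_sum_le[of "u (t (r j)) x - u l x" "u l x"] by simp
    qed (use sq sqd in \<open>auto simp: sqint_def\<close>)
    then show ?thesis using sq sqd by (simp add: L2T_norm_sq sqint_def)
  qed
  also have "\<dots> \<le> 2 * 1\<^sup>2 + 2 * (L2T_norm (u l))\<^sup>2"
    using j(1) L2T_norm_nonneg by (intro add_mono mult_left_mono power_mono) auto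
  also have "\<dots> < real (r j)"
    using m j(2) seq_suble[OF r(1), of j] by simp
  finally show False using t(3)[of "r j"] by simp
qed

text \<open>The Duhamel equation in Fourier coefficients, for a Borel potential.  Continuity
  on the whole line presupposes a continuation of the coefficients to negative times, such as the one
  by their initial values.\<close>

definition coeff_system :: "(real \<Rightarrow> real) \<Rightarrow> real \<Rightarrow> (int \<Rightarrow> real \<Rightarrow> complex) \<Rightarrow> bool" where
  "coeff_system q k c \<longleftrightarrow>
     (\<forall>n. continuous_on UNIV (c n)) \<and>
     (\<forall>T. \<exists>K. \<forall>t\<le>T. \<forall>n. cmod (c n t) \<le> K) \<and>
     (\<forall>n. \<forall>t\<ge>0. c n t = (if n = 0 then 1 else 0) + \<i> * (LINT \<tau>:{0..t}|lborel.
        cis (- (k * (t - \<tau>)) * (of_int n)\<^sup>2) * (q \<tau> * ((c (n - 1) \<tau> + c (n + 1) \<tau>) / 2))))"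

lemma fourier_coeff_one: "fourier_coeff (\<lambda>_. 1) n = (if n = 0 then 1 else 0)"
  using fourier_coeff_cis[of 0 n] by auto

lemma one_L2T: "(\<lambda>_. 1) \<in> L2T"
  using cis_in_L2T[of 0] by simp

text \<open>Pairing the Duhamel integral with \<open>e\<^sup>i\<^sup>n\<^sup>\<theta>\<close> is one of the functionals that define the weak integral.\<close>

lemma mild_solution_coeff_equation:
  assumes mild: "mild_solution q k u" and t: "0 \<le> t"
  shows "fourier_coeff (u t) n = (if n = 0 then 1 else 0) + \<i> * (LINT \<tau>:{0..t}|lebesgue.
    cis (- (k * (t - \<tau>)) * (of_int n)\<^sup>2) *
      (q \<tau> * ((fourier_coeff (u \<tau>) (n - 1) + fourier_coeff (u \<tau>) (n + 1)) / 2)))"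
proof -
  define F where "F \<tau> = free_evol (k * (t - \<tau>)) (\<lambda>\<theta>. complex_of_real (q \<tau> * cos \<theta>) * u \<tau> \<theta>)" for \<tau>
  obtain I where I: "has_L2T_integral F {0..t} I"
    and AE: "AE \<theta> in lebesgue. u t \<theta> = free_evol (k * t) (\<lambda>_. 1) \<theta> + \<i> * I \<theta>"
    using mild t unfolding mild_solution_def F_def by blast
  have IL: "I \<in> L2T" using I by (simp add: has_L2T_integral_def)
  have F_L: "F \<tau> \<in> L2T" and F_coeff: "fourier_coeff (F \<tau>) n = cis (- (k * (t - \<tau>)) * (of_int n)\<^sup>2) *
      (q \<tau> * ((fourier_coeff (u \<tau>) (n - 1) + fourier_coeff (u \<tau>) (n + 1)) / 2))" if "\<tau> \<in> {0..t}" for \<tau>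
  proof -
    have "u \<tau> \<in> L2T" using mild_solution_L2T[OF mild] that by simp
    then show "F \<tau> \<in> L2T" and "fourier_coeff (F \<tau>) n = cis (- (k * (t - \<tau>)) * (of_int n)\<^sup>2) *
      (q \<tau> * ((fourier_coeff (u \<tau>) (n - 1) + fourier_coeff (u \<tau>) (n + 1)) / 2))"
      unfolding F_def
      by (simp_all only: free_evol_L2T[OF cos_mult_L2T] fourier_coeff_free_evol[OF cos_mult_L2T] fourier_coeff_cos_mult)
  qed
  define e where "e = (\<lambda>\<theta>. cis (of_int n * \<theta>))"
  have "e \<in> L2T" unfolding e_def by (rule cis_in_L2T)
  then have "L2T_inner I e = (LINT \<tau>:{0..t}|lebesgue. L2T_inner (F \<tau>) e)"
    using I by (simp add: has_L2T_integral_def)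
  then have "fourier_coeff I n = (LINT \<tau>:{0..t}|lebesgue. L2T_inner (F \<tau>) e) / (2 * pi)"
    by (simp add: fourier_coeff_inner e_def)
  also have "\<dots> = (LINT \<tau>:{0..t}|lebesgue. fourier_coeff (F \<tau>) n)"
    by (simp add: fourier_coeff_inner e_def)
  also have "\<dots> = (LINT \<tau>:{0..t}|lebesgue. cis (- (k * (t - \<tau>)) * (of_int n)\<^sup>2) *
      (q \<tau> * ((fourier_coeff (u \<tau>) (n - 1) + fourier_coeff (u \<tau>) (n + 1)) / 2)))"
    by (rule set_lebesgue_integral_cong) (simp, use F_coeff in blast)
  finally have coeff_I: "fourier_coeff I n = \<dots>" .
  have fe: "free_evol (k * t) (\<lambda>_. 1) \<in> L2T" by (rule free_evol_L2T[OF one_L2T])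
  have [measurable]: "free_evol (k * t) (\<lambda>_. 1) \<in> borel_measurable lebesgue" "I \<in> borel_measurable lebesgue"
    "u t \<in> borel_measurable lebesgue"
    using fe IL mild_solution_L2T[OF mild t] by (auto simp: L2T_def)
  have "fourier_coeff (u t) n = fourier_coeff (\<lambda>\<theta>. free_evol (k * t) (\<lambda>_. 1) \<theta> + \<i> * I \<theta>) n"
    by (rule fourier_coeff_cong_AE[OF AE]) measurable
  also have "\<dots> = fourier_coeff (free_evol (k * t) (\<lambda>_. 1)) n + \<i> * fourier_coeff I n"
    using L2T_sqint[OF fe] sqint_cmult[OF L2T_sqint[OF IL], of \<i>]
    by (subst fourier_coeff_add) (simp_all only: fourier_coeff_cmult)
  also have "fourier_coeff (free_evol (k * t) (\<lambda>_. 1)) n = (if n = 0 then 1 else 0)"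
    unfolding fourier_coeff_free_evol[OF one_L2T] fourier_coeff_one by simp
  finally show ?thesis unfolding coeff_I .
qed

lemma mild_solution_coeff_continuous:
  assumes mild: "mild_solution q k u"
  shows "continuous_on {0..} (\<lambda>t. fourier_coeff (u t) n)"
  unfolding continuous_on_def
proof
  fix t :: real assume t: "t \<in> {0..}"
  have "((\<lambda>s. L2T_norm (\<lambda>\<theta>. u s \<theta> - u t \<theta>) / sqrt (2 * pi)) \<longlongrightarrow> 0 / sqrt (2 * pi)) (at t within {0..})"
    using mild t by (intro tendsto_divide tendsto_const) (auto simp: mild_solution_def)
  then have lim: "((\<lambda>s. L2T_norm (\<lambda>\<theta>. u s \<theta> - u t \<theta>) / sqrt (2 * pi)) \<longlongrightarrow> 0) (at t within {0..})"
    by simp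
  have "((\<lambda>s. fourier_coeff (u s) n - fourier_coeff (u t) n) \<longlongrightarrow> 0) (at t within {0..})"
  proof (rule Lim_null_comparison[OF _ lim])
    have "norm (fourier_coeff (u s) n - fourier_coeff (u t) n) \<le> L2T_norm (\<lambda>\<theta>. u s \<theta> - u t \<theta>) / sqrt (2 * pi)"
      if "s \<in> {0..}" for s
    proof -
      have sq: "sqint (u s)" "sqint (u t)"
        using mild_solution_L2T[OF mild] that t by (auto intro: L2T_sqint)
      show ?thesis using fourier_coeff_bound[OF sqint_diff[OF sq], of n] by (simp only: fourier_coeff_diff[OF sq])
    qed
    then show "\<forall>\<^sub>F s in at t within {0..}. norm (fourier_coeff (u s) n - fourier_coeff (u t) n)
        \<le> L2T_norm (\<lambda>\<theta>. u s \<theta> - u t \<theta>) / sqrt (2 * pi)"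
      by (auto simp: eventually_at_filter)
  qed
  then show "((\<lambda>s. fourier_coeff (u s) n) \<longlongrightarrow> fourier_coeff (u t) n) (at t within {0..})"
    by (rule LIM_zero_cancel)
qed

lemma mild_solution_coeff_bounded:
  assumes mild: "mild_solution q k u"
  shows "\<exists>K. \<forall>t\<in>{0..T}. \<forall>n. cmod (fourier_coeff (u t) n) \<le> K"
proof -
  obtain K where K: "\<And>t. 0 \<le> t \<Longrightarrow> t \<le> T \<Longrightarrow> (L2T_norm (u t))\<^sup>2 \<le> K"
    using mild_solution_norm_bounded[OF mild] by blast
  have "cmod (fourier_coeff (u t) n) \<le> sqrt K / sqrt (2 * pi)" if t: "t \<in> {0..T}" for t n
  proof -
    have "L2T_norm (u t) \<le> sqrt K" using K[of t] t by (intro real_le_rsqrt) auto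
    moreover have "cmod (fourier_coeff (u t) n) \<le> L2T_norm (u t) / sqrt (2 * pi)"
      using mild_solution_L2T[OF mild] t by (intro fourier_coeff_bound L2T_sqint) auto
    ultimately show ?thesis by (meson order_trans divide_right_mono pi_ge_zero real_sqrt_ge_zero mult_nonneg_nonneg zero_le_numeral)
  qed
  then show ?thesis by blast
qed

text \<open>A Borel representative of the potential makes product measurability in \<open>(k, t)\<close> available, as needed
  for Fubini's theorem.\<close>

lemma borel_potential:
  fixes q :: "real \<Rightarrow> real"
  assumes q: "\<And>T. T > 0 \<Longrightarrow> set_integrable lebesgue {0..T} q"
  obtains q' where "q' \<in> borel_measurable borel" "AE t in lborel. t \<ge> 0 \<longrightarrow> q' t = q t"
    "AE t in lebesgue. t \<ge> 0 \<longrightarrow> q' t = q t" "\<And>T. set_integrable lborel {0..T} q'"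
proof -
  have "(\<lambda>t. indicator {0..real (Suc n)} t * q t) \<in> borel_measurable lebesgue" for n
    using q[of "real (Suc n)"] unfolding set_integrable_def by (auto dest: borel_measurable_integrable)
  then have "(\<lambda>t. lim (\<lambda>n. indicator {0..real (Suc n)} t * q t)) \<in> borel_measurable lebesgue"
    by (rule borel_measurable_lim_metric)
  moreover have "lim (\<lambda>n. indicator {0..real (Suc n)} t * q t) = indicator {0..} t * q t" for t
  proof (rule limI, rule tendsto_eventually)
    obtain m :: nat where m: "t < m" using reals_Archimedean2 by blast
    have "indicator {0..real (Suc n)} t * q t = indicator {0..} t * q t" if "n \<ge> m" for n
    proof -
      have "t \<le> real (Suc n)" using that m by linarith
      then show ?thesis by (auto simp: indicator_def)
    qed
    then show "\<forall>\<^sub>F n in sequentially. indicator {0..real (Suc n)} t * q t = indicator {0..} t * q t"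
      unfolding eventually_sequentially by blast
  qed
  ultimately have meas: "(\<lambda>t. indicator {0..} t * q t) \<in> borel_measurable lebesgue" by simp
  obtain q' where q': "q' \<in> borel_measurable lborel" "AE t in lborel. indicator {0..} t * q t = q' t"
    using completion_ex_borel_measurable_real[OF meas] by blast
  have AE: "AE t in lborel. t \<ge> 0 \<longrightarrow> q' t = q t"
    using q'(2) by (rule eventually_mono) (auto simp: indicator_def)
  have AE': "AE t in lebesgue. t \<ge> 0 \<longrightarrow> q' t = q t"
    using AE by (rule AE_completion)
  have [measurable]: "q' \<in> borel_measurable borel" using q'(1) by simp
  have "set_integrable lborel {0..T} q'" for T
  proof -
    have m: "(\<lambda>x. indicator {0..T} x *\<^sub>R q' x) \<in> borel_measurable lborel" by measurable
    have "set_integrable lebesgue {0..max 1 T} q" by (rule q) simp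
    then have "set_integrable lebesgue {0..T} q"
      by (rule set_integrable_subset) auto
    then have "integrable lebesgue (\<lambda>x. indicator {0..T} x *\<^sub>R q' x)"
      unfolding set_integrable_def
      by (rule integrable_cong_AE_imp[OF _ measurable_completion[OF m]])
        (use AE' in \<open>auto elim!: eventually_mono simp: indicator_def\<close>)
    then show ?thesis
      unfolding set_integrable_def by (rule integrable_completion[OF m, THEN iffD1])
  qed
  then show ?thesis by (rule that[OF \<open>q' \<in> borel_measurable borel\<close> AE AE'])
qed

theorem mild_solution_coeff_system:
  assumes mild: "mild_solution q k u" and [measurable]: "q' \<in> borel_measurable borel"
    and AE: "AE t in lebesgue. t \<ge> 0 \<longrightarrow> q' t = q t"
  shows "coeff_system q' k (\<lambda>n t. fourier_coeff (u (max 0 t)) n)"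
  unfolding coeff_system_def
proof (intro conjI allI impI)
  define c where "c n t = fourier_coeff (u (max 0 t)) n" for n t
  have cont: "continuous_on UNIV (c n)" for n
    unfolding c_def
    by (rule continuous_on_compose2[OF mild_solution_coeff_continuous[OF mild], of _ "\<lambda>t. max 0 t"])
      (auto intro!: continuous_intros)
  then show "continuous_on UNIV (\<lambda>t. fourier_coeff (u (max 0 t)) n)" for n unfolding c_def .
  show "\<exists>K. \<forall>t\<le>T. \<forall>n. cmod (fourier_coeff (u (max 0 t)) n) \<le> K" for T
  proof -
    obtain K where "\<forall>t\<in>{0..max 0 T}. \<forall>n. cmod (fourier_coeff (u t) n) \<le> K"
      using mild_solution_coeff_bounded[OF mild] by blast
    then show ?thesis by (intro exI[of _ K]) auto
  qed
  have [measurable]: "c n \<in> borel_measurable borel" for n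
    by (intro borel_measurable_continuous_onI cont)
  fix n and t :: real assume t: "0 \<le> t"
  have cism [measurable]: "(\<lambda>\<tau>. cis (- (k * (t - \<tau>)) * (of_int n)\<^sup>2)) \<in> borel_measurable borel"
    by (intro borel_measurable_continuous_onI continuous_intros)
  define G where "G r \<tau> = indicator {0..t} \<tau> *\<^sub>R (cis (- (k * (t - \<tau>)) * (of_int n)\<^sup>2) *
      (complex_of_real (r \<tau>) * ((c (n - 1) \<tau> + c (n + 1) \<tau>) / 2)))" for r :: "real \<Rightarrow> real" and \<tau>
  have m: "G q' \<in> borel_measurable lborel" unfolding G_def by measurable
  have AEG: "AE \<tau> in lebesgue. G q' \<tau> = G q \<tau>"
    using AE by (rule eventually_mono) (auto simp: G_def indicator_def)
  have "(LINT \<tau>|lborel. G q' \<tau>) = (LINT \<tau>|lebesgue. G q' \<tau>)"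
    by (rule integral_completion[OF m, symmetric])
  also have "\<dots> = (LINT \<tau>|lebesgue. G q \<tau>)"
  proof (rule integral_cong_AE[OF _ _ AEG])
    show 1: "G q' \<in> borel_measurable lebesgue" by (rule measurable_completion[OF m])
    show "G q \<in> borel_measurable lebesgue"
      by (rule borel_measurable_AE[OF 1 AEG])
  qed
  finally have "(LINT \<tau>|lebesgue. G q \<tau>) = (LINT \<tau>|lborel. G q' \<tau>)" ..
  moreover have "fourier_coeff (u (max 0 t)) n = (if n = 0 then 1 else 0) + \<i> * (LINT \<tau>|lebesgue. G q \<tau>)"
  proof -
    have "(LINT \<tau>|lebesgue. G q \<tau>) = (LINT \<tau>:{0..t}|lebesgue. cis (- (k * (t - \<tau>)) * (of_int n)\<^sup>2) *
      (q \<tau> * ((fourier_coeff (u \<tau>) (n - 1) + fourier_coeff (u \<tau>) (n + 1)) / 2)))"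
      unfolding set_lebesgue_integral_def
      by (rule Bochner_Integration.integral_cong) (auto simp: G_def c_def indicator_def)
    then show ?thesis using mild_solution_coeff_equation[OF mild t, of n] t by simp
  qed
  ultimately show "fourier_coeff (u (max 0 t)) n = (if n = 0 then 1 else 0) + \<i> * (LINT \<tau>:{0..t}|lborel.
        cis (- (k * (t - \<tau>)) * (of_int n)\<^sup>2) *
        (q' \<tau> * ((fourier_coeff (u (max 0 \<tau>)) (n - 1) + fourier_coeff (u (max 0 \<tau>)) (n + 1)) / 2)))"
    by (simp only: G_def c_def set_lebesgue_integral_def)
qed

section \<open>Calculus of indefinite integrals\<close>

text \<open>The square is the union of the triangles below and above the diagonal, and Fubini's theorem
  evaluates each of them: integration by parts in integrated form.\<close>

lemma integral_product_triangles:
  fixes f g :: "real \<Rightarrow> complex"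
  assumes f: "integrable lborel f" and g: "integrable lborel g"
  shows "integrable lborel (\<lambda>x. f x * (LINT y:{..x}|lborel. g y))"
    and "integrable lborel (\<lambda>x. (LINT y:{..x}|lborel. f y) * g x)"
    and "(LINT x|lborel. f x) * (LINT y|lborel. g y) =
      (LINT x|lborel. f x * (LINT y:{..x}|lborel. g y)) + (LINT x|lborel. (LINT y:{..x}|lborel. f y) * g x)"
proof -
  have [measurable]: "f \<in> borel_measurable borel" "g \<in> borel_measurable borel"
    using f g by (auto dest: borel_measurable_integrable)
  have H: "integrable (lborel \<Otimes>\<^sub>M lborel) (\<lambda>(x, y). f x * g y)"
  proof (rule lborel_pair.Fubini_integrable)
    show "integrable lborel (\<lambda>x. LINT y|lborel. cmod (case (x, y) of (x, y) \<Rightarrow> f x * g y))"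
      using f by (simp add: norm_mult)
  qed (use g in \<open>auto simp: split_beta'\<close>)
  have m1: "(\<lambda>(x, y). indicator {..x} y *\<^sub>R (f x * g y)) \<in> borel_measurable (lborel \<Otimes>\<^sub>M lborel)"
    and m2: "(\<lambda>(x, y). indicator {..<y} x *\<^sub>R (f x * g y)) \<in> borel_measurable (lborel \<Otimes>\<^sub>M lborel)"
    by (auto simp: indicator_def[abs_def] split_beta')
  have H1: "integrable (lborel \<Otimes>\<^sub>M lborel) (\<lambda>(x, y). indicator {..x} y *\<^sub>R (f x * g y))"
    by (rule Bochner_Integration.integrable_bound[OF H m1]) (auto simp: indicator_def)
  have H2: "integrable (lborel \<Otimes>\<^sub>M lborel) (\<lambda>(x, y). indicator {..<y} x *\<^sub>R (f x * g y))"
    by (rule Bochner_Integration.integrable_bound[OF H m2]) (auto simp: indicator_def)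
  have eq1: "(LINT y|lborel. indicator {..x} y *\<^sub>R (f x * g y)) = f x * (LINT y:{..x}|lborel. g y)" for x
    unfolding set_lebesgue_integral_def by (simp flip: integral_mult_right_zero)
  have eq2: "(LINT x|lborel. indicator {..<y} x *\<^sub>R (f x * g y)) = (LINT x:{..y}|lborel. f x) * g y" for y
  proof -
    have "(LINT x|lborel. indicator {..<y} x *\<^sub>R (f x * g y)) = (LINT x:{..<y}|lborel. f x) * g y"
      unfolding set_lebesgue_integral_def by (simp flip: integral_mult_left_zero)
    also have "(LINT x:{..<y}|lborel. f x) = (LINT x:{..y}|lborel. f x)"
      unfolding set_lebesgue_integral_def
      by (rule integral_cong_AE)
        (auto simp: indicator_def intro!: eventually_mono[OF AE_lborel_singleton[of y]])
    finally show ?thesis .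
  qed
  show "integrable lborel (\<lambda>x. f x * (LINT y:{..x}|lborel. g y))"
    using lborel_pair.integrable_fst[OF H1] by (simp only: eq1)
  show "integrable lborel (\<lambda>x. (LINT y:{..x}|lborel. f y) * g x)"
    using lborel_pair.integrable_snd[OF H2] by (simp only: eq2)
  have "(LINT x|lborel. f x) * (LINT y|lborel. g y) = (LINT x|lborel. LINT y|lborel. f x * g y)"
    by simp
  also have "\<dots> = (LINT p|(lborel \<Otimes>\<^sub>M lborel). (case p of (x, y) \<Rightarrow> f x * g y))"
    by (rule lborel_pair.integral_fst[OF H])
  also have "\<dots> = (LINT p|(lborel \<Otimes>\<^sub>M lborel). (case p of (x, y) \<Rightarrow> indicator {..x} y *\<^sub>R (f x * g y))
      + (case p of (x, y) \<Rightarrow> indicator {..<y} x *\<^sub>R (f x * g y)))"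
    by (rule Bochner_Integration.integral_cong) (auto simp: indicator_def)
  also have "\<dots> = (LINT p|(lborel \<Otimes>\<^sub>M lborel). (case p of (x, y) \<Rightarrow> indicator {..x} y *\<^sub>R (f x * g y)))
      + (LINT p|(lborel \<Otimes>\<^sub>M lborel). (case p of (x, y) \<Rightarrow> indicator {..<y} x *\<^sub>R (f x * g y)))"
    by (rule Bochner_Integration.integral_add[OF H1 H2])
  also have "(LINT p|(lborel \<Otimes>\<^sub>M lborel). (case p of (x, y) \<Rightarrow> indicator {..x} y *\<^sub>R (f x * g y)))
      = (LINT x|lborel. f x * (LINT y:{..x}|lborel. g y))"
    by (subst lborel_pair.integral_fst[OF H1, symmetric]) (simp only: eq1)
  also have "(LINT p|(lborel \<Otimes>\<^sub>M lborel). (case p of (x, y) \<Rightarrow> indicator {..<y} x *\<^sub>R (f x * g y)))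
      = (LINT x|lborel. (LINT y:{..x}|lborel. f y) * g x)"
    by (subst lborel_pair.integral_snd[OF H2, symmetric]) (simp only: eq2)
  finally show "(LINT x|lborel. f x) * (LINT y|lborel. g y) =
      (LINT x|lborel. f x * (LINT y:{..x}|lborel. g y)) + (LINT x|lborel. (LINT y:{..x}|lborel. f y) * g x)" .
qed

text \<open>Absolute continuity, with an explicit density in place of an a.e. derivative.  The densities below are
  products of the merely integrable potential with continuous functions, so derivatives exist only
  almost everywhere.\<close>

definition prim_on :: "real \<Rightarrow> real \<Rightarrow> (real \<Rightarrow> complex) \<Rightarrow> (real \<Rightarrow> complex) \<Rightarrow> bool" where
  "prim_on a b f f' \<longleftrightarrow> set_integrable lborel {a..b} f' \<and>
     (\<forall>t\<in>{a..b}. f t = f a + (LINT s:{a..t}|lborel. f' s))"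

lemma prim_on_integrable: "prim_on a b f f' \<Longrightarrow> set_integrable lborel {a..b} f'"
  by (simp add: prim_on_def)

lemma prim_onD: "prim_on a b f f' \<Longrightarrow> a \<le> t \<Longrightarrow> t \<le> b \<Longrightarrow> f t = f a + (LINT s:{a..t}|lborel. f' s)"
  unfolding prim_on_def by (meson atLeastAtMost_iff)

lemma set_integrable_subinterval:
  fixes f :: "real \<Rightarrow> 'a::{banach,second_countable_topology}"
  shows "set_integrable lborel {a..b} f \<Longrightarrow> a \<le> c \<Longrightarrow> d \<le> b \<Longrightarrow> set_integrable lborel {c..d} f"
  by (rule set_integrable_subset) auto

lemma set_integral_lborel_point:
  fixes f :: "real \<Rightarrow> 'a::{banach,second_countable_topology}"
  shows "(LINT s:{a..a}|lborel. f s) = 0"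
proof -
  have "AE s in lborel. indicator {a..a} s *\<^sub>R f s = 0"
    using AE_lborel_singleton[of a] by (rule eventually_mono) (auto simp: indicator_def)
  then show ?thesis unfolding set_lebesgue_integral_def by (rule integral_eq_zero_AE)
qed

lemma prim_on_primitive:
  "set_integrable lborel {a..b} f' \<Longrightarrow> prim_on a b (\<lambda>t. C + (LINT s:{a..t}|lborel. f' s)) f'"
  by (simp add: prim_on_def set_integral_lborel_point del: atLeastAtMost_singleton)

lemma set_integral_lborel_interval_split:
  fixes f :: "real \<Rightarrow> 'a::{banach,second_countable_topology}"
  assumes f: "set_integrable lborel {a..b} f" and "a \<le> c" "c \<le> b"
  shows "(LINT s:{a..b}|lborel. f s) = (LINT s:{a..c}|lborel. f s) + (LINT s:{c..b}|lborel. f s)"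
proof -
  have i: "set_integrable lborel {a..c} f" "set_integrable lborel {c..b} f"
    by (rule set_integrable_subinterval[OF f]; use assms in auto)+
  have "AE s in lborel. indicator {a..b} s *\<^sub>R f s = indicator {a..c} s *\<^sub>R f s + indicator {c..b} s *\<^sub>R f s"
    using AE_lborel_singleton[of c] by (rule eventually_mono) (use assms in \<open>auto simp: indicator_def\<close>)
  then have "(LINT s:{a..b}|lborel. f s) = (LINT s|lborel. indicator {a..c} s *\<^sub>R f s + indicator {c..b} s *\<^sub>R f s)"
    using i f unfolding set_lebesgue_integral_def set_integrable_def by (intro integral_cong_AE) auto
  then show ?thesis using i unfolding set_lebesgue_integral_def set_integrable_def by simp
qed

lemma prim_on_subinterval:
  assumes "prim_on a b f f'" "a \<le> c" "d \<le> b"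
  shows "prim_on c d f f'"
  unfolding prim_on_def
proof (intro conjI ballI)
  show "set_integrable lborel {c..d} f'"
    using set_integrable_subinterval[OF prim_on_integrable[OF assms(1)]] assms by auto
  fix t assume t: "t \<in> {c..d}"
  have "f t = f a + (LINT s:{a..t}|lborel. f' s)" "f c = f a + (LINT s:{a..c}|lborel. f' s)"
    by (rule prim_onD[OF assms(1)]; use t assms(2,3) in simp)+
  moreover have "(LINT s:{a..t}|lborel. f' s) = (LINT s:{a..c}|lborel. f' s) + (LINT s:{c..t}|lborel. f' s)"
    using t assms by (intro set_integral_lborel_interval_split
        set_integrable_subinterval[OF prim_on_integrable[OF assms(1)]]) auto
  ultimately show "f t = f c + (LINT s:{c..t}|lborel. f' s)" by simp
qed

lemma prim_on_const: "prim_on a b (\<lambda>_. C) (\<lambda>_. 0)"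
  by (simp add: prim_on_def set_integrable_def)

lemma prim_on_add:
  assumes f: "prim_on a b f f'" and g: "prim_on a b g g'"
  shows "prim_on a b (\<lambda>t. f t + g t) (\<lambda>t. f' t + g' t)"
  unfolding prim_on_def
proof (intro conjI ballI)
  note i = prim_on_integrable[OF f] prim_on_integrable[OF g]
  show "set_integrable lborel {a..b} (\<lambda>t. f' t + g' t)" by (intro set_integral_add i)
  fix t assume t: "t \<in> {a..b}"
  have "(LINT s:{a..t}|lborel. f' s + g' s) = (LINT s:{a..t}|lborel. f' s) + (LINT s:{a..t}|lborel. g' s)"
    using t by (intro set_integral_add set_integrable_subinterval[OF i(1)] set_integrable_subinterval[OF i(2)]) auto
  then show "f t + g t = f a + g a + (LINT s:{a..t}|lborel. f' s + g' s)"
    using t prim_onD[OF f, of t] prim_onD[OF g, of t] by simp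
qed

lemma prim_on_bounded_linear:
  fixes L :: "complex \<Rightarrow> complex"
  assumes L: "bounded_linear L" and f: "prim_on a b f f'"
  shows "prim_on a b (\<lambda>t. L (f t)) (\<lambda>t. L (f' t))"
proof -
  interpret L: bounded_linear L by fact
  have int: "integrable lborel (\<lambda>x. indicator {a..t} x *\<^sub>R f' x)" if "t \<le> b" for t
    using set_integrable_subinterval[OF prim_on_integrable[OF f], of a t] that by (simp add: set_integrable_def)
  have "(LINT x|lborel. indicator {a..t} x *\<^sub>R L (f' x)) = L (LINT x|lborel. indicator {a..t} x *\<^sub>R f' x)"
    if "t \<le> b" for t
    using integral_bounded_linear[OF L int[OF that]] by (simp add: L.scale)
  moreover have "integrable lborel (\<lambda>x. indicator {a..b} x *\<^sub>R L (f' x))"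
    using integrable_bounded_linear[OF L int[of b]] by (simp add: L.scale)
  moreover have "L (f t) = L (f a) + L (LINT x|lborel. indicator {a..t} x *\<^sub>R f' x)" if "t \<in> {a..b}" for t
    using prim_onD[OF f, of t] that by (simp only: set_lebesgue_integral_def L.add atLeastAtMost_iff)
  moreover note int
  ultimately show ?thesis
    unfolding prim_on_def set_integrable_def set_lebesgue_integral_def
    by (intro conjI ballI) (blast, metis atLeastAtMost_iff)
qed

lemma prim_on_cmult: "prim_on a b f f' \<Longrightarrow> prim_on a b (\<lambda>t. c * f t) (\<lambda>t. c * f' t)"
  by (rule prim_on_bounded_linear[OF bounded_linear_mult_right])

lemma prim_on_cnj: "prim_on a b f f' \<Longrightarrow> prim_on a b (\<lambda>t. cnj (f t)) (\<lambda>t. cnj (f' t))"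
  by (rule prim_on_bounded_linear[OF bounded_linear_cnj])

lemma prim_on_sum:
  "(\<And>i. i \<in> F \<Longrightarrow> prim_on a b (f i) (f' i)) \<Longrightarrow>
    prim_on a b (\<lambda>t. \<Sum>i\<in>F. f i t) (\<lambda>t. \<Sum>i\<in>F. f' i t)"
  by (induction F rule: infinite_finite_induct) (auto intro: prim_on_add prim_on_const)

lemma prim_on_cong:
  assumes "prim_on a b f f'" "\<And>t. t \<in> {a..b} \<Longrightarrow> f t = g t" "\<And>t. t \<in> {a..b} \<Longrightarrow> f' t = g' t"
  shows "prim_on a b g g'"
proof -
  have "set_integrable lborel {a..b} f' = set_integrable lborel {a..b} g'"
    by (rule set_integrable_cong) (use assms in auto)
  moreover have "(LINT s:{a..t}|lborel. f' s) = (LINT s:{a..t}|lborel. g' s)" if "t \<in> {a..b}" for t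
    by (rule set_lebesgue_integral_cong) (use that assms in auto)
  moreover have "g t = g a + (LINT s:{a..t}|lborel. f' s)" if "t \<in> {a..b}" for t
    using prim_onD[OF assms(1), of t] that assms(2)[of t] assms(2)[of a] by simp
  ultimately show ?thesis
    using prim_on_integrable[OF assms(1)] unfolding prim_on_def by metis
qed

text \<open>With \<open>f = f(a) + \<integral>f'\<close> and \<open>g = g(a) + \<integral>g'\<close>, the product of the two integrals is split into
  triangles.\<close>

lemma prim_on_mult:
  assumes f: "prim_on a b f f'" and g: "prim_on a b g g'"
  shows "prim_on a b (\<lambda>t. f t * g t) (\<lambda>t. f' t * g t + f t * g' t)"
proof (cases "a \<le> b")
  case False
  then show ?thesis by (simp add: prim_on_def set_integrable_def)
next
  case ab: True
  define F where "F t = (LINT s:{a..t}|lborel. f' s)" for t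
  define G where "G t = (LINT s:{a..t}|lborel. g' s)" for t
  have key: "set_integrable lborel {a..t} (\<lambda>x. f' x * G x)" "set_integrable lborel {a..t} (\<lambda>x. F x * g' x)"
    "F t * G t = (LINT x:{a..t}|lborel. f' x * G x) + (LINT x:{a..t}|lborel. F x * g' x)" if t: "t \<in> {a..b}" for t
  proof -
    define f1 where "f1 x = indicator {a..t} x *\<^sub>R f' x" for x
    define g1 where "g1 x = indicator {a..t} x *\<^sub>R g' x" for x
    have "set_integrable lborel {a..t} f'" "set_integrable lborel {a..t} g'"
      using t by (auto intro: set_integrable_subinterval[OF prim_on_integrable[OF f]] set_integrable_subinterval[OF prim_on_integrable[OF g]])
    then have i: "integrable lborel f1" "integrable lborel g1"
      by (simp_all add: f1_def[abs_def] g1_def[abs_def] set_integrable_def)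
    have g1: "(LINT y:{..x}|lborel. g1 y) = G x" and f1: "(LINT y:{..x}|lborel. f1 y) = F x" if "x \<in> {a..t}" for x
      using that unfolding G_def F_def g1_def f1_def set_lebesgue_integral_def
      by (auto intro!: Bochner_Integration.integral_cong simp: indicator_def)
    have e1: "f1 x * (LINT y:{..x}|lborel. g1 y) = indicator {a..t} x *\<^sub>R (f' x * G x)" for x
      using g1[of x] by (cases "x \<in> {a..t}") (auto simp: f1_def)
    have e2: "(LINT y:{..x}|lborel. f1 y) * g1 x = indicator {a..t} x *\<^sub>R (F x * g' x)" for x
      using f1[of x] by (cases "x \<in> {a..t}") (auto simp: g1_def)
    note T = integral_product_triangles[OF i, unfolded e1 e2]
    show "set_integrable lborel {a..t} (\<lambda>x. f' x * G x)" "set_integrable lborel {a..t} (\<lambda>x. F x * g' x)"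
      using T(1,2) by (simp_all add: set_integrable_def)
    show "F t * G t = (LINT x:{a..t}|lborel. f' x * G x) + (LINT x:{a..t}|lborel. F x * g' x)"
      using T(3) by (simp add: set_lebesgue_integral_def F_def G_def f1_def g1_def)
  qed
  have Ga: "G a = 0" "F a = 0"
    unfolding G_def F_def by (rule set_integral_lborel_point)+
  have "prim_on a b (\<lambda>t. F t * G t) (\<lambda>t. f' t * G t + F t * g' t)"
    unfolding prim_on_def
  proof (intro conjI ballI)
    show "set_integrable lborel {a..b} (\<lambda>t. f' t * G t + F t * g' t)"
      using key[of b] ab by (intro set_integral_add) auto
    fix t assume t: "t \<in> {a..b}"
    show "F t * G t = F a * G a + (LINT s:{a..t}|lborel. f' s * G s + F s * g' s)"
      using key[OF t] by (simp add: Ga set_integral_add)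
  qed
  moreover have "prim_on a b (\<lambda>t. f a * g t) (\<lambda>t. f a * g' t)" by (rule prim_on_cmult[OF g])
  moreover have "prim_on a b (\<lambda>t. g a * f t) (\<lambda>t. g a * f' t)" by (rule prim_on_cmult[OF f])
  ultimately have "prim_on a b (\<lambda>t. (F t * G t + (f a * g t + g a * f t)) + - (f a * g a))
      (\<lambda>t. (f' t * G t + F t * g' t + (f a * g' t + g a * f' t)) + 0)"
    by (intro prim_on_add prim_on_const)
  then show ?thesis
  proof (rule prim_on_cong)
    fix t assume t: "t \<in> {a..b}"
    have ft: "f t = f a + F t" and gt: "g t = g a + G t"
      using prim_onD[OF f, of t] prim_onD[OF g, of t] t by (auto simp: F_def G_def)
    show "F t * G t + (f a * g t + g a * f t) + - (f a * g a) = f t * g t"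
      "f' t * G t + F t * g' t + (f a * g' t + g a * f' t) + 0 = f' t * g t + f t * g' t"
      unfolding ft gt by (simp_all add: algebra_simps)
  qed
qed

lemma prim_on_tail:
  assumes "set_integrable lborel {a..b} f'"
  shows "prim_on a b (\<lambda>t. LINT s:{t..b}|lborel. f' s) (\<lambda>t. - f' t)"
proof -
  have "prim_on a b (\<lambda>t. (LINT s:{a..b}|lborel. f' s) + (LINT s:{a..t}|lborel. - f' s)) (\<lambda>t. - f' t)"
    using assms by (intro prim_on_primitive) (simp add: set_integrable_def)
  then show ?thesis
  proof (rule prim_on_cong)
    fix t assume t: "t \<in> {a..b}"
    have "(LINT s:{a..t}|lborel. - f' s) = - (LINT s:{a..t}|lborel. f' s)"
      by (simp add: set_lebesgue_integral_def)
    then show "(LINT s:{a..b}|lborel. f' s) + (LINT s:{a..t}|lborel. - f' s) = (LINT s:{t..b}|lborel. f' s)"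
      using set_integral_lborel_interval_split[OF assms, of t] t by simp
  qed simp
qed

lemma prim_on_norm_diff_le:
  assumes f: "prim_on a b f f'" and t: "t \<in> {a..b}" and h: "set_integrable lborel {a..b} h"
    and le: "\<And>s. s \<in> {a..b} \<Longrightarrow> cmod (f' s) \<le> h s"
  shows "cmod (f t - f a) \<le> (LINT s:{a..t}|lborel. h s)"
proof -
  have i: "set_integrable lborel {a..t} f'" "set_integrable lborel {a..t} h"
    using t by (auto intro: set_integrable_subinterval[OF prim_on_integrable[OF f]] set_integrable_subinterval[OF h])
  have "cmod (f t - f a) = cmod (LINT s:{a..t}|lborel. f' s)"
    using prim_onD[OF f, of t] t by simp
  also have "\<dots> \<le> (LINT s:{a..t}|lborel. cmod (f' s))"
    using i(1) by (rule set_integral_norm_bound)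
  also have "\<dots> \<le> (LINT s:{a..t}|lborel. h s)"
    by (rule set_integral_mono) (use i t le in \<open>auto intro: set_integrable_norm\<close>)
  finally show ?thesis .
qed

section \<open>The Picard iteration\<close>

lemma cmod_exp_minus_le_1: "Re z \<ge> 0 \<Longrightarrow> cmod (exp (- z)) \<le> 1"
  by simp

text \<open>The amount of interaction up to time \<open>t\<close>, \<open>A t = \<integral>\<^sub>0\<^sup>t |q|\<close>, serves as the intrinsic time: the bounds of
  the Picard iteration are powers of \<open>A\<close>.\<close>

locale potential =
  fixes q :: "real \<Rightarrow> real"
  assumes q_meas [measurable]: "q \<in> borel_measurable borel"
    and q_int: "\<And>T. set_integrable lborel {0..T} q"
begin

definition A :: "real \<Rightarrow> real" where
  "A t = (LINT s:{0..t}|lborel. \<bar>q s\<bar>)"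

lemma q_abs_int: "set_integrable lborel {0..T} (\<lambda>s. \<bar>q s\<bar>)"
  by (rule set_integrable_abs[OF q_int])

lemma A_nonneg: "0 \<le> A t"
  unfolding A_def set_lebesgue_integral_def by (rule Bochner_Integration.integral_nonneg) simp

lemma A_prim: "prim_on 0 T (\<lambda>t. complex_of_real (A t)) (\<lambda>t. complex_of_real \<bar>q t\<bar>)"
proof -
  have "set_integrable lborel {0..T} (\<lambda>t. complex_of_real \<bar>q t\<bar>)"
    using q_abs_int[of T] unfolding set_integrable_def
    by (simp add: scaleR_conv_of_real flip: of_real_mult)
  from prim_on_primitive[OF this, of 0] show ?thesis
    by (simp add: A_def set_integral_complex_of_real)
qed

lemma A_mono: "s \<le> t \<Longrightarrow> A s \<le> A t"
  unfolding A_def set_lebesgue_integral_def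
  by (rule integral_mono) (use q_abs_int in \<open>auto simp: set_integrable_def indicator_def\<close>)

lemma A_power_prim:
  "prim_on 0 T (\<lambda>t. complex_of_real (A t ^ Suc m)) (\<lambda>t. complex_of_real (real (Suc m) * (\<bar>q t\<bar> * A t ^ m)))"
proof (induction m)
  case 0
  then show ?case using A_prim by simp
next
  case (Suc m)
  show ?case
    by (rule prim_on_cong[OF prim_on_mult[OF Suc A_prim]]) (simp_all add: algebra_simps)
qed

lemma set_integrable_q_mult:
  assumes [measurable]: "b \<in> borel_measurable borel" and b: "\<And>s. s \<in> {0..T} \<Longrightarrow> cmod (b s) \<le> B"
  shows "set_integrable lborel {0..T} (\<lambda>s. b s * complex_of_real (q s))"
proof -
  have "set_integrable lborel {0..T} (\<lambda>s. B * \<bar>q s\<bar>)"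
    using q_abs_int by (rule set_integrable_mult_right)
  then show ?thesis
    unfolding set_integrable_def
  proof (rule Bochner_Integration.integrable_bound)
    have "cmod (b s) * \<bar>q s\<bar> \<le> \<bar>B * \<bar>q s\<bar>\<bar>" if "s \<in> {0..T}" for s
      using mult_right_mono[OF b[OF that], of "\<bar>q s\<bar>"] by simp
    then show "AE s in lborel. norm (indicator {0..T} s *\<^sub>R (b s * complex_of_real (q s)))
        \<le> norm (indicator {0..T} s *\<^sub>R (B * \<bar>q s\<bar>))"
      by (intro AE_I2) (auto simp: indicator_def norm_mult)
  qed measurable
qed

text \<open>\<open>(A\<^sup>m\<^sup>+\<^sup>1)' = (m+1) |q| A\<^sup>m\<close>; this is where the factorials in the Picard bounds come from.\<close>

lemma A_power_integral:
  assumes "t \<ge> 0"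
  shows "set_integrable lborel {0..t} (\<lambda>s. \<bar>q s\<bar> * A s ^ m)"
    and "(LINT s:{0..t}|lborel. \<bar>q s\<bar> * A s ^ m) = A t ^ Suc m / real (Suc m)"
proof -
  have A0: "A 0 = 0" by (simp only: A_def set_integral_lborel_point)
  have i: "set_integrable lborel {0..t} (\<lambda>s. real (Suc m) * (\<bar>q s\<bar> * A s ^ m))"
    using prim_on_integrable[OF A_power_prim[of t m]]
    unfolding set_integrable_def scaleR_conv_of_real of_real_mult[symmetric] complex_of_real_integrable_eq
    by (simp only: real_scaleR_def of_real_eq_id id_apply)
  show "set_integrable lborel {0..t} (\<lambda>s. \<bar>q s\<bar> * A s ^ m)"
    using set_integrable_mult_right[OF i, of "1 / real (Suc m)"] by (simp add: field_simps del: of_nat_Suc)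
  have "complex_of_real (A t ^ Suc m) = complex_of_real (A 0 ^ Suc m)
      + complex_of_real (LINT s:{0..t}|lborel. real (Suc m) * (\<bar>q s\<bar> * A s ^ m))"
    using prim_onD[OF A_power_prim[of t m], of t] assms
    unfolding set_integral_complex_of_real by blast
  then have "A t ^ Suc m = A 0 ^ Suc m + (LINT s:{0..t}|lborel. real (Suc m) * (\<bar>q s\<bar> * A s ^ m))"
    unfolding of_real_add[symmetric] of_real_eq_iff .
  then show "(LINT s:{0..t}|lborel. \<bar>q s\<bar> * A s ^ m) = A t ^ Suc m / real (Suc m)"
    unfolding set_integral_mult_right by (simp add: A0 field_simps del: of_nat_Suc)
qed

text \<open>The Duhamel operator for the damping \<open>\<zeta>\<close>: the Schroedinger group is \<open>\<zeta> = i k\<close>, the heat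
  semigroup \<open>\<zeta> > 0\<close>.\<close>

definition duhamel :: "complex \<Rightarrow> (int \<Rightarrow> real \<Rightarrow> complex) \<Rightarrow> int \<Rightarrow> real \<Rightarrow> complex" where
  "duhamel \<zeta> g n t = \<i> * (LINT \<tau>:{0..t}|lborel.
     exp (- (\<zeta> * of_real ((t - \<tau>) * (of_int n)\<^sup>2))) * ((g (n - 1) \<tau> + g (n + 1) \<tau>) / 2) * of_real (q \<tau>))"

lemma duhamel_integrable:
  assumes \<zeta>: "Re \<zeta> \<ge> 0" and [measurable]: "\<And>n. g n \<in> borel_measurable borel"
    and g: "\<And>n \<tau>. \<tau> \<in> {0..t} \<Longrightarrow> cmod (g n \<tau>) \<le> B"
  shows "set_integrable lborel {0..t} (\<lambda>\<tau>.
     exp (- (\<zeta> * of_real ((t - \<tau>) * (of_int n)\<^sup>2))) * ((g (n - 1) \<tau> + g (n + 1) \<tau>) / 2) * of_real (q \<tau>))"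
proof (rule set_integrable_q_mult)
  show "(\<lambda>\<tau>. exp (- (\<zeta> * of_real ((t - \<tau>) * (of_int n)\<^sup>2))) * ((g (n - 1) \<tau> + g (n + 1) \<tau>) / 2)) \<in> borel_measurable borel"
    by measurable
  fix s assume s: "s \<in> {0..t}"
  have 1: "cmod (exp (- (\<zeta> * of_real ((t - s) * (of_int n)\<^sup>2)))) \<le> 1"
    using s \<zeta> by (intro cmod_exp_minus_le_1) simp
  have "cmod ((g (n - 1) s + g (n + 1) s) / 2) \<le> B"
    using g[OF s, of "n - 1"] g[OF s, of "n + 1"] norm_triangle_ineq[of "g (n - 1) s" "g (n + 1) s"]
    by (simp add: norm_divide)
  with 1 show "cmod (exp (- (\<zeta> * of_real ((t - s) * (of_int n)\<^sup>2))) * ((g (n - 1) s + g (n + 1) s) / 2)) \<le> B"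
    unfolding norm_mult using mult_mono[OF 1, of "cmod ((g (n - 1) s + g (n + 1) s) / 2)" B] by simp
qed

lemma duhamel_bound:
  assumes \<zeta>: "Re \<zeta> \<ge> 0" and t: "t \<ge> 0" and B: "B \<ge> 0"
    and [measurable]: "\<And>n. g n \<in> borel_measurable borel"
    and g: "\<And>n \<tau>. \<tau> \<in> {0..t} \<Longrightarrow> cmod (g n \<tau>) \<le> B * A \<tau> ^ m"
  shows "cmod (duhamel \<zeta> g n t) \<le> B * A t ^ Suc m / real (Suc m)"
proof -
  define F where "F \<tau> = exp (- (\<zeta> * of_real ((t - \<tau>) * (of_int n)\<^sup>2))) * ((g (n - 1) \<tau> + g (n + 1) \<tau>) / 2) * of_real (q \<tau>)" for \<tau>
  have gB: "cmod (g n \<tau>) \<le> B * A t ^ m" if "\<tau> \<in> {0..t}" for n \<tau>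
    using g[OF that, of n] B that by (meson A_mono A_nonneg atLeastAtMost_iff mult_left_mono order_trans power_mono)
  have iF: "set_integrable lborel {0..t} F"
    unfolding F_def by (rule duhamel_integrable[OF \<zeta> _ gB]) auto
  have "cmod (duhamel \<zeta> g n t) = cmod (LINT \<tau>:{0..t}|lborel. F \<tau>)"
    by (simp add: duhamel_def F_def norm_mult)
  also have "\<dots> \<le> (LINT \<tau>:{0..t}|lborel. cmod (F \<tau>))"
    by (rule set_integral_norm_bound[OF iF])
  also have "\<dots> \<le> (LINT \<tau>:{0..t}|lborel. B * (\<bar>q \<tau>\<bar> * A \<tau> ^ m))"
  proof (rule set_integral_mono)
    show "set_integrable lborel {0..t} (\<lambda>\<tau>. cmod (F \<tau>))" by (rule set_integrable_norm[OF iF])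
    show "set_integrable lborel {0..t} (\<lambda>\<tau>. B * (\<bar>q \<tau>\<bar> * A \<tau> ^ m))"
      by (rule set_integrable_mult_right[OF A_power_integral(1)[OF t]])
    fix s assume s: "s \<in> {0..t}"
    have 1: "cmod (exp (- (\<zeta> * of_real ((t - s) * (of_int n)\<^sup>2)))) \<le> 1"
      using s \<zeta> by (intro cmod_exp_minus_le_1) simp
    have 2: "cmod ((g (n - 1) s + g (n + 1) s) / 2) \<le> B * A s ^ m"
      using g[OF s, of "n - 1"] g[OF s, of "n + 1"] norm_triangle_ineq[of "g (n - 1) s" "g (n + 1) s"]
      by (simp add: norm_divide)
    have "cmod (F s) \<le> 1 * (B * A s ^ m) * \<bar>q s\<bar>"
      unfolding F_def norm_mult norm_of_real by (intro mult_mono mult_right_mono 1 2) auto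
    then show "cmod (F s) \<le> B * (\<bar>q s\<bar> * A s ^ m)" by (simp add: mult_ac)
  qed
  also have "\<dots> = B * A t ^ Suc m / real (Suc m)"
    using A_power_integral[OF t, of m] by simp
  finally show ?thesis .
qed

lemma duhamel_diff:
  assumes \<zeta>: "Re \<zeta> \<ge> 0"
    and g [measurable]: "\<And>n. g n \<in> borel_measurable borel" and gB: "\<And>n \<tau>. \<tau> \<in> {0..t} \<Longrightarrow> cmod (g n \<tau>) \<le> B"
    and h [measurable]: "\<And>n. h n \<in> borel_measurable borel" and hB: "\<And>n \<tau>. \<tau> \<in> {0..t} \<Longrightarrow> cmod (h n \<tau>) \<le> B'"
  shows "duhamel \<zeta> g n t - duhamel \<zeta> h n t = duhamel \<zeta> (\<lambda>n \<tau>. g n \<tau> - h n \<tau>) n t"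
  unfolding duhamel_def right_diff_distrib[symmetric]
  by (subst set_integral_diff(2)[OF duhamel_integrable[OF \<zeta> g gB] duhamel_integrable[OF \<zeta> h hB], symmetric])
    (auto intro!: arg_cong[where f = "\<lambda>x. \<i> * x"] set_lebesgue_integral_cong simp: algebra_simps diff_divide_distrib add_divide_distrib)

primrec picard :: "complex \<Rightarrow> nat \<Rightarrow> int \<Rightarrow> real \<Rightarrow> complex" where
  "picard \<zeta> 0 = (\<lambda>n t. if n = 0 then 1 else 0)"
| "picard \<zeta> (Suc m) = (\<lambda>n t. (if n = 0 then 1 else 0) + duhamel \<zeta> (picard \<zeta> m) n t)"

lemma picard_measurable_pair:
  "(\<lambda>p. picard (fst p) m n (snd p)) \<in> borel_measurable (borel \<Otimes>\<^sub>M borel)"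
proof (induction m arbitrary: n)
  case (Suc m)
  have [measurable]: "(\<lambda>x. picard (fst (fst x)) m n (snd x)) \<in> borel_measurable ((borel \<Otimes>\<^sub>M borel) \<Otimes>\<^sub>M borel)"
    for n
    by (rule measurable_compose[OF _ Suc, of "\<lambda>x. (fst (fst x), snd x)", simplified]) measurable
  have ind: "(\<lambda>x :: (complex \<times> real) \<times> real. indicator {0..snd (fst x)} (snd x) :: real) \<in> borel_measurable ((borel \<Otimes>\<^sub>M borel) \<Otimes>\<^sub>M borel)"
    unfolding indicator_def atLeastAtMost_iff by measurable
  have "(\<lambda>x. indicator {0..snd (fst x)} (snd x) *\<^sub>R
      (exp (- (fst (fst x) * of_real ((snd (fst x) - snd x) * (of_int n)\<^sup>2))) *
        ((picard (fst (fst x)) m (n - 1) (snd x) + picard (fst (fst x)) m (n + 1) (snd x)) / 2) * of_real (q (snd x))))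
      \<in> borel_measurable ((borel \<Otimes>\<^sub>M borel) \<Otimes>\<^sub>M lborel)"
    using ind by measurable
  then have "(\<lambda>p. (LINT \<tau>|lborel. indicator {0..snd p} \<tau> *\<^sub>R
      (exp (- (fst p * of_real ((snd p - \<tau>) * (of_int n)\<^sup>2))) *
        ((picard (fst p) m (n - 1) \<tau> + picard (fst p) m (n + 1) \<tau>) / 2) * of_real (q \<tau>))))
      \<in> borel_measurable (borel \<Otimes>\<^sub>M borel)"
    by (intro lborel.borel_measurable_lebesgue_integral) (simp add: split_beta')
  then show ?case
    unfolding picard.simps duhamel_def set_lebesgue_integral_def
    by (intro borel_measurable_add borel_measurable_times borel_measurable_const)
qed simp

lemma picard_measurable [measurable]: "picard \<zeta> m n \<in> borel_measurable borel"
  using measurable_compose[OF _ picard_measurable_pair, of "\<lambda>t. (\<zeta>, t)" borel m n] by simp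

lemma A_power_fact_tendsto_0: "(\<lambda>m. A t ^ m / fact m) \<longlonglongrightarrow> 0"
proof -
  have "(\<lambda>j. A t ^ j / fact j) sums exp (A t)"
    using exp_converges[of "A t"] by (simp add: divide_inverse mult.commute)
  then show ?thesis by (intro summable_LIMSEQ_zero sums_summable)
qed

lemma picard_step_le:
  assumes \<zeta>: "Re \<zeta> \<ge> 0" and "t \<ge> 0"
  shows "(\<exists>B. \<forall>n. \<forall>\<tau>\<in>{0..t}. cmod (picard \<zeta> m n \<tau>) \<le> B) \<and>
    cmod (picard \<zeta> (Suc m) n t - picard \<zeta> m n t) \<le> A t ^ Suc m / fact (Suc m)"
  using assms(2)
proof (induction m arbitrary: n t)
  case 0
  have "cmod (duhamel \<zeta> (picard \<zeta> 0) n t) \<le> 1 * A t ^ Suc 0 / real (Suc 0)"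
    by (rule duhamel_bound[OF \<zeta> 0]) auto
  then show ?case by (auto intro!: exI[of _ 1])
next
  case (Suc m)
  have b: "\<exists>B. \<forall>n. \<forall>\<tau>\<in>{0..t}. cmod (picard \<zeta> m n \<tau>) \<le> B" using Suc.IH[OF Suc.prems] by blast
  then obtain B where B: "\<And>n \<tau>. \<tau> \<in> {0..t} \<Longrightarrow> cmod (picard \<zeta> m n \<tau>) \<le> B" by blast
  have d: "cmod (picard \<zeta> (Suc m) n \<tau> - picard \<zeta> m n \<tau>) \<le> 1 / fact (Suc m) * A \<tau> ^ Suc m" if "\<tau> \<in> {0..t}" for n \<tau>
    using Suc.IH[of \<tau> n] that by simp
  have B': "cmod (picard \<zeta> (Suc m) n \<tau>) \<le> B + 1 / fact (Suc m) * A t ^ Suc m" if "\<tau> \<in> {0..t}" for n \<tau>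
  proof -
    have "A \<tau> ^ Suc m \<le> A t ^ Suc m" using that by (intro power_mono A_mono A_nonneg) auto
    then have "1 / fact (Suc m) * A \<tau> ^ Suc m \<le> 1 / fact (Suc m) * A t ^ Suc m"
      by (intro mult_left_mono) auto
    then show ?thesis using d[OF that, of n] B[OF that, of n]
        norm_triangle_ineq[of "picard \<zeta> m n \<tau>" "picard \<zeta> (Suc m) n \<tau> - picard \<zeta> m n \<tau>"] by simp
  qed
  have "picard \<zeta> (Suc (Suc m)) n t - picard \<zeta> (Suc m) n t
      = duhamel \<zeta> (picard \<zeta> (Suc m)) n t - duhamel \<zeta> (picard \<zeta> m) n t"
    by simp
  also have "\<dots> = duhamel \<zeta> (\<lambda>n \<tau>. picard \<zeta> (Suc m) n \<tau> - picard \<zeta> m n \<tau>) n t"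
    by (rule duhamel_diff[OF \<zeta> picard_measurable B' picard_measurable B])
  also have "cmod \<dots> \<le> 1 / fact (Suc m) * A t ^ Suc (Suc m) / real (Suc (Suc m))"
  proof (rule duhamel_bound[OF \<zeta> Suc.prems])
    show "cmod (picard \<zeta> (Suc m) n \<tau> - picard \<zeta> m n \<tau>) \<le> 1 / fact (Suc m) * A \<tau> ^ Suc m"
      if "\<tau> \<in> {0..t}" for n \<tau> by (rule d[OF that])
    show "(\<lambda>\<tau>. picard \<zeta> (Suc m) n \<tau> - picard \<zeta> m n \<tau>) \<in> borel_measurable borel" for n
      by (intro borel_measurable_diff picard_measurable)
  qed simp
  finally have "cmod (picard \<zeta> (Suc (Suc m)) n t - picard \<zeta> (Suc m) n t) \<le> A t ^ Suc (Suc m) / fact (Suc (Suc m))"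
    by (simp add: divide_simps mult_ac del: of_nat_Suc)
  then show ?case using B' by blast
qed

lemma picard_bounded:
  assumes "Re \<zeta> \<ge> 0" and "t \<ge> 0"
  shows "cmod (picard \<zeta> m n t) \<le> exp (A t)"
proof -
  have "cmod (picard \<zeta> m n t) \<le> (\<Sum>j\<le>m. A t ^ j / fact j)"
  proof (induction m)
    case (Suc m)
    then show ?case using picard_step_le[OF assms, of m n]
        norm_triangle_ineq[of "picard \<zeta> m n t" "picard \<zeta> (Suc m) n t - picard \<zeta> m n t"] by simp
  qed simp
  also have "\<dots> \<le> exp (A t)"
  proof -
    have sums: "(\<lambda>j. A t ^ j / fact j) sums exp (A t)"
      using exp_converges[of "A t"] by (simp add: divide_inverse mult.commute)
    show ?thesis
      unfolding sums_unique[OF sums]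
      by (rule sum_le_suminf[OF sums_summable[OF sums]]) (use A_nonneg in auto)
  qed
  finally show ?thesis .
qed

lemma picard_support: "\<bar>n\<bar> > int m \<Longrightarrow> picard \<zeta> m n t = 0"
proof (induction m arbitrary: n t)
  case (Suc m)
  then have "picard \<zeta> m (n - 1) \<tau> = 0" "picard \<zeta> m (n + 1) \<tau> = 0" for \<tau> by auto
  then show ?case using Suc.prems by (simp add: duhamel_def set_lebesgue_integral_def)
qed auto

lemma coeff_system_measurable: "coeff_system q k c \<Longrightarrow> c n \<in> borel_measurable borel"
  unfolding coeff_system_def by (blast intro: borel_measurable_continuous_onI)

lemma coeff_system_bounded:
  "coeff_system q k c \<Longrightarrow> \<exists>K. \<forall>t\<le>T. \<forall>n. cmod (c n t) \<le> K"
  unfolding coeff_system_def by blast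

lemma coeff_system_duhamel:
  assumes "coeff_system q k c" "t \<ge> 0"
  shows "c n t = (if n = 0 then 1 else 0) + duhamel (\<i> * of_real k) c n t"
proof -
  have "cis (- (k * (t - \<tau>)) * (of_int n)\<^sup>2) = exp (- (\<i> * of_real k * of_real ((t - \<tau>) * (of_int n)\<^sup>2)))" for \<tau>
    by (simp add: cis_conv_exp algebra_simps)
  then have eq: "cis (- (k * (t - \<tau>)) * (of_int n)\<^sup>2) * (q \<tau> * ((c (n - 1) \<tau> + c (n + 1) \<tau>) / 2))
      = exp (- (\<i> * of_real k * of_real ((t - \<tau>) * (of_int n)\<^sup>2))) * ((c (n - 1) \<tau> + c (n + 1) \<tau>) / 2) * of_real (q \<tau>)" for \<tau>
    by (simp only: mult_ac)
  have "c n t = (if n = 0 then 1 else 0) + \<i> * (LINT \<tau>:{0..t}|lborel.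
        cis (- (k * (t - \<tau>)) * (of_int n)\<^sup>2) * (q \<tau> * ((c (n - 1) \<tau> + c (n + 1) \<tau>) / 2)))"
    using assms unfolding coeff_system_def by blast
  then show ?thesis by (simp only: eq duhamel_def)
qed

text \<open>The bound on the coefficients is uniform in \<open>n\<close>, so the contraction argument runs in the supremum norm
  over all frequencies.\<close>

lemma coeff_minus_picard_le:
  assumes sys: "coeff_system q k c" and K: "\<And>n t. t \<in> {0..T} \<Longrightarrow> cmod (c n t) \<le> K" and "t \<in> {0..T}"
  shows "cmod (c n t - picard (\<i> * of_real k) m n t) \<le> (K + 1) * A t ^ m / fact m"
  using assms(3)
proof (induction m arbitrary: n t)
  case 0
  have "cmod (c n t - (if n = 0 then 1 else 0)) \<le> cmod (c n t) + 1"
    using norm_triangle_ineq4[of "c n t" "if n = 0 then 1 else 0"] by (simp split: if_splits)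
  then show ?case using K[OF 0, of n] by simp
next
  case (Suc m)
  have Kp: "0 \<le> K + 1" using K[OF Suc.prems, of 0] norm_ge_zero[of "c 0 t"] by linarith
  let ?P = "picard (\<i> * of_real k)"
  have \<zeta>: "0 \<le> Re (\<i> * of_real k)" by simp
  have [measurable]: "c n \<in> borel_measurable borel" for n by (rule coeff_system_measurable[OF sys])
  have Kt: "cmod (c n \<tau>) \<le> K" if "\<tau> \<in> {0..t}" for n \<tau> using K that Suc.prems by auto
  have Pt: "cmod (?P m n \<tau>) \<le> exp (A t)" if "\<tau> \<in> {0..t}" for n \<tau>
    using picard_bounded[OF \<zeta>, of \<tau> m n] that A_mono[of \<tau> t] exp_le_cancel_iff by (force intro: order_trans)
  have "c n t - ?P (Suc m) n t = duhamel (\<i> * of_real k) c n t - duhamel (\<i> * of_real k) (?P m) n t"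
    using coeff_system_duhamel[OF sys, of t n] Suc.prems by simp
  also have "\<dots> = duhamel (\<i> * of_real k) (\<lambda>n \<tau>. c n \<tau> - ?P m n \<tau>) n t"
    by (rule duhamel_diff[OF \<zeta> _ Kt _ Pt]) measurable
  also have "cmod \<dots> \<le> (K + 1) / fact m * A t ^ Suc m / real (Suc m)"
  proof (rule duhamel_bound[OF \<zeta>])
    show "cmod (c n \<tau> - ?P m n \<tau>) \<le> (K + 1) / fact m * A \<tau> ^ m" if "\<tau> \<in> {0..t}" for n \<tau>
      using Suc.IH[of \<tau> n] that Suc.prems by simp
  qed (use Suc.prems Kp in auto)
  also have "\<dots> = (K + 1) * A t ^ Suc m / fact (Suc m)"
    by (simp add: divide_simps mult_ac del: of_nat_Suc)
  finally show ?case .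
qed

lemma coeff_picard_limit:
  assumes sys: "coeff_system q k c" and t: "t \<ge> 0"
  shows "(\<lambda>m. picard (\<i> * of_real k) m n t) \<longlonglongrightarrow> c n t"
proof -
  obtain K where K: "\<forall>s\<le>t. \<forall>n. cmod (c n s) \<le> K" using coeff_system_bounded[OF sys] by blast
  have le: "cmod (picard (\<i> * of_real k) m n t - c n t) \<le> (K + 1) * (A t ^ m / fact m)" for m
    using coeff_minus_picard_le[OF sys, of t K t n m] K t by (simp add: norm_minus_commute)
  have lim: "(\<lambda>m. (K + 1) * (A t ^ m / fact m)) \<longlonglongrightarrow> 0"
    by (rule tendsto_mult_right_zero[OF A_power_fact_tendsto_0])
  have "(\<lambda>m. picard (\<i> * of_real k) m n t - c n t) \<longlonglongrightarrow> 0"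
    by (rule Lim_null_comparison[OF always_eventually lim]) (use le in blast)
  then show ?thesis by (rule LIM_zero_cancel)
qed

text \<open>The \<open>n\<close>-th coefficient needs at least \<open>|n|\<close> interactions, so it is bounded by the remainder
  of the Picard iteration of order \<open>|n| - 1\<close>.\<close>

lemma coeff_decay:
  assumes sys: "coeff_system q k c" and T: "T \<ge> 0"
  obtains K where "K \<ge> 0" "\<And>n t. t \<in> {0..T} \<Longrightarrow> cmod (c n t) \<le> K * A T ^ (nat \<bar>n\<bar> - 1) / fact (nat \<bar>n\<bar> - 1)"
proof -
  obtain K where K: "\<forall>s\<le>T. \<forall>n. cmod (c n s) \<le> K" using coeff_system_bounded[OF sys] by blast
  have Kp: "0 \<le> K" using K T norm_ge_zero order_trans by blast
  have "cmod (c n t) \<le> (K + 1) * A T ^ (nat \<bar>n\<bar> - 1) / fact (nat \<bar>n\<bar> - 1)" if t: "t \<in> {0..T}" for n t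
  proof (cases "n = 0")
    case True
    then show ?thesis using K t by (simp add: add_increasing2)
  next
    case False
    have "cmod (c n t - picard (\<i> * of_real k) (nat \<bar>n\<bar> - 1) n t) \<le> (K + 1) * A t ^ (nat \<bar>n\<bar> - 1) / fact (nat \<bar>n\<bar> - 1)"
      by (rule coeff_minus_picard_le[OF sys _ t]) (use K in auto)
    moreover have "picard (\<i> * of_real k) (nat \<bar>n\<bar> - 1) n t = 0"
      using False by (intro picard_support) auto
    moreover have "A t ^ (nat \<bar>n\<bar> - 1) \<le> A T ^ (nat \<bar>n\<bar> - 1)"
      using t by (intro power_mono A_mono A_nonneg) auto
    then have "(K + 1) * A t ^ (nat \<bar>n\<bar> - 1) / fact (nat \<bar>n\<bar> - 1) \<le> (K + 1) * A T ^ (nat \<bar>n\<bar> - 1) / fact (nat \<bar>n\<bar> - 1)"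
      using Kp by (intro divide_right_mono mult_left_mono) auto
    ultimately show ?thesis by simp
  qed
  then show ?thesis using that[of "K + 1"] Kp by simp
qed

end

section \<open>Energy identities\<close>

lemma sum_by_parts_int:
  fixes v r :: "int \<Rightarrow> real" and M :: nat
  assumes v: "\<And>n. \<bar>n\<bar> > int M \<Longrightarrow> v n = 0"
  shows "(\<Sum>n\<in>{-int M..int M}. v n * (r n - r (n + 1))) = (\<Sum>n\<in>{-int M..int M + 1}. (v n - v (n - 1)) * r n)"
proof -
  have 1: "(\<Sum>n\<in>{-int M..int M}. v n * r n) = (\<Sum>n\<in>{-int M..int M + 1}. v n * r n)"
    by (rule sum.mono_neutral_left) (auto simp: v)
  have "(\<Sum>n\<in>{-int M..int M}. v n * r (n + 1)) = (\<Sum>n\<in>{-int M + 1..int M + 1}. v (n - 1) * r n)"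
    by (rule sum.reindex_bij_witness[of _ "\<lambda>n. n - 1" "\<lambda>n. n + 1"]) auto
  also have "\<dots> = (\<Sum>n\<in>{-int M..int M + 1}. v (n - 1) * r n)"
    by (rule sum.mono_neutral_left) (auto simp: v)
  finally show ?thesis using 1
    by (simp add: right_diff_distrib left_diff_distrib sum_subtractf)
qed

context potential
begin

text \<open>The phase in the coupling of \<open>a\<^sub>n\<close> with \<open>a\<^sub>n\<^sub>-\<^sub>1\<close>, \<open>n\<^sup>2 - (n-1)\<^sup>2 = 2n - 1\<close>.\<close>

definition rot :: "real \<Rightarrow> int \<Rightarrow> real \<Rightarrow> complex" where
  "rot k n t = cis (k * of_int (2 * n - 1) * t)"

text \<open>The interaction picture, in which the free evolution is removed.\<close>

definition amp :: "real \<Rightarrow> (int \<Rightarrow> real \<Rightarrow> complex) \<Rightarrow> int \<Rightarrow> real \<Rightarrow> complex" where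
  "amp k c n t = cis (k * (of_int n)\<^sup>2 * t) * c n t"

definition amp_deriv :: "real \<Rightarrow> (int \<Rightarrow> real \<Rightarrow> complex) \<Rightarrow> int \<Rightarrow> real \<Rightarrow> complex" where
  "amp_deriv k c n t = \<i> / 2 * q t * (rot k n t * amp k c (n - 1) t + cnj (rot k (n + 1) t) * amp k c (n + 1) t)"

text \<open>The rate at which mass passes from frequency \<open>n - 1\<close> to frequency \<open>n\<close>.\<close>

definition flux :: "real \<Rightarrow> (int \<Rightarrow> real \<Rightarrow> complex) \<Rightarrow> int \<Rightarrow> real \<Rightarrow> real" where
  "flux k c n t = - q t * Im (rot k n t * (amp k c (n - 1) t * cnj (amp k c n t)))"

lemma cmod_amp [simp]: "cmod (amp k c n t) = cmod (c n t)"
  by (simp add: amp_def norm_mult)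

lemma cmod_rot [simp]: "cmod (rot k n t) = 1"
  by (simp add: rot_def)

lemma rot_measurable [measurable]: "rot k n \<in> borel_measurable borel"
  unfolding rot_def[abs_def] by (intro borel_measurable_continuous_onI continuous_intros)

lemma coeff_system_initial: "coeff_system q k c \<Longrightarrow> c n 0 = (if n = 0 then 1 else 0)"
  unfolding coeff_system_def by (auto simp: set_integral_lborel_point simp del: atLeastAtMost_singleton)

lemma amp_prim:
  assumes sys: "coeff_system q k c"
  shows "prim_on 0 T (amp k c n) (amp_deriv k c n)"
  unfolding prim_on_def
proof (intro conjI ballI)
  have [measurable]: "c n \<in> borel_measurable borel" for n by (rule coeff_system_measurable[OF sys])
  have [measurable]: "(\<lambda>t. cis (k * (of_int n)\<^sup>2 * t)) \<in> borel_measurable borel" for n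
    by (intro borel_measurable_continuous_onI continuous_intros)
  have [measurable]: "amp k c n \<in> borel_measurable borel" for n
    unfolding amp_def[abs_def] by measurable
  obtain K where K: "\<forall>s\<le>T. \<forall>n. cmod (c n s) \<le> K" using coeff_system_bounded[OF sys] by blast
  have "set_integrable lborel {0..T} (\<lambda>t. (\<i> / 2 * (rot k n t * amp k c (n - 1) t + cnj (rot k (n + 1) t) * amp k c (n + 1) t)) * of_real (q t))"
  proof (rule set_integrable_q_mult)
    fix s assume "s \<in> {0..T}"
    then have "cmod (rot k n s * amp k c (n - 1) s + cnj (rot k (n + 1) s) * amp k c (n + 1) s) \<le> K + K"
      using K by (intro norm_triangle_le add_mono) (auto simp: norm_mult)
    then show "cmod (\<i> / 2 * (rot k n s * amp k c (n - 1) s + cnj (rot k (n + 1) s) * amp k c (n + 1) s)) \<le> K"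
      by (simp add: norm_mult norm_divide)
  qed measurable
  then show "set_integrable lborel {0..T} (amp_deriv k c n)"
    by (simp add: amp_deriv_def[abs_def] mult_ac)
  fix t assume t: "t \<in> {0..T}"
  have eq: "cis (k * (of_int n)\<^sup>2 * t) * (\<i> * (cis (- (k * (t - \<tau>)) * (of_int n)\<^sup>2) * (q \<tau> * ((c (n - 1) \<tau> + c (n + 1) \<tau>) / 2))))
     = amp_deriv k c n \<tau>" for \<tau>
  proof -
    have 1: "cis (k * (of_int n)\<^sup>2 * t) * cis (- (k * (t - \<tau>)) * (of_int n)\<^sup>2) = cis (k * (of_int n)\<^sup>2 * \<tau>)"
      by (simp add: cis_mult algebra_simps)
    have 2: "rot k n \<tau> * amp k c (n - 1) \<tau> = cis (k * (of_int n)\<^sup>2 * \<tau>) * c (n - 1) \<tau>"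
      "cnj (rot k (n + 1) \<tau>) * amp k c (n + 1) \<tau> = cis (k * (of_int n)\<^sup>2 * \<tau>) * c (n + 1) \<tau>"
      unfolding rot_def amp_def cis_cnj mult.assoc[symmetric] cis_mult
      by (simp_all add: power2_eq_square algebra_simps)
    have "cis (k * (of_int n)\<^sup>2 * t) * (\<i> * (cis (- (k * (t - \<tau>)) * (of_int n)\<^sup>2) * (q \<tau> * ((c (n - 1) \<tau> + c (n + 1) \<tau>) / 2))))
      = (cis (k * (of_int n)\<^sup>2 * t) * cis (- (k * (t - \<tau>)) * (of_int n)\<^sup>2)) * (\<i> / 2 * q \<tau> * (c (n - 1) \<tau> + c (n + 1) \<tau>))"
      by (simp add: field_simps)
    also have "\<dots> = amp_deriv k c n \<tau>"
      unfolding 1 amp_deriv_def 2 by (simp add: algebra_simps)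
    finally show ?thesis .
  qed
  have "c n t = (if n = 0 then 1 else 0) + \<i> * (LINT \<tau>:{0..t}|lborel.
        cis (- (k * (t - \<tau>)) * (of_int n)\<^sup>2) * (q \<tau> * ((c (n - 1) \<tau> + c (n + 1) \<tau>) / 2)))"
    using sys t unfolding coeff_system_def by auto
  then have "amp k c n t = cis (k * (of_int n)\<^sup>2 * t) * (if n = 0 then 1 else 0) +
      cis (k * (of_int n)\<^sup>2 * t) * (\<i> * (LINT \<tau>:{0..t}|lborel.
        cis (- (k * (t - \<tau>)) * (of_int n)\<^sup>2) * (q \<tau> * ((c (n - 1) \<tau> + c (n + 1) \<tau>) / 2))))"
    unfolding amp_def by (simp add: distrib_left)
  also have "cis (k * (of_int n)\<^sup>2 * t) * (if n = 0 then 1 else 0) = amp k c n 0"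
    by (auto simp: amp_def coeff_system_initial[OF sys])
  finally show "amp k c n t = amp k c n 0 + (LINT s:{0..t}|lborel. amp_deriv k c n s)"
    unfolding set_integral_mult_right[symmetric] eq .
qed

lemma amp_square_prim:
  assumes sys: "coeff_system q k c"
  shows "prim_on 0 T (\<lambda>t. complex_of_real ((cmod (c n t))\<^sup>2)) (\<lambda>t. of_real (flux k c n t - flux k c (n + 1) t))"
proof (rule prim_on_cong[OF prim_on_mult[OF amp_prim[OF sys] prim_on_cnj[OF amp_prim[OF sys]]]])
  fix t
  show "amp k c n t * cnj (amp k c n t) = complex_of_real ((cmod (c n t))\<^sup>2)"
    using complex_norm_square[of "amp k c n t"] by simp
  have gen: "\<i> / 2 * x * (e * a' + cnj e2 * a2) * cnj a + a * cnj (\<i> / 2 * x * (e * a' + cnj e2 * a2))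
     = of_real (- x * Im (e * (a' * cnj a)) - - x * Im (e2 * (a * cnj a2)))" for x :: real and e e2 a a' a2 :: complex
  proof -
    define z where "z = e * (a' * cnj a)"
    define z2 where "z2 = e2 * (a * cnj a2)"
    define u where "u = \<i> / 2 * x * (e * a' + cnj e2 * a2)"
    have u: "u * cnj a = \<i> / 2 * x * (z + cnj z2)"
      by (simp add: u_def z_def z2_def algebra_simps)
    have "u * cnj a + a * cnj u = u * cnj a + cnj (u * cnj a)" by simp
    also have "\<dots> = of_real (- x * Im z - - x * Im z2)"
      unfolding u by (simp add: complex_eq_iff field_simps)
    finally show ?thesis by (simp add: u_def z_def z2_def)
  qed
  show "amp_deriv k c n t * cnj (amp k c n t) + amp k c n t * cnj (amp_deriv k c n t)
      = of_real (flux k c n t - flux k c (n + 1) t)"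
    unfolding amp_deriv_def flux_def using gen by simp
qed

lemma flux_bound: "\<bar>flux k c n t\<bar> \<le> \<bar>q t\<bar> * (cmod (c (n - 1) t) * cmod (c n t))"
proof -
  have "\<bar>Im (rot k n t * (amp k c (n - 1) t * cnj (amp k c n t)))\<bar> \<le> cmod (c (n - 1) t) * cmod (c n t)"
    using abs_Im_le_cmod[of "rot k n t * (amp k c (n - 1) t * cnj (amp k c n t))"] by (simp add: norm_mult)
  then show ?thesis unfolding flux_def abs_mult by (simp add: mult_left_mono)
qed

text \<open>Summation by parts: a weight that vanishes outside a finite set feels the flux only through its
  increments.\<close>

lemma weighted_square_sum_prim:
  assumes sys: "coeff_system q k c" and v: "\<And>n. \<bar>n\<bar> > int M \<Longrightarrow> v n = 0"
  shows "prim_on 0 T (\<lambda>t. complex_of_real (L + (\<Sum>n\<in>{-int M..int M}. v n * (cmod (c n t))\<^sup>2)))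
    (\<lambda>t. of_real (\<Sum>n\<in>{-int M..int M + 1}. (v n - v (n - 1)) * flux k c n t))"
proof -
  have "prim_on 0 T (\<lambda>t. of_real L + (\<Sum>n\<in>{-int M..int M}. complex_of_real (v n) * complex_of_real ((cmod (c n t))\<^sup>2)))
     (\<lambda>t. 0 + (\<Sum>n\<in>{-int M..int M}. complex_of_real (v n) * of_real (flux k c n t - flux k c (n + 1) t)))"
    by (intro prim_on_add prim_on_const prim_on_sum prim_on_cmult amp_square_prim[OF sys])
  then show ?thesis
    by (rule prim_on_cong) (simp_all add: sum_by_parts_int[where v = v, OF v, symmetric])
qed

lemma real_prim_diff_le:
  assumes f: "prim_on 0 T (\<lambda>t. complex_of_real (f t)) (\<lambda>t. of_real (f' t))"
    and st: "0 \<le> s" "s \<le> t" "t \<le> T"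
    and le: "\<And>\<tau>. s \<le> \<tau> \<Longrightarrow> \<tau> \<le> t \<Longrightarrow> \<bar>f' \<tau>\<bar> \<le> B * \<bar>q \<tau>\<bar>"
  shows "\<bar>f t - f s\<bar> \<le> B * (A t - A s)"
proof -
  have pr: "prim_on s t (\<lambda>t. complex_of_real (f t)) (\<lambda>t. of_real (f' t))"
    by (rule prim_on_subinterval[OF f]) (use st in auto)
  have qi: "set_integrable lborel {s..t} (\<lambda>\<tau>. \<bar>q \<tau>\<bar>)"
    by (rule set_integrable_subinterval[OF q_abs_int[of T]]) (use st in auto)
  have "cmod (complex_of_real (f t) - complex_of_real (f s)) \<le> (LINT \<tau>:{s..t}|lborel. B * \<bar>q \<tau>\<bar>)"
    by (rule prim_on_norm_diff_le[OF pr]) (use st le qi in auto)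
  also have "(LINT \<tau>:{s..t}|lborel. B * \<bar>q \<tau>\<bar>) = B * (A t - A s)"
    using set_integral_lborel_interval_split[OF q_abs_int[of t], of s] st by (simp add: A_def)
  finally show ?thesis by (simp flip: of_real_diff)
qed

text \<open>On \<open>{-M..M}\<close> the mass changes only by the flux through the two ends, which tends to \<open>0\<close> by the
  factorial decay of the coefficients.\<close>

theorem square_sum_conserved:
  assumes sys: "coeff_system q k c" and t: "t \<ge> 0"
  shows "(\<lambda>M. \<Sum>n\<in>{-int M..int M}. (cmod (c n t))\<^sup>2) \<longlonglongrightarrow> 1"
proof -
  obtain K where K: "K \<ge> 0"
    and dec: "\<And>n s. s \<in> {0..t} \<Longrightarrow> cmod (c n s) \<le> K * A t ^ (nat \<bar>n\<bar> - 1) / fact (nat \<bar>n\<bar> - 1)"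
    using coeff_decay[OF sys t] by blast
  define z where "z m = K * A t ^ m / fact m" for m :: nat
  have z0: "z m \<ge> 0" for m using K A_nonneg by (simp add: z_def)
  have zlim: "z \<longlonglongrightarrow> 0"
  proof -
    have "(\<lambda>m. K * (A t ^ m / fact m)) \<longlonglongrightarrow> 0"
      by (rule tendsto_mult_right_zero[OF A_power_fact_tendsto_0])
    then show ?thesis by (simp add: z_def[abs_def])
  qed
  have le: "\<bar>(\<Sum>n\<in>{-int M..int M}. (cmod (c n t))\<^sup>2) - 1\<bar> \<le> 2 * (z (M - 1) * z M) * A t" if M: "M \<ge> 1" for M
  proof -
    define v where "v n = (if \<bar>n\<bar> \<le> int M then 1 else 0 :: real)" for n
    let ?S = "\<lambda>t. 0 + (\<Sum>n\<in>{-int M..int M}. v n * (cmod (c n t))\<^sup>2)"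
    have pr: "prim_on 0 t (\<lambda>t. complex_of_real (?S t))
        (\<lambda>t. of_real (\<Sum>n\<in>{-int M..int M + 1}. (v n - v (n - 1)) * flux k c n t))"
      by (rule weighted_square_sum_prim[OF sys]) (simp add: v_def)
    have "\<bar>?S t - ?S 0\<bar> \<le> 2 * (z (M - 1) * z M) * (A t - A 0)"
    proof (rule real_prim_diff_le[OF pr])
      fix s assume s: "0 \<le> s" "s \<le> t"
      have "(\<Sum>n\<in>{-int M..int M + 1}. (v n - v (n - 1)) * flux k c n s)
          = (\<Sum>n\<in>{-int M, int M + 1}. (v n - v (n - 1)) * flux k c n s)"
        by (rule sum.mono_neutral_right) (auto simp: v_def)
      also have "\<dots> = flux k c (- int M) s - flux k c (int M + 1) s"
        by (auto simp: v_def)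
      finally have "\<bar>\<Sum>n\<in>{-int M..int M + 1}. (v n - v (n - 1)) * flux k c n s\<bar>
          \<le> \<bar>flux k c (- int M) s\<bar> + \<bar>flux k c (int M + 1) s\<bar>" by simp
      also have "\<dots> \<le> \<bar>q s\<bar> * (z M * z (M - 1)) + \<bar>q s\<bar> * (z (M - 1) * z M)"
      proof (rule add_mono)
        have "nat (int M + 1) - 1 = M" "nat \<bar>- int M - 1\<bar> - 1 = M" by auto
        then have b: "cmod (c (int M) s) \<le> z (M - 1)" "cmod (c (- int M) s) \<le> z (M - 1)"
          "cmod (c (int M + 1) s) \<le> z M" "cmod (c (- int M - 1) s) \<le> z M"
          using dec[of s "int M"] dec[of s "- int M"] dec[of s "int M + 1"] dec[of s "- int M - 1"] s
          by (simp_all add: z_def)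
        show "\<bar>flux k c (- int M) s\<bar> \<le> \<bar>q s\<bar> * (z M * z (M - 1))"
          by (rule order_trans[OF flux_bound]) (intro mult_left_mono mult_mono b z0; simp)
        show "\<bar>flux k c (int M + 1) s\<bar> \<le> \<bar>q s\<bar> * (z (M - 1) * z M)"
          by (rule order_trans[OF flux_bound]) (use b z0 in \<open>auto intro!: mult_left_mono mult_mono\<close>)
      qed
      finally show "\<bar>\<Sum>n\<in>{-int M..int M + 1}. (v n - v (n - 1)) * flux k c n s\<bar> \<le> 2 * (z (M - 1) * z M) * \<bar>q s\<bar>"
        by (simp add: mult_ac)
    qed (use t in auto)
    moreover have "?S 0 = 1"
    proof -
      have "v n * (cmod (c n 0))\<^sup>2 = (if n = 0 then 1 else 0)" for n
        by (simp add: coeff_system_initial[OF sys] v_def)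
      then show ?thesis by simp
    qed
    moreover have "?S t = (\<Sum>n\<in>{-int M..int M}. (cmod (c n t))\<^sup>2)"
      by (simp, rule sum.cong) (auto simp: v_def)
    moreover have "2 * (z (M - 1) * z M) * (A t - A 0) \<le> 2 * (z (M - 1) * z M) * A t"
      using z0 A_nonneg by (intro mult_left_mono) auto
    ultimately show ?thesis by linarith
  qed
  have "(\<lambda>M. 2 * (z (M - 1) * z M) * A t) \<longlonglongrightarrow> 2 * (0 * 0) * A t"
    by (intro tendsto_intros zlim) (rule LIMSEQ_offset[of "\<lambda>M. z (M - 1)" 1], simp add: zlim)
  then have limz: "(\<lambda>M. 2 * (z (M - 1) * z M) * A t) \<longlonglongrightarrow> 0" by simp
  have ev: "\<forall>\<^sub>F M in sequentially. norm ((\<Sum>n\<in>{-int M..int M}. (cmod (c n t))\<^sup>2) - 1) \<le> 2 * (z (M - 1) * z M) * A t"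
    using eventually_ge_at_top[of 1] by (rule eventually_mono) (use le in simp)
  have "(\<lambda>M. (\<Sum>n\<in>{-int M..int M}. (cmod (c n t))\<^sup>2) - 1) \<longlonglongrightarrow> 0"
    by (rule Lim_null_comparison[OF ev limz])
  then show ?thesis by (rule LIM_zero_cancel)
qed

lemma finite_int_subset: "finite F \<Longrightarrow> \<exists>M::nat. F \<subseteq> {-int M..int M}"
proof -
  assume "finite F"
  then have "\<bar>n\<bar> \<le> Max (insert 0 (abs ` F))" if "n \<in> F" for n
    using that by (intro Max_ge) auto
  then show ?thesis
    by (intro exI[of _ "nat (Max (insert 0 (abs ` F)))"]) (force simp: abs_le_iff)
qed

lemma square_sum_le_1:
  assumes sys: "coeff_system q k c" and t: "t \<ge> 0" and F: "finite F"
  shows "(\<Sum>n\<in>F. (cmod (c n t))\<^sup>2) \<le> 1"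
proof -
  obtain M0 where M0: "F \<subseteq> {-int M0..int M0}" using finite_int_subset[OF F] by blast
  have "(\<Sum>n\<in>F. (cmod (c n t))\<^sup>2) \<le> (\<Sum>n\<in>{-int M..int M}. (cmod (c n t))\<^sup>2)" if "M \<ge> M0" for M
    by (rule sum_mono2) (use M0 that in auto)
  then show ?thesis by (intro LIMSEQ_le_const[OF square_sum_conserved[OF sys t]]) blast
qed

lemma coeff_le_1: "coeff_system q k c \<Longrightarrow> t \<ge> 0 \<Longrightarrow> cmod (c n t) \<le> 1"
  using square_sum_le_1[of k c t "{n}"] by (simp add: power_le_one_iff abs_square_le_1)

end

lemma abs_power_diff_le:
  fixes x y z :: real
  assumes "0 \<le> x" "x \<le> z" "0 \<le> y" "y \<le> z"
  shows "\<bar>x ^ m - y ^ m\<bar> \<le> real m * z ^ (m - 1) * \<bar>x - y\<bar>"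
proof (induction m)
  case (Suc m)
  have "\<bar>x ^ Suc m - y ^ Suc m\<bar> = \<bar>x * (x ^ m - y ^ m) + (x - y) * y ^ m\<bar>" by (simp add: algebra_simps)
  also have "\<dots> \<le> x * \<bar>x ^ m - y ^ m\<bar> + \<bar>x - y\<bar> * y ^ m"
    using assms by (intro order_trans[OF abs_triangle_ineq]) (simp add: abs_mult)
  also have "\<dots> \<le> z * (real m * z ^ (m - 1) * \<bar>x - y\<bar>) + \<bar>x - y\<bar> * z ^ m"
    using assms Suc by (intro add_mono mult_mono power_mono) auto
  also have "\<dots> = real (Suc m) * z ^ (Suc m - 1) * \<bar>x - y\<bar>"
    by (cases m) (simp_all add: algebra_simps)
  finally show ?case .
qed simp

text \<open>Dividing by \<open>x\<^sup>m\<^sup>-\<^sup>1\<close> closes the energy estimates: the maximum \<open>x\<^sup>m\<close> of an energy is compared with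
  \<open>x\<^sup>m\<^sup>-\<^sup>1\<close>.\<close>

lemma power_le_plus_mult_imp_le:
  fixes x e D :: real
  assumes le: "x ^ m \<le> e ^ m + D * x ^ (m - 1)" and m: "m \<ge> 1" and e: "e \<ge> 0" and x: "x > 0" and D: "D \<ge> 0"
  shows "x \<le> e + D"
proof (cases "x \<le> e")
  case False
  then have "e ^ (m - 1) \<le> x ^ (m - 1)" using e by (intro power_mono) auto
  then have "e ^ m \<le> e * x ^ (m - 1)"
    using m e by (cases m) (auto intro: mult_left_mono)
  then have "x * x ^ (m - 1) \<le> (e + D) * x ^ (m - 1)"
    using le m by (cases m) (auto simp: algebra_simps)
  then show ?thesis using x by (simp add: mult_le_cancel_right)
qed (use D in simp)

lemma sum_shift_le:
  fixes f :: "int \<Rightarrow> real"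
  assumes f: "\<And>n. f n \<ge> 0" and "- 2 \<le> i" "i \<le> 1"
  shows "(\<Sum>n\<in>{-int M..int M + 1}. f (n + i)) \<le> (\<Sum>n\<in>{-int M - 2..int M + 2}. f n)"
proof -
  have "(\<Sum>n\<in>{-int M..int M + 1}. f (n + i)) = (\<Sum>n\<in>{-int M + i..int M + 1 + i}. f n)"
    by (rule sum.reindex_bij_witness[of _ "\<lambda>n. n - i" "\<lambda>n. n + i"]) auto
  also have "\<dots> \<le> (\<Sum>n\<in>{-int M - 2..int M + 2}. f n)"
    by (rule sum_mono2) (use assms in auto)
  finally show ?thesis .
qed

context potential
begin

text \<open>For a weight equal to \<open>L\<close> outside \<open>{-M..M}\<close> this is \<open>\<Sum>\<^sub>n w\<^sub>n |c\<^sub>n|\<^sup>2\<close>, rewritten as a finite sum by means of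
  the conservation of mass.\<close>

definition energy :: "nat \<Rightarrow> (int \<Rightarrow> real) \<Rightarrow> real \<Rightarrow> (int \<Rightarrow> real \<Rightarrow> complex) \<Rightarrow> real \<Rightarrow> real" where
  "energy M w L c t = L + (\<Sum>n\<in>{-int M..int M}. (w n - L) * (cmod (c n t))\<^sup>2)"

lemma energy_ge:
  assumes sys: "coeff_system q k c" and t: "t \<ge> 0" and F: "finite F"
    and w: "\<And>n. 0 \<le> w n" "\<And>n. w n \<le> L" "\<And>n. \<bar>n\<bar> > int M \<Longrightarrow> w n = L"
  shows "(\<Sum>n\<in>F. w n * (cmod (c n t))\<^sup>2) \<le> energy M w L c t"
proof -
  define I where "I = {-int M..int M}"
  define G where "G = F \<union> I"
  have [simp]: "finite G" "finite I" and sub: "I \<subseteq> G" using F by (auto simp: G_def I_def)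
  have L: "L \<ge> 0" using w(1)[of 0] w(2)[of 0] by simp
  have "(\<Sum>n\<in>F. w n * (cmod (c n t))\<^sup>2) \<le> (\<Sum>n\<in>G. w n * (cmod (c n t))\<^sup>2)"
    by (rule sum_mono2) (auto simp: G_def w I_def F)
  also have "\<dots> = (\<Sum>n\<in>G - I. w n * (cmod (c n t))\<^sup>2) + (\<Sum>n\<in>I. w n * (cmod (c n t))\<^sup>2)"
    by (rule sum.subset_diff[OF sub]) simp
  also have "(\<Sum>n\<in>G - I. w n * (cmod (c n t))\<^sup>2) = L * (\<Sum>n\<in>G - I. (cmod (c n t))\<^sup>2)"
    unfolding sum_distrib_left by (rule sum.cong) (auto simp: I_def w(3))
  also have "\<dots> \<le> L * (1 - (\<Sum>n\<in>I. (cmod (c n t))\<^sup>2))"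
  proof (rule mult_left_mono[OF _ L])
    have "(\<Sum>n\<in>G - I. (cmod (c n t))\<^sup>2) + (\<Sum>n\<in>I. (cmod (c n t))\<^sup>2) = (\<Sum>n\<in>G. (cmod (c n t))\<^sup>2)"
      by (rule sum.subset_diff[OF sub, symmetric]) simp
    also have "\<dots> \<le> 1" by (rule square_sum_le_1[OF sys t]) simp
    finally show "(\<Sum>n\<in>G - I. (cmod (c n t))\<^sup>2) \<le> 1 - (\<Sum>n\<in>I. (cmod (c n t))\<^sup>2)" by simp
  qed
  also have "L * (1 - (\<Sum>n\<in>I. (cmod (c n t))\<^sup>2)) + (\<Sum>n\<in>I. w n * (cmod (c n t))\<^sup>2) = energy M w L c t"
    by (simp add: energy_def I_def left_diff_distrib right_diff_distrib sum_subtractf sum_distrib_left)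
  finally show ?thesis by simp
qed

lemma energy_prim:
  assumes sys: "coeff_system q k c" and w: "\<And>n. \<bar>n\<bar> > int M \<Longrightarrow> w n = L"
  shows "prim_on 0 T (\<lambda>t. complex_of_real (energy M w L c t))
    (\<lambda>t. of_real (\<Sum>n\<in>{-int M..int M + 1}. (w n - w (n - 1)) * flux k c n t))"
  using weighted_square_sum_prim[OF sys, of M "\<lambda>n. w n - L" T L] w by (simp add: energy_def[abs_def])

lemma energy_initial: "coeff_system q k c \<Longrightarrow> energy M w L c 0 = w 0"
proof -
  assume sys: "coeff_system q k c"
  have "(w n - L) * (cmod (c n 0))\<^sup>2 = (if n = 0 then w 0 - L else 0)" for n
    by (simp add: coeff_system_initial[OF sys])
  then show ?thesis by (simp add: energy_def)
qed

lemma energy_continuous: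
  "coeff_system q k c \<Longrightarrow> continuous_on UNIV (energy M w L c)"
  unfolding energy_def[abs_def] coeff_system_def by (intro continuous_intros) auto

lemma sum_flux_bound:
  "\<bar>\<Sum>n\<in>I. (w n - w (n - 1)) * flux k c n t\<bar> \<le> (\<Sum>n\<in>I. \<bar>w n - w (n - 1)\<bar> * (cmod (c (n - 1) t) * cmod (c n t))) * \<bar>q t\<bar>"
proof -
  have "\<bar>\<Sum>n\<in>I. (w n - w (n - 1)) * flux k c n t\<bar> \<le> (\<Sum>n\<in>I. \<bar>(w n - w (n - 1)) * flux k c n t\<bar>)"
    by (rule sum_abs)
  also have "\<dots> \<le> (\<Sum>n\<in>I. \<bar>w n - w (n - 1)\<bar> * (\<bar>q t\<bar> * (cmod (c (n - 1) t) * cmod (c n t))))"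
    unfolding abs_mult by (intro sum_mono mult_left_mono flux_bound) auto
  also have "\<dots> = (\<Sum>n\<in>I. \<bar>w n - w (n - 1)\<bar> * (cmod (c (n - 1) t) * cmod (c n t))) * \<bar>q t\<bar>"
    by (simp add: sum_distrib_left sum_distrib_right mult_ac)
  finally show ?thesis .
qed

lemma shifted_square_sum_le_1:
  assumes sys: "coeff_system q k c" and t: "t \<ge> 0" and F: "finite F"
  shows "(\<Sum>n\<in>F. (cmod (c (n + i) t))\<^sup>2) \<le> 1"
proof -
  have "(\<Sum>n\<in>F. (cmod (c (n + i) t))\<^sup>2) = (\<Sum>n\<in>(\<lambda>n. n + i) ` F. (cmod (c n t))\<^sup>2)"
    by (subst sum.reindex) (auto simp: inj_on_def)
  also have "\<dots> \<le> 1" by (rule square_sum_le_1[OF sys t]) (use F in simp)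
  finally show ?thesis .
qed

text \<open>The weight \<open>min(|n|, N)\<^sup>2\<close> vanishes at \<open>n = 0\<close>, so the energy starts at \<open>0\<close>, and its
  increments are at most \<open>min(|n|, N) + min(|n-1|, N)\<close>: by Cauchy--Schwarz the energy \<open>E\<close> satisfies
  \<open>|E'| \<le> 2 |q| \<surd>E\<close>.\<close>

theorem high_freq_bound:
  assumes sys: "coeff_system q k c" and t: "t \<ge> 0" and N: "N \<ge> 1" and F: "finite F" "\<And>n. n \<in> F \<Longrightarrow> \<bar>n\<bar> \<ge> int N"
  shows "(\<Sum>n\<in>F. (cmod (c n t))\<^sup>2) \<le> 4 * (A t)\<^sup>2 / (real N)\<^sup>2"
proof -
  define \<mu> where "\<mu> n = real_of_int (min \<bar>n\<bar> (int N))" for n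
  define w where "w n = (\<mu> n)\<^sup>2" for n
  have mu0: "\<mu> n \<ge> 0" and muN: "\<mu> n \<le> real N" for n by (auto simp: \<mu>_def)
  have w: "0 \<le> w n" "w n \<le> (real N)\<^sup>2" "\<bar>n\<bar> > int N \<Longrightarrow> w n = (real N)\<^sup>2" for n
    using mu0 muN by (auto simp: w_def \<mu>_def intro!: power_mono)
  let ?E = "energy N w ((real N)\<^sup>2) c"
  have ge: "(\<Sum>n\<in>G. w n * (cmod (c n s))\<^sup>2) \<le> ?E s" if "finite G" "s \<ge> 0" for G s
    by (rule energy_ge[OF sys that(2,1) w])
  obtain s0 where s0: "s0 \<in> {0..t}" "\<And>s. s \<in> {0..t} \<Longrightarrow> ?E s \<le> ?E s0"
    using continuous_attains_sup[of "{0..t}" ?E] t continuous_on_subset[OF energy_continuous[OF sys]] by auto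
  have E0: "?E s0 \<ge> 0" using ge[of "{}" s0] s0 by simp
  define X where "X = sqrt (?E s0)"
  have X: "X \<ge> 0" "X\<^sup>2 = ?E s0" using E0 by (auto simp: X_def)
  have "\<bar>?E s0 - ?E 0\<bar> \<le> (2 * X) * (A s0 - A 0)"
  proof (rule real_prim_diff_le[OF energy_prim[OF sys w(3)]])
    fix s assume s: "0 \<le> s" "s \<le> s0"
    define I where "I = {-int N..int N + 1}"
    have finI: "finite I" by (simp add: I_def)
    have XS: "(\<Sum>n\<in>G. w n * (cmod (c n s))\<^sup>2) \<le> X\<^sup>2" if "finite G" for G
      using ge[OF that s(1)] s0(2)[of s] s s0(1) X by auto
    have CS: "(\<Sum>n\<in>I. f n * g n) \<le> X" if f: "(\<Sum>n\<in>I. (f n)\<^sup>2) \<le> X\<^sup>2" and g: "(\<Sum>n\<in>I. (g n)\<^sup>2) \<le> 1" for f g :: "int \<Rightarrow> real"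
    proof -
      have "(\<Sum>n\<in>I. f n * g n)\<^sup>2 \<le> (\<Sum>n\<in>I. (f n)\<^sup>2) * (\<Sum>n\<in>I. (g n)\<^sup>2)" by (rule Cauchy_Schwarz_ineq_sum)
      also have "\<dots> \<le> X\<^sup>2 * 1" using f g by (intro mult_mono sum_nonneg) auto
      finally have "(\<Sum>n\<in>I. f n * g n)\<^sup>2 \<le> X\<^sup>2" by simp
      then show ?thesis using X(1) by (rule power2_le_imp_le)
    qed
    have 1: "(\<Sum>n\<in>I. (\<mu> n * cmod (c n s)) * cmod (c (n - 1) s)) \<le> X"
      by (rule CS)
        (use XS[OF finI] shifted_square_sum_le_1[OF sys s(1) finI, of "-1"] in \<open>simp_all add: w_def power_mult_distrib\<close>)
    have "(\<Sum>n\<in>I. (\<mu> (n - 1) * cmod (c (n - 1) s))\<^sup>2) = (\<Sum>n\<in>(\<lambda>n. n - 1) ` I. w n * (cmod (c n s))\<^sup>2)"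
      by (subst sum.reindex) (auto simp: inj_on_def w_def power_mult_distrib)
    then have 2: "(\<Sum>n\<in>I. (\<mu> (n - 1) * cmod (c (n - 1) s)) * cmod (c n s)) \<le> X"
      by (intro CS) (use XS[of "(\<lambda>n. n - 1) ` I"] finI square_sum_le_1[OF sys s(1) finI] in simp_all)
    have dw: "\<bar>w n - w (n - 1)\<bar> \<le> \<mu> n + \<mu> (n - 1)" for n
    proof -
      have "\<bar>min \<bar>n\<bar> (int N) - min \<bar>n - 1\<bar> (int N)\<bar> \<le> 1" by (auto simp: min_def abs_if)
      then have "real_of_int \<bar>min \<bar>n\<bar> (int N) - min \<bar>n - 1\<bar> (int N)\<bar> \<le> 1"
        by (simp only: of_int_le_1_iff)
      then have "\<bar>\<mu> n - \<mu> (n - 1)\<bar> \<le> 1" by (simp only: \<mu>_def of_int_abs of_int_diff)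
      then have "\<bar>\<mu> n - \<mu> (n - 1)\<bar> * \<bar>\<mu> n + \<mu> (n - 1)\<bar> \<le> 1 * \<bar>\<mu> n + \<mu> (n - 1)\<bar>"
        by (intro mult_right_mono) auto
      moreover have "w n - w (n - 1) = (\<mu> n - \<mu> (n - 1)) * (\<mu> n + \<mu> (n - 1))"
        by (simp add: w_def power2_eq_square algebra_simps)
      ultimately show ?thesis using mu0[of n] mu0[of "n - 1"] by (simp add: abs_mult)
    qed
    have "(\<Sum>n\<in>I. \<bar>w n - w (n - 1)\<bar> * (cmod (c (n - 1) s) * cmod (c n s)))
        \<le> (\<Sum>n\<in>I. (\<mu> n + \<mu> (n - 1)) * (cmod (c (n - 1) s) * cmod (c n s)))"
      by (intro sum_mono mult_right_mono dw) auto
    also have "\<dots> = (\<Sum>n\<in>I. (\<mu> n * cmod (c n s)) * cmod (c (n - 1) s)) + (\<Sum>n\<in>I. (\<mu> (n - 1) * cmod (c (n - 1) s)) * cmod (c n s))"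
      unfolding sum.distrib[symmetric] by (rule sum.cong) (simp_all add: algebra_simps)
    also have "\<dots> \<le> 2 * X" using 1 2 by simp
    finally have "(\<Sum>n\<in>I. \<bar>w n - w (n - 1)\<bar> * (cmod (c (n - 1) s) * cmod (c n s))) * \<bar>q s\<bar> \<le> 2 * X * \<bar>q s\<bar>"
      by (rule mult_right_mono) simp
    then show "\<bar>\<Sum>n\<in>{-int N..int N + 1}. (w n - w (n - 1)) * flux k c n s\<bar> \<le> 2 * X * \<bar>q s\<bar>"
      using sum_flux_bound[of w k c s I] unfolding I_def by (rule order_trans[rotated])
  qed (use s0 in auto)
  moreover have "?E 0 = 0" by (simp add: energy_initial[OF sys] w_def \<mu>_def)
  moreover have "(2 * X) * (A s0 - A 0) \<le> 2 * X * A t"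
    using X A_nonneg[of 0] A_mono[of s0 t] s0 by (intro mult_left_mono) auto
  ultimately have "X * X \<le> X * (2 * A t)" using X by (simp add: power2_eq_square)
  then have "X \<le> 2 * A t" using X(1) A_nonneg[of t] by (cases "X = 0") auto
  then have "X\<^sup>2 \<le> (2 * A t)\<^sup>2" using X(1) by (rule power_mono)
  then have "?E t \<le> 4 * (A t)\<^sup>2" using s0(2)[of t] t X by (simp add: power_mult_distrib)
  moreover have "(\<Sum>n\<in>F. w n * (cmod (c n t))\<^sup>2) = (real N)\<^sup>2 * (\<Sum>n\<in>F. (cmod (c n t))\<^sup>2)"
    unfolding sum_distrib_left by (rule sum.cong) (simp_all add: w_def \<mu>_def min_absorb2 F(2))
  ultimately have "(real N)\<^sup>2 * (\<Sum>n\<in>F. (cmod (c n t))\<^sup>2) \<le> 4 * (A t)\<^sup>2"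
    using ge[OF F(1) t] by simp
  then show ?thesis using N by (simp add: field_simps)
qed

end

section \<open>Energies with polynomial weights\<close>

text \<open>The weight \<open>(|n| + 1)\<^sup>m\<close>, frozen beyond \<open>M\<close>.  All bounds are uniform in \<open>M\<close>.\<close>

definition pweight :: "nat \<Rightarrow> nat \<Rightarrow> int \<Rightarrow> real" where
  "pweight M m n = (real_of_int (min (\<bar>n\<bar> + 1) (int M + 1))) ^ m"

lemma pweight_props:
  "1 \<le> pweight M m n" "0 \<le> pweight M m n" "pweight M m n \<le> pweight M m (int M)"
  "\<bar>n\<bar> > int M \<Longrightarrow> pweight M m n = pweight M m (int M)" "pweight M m 0 = 1"
  unfolding pweight_def by (auto intro!: power_mono one_le_power)

text \<open>Neighbouring frequencies differ by a factor of at most \<open>3\<close>; comparing with any \<open>j\<close> near \<open>n\<close> allows the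
  increment to be paired with the coefficients of all the neighbours.\<close>

lemma pweight_diff_le:
  assumes j: "j \<in> {n - 2..n + 1}"
  shows "\<bar>pweight M m n - pweight M m (n - 1)\<bar> \<le> real m * 3 ^ (m - 1) * pweight M (m - 1) j"
proof -
  define W where "W n = real_of_int (min (\<bar>n\<bar> + 1) (int M + 1))" for n
  have W3: "W i \<le> 3 * W j" if "\<bar>i - j\<bar> \<le> 2" for i
  proof -
    have "min (\<bar>i\<bar> + 1) (int M + 1) \<le> 3 * min (\<bar>j\<bar> + 1) (int M + 1)"
      using that by (auto simp: min_def abs_if split: if_splits)
    then have "real_of_int (min (\<bar>i\<bar> + 1) (int M + 1)) \<le> real_of_int (3 * min (\<bar>j\<bar> + 1) (int M + 1))"
      by (simp only: of_int_le_iff)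
    then show ?thesis by (simp only: W_def of_int_mult of_int_numeral)
  qed
  have "\<bar>W n ^ m - W (n - 1) ^ m\<bar> \<le> real m * (3 * W j) ^ (m - 1) * \<bar>W n - W (n - 1)\<bar>"
    by (rule abs_power_diff_le) (use j W3[of n] W3[of "n - 1"] in \<open>auto simp: W_def abs_if\<close>)
  also have "\<dots> \<le> real m * (3 * W j) ^ (m - 1) * 1"
    by (intro mult_left_mono) (auto simp: W_def)
  finally show ?thesis by (simp add: pweight_def W_def power_mult_distrib)
qed

context potential
begin

abbreviation penergy :: "nat \<Rightarrow> nat \<Rightarrow> (int \<Rightarrow> real \<Rightarrow> complex) \<Rightarrow> real \<Rightarrow> real" where
  "penergy M m \<equiv> energy M (pweight M m) (pweight M m (int M))"

lemma penergy_ge: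
  assumes "coeff_system q k c" "t \<ge> 0" "finite F"
  shows "(\<Sum>n\<in>F. pweight M m n * (cmod (c n t))\<^sup>2) \<le> penergy M m c t"
  by (rule energy_ge[OF assms]) (auto intro: pweight_props)

lemma penergy_ge_1:
  assumes sys: "coeff_system q k c" and t: "t \<ge> 0"
  shows "1 \<le> penergy M m c t"
proof (rule LIMSEQ_le_const2[OF square_sum_conserved[OF sys t]])
  have "(\<Sum>n\<in>{-int j..int j}. (cmod (c n t))\<^sup>2) \<le> penergy M m c t" for j
  proof (rule order_trans[OF sum_mono penergy_ge[OF sys t]])
    show "(cmod (c n t))\<^sup>2 \<le> pweight M m n * (cmod (c n t))\<^sup>2" for n
      using mult_right_mono[OF pweight_props(1)[of M m n], of "(cmod (c n t))\<^sup>2"] by simp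
  qed simp
  then show "\<exists>N. \<forall>j\<ge>N. (\<Sum>n\<in>{-int j..int j}. (cmod (c n t))\<^sup>2) \<le> penergy M m c t" by blast
qed

text \<open>The interpolation \<open>E\<^sub>m\<^sub>-\<^sub>1 \<lesssim> E\<^sub>m\<^sup>1\<^sup>-\<^sup>1\<^sup>/\<^sup>m\<close> for a mass distribution of total mass at most \<open>1\<close>:
  split the frequencies according to whether the weight exceeds \<open>X\<close>.\<close>

lemma pweight_interpolation:
  assumes sys: "coeff_system q k c" and t: "t \<ge> 0" and F: "finite F" and m: "m \<ge> 1"
    and X: "X > 0" "penergy M m c t \<le> X ^ m"
  shows "(\<Sum>n\<in>F. pweight M (m - 1) n * (cmod (c n t))\<^sup>2) \<le> 2 * X ^ (m - 1)"
proof -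
  have le: "pweight M (m - 1) n \<le> pweight M m n / X + X ^ (m - 1)" for n
  proof -
    define W where "W = real_of_int (min (\<bar>n\<bar> + 1) (int M + 1))"
    have W: "W > 0" by (auto simp: W_def)
    have Wm: "W ^ m = W * W ^ (m - 1)" using m by (cases m) auto
    have "W ^ (m - 1) \<le> W ^ m / X + X ^ (m - 1)"
    proof (cases "W \<ge> X")
      case True
      then have "X * W ^ (m - 1) \<le> W ^ m" unfolding Wm using W by (intro mult_right_mono) auto
      then have "W ^ (m - 1) \<le> W ^ m / X" using X by (simp add: field_simps)
      moreover have "X ^ (m - 1) \<ge> 0" using X by simp
      ultimately show ?thesis by linarith
    next
      case False
      then have "W ^ (m - 1) \<le> X ^ (m - 1)" using W by (intro power_mono) auto
      moreover have "W ^ m / X \<ge> 0" using W X by simp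
      ultimately show ?thesis by linarith
    qed
    then show ?thesis by (simp add: pweight_def W_def)
  qed
  have "(\<Sum>n\<in>F. pweight M (m - 1) n * (cmod (c n t))\<^sup>2)
      \<le> (\<Sum>n\<in>F. (pweight M m n / X + X ^ (m - 1)) * (cmod (c n t))\<^sup>2)"
    by (intro sum_mono mult_right_mono le) auto
  also have "\<dots> = (\<Sum>n\<in>F. pweight M m n * (cmod (c n t))\<^sup>2) / X + X ^ (m - 1) * (\<Sum>n\<in>F. (cmod (c n t))\<^sup>2)"
    by (simp add: distrib_right sum.distrib sum_divide_distrib sum_distrib_left)
  also have "\<dots> \<le> X ^ m / X + X ^ (m - 1) * 1"
    using X penergy_ge[OF sys t F, of M m] square_sum_le_1[OF sys t F]
    by (intro add_mono mult_left_mono divide_right_mono) auto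
  also have "\<dots> = 2 * X ^ (m - 1)" using m X by (cases m) auto
  finally show ?thesis .
qed

lemma sum_weighted_shift_le:
  assumes sys: "coeff_system q k c" and t: "t \<ge> 0" and m: "m \<ge> 1"
    and X: "X > 0" "penergy M m c t \<le> X ^ m" and i: "- 2 \<le> i" "i \<le> 1"
  shows "(\<Sum>n\<in>{-int M..int M + 1}. \<bar>pweight M m n - pweight M m (n - 1)\<bar> * (cmod (c (n + i) t))\<^sup>2)
    \<le> real m * 3 ^ (m - 1) * (2 * X ^ (m - 1))"
proof -
  have "(\<Sum>n\<in>{-int M..int M + 1}. \<bar>pweight M m n - pweight M m (n - 1)\<bar> * (cmod (c (n + i) t))\<^sup>2)
      \<le> (\<Sum>n\<in>{-int M..int M + 1}. real m * 3 ^ (m - 1) * pweight M (m - 1) (n + i) * (cmod (c (n + i) t))\<^sup>2)"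
    by (intro sum_mono mult_right_mono pweight_diff_le) (use i in auto)
  also have "\<dots> = real m * 3 ^ (m - 1) * (\<Sum>n\<in>{-int M..int M + 1}. pweight M (m - 1) (n + i) * (cmod (c (n + i) t))\<^sup>2)"
    by (simp add: sum_distrib_left mult_ac)
  also have "\<dots> \<le> real m * 3 ^ (m - 1) * (\<Sum>n\<in>{-int M - 2..int M + 2}. pweight M (m - 1) n * (cmod (c n t))\<^sup>2)"
    by (intro mult_left_mono sum_shift_le[OF _ i]) (auto intro: mult_nonneg_nonneg pweight_props)
  also have "\<dots> \<le> real m * 3 ^ (m - 1) * (2 * X ^ (m - 1))"
    by (intro mult_left_mono pweight_interpolation[OF sys t _ m X]) auto
  finally show ?thesis .
qed

lemma sum_weighted_neighbours_le:
  assumes sys: "coeff_system q k c" and t: "t \<ge> 0" and m: "m \<ge> 1"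
    and X: "X > 0" "penergy M m c t \<le> X ^ m"
  shows "(\<Sum>n\<in>{-int M..int M + 1}. \<bar>pweight M m n - pweight M m (n - 1)\<bar> * (cmod (c (n - 1) t) * cmod (c n t)))
    \<le> 2 * real m * 3 ^ (m - 1) * X ^ (m - 1)"
proof -
  have "(\<Sum>n\<in>{-int M..int M + 1}. \<bar>pweight M m n - pweight M m (n - 1)\<bar> * (cmod (c (n - 1) t) * cmod (c n t)))
    \<le> (\<Sum>n\<in>{-int M..int M + 1}. \<bar>pweight M m n - pweight M m (n - 1)\<bar> * ((cmod (c (n + -1) t))\<^sup>2 / 2 + (cmod (c (n + 0) t))\<^sup>2 / 2))"
  proof (intro sum_mono mult_left_mono)
    show "cmod (c (n - 1) t) * cmod (c n t) \<le> (cmod (c (n + -1) t))\<^sup>2 / 2 + (cmod (c (n + 0) t))\<^sup>2 / 2" for n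
      using sum_squares_bound[of "cmod (c (n - 1) t)" "cmod (c n t)"] by simp
  qed simp
  also have "\<dots> = (\<Sum>n\<in>{-int M..int M + 1}. \<bar>pweight M m n - pweight M m (n - 1)\<bar> * (cmod (c (n + -1) t))\<^sup>2) / 2
     + (\<Sum>n\<in>{-int M..int M + 1}. \<bar>pweight M m n - pweight M m (n - 1)\<bar> * (cmod (c (n + 0) t))\<^sup>2) / 2"
    by (simp only: distrib_left sum.distrib sum_divide_distrib times_divide_eq_right)
  also have "\<dots> \<le> real m * 3 ^ (m - 1) * (2 * X ^ (m - 1)) / 2 + real m * 3 ^ (m - 1) * (2 * X ^ (m - 1)) / 2"
    by (intro add_mono divide_right_mono sum_weighted_shift_le[OF sys t m X]) auto
  finally show ?thesis by (simp add: mult_ac)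
qed

text \<open>The maximum over time is written as an \<open>m\<close>-th power, \<open>X\<close> playing the role of the largest frequency
  carrying mass.\<close>

lemma penergy_attains_max:
  assumes sys: "coeff_system q k c" and ab: "0 \<le> a" "a \<le> b" and m: "m \<ge> 1"
  obtains s0 X where "s0 \<in> {a..b}" "X \<ge> 1" "X ^ m = penergy M m c s0"
    "\<And>s. s \<in> {a..b} \<Longrightarrow> penergy M m c s \<le> X ^ m"
proof -
  obtain s0 where s0: "s0 \<in> {a..b}" "\<And>s. s \<in> {a..b} \<Longrightarrow> penergy M m c s \<le> penergy M m c s0"
    using continuous_attains_sup[of "{a..b}" "penergy M m c"] ab continuous_on_subset[OF energy_continuous[OF sys]] by auto
  have E: "penergy M m c s0 \<ge> 1" by (rule penergy_ge_1[OF sys]) (use s0 ab in auto)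
  define X where "X = root m (penergy M m c s0)"
  have "X ^ m = penergy M m c s0" "X \<ge> 1"
    using E m by (auto simp: X_def intro: real_root_pow_pos2)
  with s0 show ?thesis using that by metis
qed

text \<open>Up to the maximal point the energy \<open>E\<^sub>m\<close> grows at a rate \<open>\<lesssim> |q| E\<^sub>m\<^sub>-\<^sub>1 \<lesssim> |q| X\<^sup>m\<^sup>-\<^sup>1\<close>, and the factor
  \<open>X\<^sup>m\<^sup>-\<^sup>1\<close> is divided out.\<close>

theorem penergy_growth:
  assumes sys: "coeff_system q k c" and t: "t \<ge> 0" and m: "m \<ge> 1"
  shows "penergy M m c t \<le> (1 + 2 * real m * 3 ^ (m - 1) * A t) ^ m"
proof -
  obtain s0 X where s0: "s0 \<in> {0..t}" "X \<ge> 1" "X ^ m = penergy M m c s0"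
    "\<And>s. s \<in> {0..t} \<Longrightarrow> penergy M m c s \<le> X ^ m"
    using penergy_attains_max[OF sys order_refl t m] by blast
  define D where "D = 2 * real m * 3 ^ (m - 1)"
  have D: "D \<ge> 0" by (simp add: D_def)
  have "\<bar>penergy M m c s0 - penergy M m c 0\<bar> \<le> (D * X ^ (m - 1)) * (A s0 - A 0)"
  proof (rule real_prim_diff_le[OF energy_prim[OF sys pweight_props(4)]])
    fix s assume s: "0 \<le> s" "s \<le> s0"
    have "(\<Sum>n\<in>{-int M..int M + 1}. \<bar>pweight M m n - pweight M m (n - 1)\<bar> * (cmod (c (n - 1) s) * cmod (c n s)))
        \<le> D * X ^ (m - 1)"
      unfolding D_def by (rule sum_weighted_neighbours_le[OF sys s(1) m]) (use s s0 in auto)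
    then have "(\<Sum>n\<in>{-int M..int M + 1}. \<bar>pweight M m n - pweight M m (n - 1)\<bar> * (cmod (c (n - 1) s) * cmod (c n s))) * \<bar>q s\<bar>
        \<le> (D * X ^ (m - 1)) * \<bar>q s\<bar>" by (rule mult_right_mono) simp
    then show "\<bar>\<Sum>n\<in>{-int M..int M + 1}. (pweight M m n - pweight M m (n - 1)) * flux k c n s\<bar> \<le> (D * X ^ (m - 1)) * \<bar>q s\<bar>"
      by (rule order_trans[OF sum_flux_bound])
  qed (use s0 in auto)
  moreover have "penergy M m c 0 = 1" by (simp add: energy_initial[OF sys] pweight_props)
  moreover have "(D * X ^ (m - 1)) * (A s0 - A 0) \<le> (D * X ^ (m - 1)) * A t"
    using s0 A_nonneg[of 0] A_mono[of s0 t] D by (intro mult_left_mono) auto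
  ultimately have "X ^ m \<le> 1 ^ m + (D * A t) * X ^ (m - 1)"
    unfolding s0(3) by (simp add: mult_ac)
  then have "X \<le> 1 + D * A t"
    by (rule power_le_plus_mult_imp_le) (use m s0 D A_nonneg in auto)
  then have "X ^ m \<le> (1 + D * A t) ^ m" using s0 by (intro power_mono) auto
  then show ?thesis using s0(4)[of t] t by (simp add: D_def)
qed

section \<open>Integration by parts\<close>

text \<open>The primitive \<open>Q\<^sub>n\<close> of \<open>- q e\<^sup>i\<^sup>k\<^sup>(\<^sup>2\<^sup>n\<^sup>-\<^sup>1\<^sup>)\<^sup>t\<close> that vanishes at the final time \<open>R\<close>, the \<open>\<ell>\<^sup>2\<close> norm \<open>|Q|\<close> of the
  sequence, and \<open>\<integral>|q| |Q|\<close>.\<close>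

definition osc :: "real \<Rightarrow> real \<Rightarrow> int \<Rightarrow> real \<Rightarrow> complex" where
  "osc k R n t = (LINT s:{t..R}|lborel. rot k n s * of_real (q s))"

definition osc_max :: "real \<Rightarrow> real \<Rightarrow> nat \<Rightarrow> real \<Rightarrow> real" where
  "osc_max k R M t = sqrt (\<Sum>n\<in>{-int M..int M + 1}. (cmod (osc k R n t))\<^sup>2)"

definition osc_int :: "real \<Rightarrow> real \<Rightarrow> real \<Rightarrow> nat \<Rightarrow> real" where
  "osc_int k T0 R M = (LINT t:{T0..R}|lborel. \<bar>q t\<bar> * osc_max k R M t)"

lemma rot_q_integrable:
  assumes "0 \<le> a"
  shows "set_integrable lborel {a..b} (\<lambda>s. rot k n s * of_real (q s))"
  by (rule set_integrable_subinterval[OF set_integrable_q_mult[of "rot k n" b 1]]) (use assms in auto)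

lemma osc_measurable_pair:
  "(\<lambda>p. osc (fst p) R n (snd p)) \<in> borel_measurable (borel \<Otimes>\<^sub>M borel)"
proof -
  have ind: "(\<lambda>x :: (real \<times> real) \<times> real. indicator {snd (fst x)..R} (snd x) :: real) \<in> borel_measurable ((borel \<Otimes>\<^sub>M borel) \<Otimes>\<^sub>M borel)"
    unfolding indicator_def atLeastAtMost_iff by measurable
  have cism: "(\<lambda>x::real. cis x) \<in> borel_measurable borel"
    by (intro borel_measurable_continuous_onI continuous_intros)
  have rotm: "(\<lambda>x :: (real \<times> real) \<times> real. rot (fst (fst x)) n (snd x)) \<in> borel_measurable ((borel \<Otimes>\<^sub>M borel) \<Otimes>\<^sub>M borel)"
    unfolding rot_def by (rule measurable_compose[OF _ cism]) measurable
  have "(\<lambda>x. indicator {snd (fst x)..R} (snd x) *\<^sub>R (rot (fst (fst x)) n (snd x) * complex_of_real (q (snd x))))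
      \<in> borel_measurable ((borel \<Otimes>\<^sub>M borel) \<Otimes>\<^sub>M lborel)"
    using ind rotm by measurable
  then have "(\<lambda>p. LINT s|lborel. indicator {snd p..R} s *\<^sub>R (rot (fst p) n s * complex_of_real (q s)))
      \<in> borel_measurable (borel \<Otimes>\<^sub>M borel)"
    by (intro lborel.borel_measurable_lebesgue_integral) (simp add: split_beta')
  then show ?thesis by (simp add: osc_def set_lebesgue_integral_def)
qed

lemma osc_measurable [measurable]: "osc k R n \<in> borel_measurable borel"
  using measurable_compose[OF _ osc_measurable_pair, of "\<lambda>t. (k, t)" borel R n] by simp

lemma osc_max_measurable [measurable]: "osc_max k R M \<in> borel_measurable borel"
  unfolding osc_max_def[abs_def] by measurable

lemma osc_max_nonneg: "0 \<le> osc_max k R M t"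
  by (simp add: osc_max_def sum_nonneg)

lemma osc_le_osc_max: "n \<in> {-int M..int M + 1} \<Longrightarrow> cmod (osc k R n t) \<le> osc_max k R M t"
  unfolding osc_max_def by (intro real_le_rsqrt member_le_sum) auto

lemma osc_bound:
  assumes "0 \<le> t"
  shows "cmod (osc k R n t) \<le> A R"
proof -
  have "cmod (osc k R n t) \<le> (LINT s:{t..R}|lborel. cmod (rot k n s * of_real (q s)))"
    unfolding osc_def by (rule set_integral_norm_bound[OF rot_q_integrable[OF assms]])
  also have "\<dots> = (LINT s:{t..R}|lborel. \<bar>q s\<bar>)" by (simp add: norm_mult)
  also have "\<dots> \<le> A R"
    unfolding A_def set_lebesgue_integral_def
    using set_integrable_subinterval[OF q_abs_int[of R], of t R] q_abs_int[of R] assms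
    by (intro integral_mono) (auto simp: set_integrable_def indicator_def)
  finally show ?thesis .
qed

lemma osc_max_integrable:
  assumes "0 \<le> a"
  shows "set_integrable lborel {a..R} (\<lambda>t. \<bar>q t\<bar> * osc_max k R M t)"
proof -
  have b: "osc_max k R M s \<le> sqrt (\<Sum>n\<in>{-int M..int M + 1}. (A R)\<^sup>2)" if "0 \<le> s" for s
    unfolding osc_max_def using osc_bound[OF that] by (intro real_sqrt_le_mono sum_mono power_mono) auto
  have "set_integrable lborel {0..R} (\<lambda>s. complex_of_real (osc_max k R M s) * of_real (q s))"
    by (rule set_integrable_q_mult[of _ _ "sqrt (\<Sum>n\<in>{-int M..int M + 1}. (A R)\<^sup>2)"])
      (use b osc_max_nonneg in auto)
  then have "set_integrable lborel {0..R} (\<lambda>s. cmod (complex_of_real (osc_max k R M s) * of_real (q s)))"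
    by (rule set_integrable_norm)
  then have "set_integrable lborel {0..R} (\<lambda>t. \<bar>q t\<bar> * osc_max k R M t)"
    using osc_max_nonneg by (simp add: norm_mult mult.commute)
  then show ?thesis by (rule set_integrable_subinterval) (use assms in auto)
qed

text \<open>The supremum over times is bounded without a maximal function: as \<open>Q' = -q e\<close> and \<open>Q(R) = 0\<close>, the
  square \<open>|Q(t)|\<^sup>2\<close> is at most \<open>2 \<integral>\<^sub>t\<^sup>R |q| |Q|\<close>.\<close>

lemma osc_square_le:
  assumes t: "0 \<le> T0" "T0 \<le> t" "t \<le> R" and n: "n \<in> {-int M..int M + 1}"
  shows "(cmod (osc k R n t))\<^sup>2 \<le> 2 * osc_int k T0 R M"
proof -
  have pr: "prim_on t R (osc k R n) (\<lambda>s. - (rot k n s * of_real (q s)))"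
    unfolding osc_def[abs_def] by (rule prim_on_tail[OF rot_q_integrable]) (use t in simp)
  have pr2: "prim_on t R (\<lambda>s. osc k R n s * cnj (osc k R n s))
     (\<lambda>s. - (rot k n s * of_real (q s)) * cnj (osc k R n s) + osc k R n s * cnj (- (rot k n s * of_real (q s))))"
    by (rule prim_on_mult[OF pr prim_on_cnj[OF pr]])
  have int: "set_integrable lborel {t..R} (\<lambda>s. \<bar>q s\<bar> * osc_max k R M s)"
    by (rule osc_max_integrable) (use t in simp)
  have "cmod (osc k R n R * cnj (osc k R n R) - osc k R n t * cnj (osc k R n t))
      \<le> (LINT s:{t..R}|lborel. 2 * (\<bar>q s\<bar> * osc_max k R M s))"
  proof (rule prim_on_norm_diff_le[OF pr2])
    fix s
    have "cmod (- (rot k n s * of_real (q s)) * cnj (osc k R n s) + osc k R n s * cnj (- (rot k n s * of_real (q s))))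
        \<le> 2 * (\<bar>q s\<bar> * cmod (osc k R n s))"
      by (rule order_trans[OF norm_triangle_ineq]) (simp add: norm_mult)
    also have "\<dots> \<le> 2 * (\<bar>q s\<bar> * osc_max k R M s)"
      by (intro mult_left_mono osc_le_osc_max[OF n]) auto
    finally show "cmod (- (rot k n s * of_real (q s)) * cnj (osc k R n s) + osc k R n s * cnj (- (rot k n s * of_real (q s))))
      \<le> 2 * (\<bar>q s\<bar> * osc_max k R M s)" .
  qed (use t int in auto)
  also have "\<dots> = 2 * (LINT s:{t..R}|lborel. \<bar>q s\<bar> * osc_max k R M s)" by simp
  also have "\<dots> \<le> 2 * osc_int k T0 R M"
    unfolding osc_int_def set_lebesgue_integral_def
    using int osc_max_integrable[OF t(1)] t osc_max_nonneg
    by (intro mult_left_mono integral_mono) (auto simp: set_integrable_def indicator_def)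
  finally have "cmod (osc k R n R * cnj (osc k R n R) - osc k R n t * cnj (osc k R n t)) \<le> 2 * osc_int k T0 R M" .
  moreover have "osc k R n R = 0" by (simp only: osc_def set_integral_lborel_point)
  ultimately show ?thesis by (simp add: norm_mult power2_eq_square)
qed

lemma osc_int_nonneg: "0 \<le> osc_int k T0 R M"
  unfolding osc_int_def set_lebesgue_integral_def
  by (rule Bochner_Integration.integral_nonneg) (auto simp: osc_max_nonneg)

text \<open>The rate \<open>E' = - q \<Sum>(w\<^sub>n - w\<^sub>n\<^sub>-\<^sub>1) Im(e\<^sub>n b\<^sub>n)\<close>, \<open>b\<^sub>n = a\<^sub>n\<^sub>-\<^sub>1 cnj a\<^sub>n\<close>, equals the derivative of
  \<open>Im H\<close>, \<open>H = \<Sum>(w\<^sub>n - w\<^sub>n\<^sub>-\<^sub>1) Q\<^sub>n b\<^sub>n\<close>, up to the terms \<open>Q\<^sub>n b\<^sub>n'\<close>, which contain a second factor \<open>q\<close>.  The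
  boundary terms are controlled by \<open>sup |Q\<^sub>n| \<le> 1 + \<integral>|q| |Q|\<close>, the others by \<open>\<integral>|q| |Q|\<close>.\<close>

theorem penergy_oscillation_bound:
  assumes sys: "coeff_system q k c" and m: "m \<ge> 1" and T0: "0 \<le> T0" and t: "T0 \<le> t" "t \<le> R"
    and e: "e \<ge> 0" "penergy M m c T0 \<le> e ^ m"
  shows "penergy M m c t \<le> (e + 12 * real m * 3 ^ (m - 1) * (1 + osc_int k T0 R M)) ^ m"
proof -
  define I where "I = {-int M..int M + 1}"
  define w where "w = pweight M m"
  define B where "B = osc_int k T0 R M"
  have B: "B \<ge> 0" unfolding B_def by (rule osc_int_nonneg)
  define D where "D = real m * 3 ^ (m - 1)"
  have D: "D \<ge> 0" by (simp add: D_def)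
  have T0R: "T0 \<le> R" using t by simp
  obtain s0 X where s0: "s0 \<in> {T0..R}" "X \<ge> 1" "X ^ m = penergy M m c s0"
    "\<And>s. s \<in> {T0..R} \<Longrightarrow> penergy M m c s \<le> X ^ m"
    using penergy_attains_max[OF sys T0 T0R m] by blast
  have X: "X > 0" using s0 by simp
  define b where "b n s = amp k c (n - 1) s * cnj (amp k c n s)" for n s
  define b' where "b' n s = amp_deriv k c (n - 1) s * cnj (amp k c n s) + amp k c (n - 1) s * cnj (amp_deriv k c n s)" for n s
  define H where "H s = (\<Sum>n\<in>I. of_real (w n - w (n - 1)) * (osc k R n s * b n s))" for s
  have D2: "2 * D * X ^ (m - 1) = 2 * real m * 3 ^ (m - 1) * X ^ (m - 1)" by (simp add: D_def)
  have Q_le: "cmod (osc k R n s) \<le> 1 + B" if "n \<in> I" "s \<in> {T0..R}" for n s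
  proof -
    have "(cmod (osc k R n s))\<^sup>2 \<le> 2 * B"
      unfolding B_def by (rule osc_square_le) (use that T0 in \<open>auto simp: I_def\<close>)
    also have "\<dots> \<le> (1 + B)\<^sup>2" by (simp add: power2_sum)
    finally show ?thesis by (rule power2_le_imp_le) (use B in simp)
  qed
  have H_le: "cmod (H s) \<le> 2 * D * X ^ (m - 1) * (1 + B)" if s: "s \<in> {T0..R}" for s
  proof -
    have "cmod (H s) \<le> (\<Sum>n\<in>I. \<bar>w n - w (n - 1)\<bar> * (cmod (osc k R n s) * (cmod (c (n - 1) s) * cmod (c n s))))"
      unfolding H_def by (rule order_trans[OF norm_sum]) (simp add: norm_mult b_def flip: of_real_diff)
    also have "\<dots> \<le> (\<Sum>n\<in>I. \<bar>w n - w (n - 1)\<bar> * ((1 + B) * (cmod (c (n - 1) s) * cmod (c n s))))"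
      by (intro sum_mono mult_left_mono mult_right_mono Q_le s) auto
    also have "\<dots> = (\<Sum>n\<in>I. \<bar>w n - w (n - 1)\<bar> * (cmod (c (n - 1) s) * cmod (c n s))) * (1 + B)"
      by (simp add: sum_distrib_left sum_distrib_right mult_ac)
    also have "\<dots> \<le> (2 * D * X ^ (m - 1)) * (1 + B)"
      unfolding D2 I_def w_def
      by (intro mult_right_mono sum_weighted_neighbours_le[OF sys _ m X s0(4)[OF s]]) (use s T0 B in auto)
    finally show ?thesis .
  qed
  have prQ: "prim_on T0 R (osc k R n) (\<lambda>s. - (rot k n s * of_real (q s)))" for n
    unfolding osc_def[abs_def] by (rule prim_on_tail[OF rot_q_integrable[OF T0]])
  have prb: "prim_on T0 R (b n) (b' n)" for n
    unfolding b_def[abs_def] b'_def[abs_def]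
    by (rule prim_on_subinterval[OF prim_on_mult[OF amp_prim[OF sys, of R] prim_on_cnj[OF amp_prim[OF sys]]]])
      (use T0 in auto)
  have prH: "prim_on T0 R H (\<lambda>s. \<Sum>n\<in>I. of_real (w n - w (n - 1)) * (- (rot k n s * of_real (q s)) * b n s + osc k R n s * b' n s))"
    unfolding H_def[abs_def] by (intro prim_on_sum prim_on_cmult prim_on_mult prQ prb)
  have prIm: "prim_on T0 R (\<lambda>s. complex_of_real (Im (H s)))
      (\<lambda>s. complex_of_real (Im (\<Sum>n\<in>I. of_real (w n - w (n - 1)) * (- (rot k n s * of_real (q s)) * b n s + osc k R n s * b' n s))))"
    by (rule prim_on_bounded_linear[OF bounded_linear_compose[OF bounded_linear_of_real bounded_linear_Im] prH])
  have prE: "prim_on T0 R (\<lambda>s. complex_of_real (penergy M m c s)) (\<lambda>s. of_real (\<Sum>n\<in>I. (w n - w (n - 1)) * flux k c n s))"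
    unfolding w_def I_def
    by (rule prim_on_subinterval[OF energy_prim[OF sys pweight_props(4), where T = R]]) (use T0 in auto)
  \<comment> \<open>subtracting \<open>Im H\<close> cancels the oscillating part of the flux\<close>
  define G where "G s = penergy M m c s - Im (H s)" for s
  have "prim_on T0 R (\<lambda>s. complex_of_real (penergy M m c s) + (-1) * complex_of_real (Im (H s)))
    (\<lambda>s. of_real (\<Sum>n\<in>I. (w n - w (n - 1)) * flux k c n s)
      + (-1) * complex_of_real (Im (\<Sum>n\<in>I. of_real (w n - w (n - 1)) * (- (rot k n s * of_real (q s)) * b n s + osc k R n s * b' n s))))"
    by (rule prim_on_add[OF prE prim_on_cmult[OF prIm]])
  then have prG: "prim_on T0 R (\<lambda>s. complex_of_real (G s))
     (\<lambda>s. of_real (- (\<Sum>n\<in>I. (w n - w (n - 1)) * Im (osc k R n s * b' n s))))"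
  proof (rule prim_on_cong)
    fix s
    show "complex_of_real (penergy M m c s) + (-1) * complex_of_real (Im (H s)) = complex_of_real (G s)"
      by (simp add: G_def)
    have "Im (\<Sum>n\<in>I. of_real (w n - w (n - 1)) * (- (rot k n s * of_real (q s)) * b n s + osc k R n s * b' n s))
        = (\<Sum>n\<in>I. (w n - w (n - 1)) * (flux k c n s + Im (osc k R n s * b' n s)))"
      unfolding Im_sum
    proof (rule sum.cong[OF refl])
      fix n
      have im: "Im (of_real r * z) = r * Im z" for r z by simp
      have "- (rot k n s * of_real (q s)) * b n s = of_real (- q s) * (rot k n s * b n s)" by simp
      then have "Im (- (rot k n s * of_real (q s)) * b n s) = flux k c n s"
        by (simp only: im flux_def b_def)
      then show "Im (of_real (w n - w (n - 1)) * (- (rot k n s * of_real (q s)) * b n s + osc k R n s * b' n s))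
        = (w n - w (n - 1)) * (flux k c n s + Im (osc k R n s * b' n s))"
        unfolding im plus_complex.simps by simp
    qed
    then show "of_real (\<Sum>n\<in>I. (w n - w (n - 1)) * flux k c n s)
      + (-1) * complex_of_real (Im (\<Sum>n\<in>I. of_real (w n - w (n - 1)) * (- (rot k n s * of_real (q s)) * b n s + osc k R n s * b' n s)))
      = of_real (- (\<Sum>n\<in>I. (w n - w (n - 1)) * Im (osc k R n s * b' n s)))"
      by (simp only: distrib_left sum.distrib of_real_add) simp
  qed
  have b'_le: "cmod (b' n s) \<le> \<bar>q s\<bar> * ((cmod (c (n + -2) s))\<^sup>2 + (cmod (c (n + -1) s))\<^sup>2 + (cmod (c (n + 0) s))\<^sup>2 + (cmod (c (n + 1) s))\<^sup>2)" for n s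
  proof -
    have ad: "cmod (amp_deriv k c j s) \<le> \<bar>q s\<bar> / 2 * (cmod (c (j - 1) s) + cmod (c (j + 1) s))" for j
      unfolding amp_deriv_def norm_mult
      by (intro mult_mono order_trans[OF norm_triangle_ineq]) (auto simp: norm_mult)
    define x where "x = cmod (c (n - 2) s)"
    define y where "y = cmod (c (n - 1) s)"
    define z where "z = cmod (c n s)"
    define u where "u = cmod (c (n + 1) s)"
    have "cmod (b' n s) \<le> cmod (amp_deriv k c (n - 1) s) * z + y * cmod (amp_deriv k c n s)"
      unfolding b'_def by (rule order_trans[OF norm_triangle_ineq]) (simp add: norm_mult z_def y_def)
    also have "\<dots> \<le> \<bar>q s\<bar> / 2 * (x + z) * z + y * (\<bar>q s\<bar> / 2 * (y + u))"
      using ad[of "n - 1"] ad[of n] by (intro add_mono mult_right_mono mult_left_mono) (auto simp: x_def y_def z_def u_def)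
    also have "\<dots> = \<bar>q s\<bar> * ((x + z) * z / 2 + y * (y + u) / 2)" by (simp add: field_simps)
    also have "\<dots> \<le> \<bar>q s\<bar> * (x\<^sup>2 + y\<^sup>2 + z\<^sup>2 + u\<^sup>2)"
    proof (rule mult_left_mono)
      have xz: "x * z \<le> (x\<^sup>2 + z\<^sup>2) / 2" and yu: "y * u \<le> (y\<^sup>2 + u\<^sup>2) / 2"
        using sum_squares_bound[of x z] sum_squares_bound[of y u] by simp_all
      have lin: "(p + c + b + r) / 2 \<le> a + b + c + d"
        if "p \<le> (a + c) / 2" "r \<le> (b + d) / 2" "0 \<le> a" "0 \<le> b" "0 \<le> c" "0 \<le> d" for a b c d p r :: real
        using that by (simp add: field_simps)
      have eq: "(x + z) * z / 2 + y * (y + u) / 2 = (x * z + z\<^sup>2 + y\<^sup>2 + y * u) / 2"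
        by (simp add: power2_eq_square algebra_simps add_divide_distrib)
      show "(x + z) * z / 2 + y * (y + u) / 2 \<le> x\<^sup>2 + y\<^sup>2 + z\<^sup>2 + u\<^sup>2"
        unfolding eq by (rule lin[OF xz yu]) simp_all
    qed simp
    finally show ?thesis by (simp add: x_def y_def z_def u_def)
  qed
  have "cmod (complex_of_real (G s0) - complex_of_real (G T0)) \<le> (LINT s:{T0..s0}|lborel. 8 * D * X ^ (m - 1) * (\<bar>q s\<bar> * osc_max k R M s))"
  proof (rule prim_on_norm_diff_le[OF prG s0(1)])
    show "set_integrable lborel {T0..R} (\<lambda>s. 8 * D * X ^ (m - 1) * (\<bar>q s\<bar> * osc_max k R M s))"
      by (rule set_integrable_mult_right[OF osc_max_integrable[OF T0]])
    fix s assume s: "s \<in> {T0..R}"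
    have s0': "0 \<le> s" using s T0 by simp
    have Es: "penergy M m c s \<le> X ^ m" by (rule s0(4)[OF s])
    have "\<bar>\<Sum>n\<in>I. (w n - w (n - 1)) * Im (osc k R n s * b' n s)\<bar>
        \<le> (\<Sum>n\<in>I. \<bar>w n - w (n - 1)\<bar> * (osc_max k R M s * (\<bar>q s\<bar> * ((cmod (c (n + -2) s))\<^sup>2 + (cmod (c (n + -1) s))\<^sup>2 + (cmod (c (n + 0) s))\<^sup>2 + (cmod (c (n + 1) s))\<^sup>2))))"
    proof (rule order_trans[OF sum_abs], rule sum_mono)
      fix n assume n: "n \<in> I"
      have "\<bar>Im (osc k R n s * b' n s)\<bar> \<le> cmod (osc k R n s) * cmod (b' n s)"
        using abs_Im_le_cmod[of "osc k R n s * b' n s"] by (simp only: norm_mult)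
      also have "\<dots> \<le> osc_max k R M s * (\<bar>q s\<bar> * ((cmod (c (n + -2) s))\<^sup>2 + (cmod (c (n + -1) s))\<^sup>2 + (cmod (c (n + 0) s))\<^sup>2 + (cmod (c (n + 1) s))\<^sup>2))"
        using n by (intro mult_mono b'_le osc_le_osc_max osc_max_nonneg) (auto simp: I_def)
      finally show "\<bar>(w n - w (n - 1)) * Im (osc k R n s * b' n s)\<bar> \<le> \<bar>w n - w (n - 1)\<bar> * (osc_max k R M s * (\<bar>q s\<bar> * ((cmod (c (n + -2) s))\<^sup>2 + (cmod (c (n + -1) s))\<^sup>2 + (cmod (c (n + 0) s))\<^sup>2 + (cmod (c (n + 1) s))\<^sup>2)))"
        unfolding abs_mult by (rule mult_left_mono) simp
    qed
    also have "\<dots> = (\<bar>q s\<bar> * osc_max k R M s) * ((\<Sum>n\<in>I. \<bar>w n - w (n - 1)\<bar> * (cmod (c (n + -2) s))\<^sup>2) + (\<Sum>n\<in>I. \<bar>w n - w (n - 1)\<bar> * (cmod (c (n + -1) s))\<^sup>2)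
        + (\<Sum>n\<in>I. \<bar>w n - w (n - 1)\<bar> * (cmod (c (n + 0) s))\<^sup>2) + (\<Sum>n\<in>I. \<bar>w n - w (n - 1)\<bar> * (cmod (c (n + 1) s))\<^sup>2))"
      unfolding sum.distrib[symmetric] sum_distrib_left by (rule sum.cong) (simp_all only: distrib_left mult_ac)
    also have "\<dots> \<le> (\<bar>q s\<bar> * osc_max k R M s) * (D * (2 * X ^ (m - 1)) + D * (2 * X ^ (m - 1)) + D * (2 * X ^ (m - 1)) + D * (2 * X ^ (m - 1)))"
      unfolding I_def w_def D_def
      by (intro mult_left_mono add_mono sum_weighted_shift_le[OF sys s0' m X Es] mult_nonneg_nonneg osc_max_nonneg) auto
    finally have "\<bar>\<Sum>n\<in>I. (w n - w (n - 1)) * Im (osc k R n s * b' n s)\<bar> \<le> 8 * D * X ^ (m - 1) * (\<bar>q s\<bar> * osc_max k R M s)"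
      by (simp add: mult_ac)
    then show "cmod (complex_of_real (- (\<Sum>n\<in>I. (w n - w (n - 1)) * Im (osc k R n s * b' n s)))) \<le> 8 * D * X ^ (m - 1) * (\<bar>q s\<bar> * osc_max k R M s)"
      by (simp only: norm_of_real abs_minus_cancel)
  qed
  also have "\<dots> = 8 * D * X ^ (m - 1) * (LINT s:{T0..s0}|lborel. \<bar>q s\<bar> * osc_max k R M s)"
    by (simp only: set_integral_mult_right)
  also have "\<dots> \<le> 8 * D * X ^ (m - 1) * B"
  proof (rule mult_left_mono)
    show "(LINT s:{T0..s0}|lborel. \<bar>q s\<bar> * osc_max k R M s) \<le> B"
      unfolding B_def osc_int_def set_lebesgue_integral_def
      using set_integrable_subinterval[OF osc_max_integrable[OF T0, of R k M], of T0 s0] osc_max_integrable[OF T0, of R k M] s0(1) osc_max_nonneg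
      by (intro integral_mono) (auto simp: set_integrable_def indicator_def)
  qed (use D X in simp)
  finally have "\<bar>G s0 - G T0\<bar> \<le> 8 * D * X ^ (m - 1) * B" by (simp flip: of_real_diff)
  moreover have "\<bar>Im (H s0)\<bar> \<le> 2 * D * X ^ (m - 1) * (1 + B)" "\<bar>Im (H T0)\<bar> \<le> 2 * D * X ^ (m - 1) * (1 + B)"
    using H_le[OF s0(1)] H_le[of T0] T0R abs_Im_le_cmod[of "H s0"] abs_Im_le_cmod[of "H T0"] by auto
  moreover have "X ^ m = penergy M m c T0 + (G s0 - G T0) + Im (H s0) - Im (H T0)"
    unfolding s0(3) G_def by simp
  ultimately have "X ^ m \<le> penergy M m c T0 + 8 * D * X ^ (m - 1) * B + 4 * D * X ^ (m - 1) * (1 + B)"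
    by linarith
  also have "\<dots> \<le> e ^ m + 8 * D * X ^ (m - 1) * (1 + B) + 4 * D * X ^ (m - 1) * (1 + B)"
    using e D X by (intro add_mono mult_left_mono) auto
  also have "\<dots> = e ^ m + (12 * D * (1 + B)) * X ^ (m - 1)" by (simp add: algebra_simps)
  finally have "X \<le> e + 12 * D * (1 + B)"
    by (rule power_le_plus_mult_imp_le) (use m e X D B in auto)
  then have "X ^ m \<le> (e + 12 * D * (1 + B)) ^ m" using X by (intro power_mono) auto
  then show ?thesis using s0(4)[of t] t by (simp add: D_def B_def mult.assoc)
qed

end

section \<open>The Cauchy kernel\<close>

text \<open>The normalization \<open>K\<^sub>y(0) = 1\<close> makes \<open>K\<^sub>y\<close> increase to \<open>1\<close> as \<open>y \<rightarrow> \<infinity>\<close>, so that weighted integrals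
  recover integrals over the line.\<close>

definition cauchy_kernel :: "real \<Rightarrow> real \<Rightarrow> real" where
  "cauchy_kernel y k = y\<^sup>2 / (y\<^sup>2 + k\<^sup>2)"

lemma cauchy_kernel_nonneg: "0 \<le> cauchy_kernel y k"
  by (simp add: cauchy_kernel_def)

lemma cauchy_kernel_measurable [measurable]: "cauchy_kernel y \<in> borel_measurable borel"
  unfolding cauchy_kernel_def[abs_def] by measurable

lemma cauchy_kernel_integrable:
  assumes "y > 0"
  shows "integrable lborel (cauchy_kernel y)"
proof -
  have "integrable lborel (\<lambda>x::real. inverse (1 + x\<^sup>2))"
    using integrable_inverse_1_plus_square by (simp add: set_integrable_def)
  from lborel_integrable_real_affine[OF this, of "1 / y" 0]
  have "integrable lborel (\<lambda>x::real. inverse (1 + (x / y)\<^sup>2))" using assms by simp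
  moreover have "inverse (1 + (x / y)\<^sup>2) = cauchy_kernel y x" for x
    using assms by (simp add: cauchy_kernel_def power_divide divide_simps)
  ultimately show ?thesis by (simp add: cauchy_kernel_def[abs_def])
qed

lemma measurable_cis' [measurable]: "cis \<in> borel_measurable borel"
  by (intro borel_measurable_continuous_onI continuous_intros)

lemma exp_half_line_integral:
  assumes y: "y > 0"
  shows "set_integrable lborel {0<..} (\<lambda>x. of_real (exp (- y * x)) * cis (k * x))"
    and "(LINT x:{0<..}|lborel. of_real (exp (- y * x)) * cis (k * x)) = 1 / (y - \<i> * k)"
proof -
  define f where "f x = of_real (exp (- y * x)) * cis (k * x)" for x
  have fexp: "f x = exp (- (y - \<i> * k) * of_real x)" for x
    by (simp add: f_def cis_conv_exp exp_of_real[symmetric] mult_exp_exp algebra_simps)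
  have [measurable]: "f \<in> borel_measurable borel" unfolding f_def by measurable
  have i0: "set_integrable lborel {0<..} (\<lambda>x. exp (- (x * y)))" by (rule integrable_I0i_exp_mscale[OF y])
  show int: "set_integrable lborel {0<..} (\<lambda>x. of_real (exp (- y * x)) * cis (k * x))"
    unfolding f_def[symmetric] using i0 unfolding set_integrable_def
    by (rule Bochner_Integration.integrable_bound) (auto simp: f_def norm_mult indicator_def mult.commute)
  have nz: "complex_of_real y - \<i> * complex_of_real k \<noteq> 0" using y by (simp add: complex_eq_iff)
  define F where "F x = - f x / (y - \<i> * k)" for x
  have dF: "(F has_vector_derivative f x) (at x)" for x
  proof -
    have "((\<lambda>z. - exp (- (y - \<i> * k) * z) / (y - \<i> * k)) has_field_derivative exp (- (y - \<i> * k) * of_real x)) (at (of_real x))"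
      using nz by (auto intro!: derivative_eq_intros simp: divide_simps) (simp_all add: algebra_simps)
    from has_vector_derivative_real_field[OF this] show ?thesis unfolding F_def fexp by simp
  qed
  have "continuous_on UNIV f" unfolding f_def by (intro continuous_intros)
  then have cf: "isCont f x" for x by (simp add: continuous_on_eq_continuous_at)
  have cF: "isCont F x" for x using dF has_vector_derivative_continuous by blast
  have lim0: "((F \<circ> real_of_ereal) \<longlongrightarrow> F 0) (at_right 0)"
    unfolding zero_ereal_def ereal_tendsto_simps1 using cF[of 0] by (simp add: isCont_def filterlim_at_split)
  have lim1: "((F \<circ> real_of_ereal) \<longlongrightarrow> 0) (at_left \<infinity>)"
    unfolding ereal_tendsto_simps1
  proof (rule Lim_null_comparison)
    show "\<forall>\<^sub>F x in at_top. norm (F x) \<le> exp (- y * x) / cmod (y - \<i> * k)"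
      by (intro always_eventually) (auto simp: F_def f_def norm_mult norm_divide)
    have "((\<lambda>x. exp (- y * x)) \<longlongrightarrow> 0) at_top" using y by real_asymp
    then show "((\<lambda>x. exp (- y * x) / cmod (y - \<i> * k)) \<longlongrightarrow> 0) at_top"
      by (rule tendsto_divide_zero)
  qed
  have "(LBINT x=0..\<infinity>. f x) = 0 - F 0"
    by (rule interval_integral_FTC_integrable[OF _ dF cf _ lim0 lim1])
      (use int in \<open>simp_all add: f_def[abs_def] zero_ereal_def einterval_eq_Ici\<close>)
  then show "(LINT x:{0<..}|lborel. of_real (exp (- y * x)) * cis (k * x)) = 1 / (y - \<i> * k)"
    by (simp add: interval_lebesgue_integral_0_infty f_def F_def)
qed

lemma laplace_fourier:
  assumes y: "y > 0"
  shows "integrable lborel (\<lambda>x. complex_of_real (exp (- y * \<bar>x\<bar>)) * cis (k * x))"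
    and "(LINT x|lborel. complex_of_real (exp (- y * \<bar>x\<bar>)) * cis (k * x)) = of_real (2 / y * cauchy_kernel y k)"
proof -
  define f where "f j x = indicator {0<..} x *\<^sub>R (of_real (exp (- y * x)) * cis (j * x))" for j x :: real
  have f: "integrable lborel (f j)" "(LINT x|lborel. f j x) = 1 / (y - \<i> * j)" for j
    using exp_half_line_integral[OF y, of j] by (simp_all add: f_def[abs_def] set_integrable_def set_lebesgue_integral_def)
  have g: "integrable lborel (\<lambda>x. f (- k) (0 + (-1) * x))"
    by (rule lborel_integrable_real_affine[OF f(1)]) simp
  have gi: "(LINT x|lborel. f (- k) (0 + (-1) * x)) = 1 / (y - \<i> * of_real (- k))"
    using lborel_integral_real_affine[of "-1" "f (- k)" 0] f(2)[of "- k"] by simp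
  have s: "integrable lborel (\<lambda>x. f k x + f (- k) (0 + (-1) * x))"
    by (rule Bochner_Integration.integrable_add[OF f(1) g])
  have AE: "AE x in lborel. f k x + f (- k) (0 + (-1) * x) = complex_of_real (exp (- y * \<bar>x\<bar>)) * cis (k * x)"
    using AE_lborel_singleton[of 0] by (rule eventually_mono) (auto simp: f_def indicator_def)
  have m: "(\<lambda>x. complex_of_real (exp (- y * \<bar>x\<bar>)) * cis (k * x)) \<in> borel_measurable lborel" by measurable
  have [measurable]: "f j \<in> borel_measurable borel" for j unfolding f_def[abs_def] by measurable
  show "integrable lborel (\<lambda>x. complex_of_real (exp (- y * \<bar>x\<bar>)) * cis (k * x))"
    by (rule integrable_cong_AE_imp[OF s m]) (use AE in \<open>auto elim: eventually_mono\<close>)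
  have "(LINT x|lborel. complex_of_real (exp (- y * \<bar>x\<bar>)) * cis (k * x)) = (LINT x|lborel. f k x + f (- k) (0 + (-1) * x))"
    by (rule integral_cong_AE[OF m]) (measurable, use AE in \<open>auto elim: eventually_mono\<close>)
  also have "\<dots> = 1 / (y - \<i> * of_real k) + 1 / (y - \<i> * of_real (- k))"
    unfolding Bochner_Integration.integral_add[OF f(1) g] f(2) gi ..
  also have "\<dots> = of_real (2 / y * cauchy_kernel y k)"
  proof -
    have nz: "complex_of_real y - \<i> * complex_of_real k \<noteq> 0" "complex_of_real y + \<i> * complex_of_real k \<noteq> 0"
      using y by (auto simp: complex_eq_iff)
    have pos: "y\<^sup>2 + k\<^sup>2 \<noteq> 0" using y by (simp add: add_pos_nonneg less_imp_neq[symmetric] sum_power2_eq_zero_iff)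
    have prod: "(complex_of_real y - \<i> * complex_of_real k) * (complex_of_real y + \<i> * complex_of_real k) = of_real (y\<^sup>2 + k\<^sup>2)"
      by (simp add: algebra_simps power2_eq_square)
    have "1 / (y - \<i> * of_real k) + 1 / (y - \<i> * of_real (- k)) = 2 * of_real y / of_real (y\<^sup>2 + k\<^sup>2)"
      unfolding prod[symmetric] using nz by (simp add: divide_simps)
    also have "\<dots> = of_real (2 * y / (y\<^sup>2 + k\<^sup>2))" by simp
    also have "2 * y / (y\<^sup>2 + k\<^sup>2) = 2 / y * cauchy_kernel y k"
      using y pos by (simp add: cauchy_kernel_def power2_eq_square)
    finally show ?thesis .
  qed
  finally show "(LINT x|lborel. complex_of_real (exp (- y * \<bar>x\<bar>)) * cis (k * x)) = of_real (2 / y * cauchy_kernel y k)" .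
qed

lemma gaussian_fourier:
  assumes "\<epsilon> > 0"
  shows "integrable lborel (\<lambda>k. exp (- ((\<epsilon> * k)\<^sup>2) / 2))"
    and "(LINT k|lborel. cis (s * k) * of_real (exp (- ((\<epsilon> * k)\<^sup>2) / 2)))
      = of_real (sqrt (2 * pi) / \<epsilon> * exp (- ((s / \<epsilon>)\<^sup>2) / 2))"
proof -
  have std: "std_normal_density x = exp (- x\<^sup>2 / 2) / sqrt (2 * pi)" for x
    by (simp add: std_normal_density_def)
  have "integrable lborel std_normal_density" by (simp add: integrable_normal_density)
  then have "integrable lborel (\<lambda>x. sqrt (2 * pi) * std_normal_density x)" by (rule integrable_mult_right)
  then have i1: "integrable lborel (\<lambda>x::real. exp (- (x\<^sup>2) / 2))" by (simp add: std)
  from lborel_integrable_real_affine[OF this, of \<epsilon> 0]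
  show "integrable lborel (\<lambda>k. exp (- ((\<epsilon> * k)\<^sup>2) / 2))" using assms by simp
  have "char std_normal_distribution u = (LINT x|lborel. std_normal_density x *\<^sub>R cis (u * x))" for u
    unfolding char_def by (subst integral_density) (auto simp: normal_density_nonneg cis_conv_exp)
  then have ch: "(LINT x|lborel. std_normal_density x *\<^sub>R cis (u * x)) = of_real (exp (- (u\<^sup>2) / 2))" for u
    by (simp add: char_std_normal_distribution)
  have "(LINT k|lborel. cis (s * k) * of_real (exp (- ((\<epsilon> * k)\<^sup>2) / 2)))
     = \<bar>1 / \<epsilon>\<bar> *\<^sub>R (LINT k|lborel. cis (s * (0 + (1 / \<epsilon>) * k)) * of_real (exp (- ((\<epsilon> * (0 + (1 / \<epsilon>) * k))\<^sup>2) / 2)))"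
    using assms by (intro lborel_integral_real_affine) simp
  also have "\<dots> = (1 / \<epsilon>) *\<^sub>R (LINT k|lborel. sqrt (2 * pi) *\<^sub>R (std_normal_density k *\<^sub>R cis ((s / \<epsilon>) * k)))"
    using assms by (simp add: std scaleR_conv_of_real mult_ac)
  also have "\<dots> = of_real (sqrt (2 * pi) / \<epsilon> * exp (- ((s / \<epsilon>)\<^sup>2) / 2))"
    by (simp only: integral_scaleR_right ch) (simp add: scaleR_conv_of_real)
  finally show "(LINT k|lborel. cis (s * k) * of_real (exp (- ((\<epsilon> * k)\<^sup>2) / 2)))
      = of_real (sqrt (2 * pi) / \<epsilon> * exp (- ((s / \<epsilon>)\<^sup>2) / 2))" .
qed

text \<open>The kernel is a multiple of the Fourier transform of \<open>e\<^sup>-\<^sup>y\<^sup>|\<^sup>x\<^sup>|\<close>.  The Gaussian factor makes the double integral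
  absolutely convergent, so that Fubini's theorem inverts the transform.\<close>

lemma gaussian_regularized_inversion:
  assumes y: "y > 0" and \<epsilon>: "\<epsilon> > 0"
  shows "(LINT k|lborel. cis (- l * k) * of_real (2 / y * cauchy_kernel y k) * of_real (exp (- ((\<epsilon> * k)\<^sup>2) / 2)))
    = of_real (sqrt (2 * pi) * (LINT w|lborel. exp (- y * \<bar>l + \<epsilon> * w\<bar>) * exp (- (w\<^sup>2) / 2)))"
proof -
  define G where "G k = exp (- ((\<epsilon> * k)\<^sup>2) / 2)" for k
  define E where "E x = exp (- y * \<bar>x\<bar>)" for x
  have [measurable]: "G \<in> borel_measurable borel" "E \<in> borel_measurable borel"
    unfolding G_def[abs_def] E_def[abs_def] by measurable
  have iG: "integrable lborel G" unfolding G_def[abs_def] by (rule gaussian_fourier(1)[OF \<epsilon>])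
  have iE: "integrable lborel E"
    using laplace_fourier(1)[OF y, of 0] by (simp add: E_def[abs_def] complex_of_real_integrable_eq)
  define H where "H k x = cis ((x - l) * k) * of_real (E x) * of_real (G k)" for k x
  have G0: "G k \<ge> 0" and E0: "E x \<ge> 0" for k x by (auto simp: G_def E_def)
  have H: "integrable (lborel \<Otimes>\<^sub>M lborel) (\<lambda>(k, x). H k x)"
  proof (rule lborel_pair.Fubini_integrable)
    show "(\<lambda>(k, x). H k x) \<in> borel_measurable (lborel \<Otimes>\<^sub>M lborel)"
      unfolding H_def split_beta' by measurable
    have "(LINT x|lborel. norm (case (k, x) of (k, x) \<Rightarrow> H k x)) = G k * (LINT x|lborel. E x)" for k
      using G0 E0 by (simp add: H_def norm_mult mult.commute)
    then show "integrable lborel (\<lambda>k. LINT x|lborel. norm (case (k, x) of (k, x) \<Rightarrow> H k x))"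
      using iG by simp
    have "integrable lborel (H k)" for k
    proof (rule Bochner_Integration.integrable_bound[OF integrable_mult_left[OF iE, of "G k"]])
      show "H k \<in> borel_measurable lborel" unfolding H_def[abs_def] by measurable
      show "AE x in lborel. norm (H k x) \<le> norm (E x * G k)" using E0 G0 by (simp add: H_def norm_mult)
    qed
    then show "AE k in lborel. integrable lborel (\<lambda>x. case (k, x) of (k, x) \<Rightarrow> H k x)" by simp
  qed
  have inner: "(LINT k|lborel. H k x) = of_real (sqrt (2 * pi) / \<epsilon> * (E x * exp (- (((x - l) / \<epsilon>)\<^sup>2) / 2)))" for x
  proof -
    have "(LINT k|lborel. H k x) = of_real (E x) * (LINT k|lborel. cis ((x - l) * k) * of_real (G k))"
      unfolding H_def by (subst integral_mult_right_zero[symmetric]) (simp add: mult_ac)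
    then show ?thesis unfolding G_def gaussian_fourier(2)[OF \<epsilon>] by simp
  qed
  have outer: "(LINT x|lborel. H k x) = cis (- l * k) * of_real (2 / y * cauchy_kernel y k) * of_real (G k)" for k
  proof -
    have "H k x = (cis (- l * k) * of_real (G k)) * (of_real (E x) * cis (k * x))" for x
    proof -
      have "cis ((x - l) * k) = cis (- l * k) * cis (k * x)" by (simp add: cis_mult algebra_simps)
      then show ?thesis by (simp add: H_def mult_ac)
    qed
    then have "(LINT x|lborel. H k x) = (cis (- l * k) * of_real (G k)) * (LINT x|lborel. of_real (E x) * cis (k * x))"
      by simp
    then show ?thesis
      unfolding E_def laplace_fourier(2)[OF y] by (simp add: mult_ac)
  qed
  have shift: "(LINT x|lborel. E x * exp (- (((x - l) / \<epsilon>)\<^sup>2) / 2)) = \<epsilon> * (LINT w|lborel. E (l + \<epsilon> * w) * exp (- (w\<^sup>2) / 2))"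
    using lborel_integral_real_affine[of \<epsilon> "\<lambda>x. E x * exp (- (((x - l) / \<epsilon>)\<^sup>2) / 2)" l] \<epsilon> by simp
  have "(LINT k|lborel. cis (- l * k) * of_real (2 / y * cauchy_kernel y k) * of_real (G k))
      = (LINT x|lborel. LINT k|lborel. H k x)"
    unfolding outer[symmetric] by (rule lborel_pair.Fubini_integral[OF H, symmetric])
  also have "\<dots> = of_real (sqrt (2 * pi) / \<epsilon> * (LINT x|lborel. E x * exp (- (((x - l) / \<epsilon>)\<^sup>2) / 2)))"
    unfolding inner by (simp only: integral_complex_of_real integral_mult_right_zero)
  finally show ?thesis using \<epsilon> unfolding shift by (simp add: G_def E_def)
qed

text \<open>Removal of the Gaussian by dominated convergence on both sides.\<close>

theorem cauchy_kernel_fourier: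
  assumes y: "y > 0"
  shows "(LINT k|lborel. cis (- l * k) * of_real (cauchy_kernel y k)) = of_real (pi * y * exp (- y * \<bar>l\<bar>))"
proof -
  define \<epsilon> where "\<epsilon> j = 1 / real (Suc j)" for j
  have eps: "\<epsilon> j > 0" for j by (simp add: \<epsilon>_def)
  have eps0: "\<epsilon> \<longlonglongrightarrow> 0" unfolding \<epsilon>_def by (rule LIMSEQ_Suc[OF lim_1_over_n])
  have iK: "integrable lborel (\<lambda>k. 2 / y * cauchy_kernel y k)"
    by (rule integrable_mult_right[OF cauchy_kernel_integrable[OF y]])
  have L: "(\<lambda>j. LINT k|lborel. cis (- l * k) * of_real (2 / y * cauchy_kernel y k) * of_real (exp (- ((\<epsilon> j * k)\<^sup>2) / 2)))
      \<longlonglongrightarrow> (LINT k|lborel. cis (- l * k) * of_real (2 / y * cauchy_kernel y k))"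
  proof (rule integral_dominated_convergence[OF _ _ iK])
    show "AE k in lborel. (\<lambda>j. cis (- l * k) * of_real (2 / y * cauchy_kernel y k) * complex_of_real (exp (- ((\<epsilon> j * k)\<^sup>2) / 2)))
        \<longlonglongrightarrow> cis (- l * k) * of_real (2 / y * cauchy_kernel y k)"
    proof (rule AE_I2)
      fix k
      have "(\<lambda>j. complex_of_real (exp (- ((\<epsilon> j * k)\<^sup>2) / 2))) \<longlonglongrightarrow> complex_of_real (exp (- ((0 * k)\<^sup>2) / 2))"
        by (intro tendsto_intros eps0) simp
      then have "(\<lambda>j. complex_of_real (exp (- ((\<epsilon> j * k)\<^sup>2) / 2))) \<longlonglongrightarrow> 1" by simp
      from tendsto_mult[OF tendsto_const[of "cis (- l * k) * of_real (2 / y * cauchy_kernel y k)"] this]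
      show "(\<lambda>j. cis (- l * k) * of_real (2 / y * cauchy_kernel y k) * complex_of_real (exp (- ((\<epsilon> j * k)\<^sup>2) / 2)))
        \<longlonglongrightarrow> cis (- l * k) * of_real (2 / y * cauchy_kernel y k)" by (simp only: mult_1_right)
    qed
    show "AE k in lborel. norm (cis (- l * k) * of_real (2 / y * cauchy_kernel y k) * complex_of_real (exp (- ((\<epsilon> j * k)\<^sup>2) / 2)))
        \<le> 2 / y * cauchy_kernel y k" for j
    proof (rule AE_I2)
      fix k
      have a: "0 \<le> 2 / y * cauchy_kernel y k" using y cauchy_kernel_nonneg[of y k] by simp
      have "norm (cis (- l * k) * of_real (2 / y * cauchy_kernel y k) * complex_of_real (exp (- ((\<epsilon> j * k)\<^sup>2) / 2)))
          = 2 / y * cauchy_kernel y k * exp (- ((\<epsilon> j * k)\<^sup>2) / 2)"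
        using a by (simp only: norm_mult norm_cis norm_of_real abs_of_nonneg[OF a] abs_exp_cancel mult_1)
      also have "\<dots> \<le> 2 / y * cauchy_kernel y k" by (rule mult_left_le[OF _ a]) simp
      finally show "norm (cis (- l * k) * of_real (2 / y * cauchy_kernel y k) * complex_of_real (exp (- ((\<epsilon> j * k)\<^sup>2) / 2)))
          \<le> 2 / y * cauchy_kernel y k" .
    qed
  qed measurable
  have i1: "integrable lborel (\<lambda>x::real. exp (- (x\<^sup>2) / 2))"
    using gaussian_fourier(1)[of 1] by simp
  have gint: "(LINT w|lborel. exp (- (w\<^sup>2) / 2)) = sqrt (2 * pi)"
  proof -
    have "complex_of_real (LINT w|lborel. exp (- (w\<^sup>2) / 2)) = complex_of_real (sqrt (2 * pi))"
      using gaussian_fourier(2)[of 1 0] by simp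
    then show ?thesis by (simp only: of_real_eq_iff)
  qed
  have R: "(\<lambda>j. LINT w|lborel. exp (- y * \<bar>l + \<epsilon> j * w\<bar>) * exp (- (w\<^sup>2) / 2))
      \<longlonglongrightarrow> (LINT w|lborel. exp (- y * \<bar>l\<bar>) * exp (- (w\<^sup>2) / 2))"
  proof (rule integral_dominated_convergence[OF _ _ i1])
    show "AE w in lborel. (\<lambda>j. exp (- y * \<bar>l + \<epsilon> j * w\<bar>) * exp (- (w\<^sup>2) / 2)) \<longlonglongrightarrow> exp (- y * \<bar>l\<bar>) * exp (- (w\<^sup>2) / 2)"
    proof (rule AE_I2)
      fix w
      have "(\<lambda>j. exp (- y * \<bar>l + \<epsilon> j * w\<bar>) * exp (- (w\<^sup>2) / 2)) \<longlonglongrightarrow> exp (- y * \<bar>l + 0 * w\<bar>) * exp (- (w\<^sup>2) / 2)"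
        by (intro tendsto_intros eps0)
      then show "(\<lambda>j. exp (- y * \<bar>l + \<epsilon> j * w\<bar>) * exp (- (w\<^sup>2) / 2)) \<longlonglongrightarrow> exp (- y * \<bar>l\<bar>) * exp (- (w\<^sup>2) / 2)"
        by simp
    qed
    show "AE w in lborel. norm (exp (- y * \<bar>l + \<epsilon> j * w\<bar>) * exp (- (w\<^sup>2) / 2)) \<le> exp (- (w\<^sup>2) / 2)" for j
      using y by (intro AE_I2) (simp add: mult_left_le_one_le)
  qed measurable
  have "(\<lambda>j. complex_of_real (sqrt (2 * pi) * (LINT w|lborel. exp (- y * \<bar>l + \<epsilon> j * w\<bar>) * exp (- (w\<^sup>2) / 2))))
      \<longlonglongrightarrow> of_real (sqrt (2 * pi) * (exp (- y * \<bar>l\<bar>) * sqrt (2 * pi)))"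
    by (intro tendsto_intros R[unfolded integral_mult_right_zero gint])
  then have "(LINT k|lborel. cis (- l * k) * of_real (2 / y * cauchy_kernel y k)) = of_real (sqrt (2 * pi) * (exp (- y * \<bar>l\<bar>) * sqrt (2 * pi)))"
    using L unfolding gaussian_regularized_inversion[OF y eps] by (rule LIMSEQ_unique[rotated])
  also have "sqrt (2 * pi) * (exp (- y * \<bar>l\<bar>) * sqrt (2 * pi)) = 2 * pi * exp (- y * \<bar>l\<bar>)"
    using real_sqrt_mult_self[of "2 * pi"] by (simp add: mult_ac)
  finally have "(LINT k|lborel. cis (- l * k) * of_real (2 / y * cauchy_kernel y k)) = of_real (2 * pi * exp (- y * \<bar>l\<bar>))" .
  moreover have "cis (- l * k) * of_real (2 / y * cauchy_kernel y k) = of_real (2 / y) * (cis (- l * k) * of_real (cauchy_kernel y k))" for k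
    by simp
  ultimately have "of_real (2 / y) * (LINT k|lborel. cis (- l * k) * of_real (cauchy_kernel y k)) = of_real (2 * pi * exp (- y * \<bar>l\<bar>))"
    by (simp only: integral_mult_right_zero)
  then show ?thesis using y by (simp add: field_simps)
qed

section \<open>Plancherel's inequality\<close>

lemma exp_abs_nn_integral:
  assumes y: "y > 0"
  shows "(\<integral>\<^sup>+s. ennreal (exp (- y * \<bar>\<tau> - s\<bar>)) \<partial>lborel) = ennreal (2 / y)"
proof -
  have i: "integrable lborel (\<lambda>x. exp (- y * \<bar>x\<bar>))"
    using laplace_fourier(1)[OF y, of 0] by (simp add: complex_of_real_integrable_eq)
  have "cauchy_kernel y 0 = 1" using y by (simp add: cauchy_kernel_def)
  then have "complex_of_real (LINT x|lborel. exp (- y * \<bar>x\<bar>)) = complex_of_real (2 / y)"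
    using laplace_fourier(2)[OF y, of 0] by simp
  then have v: "(LINT x|lborel. exp (- y * \<bar>x\<bar>)) = 2 / y" by (simp only: of_real_eq_iff)
  have "(\<integral>\<^sup>+x. ennreal (exp (- y * \<bar>x\<bar>)) \<partial>lborel) = ennreal \<bar>-1\<bar> * (\<integral>\<^sup>+s. ennreal (exp (- y * \<bar>\<tau> + (-1) * s\<bar>)) \<partial>lborel)"
    by (rule nn_integral_real_affine) auto
  also have "(\<integral>\<^sup>+x. ennreal (exp (- y * \<bar>x\<bar>)) \<partial>lborel) = ennreal (2 / y)"
    using nn_integral_eq_integral[OF i] unfolding v by simp
  finally show ?thesis by simp
qed

text \<open>Schur's test: \<open>f(\<tau>) f(s) \<le> (f(\<tau>)\<^sup>2 + f(s)\<^sup>2) / 2\<close>, and the kernel has integral \<open>2/y\<close> in each variable.\<close>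

lemma exp_kernel_quadratic_form_le:
  assumes y: "y > 0" and [measurable]: "f \<in> borel_measurable borel" and f0: "\<And>s. f s \<ge> 0"
  shows "(\<integral>\<^sup>+\<tau>. \<integral>\<^sup>+s. ennreal (f \<tau> * f s * exp (- y * \<bar>\<tau> - s\<bar>)) \<partial>lborel \<partial>lborel)
    \<le> ennreal (2 / y) * (\<integral>\<^sup>+s. ennreal ((f s)\<^sup>2) \<partial>lborel)"
proof -
  define g where "g \<tau> s = ennreal ((f \<tau>)\<^sup>2 / 2) * ennreal (exp (- y * \<bar>\<tau> - s\<bar>))" for \<tau> s
  have [measurable]: "(\<lambda>(\<tau>, s). g \<tau> s) \<in> borel_measurable (lborel \<Otimes>\<^sub>M lborel)"
    "(\<lambda>(\<tau>, s). g s \<tau>) \<in> borel_measurable (lborel \<Otimes>\<^sub>M lborel)"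
    unfolding g_def by measurable
  have mg: "(\<lambda>s. g \<tau> s) \<in> borel_measurable lborel" "(\<lambda>s. g s \<tau>) \<in> borel_measurable lborel" for \<tau>
    unfolding g_def by measurable
  have G: "(\<integral>\<^sup>+\<tau>. \<integral>\<^sup>+s. g \<tau> s \<partial>lborel \<partial>lborel) = ennreal (2 / y) * (\<integral>\<^sup>+\<tau>. ennreal ((f \<tau>)\<^sup>2 / 2) \<partial>lborel)"
  proof -
    have "(\<integral>\<^sup>+s. g \<tau> s \<partial>lborel) = ennreal (2 / y) * ennreal ((f \<tau>)\<^sup>2 / 2)" for \<tau>
    proof -
      have "(\<integral>\<^sup>+s. g \<tau> s \<partial>lborel) = ennreal ((f \<tau>)\<^sup>2 / 2) * (\<integral>\<^sup>+s. ennreal (exp (- y * \<bar>\<tau> - s\<bar>)) \<partial>lborel)"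
        unfolding g_def by (rule nn_integral_cmult) measurable
      then show ?thesis by (simp only: exp_abs_nn_integral[OF y] mult.commute)
    qed
    then show ?thesis by (simp add: nn_integral_cmult)
  qed
  have swap: "(\<integral>\<^sup>+\<tau>. \<integral>\<^sup>+s. g s \<tau> \<partial>lborel \<partial>lborel) = (\<integral>\<^sup>+\<tau>. \<integral>\<^sup>+s. g \<tau> s \<partial>lborel \<partial>lborel)"
    by (rule lborel_pair.Fubini') measurable
  have half: "(\<integral>\<^sup>+\<tau>. ennreal ((f \<tau>)\<^sup>2 / 2) \<partial>lborel) + (\<integral>\<^sup>+\<tau>. ennreal ((f \<tau>)\<^sup>2 / 2) \<partial>lborel) = (\<integral>\<^sup>+\<tau>. ennreal ((f \<tau>)\<^sup>2) \<partial>lborel)"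
    by (subst nn_integral_add[symmetric]) (auto simp flip: ennreal_plus)
  have "(\<integral>\<^sup>+\<tau>. \<integral>\<^sup>+s. ennreal (f \<tau> * f s * exp (- y * \<bar>\<tau> - s\<bar>)) \<partial>lborel \<partial>lborel)
      \<le> (\<integral>\<^sup>+\<tau>. \<integral>\<^sup>+s. g \<tau> s + g s \<tau> \<partial>lborel \<partial>lborel)"
  proof (intro nn_integral_mono)
    fix \<tau> s
    have "2 * f \<tau> * f s \<le> (f \<tau>)\<^sup>2 + (f s)\<^sup>2" by (rule sum_squares_bound)
    then have "f \<tau> * f s * exp (- y * \<bar>\<tau> - s\<bar>) \<le> ((f \<tau>)\<^sup>2 / 2 + (f s)\<^sup>2 / 2) * exp (- y * \<bar>\<tau> - s\<bar>)"
      by (intro mult_right_mono) auto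
    then have "ennreal (f \<tau> * f s * exp (- y * \<bar>\<tau> - s\<bar>)) \<le> ennreal ((f \<tau>)\<^sup>2 / 2 * exp (- y * \<bar>\<tau> - s\<bar>) + (f s)\<^sup>2 / 2 * exp (- y * \<bar>\<tau> - s\<bar>))"
      by (intro ennreal_leI) (simp add: distrib_right)
    also have "\<dots> = g \<tau> s + g s \<tau>"
      by (simp add: g_def abs_minus_commute[of s \<tau>] flip: ennreal_mult ennreal_plus)
    finally show "ennreal (f \<tau> * f s * exp (- y * \<bar>\<tau> - s\<bar>)) \<le> g \<tau> s + g s \<tau>" .
  qed
  also have "\<dots> = (\<integral>\<^sup>+\<tau>. (\<integral>\<^sup>+s. g \<tau> s \<partial>lborel) + (\<integral>\<^sup>+s. g s \<tau> \<partial>lborel) \<partial>lborel)"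
    by (simp add: nn_integral_add mg)
  also have "\<dots> = (\<integral>\<^sup>+\<tau>. \<integral>\<^sup>+s. g \<tau> s \<partial>lborel \<partial>lborel) + (\<integral>\<^sup>+\<tau>. \<integral>\<^sup>+s. g s \<tau> \<partial>lborel \<partial>lborel)"
    by (rule nn_integral_add) measurable
  also have "\<dots> = ennreal (2 / y) * (\<integral>\<^sup>+s. ennreal ((f s)\<^sup>2) \<partial>lborel)"
    unfolding swap G half[symmetric] by (simp add: distrib_left)
  finally show ?thesis .
qed

lemma fourier_swap:
  fixes f g :: "real \<Rightarrow> complex" and K :: "real \<Rightarrow> real"
  assumes f: "integrable lborel f" and K: "integrable lborel K"
    and [measurable]: "g \<in> borel_measurable borel" and g: "\<And>\<omega>. cmod (g \<omega>) \<le> B"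
  shows "(LINT \<omega>|lborel. (LINT s|lborel. f s * cis (\<omega> * s)) * g \<omega> * of_real (K \<omega>))
    = (LINT s|lborel. f s * (LINT \<omega>|lborel. cis (\<omega> * s) * g \<omega> * of_real (K \<omega>)))"
proof -
  have [measurable]: "f \<in> borel_measurable borel" "K \<in> borel_measurable borel"
    using f K by (auto dest: borel_measurable_integrable)
  have B: "B \<ge> 0" using g[of 0] norm_ge_zero order_trans by blast
  define H where "H s \<omega> = f s * cis (\<omega> * s) * g \<omega> * of_real (K \<omega>)" for s \<omega>
  have gK: "integrable lborel (\<lambda>\<omega>. g \<omega> * of_real (K \<omega>))"
    using integrable_mult_right[OF K, of B]
    by (rule Bochner_Integration.integrable_bound) (use g B in \<open>auto simp: norm_mult abs_mult intro!: mult_right_mono\<close>)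
  have H: "integrable (lborel \<Otimes>\<^sub>M lborel) (\<lambda>(s, \<omega>). H s \<omega>)"
  proof (rule lborel_pair.Fubini_integrable)
    show "(\<lambda>(s, \<omega>). H s \<omega>) \<in> borel_measurable (lborel \<Otimes>\<^sub>M lborel)"
      unfolding H_def split_beta' by measurable
    have "(LINT \<omega>|lborel. norm (case (s, \<omega>) of (s, \<omega>) \<Rightarrow> H s \<omega>)) = cmod (f s) * (LINT \<omega>|lborel. cmod (g \<omega> * of_real (K \<omega>)))" for s
      by (simp add: H_def norm_mult mult.assoc)
    then show "integrable lborel (\<lambda>s. LINT \<omega>|lborel. norm (case (s, \<omega>) of (s, \<omega>) \<Rightarrow> H s \<omega>))"
      using f by simp
    have "integrable lborel (H s)" for s
    proof (rule Bochner_Integration.integrable_bound[OF integrable_mult_right[OF gK, of "f s"]])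
      show "H s \<in> borel_measurable lborel" unfolding H_def[abs_def] by measurable
    qed (simp add: H_def norm_mult mult.assoc)
    then show "AE s in lborel. integrable lborel (\<lambda>\<omega>. case (s, \<omega>) of (s, \<omega>) \<Rightarrow> H s \<omega>)" by simp
  qed
  have "(LINT \<omega>|lborel. LINT s|lborel. H s \<omega>) = (LINT s|lborel. LINT \<omega>|lborel. H s \<omega>)"
    by (rule lborel_pair.Fubini_integral[OF H])
  moreover have "(LINT s|lborel. H s \<omega>) = (LINT s|lborel. f s * cis (\<omega> * s)) * g \<omega> * of_real (K \<omega>)" for \<omega>
    by (simp add: H_def)
  moreover have "(LINT \<omega>|lborel. H s \<omega>) = f s * (LINT \<omega>|lborel. cis (\<omega> * s) * g \<omega> * of_real (K \<omega>))" for s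
    unfolding H_def by (simp add: mult.assoc)
  ultimately show ?thesis by simp
qed

text \<open>Half of Plancherel's theorem: integrated against the Cauchy kernel, \<open>|f^|\<^sup>2\<close> is the quadratic
  form of the kernel \<open>\<pi> y e\<^sup>-\<^sup>y\<^sup>|\<^sup>s\<^sup>-\<^sup>t\<^sup>|\<close>, which has norm at most \<open>2 \<pi>\<close> on \<open>L\<^sup>2\<close>.\<close>

theorem Plancherel_le:
  fixes f :: "real \<Rightarrow> real"
  assumes f: "integrable lborel f"
  shows "(\<integral>\<^sup>+\<omega>. ennreal ((cmod (LINT s|lborel. of_real (f s) * cis (\<omega> * s)))\<^sup>2) \<partial>lborel)
    \<le> ennreal (2 * pi) * (\<integral>\<^sup>+s. ennreal ((f s)\<^sup>2) \<partial>lborel)"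
proof -
  have fm [measurable]: "f \<in> borel_measurable borel" using f by (auto dest: borel_measurable_integrable)
  define F where "F \<omega> = (LINT s|lborel. complex_of_real (f s) * cis (\<omega> * s))" for \<omega>
  have cf: "integrable lborel (\<lambda>s. complex_of_real (f s))" using f by (simp add: complex_of_real_integrable_eq)
  have Fm [measurable]: "F \<in> borel_measurable borel"
    unfolding F_def[abs_def] by (rule lborel.borel_measurable_lebesgue_integral) (simp add: split_beta')
  have Fb: "cmod (F \<omega>) \<le> (LINT s|lborel. \<bar>f s\<bar>)" for \<omega>
    using integral_norm_bound[of lborel "\<lambda>s. complex_of_real (f s) * cis (\<omega> * s)"] by (simp add: F_def norm_mult)
  have key: "(\<integral>\<^sup>+\<omega>. ennreal ((cmod (F \<omega>))\<^sup>2 * cauchy_kernel y \<omega>) \<partial>lborel) \<le> ennreal (2 * pi) * (\<integral>\<^sup>+s. ennreal ((f s)\<^sup>2) \<partial>lborel)"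
    if y: "y > 0" for y
  proof -
    note K = cauchy_kernel_integrable[OF y]
    \<comment> \<open>the reflection \<open>\<omega> \<mapsto> -\<omega>\<close> turns the conjugate of \<open>F\<close> into \<open>F\<close>, as \<open>f\<close> is real\<close>
    have inner: "(LINT \<omega>|lborel. cis (\<omega> * s) * cnj (F \<omega>) * of_real (cauchy_kernel y \<omega>))
        = (LINT s'|lborel. of_real (f s') * of_real (pi * y * exp (- y * \<bar>s' - s\<bar>)))" for s
    proof -
      have cF: "cnj (F \<omega>) = F (- \<omega>)" for \<omega>
      proof -
        have i: "integrable lborel (\<lambda>s. complex_of_real (f s) * cis (\<omega> * s))"
          using f by (rule Bochner_Integration.integrable_bound) (auto simp: norm_mult)
        show ?thesis
          unfolding F_def using integral_bounded_linear[OF bounded_linear_cnj i] by (simp add: cis_cnj)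
      qed
      have "(LINT \<omega>|lborel. cis (\<omega> * s) * cnj (F \<omega>) * of_real (cauchy_kernel y \<omega>))
          = (LINT \<omega>|lborel. cis (- (\<omega> * s)) * F \<omega> * of_real (cauchy_kernel y \<omega>))"
        using lborel_integral_real_affine[of "-1" "\<lambda>\<omega>. cis (\<omega> * s) * cnj (F \<omega>) * of_real (cauchy_kernel y \<omega>)" 0]
        by (simp add: cF cauchy_kernel_def)
      also have "\<dots> = (LINT \<omega>|lborel. (LINT s|lborel. of_real (f s) * cis (\<omega> * s)) * cis (- s * \<omega>) * of_real (cauchy_kernel y \<omega>))"
        by (simp add: F_def mult_ac)
      also have "\<dots> = (LINT s'|lborel. of_real (f s') * (LINT \<omega>|lborel. cis (\<omega> * s') * cis (- s * \<omega>) * of_real (cauchy_kernel y \<omega>)))"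
        by (rule fourier_swap[OF cf K, of _ 1]) auto
      also have "(\<lambda>s'. LINT \<omega>|lborel. cis (\<omega> * s') * cis (- s * \<omega>) * of_real (cauchy_kernel y \<omega>))
          = (\<lambda>s'. of_real (pi * y * exp (- y * \<bar>s' - s\<bar>)))"
      proof (rule ext)
        fix s'
        have "cis (\<omega> * s') * cis (- s * \<omega>) = cis (- (s - s') * \<omega>)" for \<omega>
          by (simp add: cis_mult algebra_simps)
        then have "(LINT \<omega>|lborel. cis (\<omega> * s') * cis (- s * \<omega>) * of_real (cauchy_kernel y \<omega>))
            = (LINT \<omega>|lborel. cis (- (s - s') * \<omega>) * of_real (cauchy_kernel y \<omega>))" by (simp only:)
        also have "\<dots> = of_real (pi * y * exp (- y * \<bar>s - s'\<bar>))" by (rule cauchy_kernel_fourier[OF y])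
        finally show "(LINT \<omega>|lborel. cis (\<omega> * s') * cis (- s * \<omega>) * of_real (cauchy_kernel y \<omega>)) = of_real (pi * y * exp (- y * \<bar>s' - s\<bar>))"
          by (simp only: abs_minus_commute[of s s'])
      qed
      finally show ?thesis .
    qed
    have sq: "of_real ((cmod (F \<omega>))\<^sup>2 * cauchy_kernel y \<omega>) = (LINT s|lborel. of_real (f s) * cis (\<omega> * s)) * cnj (F \<omega>) * of_real (cauchy_kernel y \<omega>)" for \<omega>
      unfolding F_def[symmetric] by (simp only: of_real_mult complex_norm_square)
    have iL: "integrable lborel (\<lambda>\<omega>. (cmod (F \<omega>))\<^sup>2 * cauchy_kernel y \<omega>)"
    proof (rule Bochner_Integration.integrable_bound[OF integrable_mult_right[OF K, of "(LINT s|lborel. \<bar>f s\<bar>)\<^sup>2"]])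
      show "AE \<omega> in lborel. norm ((cmod (F \<omega>))\<^sup>2 * cauchy_kernel y \<omega>) \<le> norm ((LINT s|lborel. \<bar>f s\<bar>)\<^sup>2 * cauchy_kernel y \<omega>)"
        using Fb cauchy_kernel_nonneg by (intro AE_I2) (simp add: abs_mult mult_right_mono power_mono)
    qed measurable
    define J where "J = (LINT s|lborel. LINT s'|lborel. f s * (f s' * (pi * y * exp (- y * \<bar>s' - s\<bar>))))"
    have "complex_of_real (LINT \<omega>|lborel. (cmod (F \<omega>))\<^sup>2 * cauchy_kernel y \<omega>)
        = (LINT s|lborel. of_real (f s) * (LINT \<omega>|lborel. cis (\<omega> * s) * cnj (F \<omega>) * of_real (cauchy_kernel y \<omega>)))"
      unfolding integral_complex_of_real[symmetric] sq
      by (rule fourier_swap[OF cf K, of _ "LINT s|lborel. \<bar>f s\<bar>"]) (use Fb in auto)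
    also have "\<dots> = complex_of_real J"
      unfolding inner J_def of_real_mult[symmetric] integral_complex_of_real integral_mult_right_zero ..
    finally have eq: "(LINT \<omega>|lborel. (cmod (F \<omega>))\<^sup>2 * cauchy_kernel y \<omega>) = J" by (simp only: of_real_eq_iff)
    have "(\<integral>\<^sup>+\<omega>. ennreal ((cmod (F \<omega>))\<^sup>2 * cauchy_kernel y \<omega>) \<partial>lborel) = ennreal J"
      unfolding eq[symmetric] by (rule nn_integral_eq_integral[OF iL]) (simp add: cauchy_kernel_nonneg)
    also have "ennreal J \<le> (\<integral>\<^sup>+s. \<integral>\<^sup>+s'. ennreal (pi * y) * ennreal (\<bar>f s\<bar> * \<bar>f s'\<bar> * exp (- y * \<bar>s - s'\<bar>)) \<partial>lborel \<partial>lborel)"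
    proof -
      \<comment> \<open>if \<open>h\<close> is not integrable, its integral is \<open>0\<close> by convention\<close>
      have 1: "ennreal (LINT x|M. h x) \<le> (\<integral>\<^sup>+x. ennreal \<bar>h x\<bar> \<partial>M)" for M and h :: "real \<Rightarrow> real"
      proof (cases "integrable M h")
        case True
        have "ennreal (LINT x|M. h x) \<le> ennreal (LINT x|M. \<bar>h x\<bar>)"
          by (intro ennreal_leI integral_mono True integrable_abs) auto
        also have "\<dots> = (\<integral>\<^sup>+x. ennreal \<bar>h x\<bar> \<partial>M)"
          by (rule nn_integral_eq_integral[symmetric]) (use True in auto)
        finally show ?thesis .
      qed (simp add: not_integrable_integral_eq)
      have 2: "ennreal \<bar>LINT x|M. h x\<bar> \<le> (\<integral>\<^sup>+x. ennreal \<bar>h x\<bar> \<partial>M)" for M and h :: "real \<Rightarrow> real"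
        using 1[of M h] 1[of M "\<lambda>x. - h x"] by (cases "(LINT x|M. h x) \<ge> 0") auto
      have "ennreal J \<le> (\<integral>\<^sup>+s. ennreal \<bar>LINT s'|lborel. f s * (f s' * (pi * y * exp (- y * \<bar>s' - s\<bar>)))\<bar> \<partial>lborel)"
        unfolding J_def by (rule 1)
      also have "\<dots> \<le> (\<integral>\<^sup>+s. \<integral>\<^sup>+s'. ennreal \<bar>f s * (f s' * (pi * y * exp (- y * \<bar>s' - s\<bar>)))\<bar> \<partial>lborel \<partial>lborel)"
        by (intro nn_integral_mono 2)
      also have "\<dots> = (\<integral>\<^sup>+s. \<integral>\<^sup>+s'. ennreal (pi * y) * ennreal (\<bar>f s\<bar> * \<bar>f s'\<bar> * exp (- y * \<bar>s - s'\<bar>)) \<partial>lborel \<partial>lborel)"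
        using y by (intro nn_integral_cong) (simp add: abs_mult mult_ac abs_minus_commute flip: ennreal_mult)
      finally show ?thesis .
    qed
    also have "\<dots> = ennreal (pi * y) * (\<integral>\<^sup>+s. \<integral>\<^sup>+s'. ennreal (\<bar>f s\<bar> * \<bar>f s'\<bar> * exp (- y * \<bar>s - s'\<bar>)) \<partial>lborel \<partial>lborel)"
      by (simp add: nn_integral_cmult)
    also have "\<dots> \<le> ennreal (pi * y) * (ennreal (2 / y) * (\<integral>\<^sup>+s. ennreal (\<bar>f s\<bar>\<^sup>2) \<partial>lborel))"
      by (intro mult_left_mono exp_kernel_quadratic_form_le[OF y]) auto
    also have "\<dots> = ennreal (2 * pi) * (\<integral>\<^sup>+s. ennreal ((f s)\<^sup>2) \<partial>lborel)"
      using y by (simp add: mult.assoc[symmetric] ennreal_mult[symmetric] mult.commute[of pi 2])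
    finally show ?thesis .
  qed
  have "(\<integral>\<^sup>+\<omega>. ennreal ((cmod (F \<omega>))\<^sup>2) \<partial>lborel)
      = (\<integral>\<^sup>+\<omega>. liminf (\<lambda>j. ennreal ((cmod (F \<omega>))\<^sup>2 * cauchy_kernel (real (Suc j)) \<omega>)) \<partial>lborel)"
  proof (rule nn_integral_cong)
    fix \<omega>
    have "(\<lambda>j. cauchy_kernel (real (Suc j)) \<omega>) \<longlonglongrightarrow> 1"
    proof -
      have "((\<lambda>y. cauchy_kernel y \<omega>) \<longlongrightarrow> 1) at_top" unfolding cauchy_kernel_def by real_asymp
      then show ?thesis
        by (rule filterlim_compose) (rule filterlim_compose[OF filterlim_real_sequentially filterlim_Suc])
    qed
    then have "(\<lambda>j. ennreal ((cmod (F \<omega>))\<^sup>2 * cauchy_kernel (real (Suc j)) \<omega>)) \<longlonglongrightarrow> ennreal ((cmod (F \<omega>))\<^sup>2 * 1)"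
      by (intro tendsto_intros)
    then show "ennreal ((cmod (F \<omega>))\<^sup>2) = liminf (\<lambda>j. ennreal ((cmod (F \<omega>))\<^sup>2 * cauchy_kernel (real (Suc j)) \<omega>))"
      by (subst lim_imp_Liminf) auto
  qed
  also have "\<dots> \<le> liminf (\<lambda>j. \<integral>\<^sup>+\<omega>. ennreal ((cmod (F \<omega>))\<^sup>2 * cauchy_kernel (real (Suc j)) \<omega>) \<partial>lborel)"
    by (rule nn_integral_liminf) measurable
  also have "\<dots> \<le> ennreal (2 * pi) * (\<integral>\<^sup>+s. ennreal ((f s)\<^sup>2) \<partial>lborel)"
    by (rule Liminf_le) (auto intro!: always_eventually key)
  finally show ?thesis unfolding F_def .
qed

section \<open>The vacuum amplitude\<close>

context potential
begin

lemma picard_measurable_k: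
  "(\<lambda>x. picard (\<i> * complex_of_real (fst x)) m n (snd x)) \<in> borel_measurable (borel \<Otimes>\<^sub>M borel)"
  using measurable_compose[OF _ picard_measurable_pair, of "\<lambda>x :: real \<times> real. (\<i> * complex_of_real (fst x), snd x)" "borel \<Otimes>\<^sub>M borel" m n]
  by simp

text \<open>All phases produced by the iteration are of the form \<open>e\<^sup>-\<^sup>i\<^sup>k\<^sup>\<lambda>\<close> with \<open>\<lambda> \<ge> 0\<close>, and on these averaging
  against the Cauchy kernel amounts to replacing \<open>i k\<close> by \<open>y\<close>: the Schroedinger evolution turns
  into a heat evolution.\<close>

lemma picard_cauchy_average:
  assumes y: "y > 0" and "t \<ge> 0" "l \<ge> 0"
  shows "(LINT k|lborel. cis (- l * k) * picard (\<i> * of_real k) m n t * of_real (cauchy_kernel y k))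
    = of_real (pi * y * exp (- y * l)) * picard (of_real y) m n t"
  using assms(2,3)
proof (induction m arbitrary: n t l)
  case 0
  have "(LINT k|lborel. cis (- l * k) * (if n = 0 then 1 else 0) * of_real (cauchy_kernel y k))
      = (if n = 0 then 1 else 0) * (LINT k|lborel. cis (- l * k) * of_real (cauchy_kernel y k))"
    by (cases "n = 0") simp_all
  then show ?case using cauchy_kernel_fourier[OF y, of l] 0 by simp
next
  case (Suc m)
  note K = cauchy_kernel_integrable[OF y]
  define c where "c k \<tau> = (picard (\<i> * of_real k) m (n - 1) \<tau> + picard (\<i> * of_real k) m (n + 1) \<tau>) / 2" for k \<tau>
  define D where "D \<tau> = (picard (of_real y) m (n - 1) \<tau> + picard (of_real y) m (n + 1) \<tau>) / 2" for \<tau>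
  define H where "H k \<tau> = indicator {0..t} \<tau> *\<^sub>R (cis (- (l + (t - \<tau>) * (of_int n)\<^sup>2) * k) * c k \<tau> * of_real (q \<tau>) * of_real (cauchy_kernel y k))" for k \<tau>
  have cm: "(\<lambda>x. c (fst x) (snd x)) \<in> borel_measurable (borel \<Otimes>\<^sub>M borel)"
    unfolding c_def using picard_measurable_k by measurable
  have cm1 [measurable]: "c k \<in> borel_measurable borel" for k
    unfolding c_def[abs_def] by measurable
  have cm2 [measurable]: "(\<lambda>k. c k \<tau>) \<in> borel_measurable borel" for \<tau>
    using measurable_compose[OF _ cm, of "\<lambda>k. (k, \<tau>)" borel] by simp
  have Pb: "cmod (picard (\<i> * of_real k) m j \<tau>) \<le> exp (A t)" if "\<tau> \<in> {0..t}" for k \<tau> j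
    by (rule order_trans[OF picard_bounded]) (use that A_mono[of \<tau> t] in auto)
  have cb: "cmod (c k \<tau>) \<le> exp (A t)" if "\<tau> \<in> {0..t}" for k \<tau>
  proof -
    have "cmod (picard (\<i> * of_real k) m (n - 1) \<tau> + picard (\<i> * of_real k) m (n + 1) \<tau>) \<le> exp (A t) + exp (A t)"
      by (intro norm_triangle_le add_mono Pb that)
    then show ?thesis by (simp add: c_def norm_divide)
  qed
  have Hb: "cmod (H k \<tau>) \<le> (exp (A t) * cauchy_kernel y k) * (indicator {0..t} \<tau> * \<bar>q \<tau>\<bar>)" for k \<tau>
  proof (cases "\<tau> \<in> {0..t}")
    case True
    have "cmod (H k \<tau>) = cmod (c k \<tau>) * (\<bar>q \<tau>\<bar> * cauchy_kernel y k)"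
      using True cauchy_kernel_nonneg[of y k] by (simp add: H_def norm_mult)
    also have "\<dots> \<le> exp (A t) * (\<bar>q \<tau>\<bar> * cauchy_kernel y k)"
      using True cauchy_kernel_nonneg[of y k] by (intro mult_right_mono cb) auto
    finally show ?thesis using True by (simp add: mult_ac)
  qed (simp add: H_def)
  have qi: "integrable lborel (\<lambda>\<tau>. indicator {0..t} \<tau> * \<bar>q \<tau>\<bar>)"
    using q_abs_int[of t] by (simp add: set_integrable_def)
  have Hm: "(\<lambda>(k, \<tau>). H k \<tau>) \<in> borel_measurable (lborel \<Otimes>\<^sub>M lborel)"
    unfolding H_def split_beta' using cm by measurable
  have Hm1: "H k \<in> borel_measurable lborel" for k unfolding H_def[abs_def] by measurable
  have H: "integrable (lborel \<Otimes>\<^sub>M lborel) (\<lambda>(k, \<tau>). H k \<tau>)"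
  proof (rule Bochner_Integration.integrable_bound[OF _ Hm])
    show "integrable (lborel \<Otimes>\<^sub>M lborel) (\<lambda>(k, \<tau>). (exp (A t) * cauchy_kernel y k) * (indicator {0..t} \<tau> * \<bar>q \<tau>\<bar>))"
    proof (rule lborel_pair.Fubini_integrable)
      show "integrable lborel (\<lambda>k. LINT \<tau>|lborel. norm (case (k, \<tau>) of (k, \<tau>) \<Rightarrow> (exp (A t) * cauchy_kernel y k) * (indicator {0..t} \<tau> * \<bar>q \<tau>\<bar>)))"
        using K by (simp add: abs_mult cauchy_kernel_nonneg)
    qed (use qi in \<open>auto simp: split_beta'\<close>)
    show "AE x in lborel \<Otimes>\<^sub>M lborel. norm (case x of (k, \<tau>) \<Rightarrow> H k \<tau>)
        \<le> norm (case x of (k, \<tau>) \<Rightarrow> (exp (A t) * cauchy_kernel y k) * (indicator {0..t} \<tau> * \<bar>q \<tau>\<bar>))"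
      using Hb by (intro AE_I2) (auto intro: order_trans[OF _ abs_ge_self])
  qed
  have duh: "cis (- l * k) * duhamel (\<i> * of_real k) (picard (\<i> * of_real k) m) n t * of_real (cauchy_kernel y k) = \<i> * (LINT \<tau>|lborel. H k \<tau>)" for k
  proof -
    have e: "cis (- l * k) * exp (- (\<i> * of_real k * of_real ((t - \<tau>) * (of_int n)\<^sup>2))) = cis (- (l + (t - \<tau>) * (of_int n)\<^sup>2) * k)" for \<tau>
    proof -
      have "exp (- (\<i> * of_real k * of_real ((t - \<tau>) * (of_int n)\<^sup>2))) = cis (- ((t - \<tau>) * (of_int n)\<^sup>2 * k))"
        by (simp add: cis_conv_exp mult_ac)
      then show ?thesis by (simp add: cis_mult algebra_simps)
    qed
    have "H k \<tau> = (cis (- l * k) * of_real (cauchy_kernel y k)) *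
        (indicator {0..t} \<tau> *\<^sub>R (exp (- (\<i> * of_real k * of_real ((t - \<tau>) * (of_int n)\<^sup>2))) * c k \<tau> * of_real (q \<tau>)))" for \<tau>
      unfolding H_def e[symmetric] by (simp add: mult_ac)
    then have "(LINT \<tau>|lborel. H k \<tau>) = (cis (- l * k) * of_real (cauchy_kernel y k)) * (LINT \<tau>|lborel.
        (indicator {0..t} \<tau> *\<^sub>R (exp (- (\<i> * of_real k * of_real ((t - \<tau>) * (of_int n)\<^sup>2))) * c k \<tau> * of_real (q \<tau>))))"
      by (simp only: integral_mult_right_zero)
    then show ?thesis by (simp only: duhamel_def set_lebesgue_integral_def c_def mult_ac)
  qed
  have inner: "(LINT k|lborel. H k \<tau>) = of_real (pi * y * exp (- y * l)) *
      (indicator {0..t} \<tau> *\<^sub>R (exp (- (of_real y * of_real ((t - \<tau>) * (of_int n)\<^sup>2))) * D \<tau> * of_real (q \<tau>)))" for \<tau>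
  proof (cases "\<tau> \<in> {0..t}")
    case True
    define lam where "lam = l + (t - \<tau>) * (of_int n)\<^sup>2"
    have lam: "lam \<ge> 0" using True Suc.prems by (simp add: lam_def)
    have I: "integrable lborel (\<lambda>k. cis (- lam * k) * picard (\<i> * of_real k) m j \<tau> * of_real (cauchy_kernel y k))" for j
    proof (rule Bochner_Integration.integrable_bound[OF integrable_mult_right[OF K, of "exp (A t)"]])
      have "(\<lambda>k. picard (\<i> * complex_of_real k) m j \<tau>) \<in> borel_measurable borel"
        using measurable_compose[OF _ picard_measurable_k, of "\<lambda>k. (k, \<tau>)" borel m j] by simp
      then show "(\<lambda>k. cis (- lam * k) * picard (\<i> * of_real k) m j \<tau> * of_real (cauchy_kernel y k)) \<in> borel_measurable lborel"
        by measurable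
      show "AE k in lborel. norm (cis (- lam * k) * picard (\<i> * of_real k) m j \<tau> * of_real (cauchy_kernel y k)) \<le> norm (exp (A t) * cauchy_kernel y k)"
        using Pb[OF True] cauchy_kernel_nonneg by (intro AE_I2) (simp add: norm_mult abs_mult mult_right_mono)
    qed
    have "H k \<tau> = (of_real (q \<tau>) / 2) * ((cis (- lam * k) * picard (\<i> * of_real k) m (n - 1) \<tau> * of_real (cauchy_kernel y k))
        + (cis (- lam * k) * picard (\<i> * of_real k) m (n + 1) \<tau> * of_real (cauchy_kernel y k)))" for k
      using True by (simp add: H_def c_def lam_def) (simp add: algebra_simps)
    then have "(LINT k|lborel. H k \<tau>) = (of_real (q \<tau>) / 2) * ((LINT k|lborel. cis (- lam * k) * picard (\<i> * of_real k) m (n - 1) \<tau> * of_real (cauchy_kernel y k))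
        + (LINT k|lborel. cis (- lam * k) * picard (\<i> * of_real k) m (n + 1) \<tau> * of_real (cauchy_kernel y k)))"
      by (simp only: integral_mult_right_zero Bochner_Integration.integral_add[OF I I])
    also have "\<dots> = (of_real (q \<tau>) / 2) * (of_real (pi * y * exp (- y * lam)) * picard (of_real y) m (n - 1) \<tau>
        + of_real (pi * y * exp (- y * lam)) * picard (of_real y) m (n + 1) \<tau>)"
      using True by (simp only: Suc.IH[OF _ lam] atLeastAtMost_iff)
    also have "exp (- y * lam) = exp (- y * l) * exp (- (y * ((t - \<tau>) * (of_int n)\<^sup>2)))"
      unfolding lam_def mult_exp_exp by (simp add: algebra_simps)
    finally show ?thesis
      using True by (simp add: D_def exp_of_real[symmetric] algebra_simps add_divide_distrib)
  qed (simp add: H_def)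
  have Hk: "integrable lborel (\<lambda>k. LINT \<tau>|lborel. H k \<tau>)"
    using lborel_pair.integrable_fst[OF H] .
  have I0: "integrable lborel (\<lambda>k. cis (- l * k) * of_real (cauchy_kernel y k))"
    by (rule Bochner_Integration.integrable_bound[OF K]) (auto simp: norm_mult)
  have "(LINT k|lborel. cis (- l * k) * picard (\<i> * of_real k) (Suc m) n t * of_real (cauchy_kernel y k))
      = (LINT k|lborel. (if n = 0 then 1 else 0) * (cis (- l * k) * of_real (cauchy_kernel y k)) + \<i> * (LINT \<tau>|lborel. H k \<tau>))"
    unfolding duh[symmetric] picard.simps by (rule Bochner_Integration.integral_cong) (simp_all add: algebra_simps)
  also have "\<dots> = (if n = 0 then 1 else 0) * (LINT k|lborel. cis (- l * k) * of_real (cauchy_kernel y k)) + \<i> * (LINT k|lborel. LINT \<tau>|lborel. H k \<tau>)"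
    unfolding Bochner_Integration.integral_add[OF integrable_mult_right[OF I0] integrable_mult_right[OF Hk]]
      integral_mult_right_zero ..
  also have "(LINT k|lborel. LINT \<tau>|lborel. H k \<tau>) = (LINT \<tau>|lborel. LINT k|lborel. H k \<tau>)"
    by (rule lborel_pair.Fubini_integral[OF H, symmetric])
  also have "\<dots> = of_real (pi * y * exp (- y * l)) * (LINT \<tau>|lborel. indicator {0..t} \<tau> *\<^sub>R (exp (- (of_real y * of_real ((t - \<tau>) * (of_int n)\<^sup>2))) * D \<tau> * of_real (q \<tau>)))"
    unfolding inner by (rule integral_mult_right_zero)
  also have "(LINT k|lborel. cis (- l * k) * of_real (cauchy_kernel y k)) = of_real (pi * y * exp (- y * l))"
    using cauchy_kernel_fourier[OF y, of l] Suc.prems by simp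
  finally have eq: "(LINT k|lborel. cis (- l * k) * picard (\<i> * of_real k) (Suc m) n t * of_real (cauchy_kernel y k))
      = (if n = 0 then 1 else 0) * of_real (pi * y * exp (- y * l)) + \<i> * (of_real (pi * y * exp (- y * l)) *
        (LINT \<tau>|lborel. indicator {0..t} \<tau> *\<^sub>R (exp (- (of_real y * of_real ((t - \<tau>) * (of_int n)\<^sup>2))) * D \<tau> * of_real (q \<tau>))))" .
  have fac: "d * C + \<i> * (C * Y) = C * (d + \<i> * Y)" for d C Y :: complex by (simp add: algebra_simps)
  show ?case
    unfolding eq fac
    by (simp only: picard.simps duhamel_def set_lebesgue_integral_def D_def)
qed

text \<open>The heat evolution with large \<open>y\<close> stays within \<open>O(1/y)\<close> of the constant \<open>1\<close>: each excursion
  away from frequency \<open>0\<close> costs a factor \<open>e\<^sup>-\<^sup>y\<^sup>(\<^sup>t\<^sup>-\<^sup>s\<^sup>)\<close>.\<close>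

definition excursion :: "real \<Rightarrow> real \<Rightarrow> real" where
  "excursion y t = (LINT s:{0..t}|lborel. exp (- y * (t - s)) * \<bar>q s\<bar>)"

lemma excursion_integrable:
  assumes "y > 0"
  shows "set_integrable lborel {0..t} (\<lambda>s. exp (- y * (t - s)) * \<bar>q s\<bar>)"
  using q_abs_int[of t] unfolding set_integrable_def
proof (rule Bochner_Integration.integrable_bound)
  have "exp (- y * (t - s)) * \<bar>q s\<bar> \<le> \<bar>q s\<bar>" if "s \<in> {0..t}" for s
    using assms that by (intro mult_left_le_one_le) (auto simp: mult_nonneg_nonneg)
  then show "AE s in lborel. norm (indicator {0..t} s *\<^sub>R (exp (- y * (t - s)) * \<bar>q s\<bar>)) \<le> norm (indicator {0..t} s *\<^sub>R \<bar>q s\<bar>)"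
    by (intro AE_I2) (auto simp: indicator_def abs_mult)
qed measurable

lemma excursion_nonneg: "0 \<le> excursion y t"
  unfolding excursion_def set_lebesgue_integral_def by (rule Bochner_Integration.integral_nonneg) simp

lemma heat_picard_bound:
  assumes y: "y > 0" and n: "n \<noteq> 0" and t: "t \<ge> 0"
    and b: "\<And>\<tau>. \<tau> \<in> {0..t} \<Longrightarrow> cmod (picard (of_real y) m (n - 1) \<tau> + picard (of_real y) m (n + 1) \<tau>) \<le> 2 * L"
  shows "cmod (picard (of_real y) (Suc m) n t) \<le> L * excursion y t"
proof -
  have \<zeta>: "0 \<le> Re (complex_of_real y)" using y by simp
  define F where "F \<tau> = exp (- (of_real y * of_real ((t - \<tau>) * (of_int n)\<^sup>2))) *
      ((picard (of_real y) m (n - 1) \<tau> + picard (of_real y) m (n + 1) \<tau>) / 2) * of_real (q \<tau>)" for \<tau>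
  have Pb: "cmod (picard (of_real y) m j \<tau>) \<le> exp (A t)" if "\<tau> \<in> {0..t}" for \<tau> j
    by (rule order_trans[OF picard_bounded[OF \<zeta>]]) (use that A_mono[of \<tau> t] in auto)
  have iF: "set_integrable lborel {0..t} F"
    unfolding F_def by (rule duhamel_integrable[OF \<zeta> picard_measurable Pb])
  have "cmod (picard (of_real y) (Suc m) n t) = cmod (LINT \<tau>:{0..t}|lborel. F \<tau>)"
    using n by (simp add: duhamel_def F_def norm_mult)
  also have "\<dots> \<le> (LINT \<tau>:{0..t}|lborel. cmod (F \<tau>))" by (rule set_integral_norm_bound[OF iF])
  also have "\<dots> \<le> (LINT \<tau>:{0..t}|lborel. L * (exp (- y * (t - \<tau>)) * \<bar>q \<tau>\<bar>))"
  proof (rule set_integral_mono)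
    show "set_integrable lborel {0..t} (\<lambda>\<tau>. cmod (F \<tau>))" by (rule set_integrable_norm[OF iF])
    show "set_integrable lborel {0..t} (\<lambda>\<tau>. L * (exp (- y * (t - \<tau>)) * \<bar>q \<tau>\<bar>))"
      by (rule set_integrable_mult_right[OF excursion_integrable[OF y]])
    fix \<tau> assume \<tau>: "\<tau> \<in> {0..t}"
    have "(of_int n :: real)\<^sup>2 \<ge> 1"
    proof -
      have "1 \<le> \<bar>n\<bar>" using n by simp
      then have "1 \<le> \<bar>real_of_int n\<bar>" by (simp flip: of_int_abs)
      then show ?thesis by (simp add: abs_le_square_iff[of 1, simplified])
    qed
    then have "y * (t - \<tau>) * 1 \<le> y * (t - \<tau>) * (of_int n)\<^sup>2"
      using y \<tau> by (intro mult_left_mono) auto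
    then have "- (y * ((t - \<tau>) * (of_int n)\<^sup>2)) \<le> - y * (t - \<tau>)" by (simp add: mult.assoc)
    moreover have "cmod (exp (- (complex_of_real y * of_real ((t - \<tau>) * (of_int n)\<^sup>2)))) = exp (- (y * ((t - \<tau>) * (of_int n)\<^sup>2)))"
      by simp
    ultimately have 1: "cmod (exp (- (complex_of_real y * of_real ((t - \<tau>) * (of_int n)\<^sup>2)))) \<le> exp (- y * (t - \<tau>))"
      by simp
    have 2: "cmod ((picard (of_real y) m (n - 1) \<tau> + picard (of_real y) m (n + 1) \<tau>) / 2) \<le> L"
      using b[OF \<tau>] by (simp add: norm_divide)
    have "cmod (F \<tau>) \<le> exp (- y * (t - \<tau>)) * L * \<bar>q \<tau>\<bar>"
      unfolding F_def norm_mult norm_of_real by (intro mult_mono mult_right_mono 1 2) auto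
    then show "cmod (F \<tau>) \<le> L * (exp (- y * (t - \<tau>)) * \<bar>q \<tau>\<bar>)" by (simp add: mult_ac)
  qed
  also have "\<dots> = L * excursion y t" by (simp add: excursion_def)
  finally show ?thesis .
qed

text \<open>Young's inequality with weight \<open>\<surd>y\<close>, against \<open>\<integral>e\<^sup>-\<^sup>2\<^sup>y\<^sup>(\<^sup>t\<^sup>-\<^sup>s\<^sup>) ds \<le> 1/(2y)\<close>.\<close>

lemma excursion_small:
  assumes y: "y > 0" and t: "t \<in> {0..T}" and q2: "set_integrable lborel {0..T} (\<lambda>s. (q s)\<^sup>2)"
  shows "excursion y t \<le> (1 + (LINT s:{0..T}|lborel. (q s)\<^sup>2)) / sqrt y"
proof -
  define I where "I = (LINT s:{0..T}|lborel. (q s)\<^sup>2)"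
  have q2t: "set_integrable lborel {0..t} (\<lambda>s. (q s)\<^sup>2)"
    by (rule set_integrable_subinterval[OF q2]) (use t in auto)
  have It: "(LINT s:{0..t}|lborel. (q s)\<^sup>2) \<le> I"
    unfolding I_def set_lebesgue_integral_def
    using q2 q2t t by (intro integral_mono) (auto simp: set_integrable_def indicator_def)
  have der: "((\<lambda>s. exp (- (2 * y) * (t - s)) / (2 * y)) has_vector_derivative exp (- (2 * y) * (t - s))) (at s within {0..t})" for s
    using y by (auto intro!: derivative_eq_intros simp: has_real_derivative_iff_has_vector_derivative[symmetric])
  have hi: "((\<lambda>s. exp (- (2 * y) * (t - s))) has_integral (exp (- (2 * y) * (t - t)) / (2 * y) - exp (- (2 * y) * (t - 0)) / (2 * y))) {0..t}"
    by (rule fundamental_theorem_of_calculus) (use t der in auto)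
  have ei: "set_integrable lborel {0..t} (\<lambda>s. exp (- (2 * y) * (t - s)))"
    by (rule borel_integrable_atLeastAtMost') (intro continuous_intros)
  have "(LINT s:{0..t}|lborel. exp (- (2 * y) * (t - s))) = 1 / (2 * y) - exp (- (2 * y) * t) / (2 * y)"
    using set_borel_integral_eq_integral(2)[OF ei] hi by (simp add: integral_unique)
  also have "\<dots> \<le> 1 / (2 * y)" using y by simp
  finally have eI: "(LINT s:{0..t}|lborel. exp (- (2 * y) * (t - s))) \<le> 1 / (2 * y)" .
  have sy: "sqrt y > 0" using y by simp
  have "excursion y t \<le> (LINT s:{0..t}|lborel. sqrt y * exp (- (2 * y) * (t - s)) + (q s)\<^sup>2 / sqrt y)"
    unfolding excursion_def
  proof (rule set_integral_mono[OF excursion_integrable[OF y]])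
    show "set_integrable lborel {0..t} (\<lambda>s. sqrt y * exp (- (2 * y) * (t - s)) + (q s)\<^sup>2 / sqrt y)"
      using q2t by (intro set_integral_add set_integrable_mult_right ei set_integrable_divide) auto
    fix s
    define e where "e = exp (- y * (t - s))"
    have e2: "exp (- (2 * y) * (t - s)) = e\<^sup>2" by (simp add: e_def power2_eq_square mult_exp_exp)
    define p where "p = sqrt y * (e * \<bar>q s\<bar>)"
    have "0 \<le> p" using y by (simp add: p_def e_def)
    have "2 * (sqrt y * e) * \<bar>q s\<bar> \<le> (sqrt y * e)\<^sup>2 + \<bar>q s\<bar>\<^sup>2" by (rule sum_squares_bound)
    also have "(sqrt y * e)\<^sup>2 + \<bar>q s\<bar>\<^sup>2 = y * e\<^sup>2 + (q s)\<^sup>2" using y by (simp add: power_mult_distrib)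
    finally have "2 * p \<le> y * e\<^sup>2 + (q s)\<^sup>2" by (simp add: p_def mult_ac)
    with \<open>0 \<le> p\<close> have "sqrt y * (e * \<bar>q s\<bar>) \<le> y * e\<^sup>2 + (q s)\<^sup>2"
      unfolding p_def by linarith
    then have "e * \<bar>q s\<bar> \<le> (y * e\<^sup>2 + (q s)\<^sup>2) / sqrt y" using sy by (simp add: field_simps)
    also have "\<dots> = y / sqrt y * e\<^sup>2 + (q s)\<^sup>2 / sqrt y" by (simp only: add_divide_distrib times_divide_eq_left)
    also have "y / sqrt y = sqrt y" by (rule real_div_sqrt) (use y in simp)
    finally show "exp (- y * (t - s)) * \<bar>q s\<bar> \<le> sqrt y * exp (- (2 * y) * (t - s)) + (q s)\<^sup>2 / sqrt y"
      unfolding e2 by (simp add: e_def)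
  qed
  also have "\<dots> = sqrt y * (LINT s:{0..t}|lborel. exp (- (2 * y) * (t - s))) + (LINT s:{0..t}|lborel. (q s)\<^sup>2) / sqrt y"
    using q2t ei by (subst set_integral_add) (auto intro!: set_integrable_mult_right set_integrable_divide)
  also have "\<dots> \<le> sqrt y * (1 / (2 * y)) + I / sqrt y"
    using eI It sy by (intro add_mono mult_left_mono divide_right_mono) auto
  also have "sqrt y * (1 / (2 * y)) = (1 / 2) / sqrt y"
    using y by (simp add: field_simps)
  also have "(1 / 2) / sqrt y + I / sqrt y \<le> (1 + I) / sqrt y"
    unfolding add_divide_distrib[symmetric] using sy by (intro divide_right_mono) auto
  finally show ?thesis unfolding I_def .
qed

text \<open>The double integral is dominated by the symmetric exponential kernel, to which Schur's test applies.\<close>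

lemma excursion_total:
  assumes y: "y > 0" and T: "T \<ge> 0" and q2: "set_integrable lborel {0..T} (\<lambda>s. (q s)\<^sup>2)"
  shows "set_integrable lborel {0..T} (\<lambda>t. \<bar>q t\<bar> * excursion y t)"
    and "(LINT t:{0..T}|lborel. \<bar>q t\<bar> * excursion y t) \<le> 2 / y * (LINT s:{0..T}|lborel. (q s)\<^sup>2)"
proof -
  define f where "f s = indicator {0..T} s * \<bar>q s\<bar>" for s
  have [measurable]: "f \<in> borel_measurable borel" unfolding f_def by measurable
  have em [measurable]: "excursion y \<in> borel_measurable borel"
  proof -
    have ind: "(\<lambda>x :: real \<times> real. indicator {0..fst x} (snd x) :: real) \<in> borel_measurable (borel \<Otimes>\<^sub>M borel)"
      unfolding indicator_def atLeastAtMost_iff by measurable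
    have "(\<lambda>x. indicator {0..fst x} (snd x) *\<^sub>R (exp (- y * (fst x - snd x)) * \<bar>q (snd x)\<bar>)) \<in> borel_measurable (borel \<Otimes>\<^sub>M lborel)"
      using ind by measurable
    then show ?thesis unfolding excursion_def[abs_def] set_lebesgue_integral_def
      by (intro lborel.borel_measurable_lebesgue_integral) (simp add: split_beta')
  qed
  have fi: "integrable lborel (\<lambda>s. (f s)\<^sup>2)"
  proof -
    have "(f s)\<^sup>2 = indicator {0..T} s *\<^sub>R (q s)\<^sup>2" for s by (simp add: f_def indicator_def)
    then show ?thesis using q2 by (simp add: set_integrable_def)
  qed
  have f2: "(\<integral>\<^sup>+s. ennreal ((f s)\<^sup>2) \<partial>lborel) = ennreal (LINT s:{0..T}|lborel. (q s)\<^sup>2)"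
  proof -
    have "(f s)\<^sup>2 = indicator {0..T} s *\<^sub>R (q s)\<^sup>2" for s by (simp add: f_def indicator_def)
    then show ?thesis using nn_integral_eq_integral[OF fi] by (simp add: set_lebesgue_integral_def)
  qed
  have ex: "ennreal (excursion y t) = (\<integral>\<^sup>+s. ennreal (indicator {0..t} s * (exp (- y * (t - s)) * \<bar>q s\<bar>)) \<partial>lborel)" for t
    unfolding excursion_def set_lebesgue_integral_def
    using excursion_integrable[OF y, of t]
    by (subst nn_integral_eq_integral) (auto simp: set_integrable_def)
  have "(\<integral>\<^sup>+t. ennreal (f t * excursion y t) \<partial>lborel)
      = (\<integral>\<^sup>+t. \<integral>\<^sup>+s. ennreal (f t) * ennreal (indicator {0..t} s * (exp (- y * (t - s)) * \<bar>q s\<bar>)) \<partial>lborel \<partial>lborel)"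
  proof (rule nn_integral_cong)
    fix t
    have "(\<integral>\<^sup>+s. ennreal (f t) * ennreal (indicator {0..t} s * (exp (- y * (t - s)) * \<bar>q s\<bar>)) \<partial>lborel) = ennreal (f t) * ennreal (excursion y t)"
      unfolding ex by (rule nn_integral_cmult) measurable
    then show "ennreal (f t * excursion y t) = (\<integral>\<^sup>+s. ennreal (f t) * ennreal (indicator {0..t} s * (exp (- y * (t - s)) * \<bar>q s\<bar>)) \<partial>lborel)"
      by (simp add: ennreal_mult f_def excursion_nonneg)
  qed
  also have "\<dots> \<le> (\<integral>\<^sup>+t. \<integral>\<^sup>+s. ennreal (f t * f s * exp (- y * \<bar>t - s\<bar>)) \<partial>lborel \<partial>lborel)"
  proof (intro nn_integral_mono)
    fix t s
    show "ennreal (f t) * ennreal (indicator {0..t} s * (exp (- y * (t - s)) * \<bar>q s\<bar>)) \<le> ennreal (f t * f s * exp (- y * \<bar>t - s\<bar>))"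
      by (auto simp: f_def indicator_def mult_ac simp flip: ennreal_mult)
  qed
  also have "\<dots> \<le> ennreal (2 / y) * ennreal (LINT s:{0..T}|lborel. (q s)\<^sup>2)"
    unfolding f2[symmetric] by (rule exp_kernel_quadratic_form_le[OF y]) (auto simp: f_def)
  also have "\<dots> = ennreal (2 / y * (LINT s:{0..T}|lborel. (q s)\<^sup>2))"
    by (subst ennreal_mult) (use y in \<open>auto simp: set_lebesgue_integral_def\<close>)
  finally have le: "(\<integral>\<^sup>+t. ennreal (f t * excursion y t) \<partial>lborel) \<le> ennreal (2 / y * (LINT s:{0..T}|lborel. (q s)\<^sup>2))" .
  have f0: "0 \<le> f t * excursion y t" for t by (simp add: f_def excursion_nonneg)
  have int: "integrable lborel (\<lambda>t. f t * excursion y t)"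
    by (rule integrableI_bounded) (use le f0 in \<open>auto simp: le_less_trans\<close>)
  then show "set_integrable lborel {0..T} (\<lambda>t. \<bar>q t\<bar> * excursion y t)"
    by (simp add: set_integrable_def f_def mult.assoc)
  have "ennreal (LINT t|lborel. f t * excursion y t) \<le> ennreal (2 / y * (LINT s:{0..T}|lborel. (q s)\<^sup>2))"
    using le nn_integral_eq_integral[OF int] f0 by simp
  moreover have "0 \<le> 2 / y * (LINT s:{0..T}|lborel. (q s)\<^sup>2)" using y by (simp add: set_lebesgue_integral_def)
  ultimately have "(LINT t|lborel. f t * excursion y t) \<le> 2 / y * (LINT s:{0..T}|lborel. (q s)\<^sup>2)"
    by (simp only: ennreal_le_iff)
  then show "(LINT t:{0..T}|lborel. \<bar>q t\<bar> * excursion y t) \<le> 2 / y * (LINT s:{0..T}|lborel. (q s)\<^sup>2)"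
    by (simp add: set_lebesgue_integral_def f_def mult.assoc)
qed

end

context potential
begin

lemma picard_vacuum_bound:
  assumes y: "y > 0" and t: "t \<ge> 0"
    and b: "\<And>\<tau>. \<tau> \<in> {0..t} \<Longrightarrow> cmod (picard (of_real y) m (-1) \<tau>) \<le> \<beta> \<tau>"
      "\<And>\<tau>. \<tau> \<in> {0..t} \<Longrightarrow> cmod (picard (of_real y) m 1 \<tau>) \<le> \<beta> \<tau>"
    and int: "set_integrable lborel {0..t} (\<lambda>\<tau>. \<bar>q \<tau>\<bar> * \<beta> \<tau>)"
  shows "cmod (picard (of_real y) (Suc m) 0 t - 1) \<le> (LINT \<tau>:{0..t}|lborel. \<bar>q \<tau>\<bar> * \<beta> \<tau>)"
proof -
  have \<zeta>: "0 \<le> Re (complex_of_real y)" using y by simp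
  define F where "F \<tau> = exp (- (of_real y * of_real ((t - \<tau>) * (of_int 0)\<^sup>2))) *
      ((picard (of_real y) m (0 - 1) \<tau> + picard (of_real y) m (0 + 1) \<tau>) / 2) * of_real (q \<tau>)" for \<tau>
  have Pb: "cmod (picard (of_real y) m j \<tau>) \<le> exp (A t)" if "\<tau> \<in> {0..t}" for \<tau> j
    by (rule order_trans[OF picard_bounded[OF \<zeta>]]) (use that A_mono[of \<tau> t] in auto)
  have iF: "set_integrable lborel {0..t} F"
    unfolding F_def by (rule duhamel_integrable[OF \<zeta> picard_measurable Pb])
  have "cmod (picard (of_real y) (Suc m) 0 t - 1) = cmod (LINT \<tau>:{0..t}|lborel. F \<tau>)"
    by (simp add: duhamel_def F_def norm_mult)
  also have "\<dots> \<le> (LINT \<tau>:{0..t}|lborel. cmod (F \<tau>))" by (rule set_integral_norm_bound[OF iF])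
  also have "\<dots> \<le> (LINT \<tau>:{0..t}|lborel. \<bar>q \<tau>\<bar> * \<beta> \<tau>)"
  proof (rule set_integral_mono[OF set_integrable_norm[OF iF] int])
    fix \<tau> assume \<tau>: "\<tau> \<in> {0..t}"
    have "cmod (picard (of_real y) m (0 - 1) \<tau> + picard (of_real y) m (0 + 1) \<tau>) \<le> \<beta> \<tau> + \<beta> \<tau>"
      using b[OF \<tau>] by (intro norm_triangle_le add_mono) simp_all
    then have "cmod ((picard (of_real y) m (0 - 1) \<tau> + picard (of_real y) m (0 + 1) \<tau>) / 2) \<le> \<beta> \<tau>"
      by (simp add: norm_divide)
    then have "cmod ((picard (of_real y) m (0 - 1) \<tau> + picard (of_real y) m (0 + 1) \<tau>) / 2) * \<bar>q \<tau>\<bar> \<le> \<beta> \<tau> * \<bar>q \<tau>\<bar>"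
      by (rule mult_right_mono) simp
    then show "cmod (F \<tau>) \<le> \<bar>q \<tau>\<bar> * \<beta> \<tau>" by (simp add: F_def norm_mult mult.commute)
  qed
  finally show ?thesis .
qed

text \<open>A bootstrap: off frequency \<open>0\<close> the iterates are \<open>O(y\<^sup>-\<^sup>1\<^sup>/\<^sup>2)\<close>, hence the iterate at frequency \<open>0\<close> is
  \<open>1 + O(y\<^sup>-\<^sup>1\<^sup>/\<^sup>2)\<close>, and with this the amplitudes at \<open>\<plusminus>1\<close> are half an excursion to leading order.
  Returning to frequency \<open>0\<close> then contributes \<open>(1/2) (2/y) \<integral>q\<^sup>2\<close>.\<close>

lemma heat_vacuum_bound:
  assumes y: "y > 0" and T: "T \<ge> 0" and q2: "set_integrable lborel {0..T} (\<lambda>s. (q s)\<^sup>2)"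
  defines "I \<equiv> (LINT s:{0..T}|lborel. (q s)\<^sup>2)"
  defines "\<epsilon> \<equiv> exp (A T) * ((1 + I) / sqrt y)"
  shows "cmod (picard (of_real y) m 0 T - 1) \<le> (1 + (A T + 1) * \<epsilon>) * I / y"
proof -
  have \<zeta>: "0 \<le> Re (complex_of_real y)" using y by simp
  have I0: "I \<ge> 0" by (simp add: I_def set_lebesgue_integral_def)
  have e0: "\<epsilon> \<ge> 0" using I0 y by (simp add: \<epsilon>_def)
  have A0: "A T \<ge> 0" by (rule A_nonneg)
  have Pb: "cmod (picard (of_real y) m j \<tau>) \<le> exp (A T)" if "\<tau> \<in> {0..T}" for \<tau> j m
    by (rule order_trans[OF picard_bounded[OF \<zeta>]]) (use that A_mono[of \<tau> T] in auto)
  \<comment> \<open>one excursion, starting from the crude bound \<open>e\<^sup>A\<close>\<close>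
  have off: "cmod (picard (of_real y) m n t) \<le> \<epsilon>" if t: "t \<in> {0..T}" and n: "n \<noteq> 0" for m n t
  proof (cases m)
    case 0
    then show ?thesis using n e0 by simp
  next
    case (Suc m')
    have "cmod (picard (of_real y) (Suc m') n t) \<le> exp (A T) * excursion y t"
    proof (rule heat_picard_bound[OF y n])
      fix \<tau> assume "\<tau> \<in> {0..t}"
      then have "\<tau> \<in> {0..T}" using t by auto
      then have "cmod (picard (of_real y) m' (n - 1) \<tau> + picard (of_real y) m' (n + 1) \<tau>) \<le> exp (A T) + exp (A T)"
        by (intro norm_triangle_le add_mono Pb)
      then show "cmod (picard (of_real y) m' (n - 1) \<tau> + picard (of_real y) m' (n + 1) \<tau>) \<le> 2 * exp (A T)" by simp
    qed (use t in simp)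
    also have "\<dots> \<le> \<epsilon>"
      unfolding \<epsilon>_def I_def by (intro mult_left_mono excursion_small[OF y t q2]) simp
    finally show ?thesis using Suc by simp
  qed
  have vac: "cmod (picard (of_real y) m 0 t - 1) \<le> A T * \<epsilon>" if t: "t \<in> {0..T}" for m t
  proof (cases m)
    case 0
    then show ?thesis using A0 e0 by simp
  next
    case (Suc m')
    have "cmod (picard (of_real y) (Suc m') 0 t - 1) \<le> (LINT \<tau>:{0..t}|lborel. \<bar>q \<tau>\<bar> * \<epsilon>)"
      by (rule picard_vacuum_bound[OF y]) (use t off q_abs_int[of t] in auto)
    also have "\<dots> = A t * \<epsilon>" by (simp add: A_def)
    also have "\<dots> \<le> A T * \<epsilon>" using t e0 by (intro mult_right_mono A_mono) auto
    finally show ?thesis using Suc by simp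
  qed
  define L where "L = (1 + (A T + 1) * \<epsilon>) / 2"
  have L0: "L \<ge> 0" using A0 e0 by (simp add: L_def)
  have first: "cmod (picard (of_real y) m n t) \<le> L * excursion y t" if t: "t \<in> {0..T}" and n: "n = 1 \<or> n = -1" for m n t
  proof (cases m)
    case 0
    then show ?thesis using n L0 excursion_nonneg[of y t] by auto
  next
    case (Suc m')
    have "cmod (picard (of_real y) (Suc m') n t) \<le> L * excursion y t"
    proof (rule heat_picard_bound[OF y])
      fix \<tau> assume "\<tau> \<in> {0..t}"
      then have \<tau>: "\<tau> \<in> {0..T}" using t by auto
      have v: "cmod (picard (of_real y) m' 0 \<tau>) \<le> 1 + A T * \<epsilon>"
        using vac[OF \<tau>, of m'] norm_triangle_ineq[of "picard (of_real y) m' 0 \<tau> - 1" 1] by simp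
      have "cmod (picard (of_real y) m' (n - 1) \<tau> + picard (of_real y) m' (n + 1) \<tau>) \<le> (1 + A T * \<epsilon>) + \<epsilon>"
        using n
      proof
        assume n: "n = 1"
        show ?thesis
          by (rule norm_triangle_le, rule add_mono) (use n v off[OF \<tau>, of 2 m'] in simp_all)
      next
        assume n: "n = -1"
        have "cmod (picard (of_real y) m' (n - 1) \<tau> + picard (of_real y) m' (n + 1) \<tau>) \<le> \<epsilon> + (1 + A T * \<epsilon>)"
          by (rule norm_triangle_le, rule add_mono) (use n v off[OF \<tau>, of "-2" m'] in simp_all)
        then show ?thesis by simp
      qed
      then show "cmod (picard (of_real y) m' (n - 1) \<tau> + picard (of_real y) m' (n + 1) \<tau>) \<le> 2 * L"
        by (simp add: L_def algebra_simps)
    qed (use n t in auto)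
    then show ?thesis using Suc by simp
  qed
  have "cmod (picard (of_real y) m 0 T - 1) \<le> L * (2 / y * I)"
  proof (cases m)
    case 0
    then show ?thesis using L0 I0 y by simp
  next
    case (Suc m')
    have i: "set_integrable lborel {0..T} (\<lambda>t. L * (\<bar>q t\<bar> * excursion y t))"
      by (rule set_integrable_mult_right[OF excursion_total(1)[OF y T q2]])
    have eq: "\<bar>q t\<bar> * (L * excursion y t) = L * (\<bar>q t\<bar> * excursion y t)" for t by simp
    have "cmod (picard (of_real y) (Suc m') 0 T - 1) \<le> (LINT t:{0..T}|lborel. \<bar>q t\<bar> * (L * excursion y t))"
      by (rule picard_vacuum_bound[OF y T]) (use first i in \<open>auto simp only: eq\<close>)
    also have "\<dots> = L * (LINT t:{0..T}|lborel. \<bar>q t\<bar> * excursion y t)"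
      unfolding eq by (rule set_integral_mult_right)
    also have "\<dots> \<le> L * (2 / y * I)"
      unfolding I_def by (intro mult_left_mono excursion_total(2)[OF y T q2] L0)
    finally show ?thesis using Suc by simp
  qed
  also have "L * (2 / y * I) = (1 + (A T + 1) * \<epsilon>) * I / y" by (simp add: L_def)
  finally show ?thesis .
qed

text \<open>For fixed \<open>k\<close> the solution is merely given; as a limit of Picard iterates it depends measurably on \<open>k\<close>.\<close>

lemma coeff_measurable_k:
  assumes sys: "\<And>k. coeff_system q k (c k)" and t: "t \<ge> 0"
  shows "(\<lambda>k. c k n t) \<in> borel_measurable borel"
proof (rule borel_measurable_LIMSEQ_metric)
  show "(\<lambda>k. picard (\<i> * complex_of_real k) m n t) \<in> borel_measurable borel" for m
    using measurable_compose[OF _ picard_measurable_k, of "\<lambda>k. (k, t)" borel m n] by simp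
  show "(\<lambda>m. picard (\<i> * complex_of_real k) m n t) \<longlonglongrightarrow> c k n t" for k
    by (rule coeff_picard_limit[OF sys t])
qed

text \<open>The kernel's factor \<open>\<pi> y\<close> compensates the factor \<open>1/y\<close> of the heat evolution.\<close>

lemma vacuum_average_le:
  assumes sys: "\<And>k. coeff_system q k (c k)" and T: "T \<ge> 0" and q2: "set_integrable lborel {0..T} (\<lambda>s. (q s)\<^sup>2)"
    and y: "y > 0"
  defines "I \<equiv> (LINT s:{0..T}|lborel. (q s)\<^sup>2)"
  shows "(\<integral>\<^sup>+k. ennreal ((1 - Re (c k 0 T)) * cauchy_kernel y k) \<partial>lborel)
    \<le> ennreal (pi * (1 + (A T + 1) * (exp (A T) * ((1 + I) / sqrt y))) * I)"
proof -
  note K = cauchy_kernel_integrable[OF y]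
  define B where "B = pi * (1 + (A T + 1) * (exp (A T) * ((1 + I) / sqrt y))) * I"
  have I0: "I \<ge> 0" by (simp add: I_def set_lebesgue_integral_def)
  have \<zeta>: "0 \<le> Re (\<i> * of_real k)" for k by simp
  have [measurable]: "(\<lambda>k. c k 0 T) \<in> borel_measurable borel" by (rule coeff_measurable_k[OF sys T])
  have [measurable]: "(\<lambda>k. picard (\<i> * complex_of_real k) m 0 T) \<in> borel_measurable borel" for m
    using measurable_compose[OF _ picard_measurable_k, of "\<lambda>k. (k, T)" borel m 0] by simp
  have Pb: "cmod (picard (\<i> * of_real k) m 0 T) \<le> exp (A T)" for k m by (rule picard_bounded[OF \<zeta> T])
  have iK: "integrable lborel (\<lambda>k. complex_of_real (cauchy_kernel y k))" using K by (simp add: complex_of_real_integrable_eq)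
  have iP: "integrable lborel (\<lambda>k. picard (\<i> * of_real k) m 0 T * of_real (cauchy_kernel y k))" for m
    using integrable_mult_right[OF K, of "exp (A T)"]
    by (rule Bochner_Integration.integrable_bound)
      (use Pb cauchy_kernel_nonneg in \<open>auto simp: norm_mult abs_mult intro!: mult_right_mono\<close>)
  have fin: "(LINT k|lborel. (1 - Re (picard (\<i> * of_real k) m 0 T)) * cauchy_kernel y k) \<le> B" for m
  proof -
    have "complex_of_real (LINT k|lborel. cauchy_kernel y k) = of_real (pi * y)"
      using cauchy_kernel_fourier[OF y, of 0] by simp
    then have k1: "(LINT k|lborel. cauchy_kernel y k) = pi * y" by (simp only: of_real_eq_iff)
    have k2: "(LINT k|lborel. picard (\<i> * of_real k) m 0 T * of_real (cauchy_kernel y k)) = of_real (pi * y) * picard (of_real y) m 0 T"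
      using picard_cauchy_average[OF y T, of 0 m 0] by simp
    have "(LINT k|lborel. Re (picard (\<i> * of_real k) m 0 T * of_real (cauchy_kernel y k))) = Re (of_real (pi * y) * picard (of_real y) m 0 T)"
      unfolding k2[symmetric] by (rule integral_bounded_linear[OF bounded_linear_Re iP])
    moreover have "integrable lborel (\<lambda>k. Re (picard (\<i> * of_real k) m 0 T * of_real (cauchy_kernel y k)))"
      by (rule integrable_bounded_linear[OF bounded_linear_Re iP])
    ultimately have "(LINT k|lborel. cauchy_kernel y k - Re (picard (\<i> * of_real k) m 0 T * of_real (cauchy_kernel y k)))
        = pi * y - Re (of_real (pi * y) * picard (of_real y) m 0 T)"
      using K by (simp add: k1)
    then have "(LINT k|lborel. (1 - Re (picard (\<i> * of_real k) m 0 T)) * cauchy_kernel y k) = pi * y * Re (1 - picard (of_real y) m 0 T)"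
      by (simp add: algebra_simps)
    also have "\<dots> \<le> pi * y * ((1 + (A T + 1) * (exp (A T) * ((1 + I) / sqrt y))) * I / y)"
      using heat_vacuum_bound[OF y T q2, of m] complex_Re_le_cmod[of "1 - picard (of_real y) m 0 T"] y
      by (intro mult_left_mono) (auto simp: I_def norm_minus_commute)
    also have "\<dots> = B" using y by (simp add: B_def)
    finally show ?thesis .
  qed
  have "(\<lambda>m. LINT k|lborel. (1 - Re (picard (\<i> * of_real k) m 0 T)) * cauchy_kernel y k)
      \<longlonglongrightarrow> (LINT k|lborel. (1 - Re (c k 0 T)) * cauchy_kernel y k)"
  proof (rule integral_dominated_convergence[where w = "\<lambda>k. (1 + exp (A T)) * cauchy_kernel y k"])
    show "AE k in lborel. (\<lambda>m. (1 - Re (picard (\<i> * of_real k) m 0 T)) * cauchy_kernel y k) \<longlonglongrightarrow> (1 - Re (c k 0 T)) * cauchy_kernel y k"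
      by (intro AE_I2 tendsto_intros coeff_picard_limit[OF sys T])
    show "AE k in lborel. norm ((1 - Re (picard (\<i> * of_real k) m 0 T)) * cauchy_kernel y k) \<le> (1 + exp (A T)) * cauchy_kernel y k" for m
    proof (rule AE_I2)
      fix k
      have "\<bar>1 - Re (picard (\<i> * of_real k) m 0 T)\<bar> \<le> 1 + exp (A T)"
        using Pb[of k m] abs_Re_le_cmod[of "picard (\<i> * of_real k) m 0 T"] by linarith
      then show "norm ((1 - Re (picard (\<i> * of_real k) m 0 T)) * cauchy_kernel y k) \<le> (1 + exp (A T)) * cauchy_kernel y k"
        using cauchy_kernel_nonneg[of y k] by (simp add: abs_mult mult_right_mono)
    qed
    show "integrable lborel (\<lambda>k. (1 + exp (A T)) * cauchy_kernel y k)" by (rule integrable_mult_right[OF K])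
  qed measurable
  then have le: "(LINT k|lborel. (1 - Re (c k 0 T)) * cauchy_kernel y k) \<le> B"
    by (rule LIMSEQ_le_const2) (use fin in blast)
  have c1: "\<bar>Re (c k 0 T)\<bar> \<le> 1" for k
    using abs_Re_le_cmod[of "c k 0 T"] coeff_le_1[OF sys T, of k 0] by linarith
  have pos: "0 \<le> (1 - Re (c k 0 T)) * cauchy_kernel y k" for k
    using c1[of k] cauchy_kernel_nonneg[of y k] by (intro mult_nonneg_nonneg) auto
  have "integrable lborel (\<lambda>k. (1 - Re (c k 0 T)) * cauchy_kernel y k)"
  proof (rule Bochner_Integration.integrable_bound[OF integrable_mult_right[OF K, of 2]])
    show "AE k in lborel. norm ((1 - Re (c k 0 T)) * cauchy_kernel y k) \<le> norm (2 * cauchy_kernel y k)"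
    proof (rule AE_I2)
      fix k
      have "\<bar>1 - Re (c k 0 T)\<bar> \<le> 2" using c1[of k] by linarith
      then show "norm ((1 - Re (c k 0 T)) * cauchy_kernel y k) \<le> norm (2 * cauchy_kernel y k)"
        using cauchy_kernel_nonneg[of y k] by (simp add: abs_mult mult_right_mono)
    qed
  qed measurable
  then have "(\<integral>\<^sup>+k. ennreal ((1 - Re (c k 0 T)) * cauchy_kernel y k) \<partial>lborel) = ennreal (LINT k|lborel. (1 - Re (c k 0 T)) * cauchy_kernel y k)"
    by (rule nn_integral_eq_integral) (use pos in simp)
  then show ?thesis using le by (simp add: B_def ennreal_leI)
qed

text \<open>As the heat parameter tends to infinity the kernel increases to \<open>1\<close>, and the correction in
  the bound disappears.\<close>

theorem vacuum_L1:
  assumes sys: "\<And>k. coeff_system q k (c k)" and T: "T \<ge> 0" and q2: "set_integrable lborel {0..T} (\<lambda>s. (q s)\<^sup>2)"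
  shows "(\<integral>\<^sup>+k. ennreal (1 - Re (c k 0 T)) \<partial>lborel) \<le> ennreal (pi * (LINT s:{0..T}|lborel. (q s)\<^sup>2))"
proof -
  define I where "I = (LINT s:{0..T}|lborel. (q s)\<^sup>2)"
  define B where "B y = pi * (1 + (A T + 1) * (exp (A T) * ((1 + I) / sqrt y))) * I" for y
  have [measurable]: "(\<lambda>k. c k 0 T) \<in> borel_measurable borel" by (rule coeff_measurable_k[OF sys T])
  have Blim: "(\<lambda>j. B (real (Suc j))) \<longlonglongrightarrow> pi * I"
  proof -
    have "(B \<longlongrightarrow> pi * (1 + (A T + 1) * (exp (A T) * 0)) * I) at_top"
      unfolding B_def by (intro tendsto_intros) real_asymp
    then have "(B \<longlongrightarrow> pi * I) at_top" by simp
    then show ?thesis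
      by (rule filterlim_compose) (rule filterlim_compose[OF filterlim_real_sequentially filterlim_Suc])
  qed
  have "(\<integral>\<^sup>+k. ennreal (1 - Re (c k 0 T)) \<partial>lborel)
      = (\<integral>\<^sup>+k. liminf (\<lambda>j. ennreal ((1 - Re (c k 0 T)) * cauchy_kernel (real (Suc j)) k)) \<partial>lborel)"
  proof (rule nn_integral_cong)
    fix k
    have "((\<lambda>y. cauchy_kernel y k) \<longlongrightarrow> 1) at_top" unfolding cauchy_kernel_def by real_asymp
    then have "(\<lambda>j. cauchy_kernel (real (Suc j)) k) \<longlonglongrightarrow> 1"
      by (rule filterlim_compose) (rule filterlim_compose[OF filterlim_real_sequentially filterlim_Suc])
    then have "(\<lambda>j. ennreal ((1 - Re (c k 0 T)) * cauchy_kernel (real (Suc j)) k)) \<longlonglongrightarrow> ennreal ((1 - Re (c k 0 T)) * 1)"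
      by (intro tendsto_intros)
    then show "ennreal (1 - Re (c k 0 T)) = liminf (\<lambda>j. ennreal ((1 - Re (c k 0 T)) * cauchy_kernel (real (Suc j)) k))"
      by (subst lim_imp_Liminf) auto
  qed
  also have "\<dots> \<le> liminf (\<lambda>j. \<integral>\<^sup>+k. ennreal ((1 - Re (c k 0 T)) * cauchy_kernel (real (Suc j)) k) \<partial>lborel)"
    by (rule nn_integral_liminf) measurable
  also have "\<dots> \<le> liminf (\<lambda>j. ennreal (B (real (Suc j))))"
    by (intro Liminf_mono always_eventually allI)
      (unfold B_def I_def, rule vacuum_average_le[OF sys T q2], simp)
  also have "\<dots> = ennreal (pi * I)"
    by (rule lim_imp_Liminf) (use Blim in \<open>auto intro: tendsto_ennrealI\<close>)
  finally show ?thesis unfolding I_def .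
qed

text \<open>The mass off frequency \<open>0\<close> is \<open>1 - |c\<^sub>0|\<^sup>2 \<le> 2 Re (1 - c\<^sub>0)\<close>.\<close>

lemma off_vacuum_mass_le:
  assumes sys: "coeff_system q k c" and t: "t \<ge> 0" and F: "finite F" "0 \<notin> F"
  shows "(\<Sum>n\<in>F. (cmod (c n t))\<^sup>2) \<le> 2 * (1 - Re (c 0 t))"
proof -
  have "(\<Sum>n\<in>insert 0 F. (cmod (c n t))\<^sup>2) \<le> 1" by (rule square_sum_le_1[OF sys t]) (use F in simp)
  then have "(\<Sum>n\<in>F. (cmod (c n t))\<^sup>2) \<le> 1 - (cmod (c 0 t))\<^sup>2" using F by simp
  also have "\<dots> \<le> 1 - (Re (c 0 t))\<^sup>2"
    using power_mono[OF abs_Re_le_cmod[of "c 0 t"], of 2] by simp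
  also have "\<dots> \<le> 2 * (1 - Re (c 0 t))"
    using zero_le_power2[of "1 - Re (c 0 t)"] by (simp add: power2_eq_square algebra_simps)
  finally show ?thesis .
qed

end

section \<open>Square functions over dyadic shells\<close>

definition shell :: "real \<Rightarrow> real set" where
  "shell \<kappa> = {k. \<kappa> < \<bar>k\<bar> \<and> \<bar>k\<bar> \<le> 2 * \<kappa>}"

lemma shell_borel [measurable]: "shell \<kappa> \<in> sets borel"
  unfolding shell_def by measurable

text \<open>A given \<open>\<omega>\<close> lies in the shell dilated by \<open>r\<close> only if \<open>|r|\<close> is between \<open>|\<omega>|/(2\<kappa>)\<close> and \<open>|\<omega>|/\<kappa>\<close>, a dyadic range
  over which the reciprocals of the odd integers have a bounded sum.\<close>

lemma odd_shell_count_le: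
  assumes \<kappa>: "\<kappa> > 0"
  shows "(\<Sum>n\<in>{-int M..int M + 1}. (1 / \<bar>real_of_int (2 * n - 1)\<bar>) * indicator (shell \<kappa>) (\<omega> / of_int (2 * n - 1))) \<le> (4 :: real)"
proof -
  define I where "I = {-int M..int M + 1}"
  define x where "x = \<bar>\<omega>\<bar> / \<kappa>"
  define S where "S = {n \<in> I. \<omega> / of_int (2 * n - 1) \<in> shell \<kappa>}"
  have fin: "finite S" by (rule finite_subset[of _ I]) (auto simp: S_def I_def)
  have S: "\<bar>real_of_int (2 * n - 1)\<bar> < x" "x \<le> 2 * \<bar>real_of_int (2 * n - 1)\<bar>" if "n \<in> S" for n
  proof -
    define j where "j = real_of_int (2 * n - 1)"
    have "2 * n - 1 \<noteq> 0" by presburger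
    then have "real_of_int (2 * n - 1) \<noteq> 0" by (simp only: of_int_eq_0_iff not_False_eq_True)
    then have j: "\<bar>j\<bar> > 0" by (simp add: j_def)
    have sh: "\<kappa> < \<bar>\<omega>\<bar> / \<bar>j\<bar>" "\<bar>\<omega>\<bar> / \<bar>j\<bar> \<le> 2 * \<kappa>"
      using that by (simp_all add: S_def shell_def j_def)
    show "\<bar>real_of_int (2 * n - 1)\<bar> < x" "x \<le> 2 * \<bar>real_of_int (2 * n - 1)\<bar>"
      unfolding j_def[symmetric] x_def using sh j \<kappa> by (simp_all add: field_simps)
  qed
  have "(\<Sum>n\<in>I. (1 / \<bar>real_of_int (2 * n - 1)\<bar>) * indicator (shell \<kappa>) (\<omega> / of_int (2 * n - 1)))
      = (\<Sum>n\<in>S. 1 / \<bar>real_of_int (2 * n - 1)\<bar>)"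
    by (rule sum.mono_neutral_cong_right) (auto simp: S_def I_def indicator_def)
  also have "\<dots> \<le> 4"
  proof (cases "S = {}")
    case False
    then have x: "x > 0" using S(1) abs_ge_zero by (meson all_not_in_conv le_less_trans)
    have "(\<lambda>n. 2 * n - 1) ` S \<subseteq> {-\<lfloor>x\<rfloor>..\<lfloor>x\<rfloor>} - {0}"
    proof (rule image_subsetI)
      fix n assume "n \<in> S"
      then have "real_of_int \<bar>2 * n - 1\<bar> < x" using S(1) by simp
      then have "\<bar>2 * n - 1\<bar> \<le> \<lfloor>x\<rfloor>" by (simp only: le_floor_iff less_imp_le)
      moreover have "2 * n - 1 \<noteq> 0" by presburger
      ultimately show "2 * n - 1 \<in> {-\<lfloor>x\<rfloor>..\<lfloor>x\<rfloor>} - {0}" by auto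
    qed
    then have "card ((\<lambda>n. 2 * n - 1) ` S) \<le> card ({-\<lfloor>x\<rfloor>..\<lfloor>x\<rfloor>} - {0})" by (intro card_mono) auto
    moreover have "card ((\<lambda>n. 2 * n - 1) ` S) = card S" by (rule card_image) (auto simp: inj_on_def)
    moreover have "card ({-\<lfloor>x\<rfloor>..\<lfloor>x\<rfloor>} - {0}) = nat (2 * \<lfloor>x\<rfloor>)" using x by (simp add: card_Diff_singleton_if)
    ultimately have "card S \<le> nat (2 * \<lfloor>x\<rfloor>)" by simp
    then have "real (card S) \<le> real (nat (2 * \<lfloor>x\<rfloor>))" by (simp only: of_nat_le_iff)
    also have "\<dots> \<le> 2 * x" using x by simp
    finally have card: "real (card S) \<le> 2 * x" .
    have "(\<Sum>n\<in>S. 1 / \<bar>real_of_int (2 * n - 1)\<bar>) \<le> (\<Sum>n\<in>S. 2 / x)"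
    proof (rule sum_mono)
      fix n assume n: "n \<in> S"
      define a where "a = \<bar>real_of_int (2 * n - 1)\<bar>"
      have a: "x \<le> 2 * a" using S(2)[OF n] by (simp add: a_def)
      then have "a > 0" using x by simp
      then show "1 / \<bar>real_of_int (2 * n - 1)\<bar> \<le> 2 / x"
        unfolding a_def[symmetric] using a x by (simp add: field_simps)
    qed
    also have "\<dots> = real (card S) * (2 / x)" by simp
    also have "\<dots> \<le> 2 * x * (2 / x)" using card x by (intro mult_right_mono) auto
    also have "\<dots> = 4" using x by simp
    finally show ?thesis .
  qed simp
  finally show ?thesis unfolding I_def .
qed

text \<open>Rescaling \<open>\<omega> = (2n-1) k\<close> turns the \<open>n\<close>-th term into an integral over the shell dilated by
  \<open>2n-1\<close>, with weight \<open>1/|2n-1|\<close>; a given \<open>\<omega>\<close> lies in about as many dilated shells as the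
  reciprocal of these weights.\<close>

lemma shell_square_function_le:
  fixes G :: "real \<Rightarrow> ennreal"
  assumes \<kappa>: "\<kappa> > 0" and [measurable]: "G \<in> borel_measurable borel"
  shows "(\<integral>\<^sup>+k. indicator (shell \<kappa>) k * (\<Sum>n\<in>{-int M..int M + 1}. G (of_int (2 * n - 1) * k)) \<partial>lborel) \<le> 4 * (\<integral>\<^sup>+\<omega>. G \<omega> \<partial>lborel)"
proof -
  define I where "I = {-int M..int M + 1}"
  have one: "(\<integral>\<^sup>+k. indicator (shell \<kappa>) k * G (of_int (2 * n - 1) * k) \<partial>lborel)
      = (\<integral>\<^sup>+\<omega>. ennreal ((1 / \<bar>real_of_int (2 * n - 1)\<bar>) * indicator (shell \<kappa>) (\<omega> / of_int (2 * n - 1))) * G \<omega> \<partial>lborel)" for n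
  proof -
    define j where "j = real_of_int (2 * n - 1)"
    have "2 * n - 1 \<noteq> 0" by presburger
    then have j: "j \<noteq> 0" unfolding j_def by (simp only: of_int_eq_0_iff not_False_eq_True)
    define H where "H \<omega> = indicator (shell \<kappa>) (\<omega> / j) * G \<omega>" for \<omega>
    have [measurable]: "(\<lambda>\<omega>. indicator (shell \<kappa>) (\<omega> / j) :: ennreal) \<in> borel_measurable borel"
      by (rule measurable_compose[of _ borel borel, OF _ borel_measurable_indicator]) measurable
    have Hm [measurable]: "H \<in> borel_measurable borel" unfolding H_def by measurable
    have "(\<integral>\<^sup>+\<omega>. H \<omega> \<partial>lborel) = ennreal \<bar>j\<bar> * (\<integral>\<^sup>+k. H (0 + j * k) \<partial>lborel)"
      by (rule nn_integral_real_affine[OF Hm j])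
    then have "ennreal (1 / \<bar>j\<bar>) * (\<integral>\<^sup>+\<omega>. H \<omega> \<partial>lborel) = (ennreal (1 / \<bar>j\<bar>) * ennreal \<bar>j\<bar>) * (\<integral>\<^sup>+k. H (j * k) \<partial>lborel)"
      by (simp add: mult.assoc)
    also have "ennreal (1 / \<bar>j\<bar>) * ennreal \<bar>j\<bar> = 1" using j by (simp flip: ennreal_mult)
    finally have "(\<integral>\<^sup>+k. H (j * k) \<partial>lborel) = ennreal (1 / \<bar>j\<bar>) * (\<integral>\<^sup>+\<omega>. H \<omega> \<partial>lborel)" by simp
    also have "\<dots> = (\<integral>\<^sup>+\<omega>. ennreal (1 / \<bar>j\<bar>) * H \<omega> \<partial>lborel)" by (rule nn_integral_cmult[symmetric]) measurable
    also have "\<dots> = (\<integral>\<^sup>+\<omega>. ennreal ((1 / \<bar>j\<bar>) * indicator (shell \<kappa>) (\<omega> / j)) * G \<omega> \<partial>lborel)"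
      by (rule nn_integral_cong) (simp add: H_def indicator_def)
    also have "(\<integral>\<^sup>+k. H (j * k) \<partial>lborel) = (\<integral>\<^sup>+k. indicator (shell \<kappa>) k * G (j * k) \<partial>lborel)"
      using j by (simp add: H_def)
    finally show ?thesis by (simp add: j_def)
  qed
  have wm [measurable]: "(\<lambda>\<omega>. ennreal ((1 / \<bar>real_of_int (2 * n - 1)\<bar>) * indicator (shell \<kappa>) (\<omega> / of_int (2 * n - 1)))) \<in> borel_measurable borel" for n
  proof -
    have "(\<lambda>\<omega>. indicator (shell \<kappa>) (\<omega> / of_int (2 * n - 1)) :: real) \<in> borel_measurable borel"
      by (rule measurable_compose[of _ borel borel, OF _ borel_measurable_indicator]) measurable
    then show ?thesis by measurable
  qed
  have "(\<integral>\<^sup>+k. indicator (shell \<kappa>) k * (\<Sum>n\<in>I. G (of_int (2 * n - 1) * k)) \<partial>lborel)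
      = (\<Sum>n\<in>I. \<integral>\<^sup>+k. indicator (shell \<kappa>) k * G (of_int (2 * n - 1) * k) \<partial>lborel)"
    unfolding sum_distrib_left by (rule nn_integral_sum) measurable
  also have "\<dots> = (\<integral>\<^sup>+\<omega>. (\<Sum>n\<in>I. ennreal ((1 / \<bar>real_of_int (2 * n - 1)\<bar>) * indicator (shell \<kappa>) (\<omega> / of_int (2 * n - 1))) * G \<omega>) \<partial>lborel)"
    unfolding one by (rule nn_integral_sum[symmetric]) measurable
  also have "\<dots> \<le> (\<integral>\<^sup>+\<omega>. 4 * G \<omega> \<partial>lborel)"
  proof (rule nn_integral_mono)
    fix \<omega>
    have "(\<Sum>n\<in>I. ennreal ((1 / \<bar>real_of_int (2 * n - 1)\<bar>) * indicator (shell \<kappa>) (\<omega> / of_int (2 * n - 1))))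
        = ennreal (\<Sum>n\<in>I. (1 / \<bar>real_of_int (2 * n - 1)\<bar>) * indicator (shell \<kappa>) (\<omega> / of_int (2 * n - 1)))"
      by (rule sum_ennreal) simp
    also have "\<dots> \<le> ennreal 4"
      unfolding I_def by (rule ennreal_leI[OF odd_shell_count_le[OF \<kappa>]])
    finally show "(\<Sum>n\<in>I. ennreal ((1 / \<bar>real_of_int (2 * n - 1)\<bar>) * indicator (shell \<kappa>) (\<omega> / of_int (2 * n - 1))) * G \<omega>) \<le> 4 * G \<omega>"
      unfolding sum_distrib_right[symmetric] by (intro mult_right_mono) auto
  qed
  also have "\<dots> = 4 * (\<integral>\<^sup>+\<omega>. G \<omega> \<partial>lborel)" by (rule nn_integral_cmult) measurable
  finally show ?thesis unfolding I_def .
qed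

lemma powr_tail_nn_integral:
  fixes a T :: real
  assumes a: "a > 1" and T: "T > 0"
  shows "(\<integral>\<^sup>+t. ennreal (t powr (- a)) * indicator {T..} t \<partial>lborel) = ennreal (T powr (1 - a) / (a - 1))"
proof -
  have "(\<integral>\<^sup>+t. ennreal (t powr (- a)) * indicator {T..} t \<partial>lborel) = ennreal (0 - T powr (1 - a) * (1 / (1 - a)))"
  proof (rule nn_integral_FTC_atLeast)
    show "(\<lambda>t. t powr (- a)) \<in> borel_measurable borel" by measurable
    show "((\<lambda>t. t powr (1 - a) * (1 / (1 - a))) has_real_derivative x powr (- a)) (at x)" if "T \<le> x" for x
    proof -
      have "((\<lambda>t. t powr (1 - a)) has_real_derivative (1 - a) * x powr (1 - a - 1)) (at x)"
        by (rule has_real_derivative_powr) (use that T in simp)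
      from DERIV_cmult_right[OF this, of "1 / (1 - a)"] show ?thesis using a by simp
    qed
    show "((\<lambda>t. t powr (1 - a) * (1 / (1 - a))) \<longlongrightarrow> 0) at_top"
      using a by real_asymp
  qed simp
  also have "0 - T powr (1 - a) * (1 / (1 - a)) = T powr (1 - a) / (a - 1)"
    using a by (simp add: divide_simps) (simp add: algebra_simps)
  finally show ?thesis .
qed

text \<open>The upper bound \<open>\<gamma> < 1\<close> makes \<open>\<integral>\<^sub>0\<^sup>T |q|\<close> grow at most like \<open>T\<^sup>1\<^sup>-\<^sup>\<gamma>\<close> without a logarithm.  A faster decay
  implies a slower one for \<open>t \<ge> 1\<close>, where alone the decay is imposed.\<close>

locale decaying_potential = potential +
  fixes \<gamma> C :: real
  assumes gamma: "3 / 4 < \<gamma>" "\<gamma> < 1" and C: "C \<ge> 0"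
    and decay: "AE t in lborel. t \<ge> 1 \<longrightarrow> \<bar>q t\<bar> \<le> C * t powr (- \<gamma>)"
begin

lemma square_tail_le:
  assumes t: "t \<ge> 1"
  shows "(\<integral>\<^sup>+s. ennreal ((indicator {t..R} s * q s)\<^sup>2) \<partial>lborel) \<le> ennreal (C\<^sup>2 / (2 * \<gamma> - 1) * t powr (1 - 2 * \<gamma>))"
proof -
  have "(\<integral>\<^sup>+s. ennreal ((indicator {t..R} s * q s)\<^sup>2) \<partial>lborel) \<le> (\<integral>\<^sup>+s. ennreal (C\<^sup>2) * (ennreal (s powr (- (2 * \<gamma>))) * indicator {t..} s) \<partial>lborel)"
  proof (rule nn_integral_mono_AE, rule AE_mp[OF decay], rule AE_I2, rule impI)
    fix s assume d: "s \<ge> 1 \<longrightarrow> \<bar>q s\<bar> \<le> C * s powr (- \<gamma>)"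
    show "ennreal ((indicator {t..R} s * q s)\<^sup>2) \<le> ennreal (C\<^sup>2) * (ennreal (s powr (- (2 * \<gamma>))) * indicator {t..} s)"
    proof (cases "s \<in> {t..R}")
      case True
      then have "\<bar>q s\<bar> \<le> C * s powr (- \<gamma>)" using d t by auto
      then have "\<bar>q s\<bar>\<^sup>2 \<le> (C * s powr (- \<gamma>))\<^sup>2" by (rule power_mono) simp
      also have "\<dots> = C\<^sup>2 * s powr (- (2 * \<gamma>))"
        by (simp add: power_mult_distrib power2_eq_square flip: powr_add)
      finally have "ennreal ((q s)\<^sup>2) \<le> ennreal (C\<^sup>2 * s powr (- (2 * \<gamma>)))" by (intro ennreal_leI) simp
      then show ?thesis using True by (simp add: ennreal_mult)
    qed simp
  qed
  also have "\<dots> = ennreal (C\<^sup>2) * (\<integral>\<^sup>+s. ennreal (s powr (- (2 * \<gamma>))) * indicator {t..} s \<partial>lborel)"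
    by (rule nn_integral_cmult) measurable
  also have "\<dots> = ennreal (C\<^sup>2) * ennreal (t powr (1 - 2 * \<gamma>) / (2 * \<gamma> - 1))"
    using gamma t by (subst powr_tail_nn_integral) auto
  also have "\<dots> = ennreal (C\<^sup>2 / (2 * \<gamma> - 1) * t powr (1 - 2 * \<gamma>))"
    using gamma by (simp flip: ennreal_mult)
  finally show ?thesis .
qed

text \<open>Plancherel's inequality for the potential cut off to \<open>[t, R]\<close>.\<close>

lemma osc_max_shell_le:
  assumes \<kappa>: "\<kappa> > 0" and t: "t \<ge> 1"
  shows "(\<integral>\<^sup>+k. indicator (shell \<kappa>) k * ennreal ((osc_max k R M t)\<^sup>2) \<partial>lborel)
    \<le> ennreal (8 * pi * (C\<^sup>2 / (2 * \<gamma> - 1)) * t powr (1 - 2 * \<gamma>))"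
proof -
  define f where "f s = indicator {t..R} s * q s" for s
  have fi: "integrable lborel f"
    using set_integrable_subinterval[OF q_int[of R], of t R] t by (simp add: set_integrable_def f_def[abs_def])
  define G where "G \<omega> = ennreal ((cmod (LINT s|lborel. of_real (f s) * cis (\<omega> * s)))\<^sup>2)" for \<omega>
  have [measurable]: "f \<in> borel_measurable borel" using fi by (auto dest: borel_measurable_integrable)
  have "(\<lambda>\<omega>. LINT s|lborel. complex_of_real (f s) * cis (\<omega> * s)) \<in> borel_measurable borel"
    by (rule lborel.borel_measurable_lebesgue_integral) (simp add: split_beta')
  then have [measurable]: "G \<in> borel_measurable borel" unfolding G_def by measurable
  have "osc k R n t = (LINT s|lborel. of_real (f s) * cis (of_int (2 * n - 1) * k * s))" for k n
    unfolding osc_def set_lebesgue_integral_def rot_def f_def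
    by (rule Bochner_Integration.integral_cong) (auto simp: indicator_def mult_ac)
  then have "ennreal ((osc_max k R M t)\<^sup>2) = (\<Sum>n\<in>{-int M..int M + 1}. G (of_int (2 * n - 1) * k))" for k
    unfolding osc_max_def G_def by (subst sum_ennreal) (simp_all add: sum_nonneg)
  then have "(\<integral>\<^sup>+k. indicator (shell \<kappa>) k * ennreal ((osc_max k R M t)\<^sup>2) \<partial>lborel) \<le> 4 * (\<integral>\<^sup>+\<omega>. G \<omega> \<partial>lborel)"
    using shell_square_function_le[OF \<kappa>, of G M] by simp
  also have "\<dots> \<le> 4 * (ennreal (2 * pi) * (\<integral>\<^sup>+s. ennreal ((f s)\<^sup>2) \<partial>lborel))"
    unfolding G_def by (intro mult_left_mono Plancherel_le fi) simp
  also have "\<dots> \<le> 4 * (ennreal (2 * pi) * ennreal (C\<^sup>2 / (2 * \<gamma> - 1) * t powr (1 - 2 * \<gamma>)))"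
    unfolding f_def by (intro mult_left_mono square_tail_le t) auto
  also have "\<dots> = ennreal (8 * pi * (C\<^sup>2 / (2 * \<gamma> - 1)) * t powr (1 - 2 * \<gamma>))"
  proof -
    define X where "X = C\<^sup>2 / (2 * \<gamma> - 1) * t powr (1 - 2 * \<gamma>)"
    have "X \<ge> 0" using gamma by (simp add: X_def)
    have "ennreal (2 * pi) * ennreal X = ennreal (2 * pi * X)"
      by (rule ennreal_mult[symmetric]) (use \<open>X \<ge> 0\<close> in auto)
    moreover have "ennreal 4 * ennreal (2 * pi * X) = ennreal (4 * (2 * pi * X))"
      by (rule ennreal_mult[symmetric]) (use \<open>X \<ge> 0\<close> in auto)
    ultimately have four: "4 * (ennreal (2 * pi) * ennreal X) = ennreal (4 * (2 * pi * X))" by simp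
    have eq: "4 * (2 * pi * X) = 8 * pi * (C\<^sup>2 / (2 * \<gamma> - 1)) * t powr (1 - 2 * \<gamma>)"
      by (simp add: X_def)
    show ?thesis using four unfolding eq by (simp only: X_def)
  qed
  finally show ?thesis .
qed


text \<open>The exponent \<open>2 \<gamma> - 3/2\<close> is positive precisely when \<open>\<gamma> > 3/4\<close>.  The weight in the
  Cauchy--Schwarz inequality is chosen to balance the two time integrals.\<close>

lemma osc_int_shell_le:
  assumes \<kappa>: "\<kappa> > 0" and T0: "T0 \<ge> 1"
  defines "\<delta> \<equiv> 2 * \<gamma> - 3 / 2"
  shows "(\<integral>\<^sup>+k. indicator (shell \<kappa>) k * ennreal ((osc_int k T0 R M)\<^sup>2) \<partial>lborel)
    \<le> ennreal (C\<^sup>2 * (8 * pi * (C\<^sup>2 / (2 * \<gamma> - 1))) / \<delta>\<^sup>2 * T0 powr (- 2 * \<delta>))"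
proof -
  have \<delta>: "\<delta> > 0" using gamma by (simp add: \<delta>_def)
  define P where "P = 8 * pi * (C\<^sup>2 / (2 * \<gamma> - 1))"
  have P: "P \<ge> 0" using gamma by (simp add: P_def)
  define W where "W = T0 powr (- \<delta>) / \<delta>"
  have W: "W \<ge> 0" using \<delta> by (simp add: W_def)
  have tailW: "(\<integral>\<^sup>+t. ennreal (t powr (- (2 * \<gamma> - 1 / 2))) * indicator {T0..} t \<partial>lborel) = ennreal W"
    using powr_tail_nn_integral[of "2 * \<gamma> - 1 / 2" T0] gamma T0 by (simp add: W_def \<delta>_def algebra_simps)
  \<comment> \<open>the split \<open>t\<^sup>-\<^sup>\<gamma> = t\<^sup>-\<^sup>(\<^sup>\<gamma>\<^sup>-\<^sup>1\<^sup>/\<^sup>4\<^sup>) t\<^sup>-\<^sup>1\<^sup>/\<^sup>4\<close> gives both squared factors the decay \<open>t\<^sup>-\<^sup>(\<^sup>2\<^sup>\<gamma>\<^sup>-\<^sup>1\<^sup>/\<^sup>2\<^sup>)\<close>\<close>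
  define u where "u t = ennreal (C * t powr (- (\<gamma> - 1 / 4))) * indicator {T0..} t" for t
  define v where "v k t = ennreal (t powr (- (1 / 4)) * osc_max k R M t) * indicator {T0..} t" for k t
  have um [measurable]: "u \<in> borel_measurable borel" unfolding u_def by measurable
  have om [measurable]: "(\<lambda>p. osc_max (fst p) R M (snd p)) \<in> borel_measurable (borel \<Otimes>\<^sub>M borel)"
    unfolding osc_max_def using osc_measurable_pair by measurable
  have vm1 [measurable]: "v k \<in> borel_measurable borel" for k unfolding v_def by measurable
  have vm: "(\<lambda>(k, t). v k t) \<in> borel_measurable (lborel \<Otimes>\<^sub>M lborel)"
  proof -
    have "(\<lambda>p. ennreal (snd p powr (- (1 / 4)) * osc_max (fst p) R M (snd p)) * indicator {T0..} (snd p)) \<in> borel_measurable (borel \<Otimes>\<^sub>M borel)"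
      by measurable
    then show ?thesis by (simp add: v_def split_beta')
  qed
  have u2: "(\<integral>\<^sup>+t. (u t)\<^sup>2 \<partial>lborel) = ennreal (C\<^sup>2 * W)"
  proof -
    have "(u t)\<^sup>2 = ennreal (C\<^sup>2) * (ennreal (t powr (- (2 * \<gamma> - 1 / 2))) * indicator {T0..} t)" for t
    proof (cases "t \<ge> T0")
      case True
      have "(C * t powr (- (\<gamma> - 1 / 4)))\<^sup>2 = C\<^sup>2 * t powr (- (2 * \<gamma> - 1 / 2))"
        by (simp add: power_mult_distrib power2_eq_square flip: powr_add)
      then show ?thesis using True C by (simp add: u_def ennreal_power flip: ennreal_mult)
    qed (simp add: u_def)
    then have "(\<integral>\<^sup>+t. (u t)\<^sup>2 \<partial>lborel) = ennreal (C\<^sup>2) * ennreal W"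
      unfolding tailW[symmetric] by (simp add: nn_integral_cmult)
    then show ?thesis using W by (simp add: ennreal_mult)
  qed
  have B_le: "ennreal ((osc_int k T0 R M)\<^sup>2) \<le> ennreal (C\<^sup>2 * W) * (\<integral>\<^sup>+t. (v k t)\<^sup>2 \<partial>lborel)" for k
  proof -
    have "ennreal (osc_int k T0 R M) = (\<integral>\<^sup>+t. ennreal (indicator {T0..R} t *\<^sub>R (\<bar>q t\<bar> * osc_max k R M t)) \<partial>lborel)"
      unfolding osc_int_def set_lebesgue_integral_def
      by (rule nn_integral_eq_integral[symmetric])
        (use osc_max_integrable[of T0 R k M] T0 osc_max_nonneg in \<open>auto simp: set_integrable_def\<close>)
    also have "\<dots> \<le> (\<integral>\<^sup>+t. u t * v k t \<partial>lborel)"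
    proof (rule nn_integral_mono_AE, rule AE_mp[OF decay], rule AE_I2, rule impI)
      fix t assume d: "t \<ge> 1 \<longrightarrow> \<bar>q t\<bar> \<le> C * t powr (- \<gamma>)"
      show "ennreal (indicator {T0..R} t *\<^sub>R (\<bar>q t\<bar> * osc_max k R M t)) \<le> u t * v k t"
      proof (cases "t \<in> {T0..R}")
        case True
        have "\<bar>q t\<bar> * osc_max k R M t \<le> (C * t powr (- \<gamma>)) * osc_max k R M t"
          using d True T0 by (intro mult_right_mono osc_max_nonneg) auto
        also have "t powr (- \<gamma>) = t powr (- (\<gamma> - 1 / 4)) * t powr (- (1 / 4))"
          by (simp flip: powr_add)
        finally have "ennreal (\<bar>q t\<bar> * osc_max k R M t) \<le> ennreal ((C * t powr (- (\<gamma> - 1 / 4))) * (t powr (- (1 / 4)) * osc_max k R M t))"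
          by (intro ennreal_leI) (simp add: mult_ac)
        also have "\<dots> = u t * v k t"
          using True C osc_max_nonneg[of k R M t] by (simp add: u_def v_def ennreal_mult)
        finally show ?thesis using True by simp
      qed simp
    qed
    finally have "(ennreal (osc_int k T0 R M))\<^sup>2 \<le> (\<integral>\<^sup>+t. u t * v k t \<partial>lborel)\<^sup>2"
      by (rule power_mono) simp
    also have "\<dots> \<le> (\<integral>\<^sup>+t. (u t)\<^sup>2 \<partial>lborel) * (\<integral>\<^sup>+t. (v k t)\<^sup>2 \<partial>lborel)"
      by (rule Cauchy_Schwarz_nn_integral) measurable
    finally show ?thesis unfolding u2 by (simp add: ennreal_power osc_int_nonneg)
  qed
  have "(\<integral>\<^sup>+k. indicator (shell \<kappa>) k * (\<integral>\<^sup>+t. (v k t)\<^sup>2 \<partial>lborel) \<partial>lborel)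
      = (\<integral>\<^sup>+k. \<integral>\<^sup>+t. indicator (shell \<kappa>) k * (v k t)\<^sup>2 \<partial>lborel \<partial>lborel)"
    by (intro nn_integral_cong nn_integral_cmult[symmetric]) measurable
  also have "\<dots> = (\<integral>\<^sup>+t. \<integral>\<^sup>+k. indicator (shell \<kappa>) k * (v k t)\<^sup>2 \<partial>lborel \<partial>lborel)"
  proof (rule lborel_pair.Fubini')
    have "(\<lambda>p. v (fst p) (snd p)) \<in> borel_measurable (lborel \<Otimes>\<^sub>M lborel)" using vm by (simp add: split_beta')
    then show "(\<lambda>(t, k). indicator (shell \<kappa>) k * (v k t)\<^sup>2) \<in> borel_measurable (lborel \<Otimes>\<^sub>M lborel)"
      unfolding split_beta'
      by (intro borel_measurable_times_ennreal borel_measurable_power_ennreal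
          measurable_compose[OF measurable_pair_swap', of "\<lambda>p. v (fst p) (snd p)", unfolded split_beta', simplified]
          measurable_compose[OF measurable_snd borel_measurable_indicator]) auto
  qed
  also have "\<dots> \<le> (\<integral>\<^sup>+t. ennreal P * (ennreal (t powr (- (2 * \<gamma> - 1 / 2))) * indicator {T0..} t) \<partial>lborel)"
  proof (rule nn_integral_mono)
    fix t
    show "(\<integral>\<^sup>+k. indicator (shell \<kappa>) k * (v k t)\<^sup>2 \<partial>lborel) \<le> ennreal P * (ennreal (t powr (- (2 * \<gamma> - 1 / 2))) * indicator {T0..} t)"
    proof (cases "t \<ge> T0")
      case True
      have [measurable]: "(\<lambda>k. osc_max k R M t) \<in> borel_measurable borel"
        using measurable_compose[OF _ om, of "\<lambda>k. (k, t)" borel] by simp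
      have v2: "(v k t)\<^sup>2 = ennreal (t powr (- (1 / 2))) * ennreal ((osc_max k R M t)\<^sup>2)" for k
      proof -
        have "(t powr (- (1 / 4)) * osc_max k R M t)\<^sup>2 = t powr (- (1 / 2)) * (osc_max k R M t)\<^sup>2"
          by (simp add: power_mult_distrib power2_eq_square flip: powr_add)
        then show ?thesis using True osc_max_nonneg[of k R M t] by (simp add: v_def ennreal_power flip: ennreal_mult)
      qed
      have "(\<integral>\<^sup>+k. indicator (shell \<kappa>) k * (v k t)\<^sup>2 \<partial>lborel)
          = (\<integral>\<^sup>+k. ennreal (t powr (- (1 / 2))) * (indicator (shell \<kappa>) k * ennreal ((osc_max k R M t)\<^sup>2)) \<partial>lborel)"
        unfolding v2 by (simp add: mult_ac)
      also have "\<dots> = ennreal (t powr (- (1 / 2))) * (\<integral>\<^sup>+k. indicator (shell \<kappa>) k * ennreal ((osc_max k R M t)\<^sup>2) \<partial>lborel)"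
        by (rule nn_integral_cmult) measurable
      also have "\<dots> \<le> ennreal (t powr (- (1 / 2))) * ennreal (P * t powr (1 - 2 * \<gamma>))"
        unfolding P_def by (intro mult_left_mono osc_max_shell_le[OF \<kappa>]) (use True T0 in auto)
      also have "\<dots> = ennreal (P * (t powr (- (1 / 2)) * t powr (1 - 2 * \<gamma>)))"
        using P by (simp add: mult_ac flip: ennreal_mult)
      also have "t powr (- (1 / 2)) * t powr (1 - 2 * \<gamma>) = t powr (- (2 * \<gamma> - 1 / 2))"
        by (simp flip: powr_add)
      finally show ?thesis using True P by (simp add: ennreal_mult)
    qed (simp add: v_def)
  qed
  also have "\<dots> = ennreal P * ennreal W"
    unfolding tailW[symmetric] by (rule nn_integral_cmult) measurable
  finally have V: "(\<integral>\<^sup>+k. indicator (shell \<kappa>) k * (\<integral>\<^sup>+t. (v k t)\<^sup>2 \<partial>lborel) \<partial>lborel) \<le> ennreal P * ennreal W" .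
  have Vm: "(\<lambda>k. \<integral>\<^sup>+t. (v k t)\<^sup>2 \<partial>lborel) \<in> borel_measurable lborel"
    by (rule lborel.borel_measurable_nn_integral) (use vm in \<open>simp add: split_beta'\<close>)
  have "(\<integral>\<^sup>+k. indicator (shell \<kappa>) k * ennreal ((osc_int k T0 R M)\<^sup>2) \<partial>lborel)
      \<le> (\<integral>\<^sup>+k. ennreal (C\<^sup>2 * W) * (indicator (shell \<kappa>) k * (\<integral>\<^sup>+t. (v k t)\<^sup>2 \<partial>lborel)) \<partial>lborel)"
    by (intro nn_integral_mono) (use B_le in \<open>auto simp: indicator_def\<close>)
  also have "\<dots> = ennreal (C\<^sup>2 * W) * (\<integral>\<^sup>+k. indicator (shell \<kappa>) k * (\<integral>\<^sup>+t. (v k t)\<^sup>2 \<partial>lborel) \<partial>lborel)"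
    by (rule nn_integral_cmult) (use Vm in measurable)
  also have "\<dots> \<le> ennreal (C\<^sup>2 * W) * (ennreal P * ennreal W)"
    by (intro mult_left_mono V) simp
  also have "\<dots> = ennreal (C\<^sup>2 * P * (W * W))"
    using P W by (simp add: mult_ac flip: ennreal_mult)
  also have "C\<^sup>2 * P * (W * W) = C\<^sup>2 * P / \<delta>\<^sup>2 * (T0 powr (- \<delta>) * T0 powr (- \<delta>))"
    by (simp add: W_def power2_eq_square)
  also have "T0 powr (- \<delta>) * T0 powr (- \<delta>) = T0 powr (- 2 * \<delta>)"
    by (simp flip: powr_add)
  finally show ?thesis by (simp add: P_def)
qed

lemma A_growth_le:
  assumes T: "T \<ge> 1"
  shows "A T \<le> A 1 + C / (1 - \<gamma>) * T powr (1 - \<gamma>)"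
proof -
  have i: "set_integrable lborel {1..T} (\<lambda>s. \<bar>q s\<bar>)"
    by (rule set_integrable_subinterval[OF q_abs_int[of T]]) auto
  have der: "((\<lambda>t. C / (1 - \<gamma>) * t powr (1 - \<gamma>)) has_vector_derivative C * x powr (- \<gamma>)) (at x within {1..T})" if "x \<in> {1..T}" for x
  proof -
    have "((\<lambda>t. t powr (1 - \<gamma>)) has_real_derivative (1 - \<gamma>) * x powr (1 - \<gamma> - 1)) (at x)"
      by (rule has_real_derivative_powr) (use that in simp)
    from DERIV_cmult[OF this, of "C / (1 - \<gamma>)"] have "((\<lambda>t. C / (1 - \<gamma>) * t powr (1 - \<gamma>)) has_real_derivative C * x powr (- \<gamma>)) (at x)"
      using gamma by simp
    then show ?thesis
      by (simp add: has_real_derivative_iff_has_vector_derivative has_vector_derivative_at_within)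
  qed
  have hi: "((\<lambda>t. C * t powr (- \<gamma>)) has_integral (C / (1 - \<gamma>) * T powr (1 - \<gamma>) - C / (1 - \<gamma>) * 1 powr (1 - \<gamma>))) {1..T}"
    by (rule fundamental_theorem_of_calculus[OF T der])
  have ip: "set_integrable lborel {1..T} (\<lambda>t. C * t powr (- \<gamma>))"
    by (rule borel_integrable_atLeastAtMost') (auto intro!: continuous_intros)
  have "(LINT s:{1..T}|lborel. \<bar>q s\<bar>) \<le> (LINT s:{1..T}|lborel. C * s powr (- \<gamma>))"
    unfolding set_lebesgue_integral_def
    by (rule integral_mono_AE)
      (use i ip decay in \<open>auto simp: set_integrable_def indicator_def elim!: eventually_mono\<close>)
  also have "\<dots> = C / (1 - \<gamma>) * T powr (1 - \<gamma>) - C / (1 - \<gamma>)"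
    unfolding set_borel_integral_eq_integral(2)[OF ip] integral_unique[OF hi] by simp
  also have "\<dots> \<le> C / (1 - \<gamma>) * T powr (1 - \<gamma>)" using C gamma by simp
  finally have "(LINT s:{1..T}|lborel. \<bar>q s\<bar>) \<le> C / (1 - \<gamma>) * T powr (1 - \<gamma>)" .
  moreover have "A T = A 1 + (LINT s:{1..T}|lborel. \<bar>q s\<bar>)"
    unfolding A_def by (rule set_integral_lborel_interval_split[OF q_abs_int]) (use T in auto)
  ultimately show ?thesis by simp
qed

end

section \<open>Uniform bounds of the frequencies\<close>

lemma dyadic_shell_cover:
  assumes K: "K > 0" and k: "k \<noteq> 0" "\<bar>k\<bar> \<le> K"
  obtains j :: nat where "k \<in> shell (K / 2 ^ Suc j)"
proof -
  have ex: "\<exists>j. K / 2 ^ Suc j < \<bar>k\<bar>"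
  proof -
    obtain j where "K / \<bar>k\<bar> < 2 ^ j" using real_arch_pow[of 2 "K / \<bar>k\<bar>"] by auto
    then have "K < \<bar>k\<bar> * 2 ^ j" using k by (simp add: field_simps)
    also have "\<dots> \<le> \<bar>k\<bar> * 2 ^ Suc j" by (intro mult_left_mono) auto
    finally have "K / 2 ^ Suc j < \<bar>k\<bar>" by (simp add: field_simps)
    then show ?thesis by blast
  qed
  define j where "j = (LEAST j. K / 2 ^ Suc j < \<bar>k\<bar>)"
  have 1: "K / 2 ^ Suc j < \<bar>k\<bar>" unfolding j_def using ex by (rule LeastI_ex)
  have 2: "\<bar>k\<bar> \<le> 2 * (K / 2 ^ Suc j)"
  proof (cases j)
    case 0
    then show ?thesis using k by simp
  next
    case (Suc i)
    have "\<not> K / 2 ^ Suc i < \<bar>k\<bar>"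
      using not_less_Least[of i "\<lambda>j. K / 2 ^ Suc j < \<bar>k\<bar>"] Suc unfolding j_def by auto
    then show ?thesis using Suc by simp
  qed
  show ?thesis by (rule that[of j]) (use 1 2 in \<open>simp add: shell_def\<close>)
qed

lemma emeasure_shell_le:
  assumes "\<kappa> \<ge> 0"
  shows "emeasure lborel (shell \<kappa>) \<le> ennreal (4 * \<kappa>)"
proof -
  have "emeasure lborel (shell \<kappa>) \<le> emeasure lborel {- (2 * \<kappa>)..2 * \<kappa>}"
    by (rule emeasure_mono) (auto simp: shell_def)
  then show ?thesis using assms by simp
qed

context decaying_potential
begin

text \<open>On the shell \<open>|k| \<sim> 2\<^sup>-\<^sup>j\<close> the oscillation is exploited only after the time \<open>2\<^sup>j\<close>; up to that time
  the frequency is bounded by the potential's integral, \<open>O(2\<^sup>j\<^sup>(\<^sup>1\<^sup>-\<^sup>\<gamma>\<^sup>))\<close>.  Its square, times the length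
  \<open>2\<^sup>-\<^sup>j\<close> of the shell, is summable in \<open>j\<close> as \<open>\<gamma> > 1/2\<close>.\<close>

definition early :: "nat \<Rightarrow> nat \<Rightarrow> real" where
  "early m j = 1 + 2 * real m * 3 ^ (m - 1) * A (2 ^ j)"

definition freq_bound :: "nat \<Rightarrow> nat \<Rightarrow> nat \<Rightarrow> real \<Rightarrow> real" where
  "freq_bound m M j k = early m j + 12 * real m * 3 ^ (m - 1) * (1 + osc_int k (2 ^ j) (real M) M)"

text \<open>Since the shells are disjoint, at most one term of the series is nonzero for each \<open>k\<close>.\<close>

definition freq_majorant :: "real \<Rightarrow> nat \<Rightarrow> nat \<Rightarrow> real \<Rightarrow> ennreal" where
  "freq_majorant K m M k = (\<Sum>j. indicator (shell (K / 2 ^ Suc j)) k * ennreal ((freq_bound m M j k)\<^sup>2))"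

lemma early_ge_1: "1 \<le> early m j"
  by (simp add: early_def A_nonneg)

lemma freq_bound_ge_1: "1 \<le> freq_bound m M j k"
  using early_ge_1[of m j] osc_int_nonneg[of k "2 ^ j" "real M" M]
  by (simp add: freq_bound_def add_increasing2)

lemma penergy_le_freq_bound:
  assumes sys: "coeff_system q k c" and m: "m \<ge> 1" and t: "0 \<le> t" "t \<le> real M"
  shows "penergy M m c t \<le> freq_bound m M j k ^ m"
proof (cases "t \<le> 2 ^ j")
  case True
  have "penergy M m c t \<le> (1 + 2 * real m * 3 ^ (m - 1) * A t) ^ m" by (rule penergy_growth[OF sys t(1) m])
  also have "\<dots> \<le> early m j ^ m"
    unfolding early_def using A_mono[OF True] A_nonneg by (intro power_mono add_mono mult_left_mono) auto
  also have "\<dots> \<le> freq_bound m M j k ^ m"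
    using early_ge_1[of m j] osc_int_nonneg[of k "2 ^ j" "real M" M] by (intro power_mono) (auto simp: freq_bound_def)
  finally show ?thesis .
next
  case False
  show ?thesis
    unfolding freq_bound_def
  proof (rule penergy_oscillation_bound[OF sys m])
    show "penergy M m c (2 ^ j) \<le> early m j ^ m"
      unfolding early_def by (rule penergy_growth[OF sys _ m]) simp
  qed (use False t early_ge_1[of m j] in auto)
qed

lemma osc_int_measurable [measurable]: "(\<lambda>k. osc_int k T0 R M) \<in> borel_measurable borel"
proof -
  have "(\<lambda>p. osc_max (fst p) R M (snd p)) \<in> borel_measurable (borel \<Otimes>\<^sub>M borel)"
    unfolding osc_max_def using osc_measurable_pair by measurable
  then have "(\<lambda>p. indicator {T0..R} (snd p) *\<^sub>R (\<bar>q (snd p)\<bar> * osc_max (fst p) R M (snd p))) \<in> borel_measurable (borel \<Otimes>\<^sub>M lborel)"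
    by measurable
  then show ?thesis unfolding osc_int_def set_lebesgue_integral_def
    by (intro lborel.borel_measurable_lebesgue_integral) (simp add: split_beta')
qed

lemma freq_majorant_measurable [measurable]: "freq_majorant K m M \<in> borel_measurable borel"
  unfolding freq_majorant_def[abs_def] freq_bound_def by measurable

text \<open>On the shell of size \<open>2\<^sup>-\<^sup>j\<close> the early times contribute \<open>2\<^sup>-\<^sup>j 2\<^sup>2\<^sup>j\<^sup>(\<^sup>1\<^sup>-\<^sup>\<gamma>\<^sup>) = a\<^sup>j\<close> and the oscillating integrals
  \<open>2\<^sup>-\<^sup>2\<^sup>\<delta>\<^sup>j = b\<^sup>j\<close>: two geometric series.\<close>

lemma freq_majorant_integral_bounded:
  assumes K: "K > 0"
  shows "\<exists>B. \<forall>M. (\<integral>\<^sup>+k. freq_majorant K m M k \<partial>lborel) \<le> ennreal B"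
proof -
  define D where "D = 12 * real m * 3 ^ (m - 1)"
  have D: "D \<ge> 0" by (simp add: D_def)
  define D2 where "D2 = 2 * real m * 3 ^ (m - 1)"
  have D2: "D2 \<ge> 0" by (simp add: D2_def)
  define \<delta> where "\<delta> = 2 * \<gamma> - 3 / 2"
  define P where "P = C\<^sup>2 * (8 * pi * (C\<^sup>2 / (2 * \<gamma> - 1))) / \<delta>\<^sup>2"
  have P: "P \<ge> 0" using gamma by (simp add: P_def)
  define E where "E = 1 + D2 * (A 1 + C / (1 - \<gamma>)) + D"
  have E: "E \<ge> 0" using D D2 A_nonneg[of 1] C gamma by (auto simp: E_def intro!: add_nonneg_nonneg mult_nonneg_nonneg)
  define a where "a = 2 powr (1 - 2 * \<gamma>)"
  define b where "b = 2 powr (- 2 * \<delta>)"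
  have ab: "0 \<le> a" "a < 1" "0 \<le> b" "b < 1"
    using gamma by (auto simp: a_def b_def \<delta>_def powr_less_one)
  have pw: "(2 ^ j) powr x = (2 powr x) ^ j" for j :: nat and x :: real
    by (simp add: powr_powr powr_realpow[symmetric] mult.commute)
  have early_le: "early m j + D \<le> E * (2 ^ j) powr (1 - \<gamma>)" for j
  proof -
    define g where "g = (2 ^ j :: real) powr (1 - \<gamma>)"
    have g: "g \<ge> 1" unfolding g_def using gamma by (intro ge_one_powr_ge_zero) auto
    have "A (2 ^ j) \<le> A 1 + C / (1 - \<gamma>) * g" unfolding g_def by (rule A_growth_le) simp
    also have "\<dots> \<le> A 1 * g + C / (1 - \<gamma>) * g" using mult_left_mono[OF g A_nonneg[of 1]] by simp
    finally have "D2 * A (2 ^ j) \<le> D2 * ((A 1 + C / (1 - \<gamma>)) * g)" using D2 by (intro mult_left_mono) (simp_all add: distrib_right)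
    moreover have "1 + D \<le> (1 + D) * g" using mult_left_mono[OF g, of "1 + D"] D by simp
    ultimately show ?thesis unfolding g_def[symmetric] by (simp add: early_def E_def D2_def algebra_simps)
  qed
  have shell_term: "(\<integral>\<^sup>+k. indicator (shell (K / 2 ^ Suc j)) k * ennreal ((freq_bound m M j k)\<^sup>2) \<partial>lborel)
      \<le> ennreal (4 * E\<^sup>2 * K * a ^ j + 2 * D\<^sup>2 * P * b ^ j)" for j M
  proof -
    define \<kappa> where "\<kappa> = K / 2 ^ Suc j"
    have \<kappa>: "\<kappa> > 0" using K by (simp add: \<kappa>_def)
    define e where "e = early m j + D"
    have e: "0 \<le> e" using early_ge_1[of m j] D by (simp add: e_def)
    define s where "s k = osc_int k (2 ^ j) (real M) M" for k
    have [measurable]: "s \<in> borel_measurable borel" unfolding s_def by measurable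
    have pt: "ennreal ((freq_bound m M j k)\<^sup>2) \<le> ennreal (2 * e\<^sup>2) + ennreal (2 * D\<^sup>2) * ennreal ((s k)\<^sup>2)" for k
    proof -
      have "freq_bound m M j k = e + D * s k" by (simp add: freq_bound_def e_def D_def s_def algebra_simps)
      moreover have "(e + D * s k)\<^sup>2 \<le> 2 * e\<^sup>2 + 2 * D\<^sup>2 * (s k)\<^sup>2"
        using sum_squares_bound[of e "D * s k"] by (simp add: power2_sum power_mult_distrib)
      ultimately have "ennreal ((freq_bound m M j k)\<^sup>2) \<le> ennreal (2 * e\<^sup>2 + 2 * D\<^sup>2 * (s k)\<^sup>2)" by (intro ennreal_leI) simp
      also have "ennreal (2 * e\<^sup>2 + 2 * D\<^sup>2 * (s k)\<^sup>2) = ennreal (2 * e\<^sup>2) + ennreal (2 * D\<^sup>2) * ennreal ((s k)\<^sup>2)"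
        by (simp flip: ennreal_mult ennreal_plus)
      finally show ?thesis .
    qed
    have "(\<integral>\<^sup>+k. indicator (shell \<kappa>) k * ennreal ((freq_bound m M j k)\<^sup>2) \<partial>lborel)
        \<le> (\<integral>\<^sup>+k. ennreal (2 * e\<^sup>2) * indicator (shell \<kappa>) k + ennreal (2 * D\<^sup>2) * (indicator (shell \<kappa>) k * ennreal ((s k)\<^sup>2)) \<partial>lborel)"
      by (rule nn_integral_mono) (use pt in \<open>auto simp: indicator_def\<close>)
    also have "\<dots> = ennreal (2 * e\<^sup>2) * emeasure lborel (shell \<kappa>)
        + ennreal (2 * D\<^sup>2) * (\<integral>\<^sup>+k. indicator (shell \<kappa>) k * ennreal ((s k)\<^sup>2) \<partial>lborel)"
      by (subst nn_integral_add) (auto simp: nn_integral_cmult nn_integral_cmult_indicator)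
    also have "\<dots> \<le> ennreal (2 * e\<^sup>2) * ennreal (4 * \<kappa>) + ennreal (2 * D\<^sup>2) * ennreal (P * (2 ^ j) powr (- 2 * \<delta>))"
      unfolding s_def P_def \<delta>_def
      by (intro add_mono mult_left_mono emeasure_shell_le osc_int_shell_le \<kappa>) (use \<kappa> in auto)
    also have "\<dots> = ennreal (8 * e\<^sup>2 * \<kappa> + 2 * D\<^sup>2 * (P * (2 ^ j) powr (- 2 * \<delta>)))"
      using \<kappa> P by (simp add: mult_ac flip: ennreal_mult ennreal_plus)
    also have "\<dots> \<le> ennreal (4 * E\<^sup>2 * K * a ^ j + 2 * D\<^sup>2 * P * b ^ j)"
    proof (rule ennreal_leI, rule add_mono)
      have "e\<^sup>2 \<le> (E * (2 ^ j) powr (1 - \<gamma>))\<^sup>2" unfolding e_def using early_le e by (intro power_mono) (auto simp: e_def)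
      then have "8 * e\<^sup>2 * \<kappa> \<le> 8 * (E * (2 ^ j) powr (1 - \<gamma>))\<^sup>2 * \<kappa>" using \<kappa> by simp
      also have "\<dots> = 4 * E\<^sup>2 * K * (((2 ^ j) powr (1 - \<gamma>))\<^sup>2 / 2 ^ j)" by (simp add: \<kappa>_def power_mult_distrib)
      also have "((2 ^ j) powr (1 - \<gamma>))\<^sup>2 / 2 ^ j = (2 ^ j :: real) powr (1 - 2 * \<gamma>)"
      proof -
        have "((2 ^ j :: real) powr (1 - \<gamma>))\<^sup>2 = (2 ^ j) powr (2 - 2 * \<gamma>)"
          by (simp add: power2_eq_square flip: powr_add)
        then have "((2 ^ j :: real) powr (1 - \<gamma>))\<^sup>2 / 2 ^ j = (2 ^ j) powr (2 - 2 * \<gamma>) / (2 ^ j) powr 1" by simp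
        also have "\<dots> = (2 ^ j) powr (1 - 2 * \<gamma>)" unfolding powr_diff[symmetric] by simp
        finally show ?thesis .
      qed
      finally show "8 * e\<^sup>2 * \<kappa> \<le> 4 * E\<^sup>2 * K * a ^ j" by (simp add: pw a_def)
      show "2 * D\<^sup>2 * (P * (2 ^ j) powr (- 2 * \<delta>)) \<le> 2 * D\<^sup>2 * P * b ^ j" by (simp add: pw b_def)
    qed
    finally show ?thesis by (simp add: \<kappa>_def)
  qed
  have summ: "summable (\<lambda>j. 4 * E\<^sup>2 * K * a ^ j + 2 * D\<^sup>2 * P * b ^ j)"
    using ab by (intro summable_add summable_mult summable_geometric) auto
  have nn: "0 \<le> 4 * E\<^sup>2 * K * a ^ j + 2 * D\<^sup>2 * P * b ^ j" for j using K P ab by simp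
  have "(\<integral>\<^sup>+k. freq_majorant K m M k \<partial>lborel) \<le> ennreal (\<Sum>j. 4 * E\<^sup>2 * K * a ^ j + 2 * D\<^sup>2 * P * b ^ j)" for M
  proof -
    have "(\<integral>\<^sup>+k. freq_majorant K m M k \<partial>lborel)
        = (\<Sum>j. \<integral>\<^sup>+k. indicator (shell (K / 2 ^ Suc j)) k * ennreal ((freq_bound m M j k)\<^sup>2) \<partial>lborel)"
      unfolding freq_majorant_def freq_bound_def by (rule nn_integral_suminf) measurable
    also have "\<dots> \<le> (\<Sum>j. ennreal (4 * E\<^sup>2 * K * a ^ j + 2 * D\<^sup>2 * P * b ^ j))"
      by (intro suminf_le shell_term) auto
    also have "\<dots> = ennreal (\<Sum>j. 4 * E\<^sup>2 * K * a ^ j + 2 * D\<^sup>2 * P * b ^ j)"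
      by (rule suminf_ennreal2[OF nn summ])
    finally show ?thesis .
  qed
  then show ?thesis by blast
qed

text \<open>The square of the largest relevant frequency is integrable in \<open>k\<close>.  The bound for all times
  is the lower limit of the bounds for finite times, by Fatou's lemma.\<close>

theorem uniform_frequency_bound:
  assumes K: "K > 0" and m: "m \<ge> 1" and sys: "\<And>k. coeff_system q k (c k)"
  obtains Z where "Z \<in> borel_measurable borel" "(\<integral>\<^sup>+k. Z k \<partial>lborel) < \<infinity>"
    "\<And>k t F. k \<noteq> 0 \<Longrightarrow> \<bar>k\<bar> \<le> K \<Longrightarrow> Z k < \<infinity> \<Longrightarrow> t \<ge> 0 \<Longrightarrow> finite F \<Longrightarrow>
      (\<Sum>n\<in>F. (1 + \<bar>of_int n\<bar>) ^ m * (cmod (c k n t))\<^sup>2) \<le> sqrt (enn2real (Z k) + 1) ^ m"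
proof -
  define Z where "Z k = liminf (\<lambda>M. freq_majorant K m M k)" for k
  obtain B where B: "\<And>M. (\<integral>\<^sup>+k. freq_majorant K m M k \<partial>lborel) \<le> ennreal B"
    using freq_majorant_integral_bounded[OF K] by blast
  have "(\<integral>\<^sup>+k. Z k \<partial>lborel) \<le> liminf (\<lambda>M. \<integral>\<^sup>+k. freq_majorant K m M k \<partial>lborel)"
    unfolding Z_def by (rule nn_integral_liminf) measurable
  also have "\<dots> \<le> ennreal B" by (rule Liminf_le) (auto intro!: always_eventually B)
  finally have int: "(\<integral>\<^sup>+k. Z k \<partial>lborel) < \<infinity>" by (simp add: le_less_trans)
  have meas: "Z \<in> borel_measurable borel" unfolding Z_def by measurable
  have bound: "(\<Sum>n\<in>F. (1 + \<bar>of_int n\<bar>) ^ m * (cmod (c k n t))\<^sup>2) \<le> sqrt (enn2real (Z k) + 1) ^ m"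
    if k: "k \<noteq> 0" "\<bar>k\<bar> \<le> K" and Zk: "Z k < \<infinity>" and t: "t \<ge> 0" and F: "finite F" for k t F
  proof -
    obtain j where j: "k \<in> shell (K / 2 ^ Suc j)" using dyadic_shell_cover[OF K k] .
    obtain M0 where M0: "F \<subseteq> {-int M0..int M0}" using finite_int_subset[OF F] by blast
    obtain M1 :: nat where M1: "t \<le> real M1" using real_arch_simple by blast
    have "Z k < ennreal (enn2real (Z k) + 1)"
      using Zk by (cases "Z k") (auto simp: ennreal_less_iff)
    then have "\<exists>\<^sub>F M in sequentially. freq_majorant K m M k < ennreal (enn2real (Z k) + 1)"
    proof (rule contrapos_pp)
      assume "\<not> (\<exists>\<^sub>F M in sequentially. freq_majorant K m M k < ennreal (enn2real (Z k) + 1))"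
      then have "\<forall>\<^sub>F M in sequentially. ennreal (enn2real (Z k) + 1) \<le> freq_majorant K m M k"
        by (simp add: not_frequently not_less)
      then have "ennreal (enn2real (Z k) + 1) \<le> Z k" unfolding Z_def by (rule Liminf_bounded)
      then show "\<not> Z k < ennreal (enn2real (Z k) + 1)" by simp
    qed
    \<comment> \<open>the bound for a single \<open>M\<close> suffices, provided that \<open>M\<close> exceeds the time \<open>t\<close> and the frequencies in \<open>F\<close>\<close>
    then obtain M where M: "M \<ge> max M0 M1" "freq_majorant K m M k < ennreal (enn2real (Z k) + 1)"
      unfolding frequently_sequentially by blast
    define h where "h j = indicator (shell (K / 2 ^ Suc j)) k * ennreal ((freq_bound m M j k)\<^sup>2)" for j
    have "h j \<le> (\<Sum>j. h j)" using sum_le_suminf[of h "{j}"] by simp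
    then have "h j \<le> freq_majorant K m M k" by (simp only: freq_majorant_def h_def)
    moreover have "h j = ennreal ((freq_bound m M j k)\<^sup>2)" using j by (simp add: h_def)
    ultimately have "ennreal ((freq_bound m M j k)\<^sup>2) \<le> freq_majorant K m M k" by simp
    also note M(2)
    finally have "ennreal ((freq_bound m M j k)\<^sup>2) < ennreal (enn2real (Z k) + 1)" .
    then have "(freq_bound m M j k)\<^sup>2 < enn2real (Z k) + 1" by (rule ennreal_less_iff[THEN iffD1, rotated]) simp
    then have fb: "freq_bound m M j k \<le> sqrt (enn2real (Z k) + 1)"
      by (intro real_le_rsqrt) simp
    have "(\<Sum>n\<in>F. (1 + \<bar>of_int n\<bar>) ^ m * (cmod (c k n t))\<^sup>2) = (\<Sum>n\<in>F. pweight M m n * (cmod (c k n t))\<^sup>2)"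
    proof (rule sum.cong[OF refl])
      fix n assume "n \<in> F"
      then have "n \<in> {- int M0..int M0}" using M0 by blast
      then have "\<bar>n\<bar> + 1 \<le> int M + 1" using M(1) by (simp add: abs_le_iff)
      then have "real_of_int (min (\<bar>n\<bar> + 1) (int M + 1)) = 1 + \<bar>of_int n\<bar>" by (simp add: min_absorb1)
      then show "(1 + \<bar>of_int n\<bar>) ^ m * (cmod (c k n t))\<^sup>2 = pweight M m n * (cmod (c k n t))\<^sup>2"
        by (simp only: pweight_def)
    qed
    also have "\<dots> \<le> penergy M m (c k) t" by (rule penergy_ge[OF sys t F])
    also have "\<dots> \<le> freq_bound m M j k ^ m"
      by (rule penergy_le_freq_bound[OF sys m t]) (use M1 M(1) in linarith)
    also have "\<dots> \<le> sqrt (enn2real (Z k) + 1) ^ m"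
      using fb freq_bound_ge_1[of m M j k] by (intro power_mono) auto
    finally show ?thesis .
  qed
  show ?thesis using that[OF meas int bound] .
qed

end

section \<open>Sobolev norms and analyticity\<close>

text \<open>The squared Sobolev norm is again the plain sum.\<close>

lemma ennpow_half_square: "(ennpow x (1 / 2))\<^sup>2 = x"
proof (cases x)
  case (real r)
  then show ?thesis by (simp add: ennpow_def ennreal_power powr_half_sqrt)
qed (simp add: ennpow_def power2_eq_square)

lemma ennpow_ennreal: "a \<noteq> 0 \<Longrightarrow> r \<ge> 0 \<Longrightarrow> ennpow (ennreal r) a = ennreal (r powr a)"
  by (simp add: ennpow_def)

lemma ennpow_less_top: "x < \<infinity> \<Longrightarrow> ennpow x a < \<infinity>"
  by (auto simp: ennpow_def)

lemma ennpow_mono: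
  assumes "x \<le> y" "a \<ge> 0"
  shows "ennpow x a \<le> ennpow y a"
proof (cases "a = 0 \<or> y = \<infinity>")
  case True
  then show ?thesis by (auto simp: ennpow_def)
next
  case False
  then have "x < \<infinity>" "y < \<infinity>" using assms(1) by (auto simp: top.not_eq_extremum intro: le_less_trans)
  then show ?thesis using False assms
    by (auto simp: ennpow_def intro!: ennreal_leI powr_mono2 enn2real_mono)
qed

definition sobolev_sum :: "real \<Rightarrow> (real \<Rightarrow> complex) \<Rightarrow> ennreal" where
  "sobolev_sum s f = (SUP F\<in>Collect finite. ennreal (\<Sum>n\<in>F. (1 + (of_int n)\<^sup>2) powr s * (cmod (fourier_coeff f n))\<^sup>2))"

lemma sobolev_norm_eq: "sobolev_norm s f = ennpow (sobolev_sum s f) (1 / 2)"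
proof -
  have "(\<Sum>\<^sub>\<infinity>n::int\<in>UNIV. ennreal ((1 + (of_int n)\<^sup>2) powr s * (cmod (fourier_coeff f n))\<^sup>2))
      = (SUP F\<in>{F. finite F \<and> F \<subseteq> UNIV}. \<Sum>n\<in>F. ennreal ((1 + (of_int n)\<^sup>2) powr s * (cmod (fourier_coeff f n))\<^sup>2))"
    by (rule nonneg_infsum_complete) simp
  also have "\<dots> = sobolev_sum s f"
    unfolding sobolev_sum_def by (intro SUP_cong) (auto simp: sum_ennreal)
  finally show ?thesis by (simp add: sobolev_norm_def)
qed

text \<open>A real smoothness \<open>s\<close> is reduced to the integer moment \<open>m \<ge> 2s\<close>: frequencies below \<open>X\<close> are bounded by
  \<open>X\<^sup>2\<^sup>s\<close> and carry mass at most \<open>1\<close>; those above \<open>X\<close> satisfy \<open>w\<^sup>2\<^sup>s \<le> w\<^sup>m X\<^sup>2\<^sup>s\<^sup>-\<^sup>m\<close>.\<close>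

lemma sobolev_partial_sum_le:
  fixes p :: "int \<Rightarrow> real"
  assumes F: "finite F" and p: "\<And>n. p n \<ge> 0" "(\<Sum>n\<in>F. p n) \<le> 1"
    and X: "X \<ge> 1" "(\<Sum>n\<in>F. (1 + \<bar>of_int n\<bar>) ^ m * p n) \<le> X ^ m" and s: "0 \<le> s" "2 * s \<le> real m"
  shows "(\<Sum>n\<in>F. (1 + (of_int n)\<^sup>2) powr s * p n) \<le> 2 * X powr (2 * s)"
proof -
  have le: "(1 + (of_int n)\<^sup>2) powr s \<le> (1 + \<bar>of_int n\<bar>) ^ m * X powr (2 * s - real m) + X powr (2 * s)" for n
  proof -
    define W where "W = 1 + \<bar>real_of_int n\<bar>"
    have W: "W \<ge> 1" by (simp add: W_def)
    have "1 + (real_of_int n)\<^sup>2 \<le> W\<^sup>2" by (simp add: W_def power2_sum)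
    then have "(1 + (real_of_int n)\<^sup>2) powr s \<le> (W\<^sup>2) powr s" by (intro powr_mono2 s) auto
    also have "(W\<^sup>2) powr s = W powr (2 * s)" using W by (simp add: powr_powr flip: powr_numeral)
    also have "W powr (2 * s) \<le> W ^ m * X powr (2 * s - real m) + X powr (2 * s)"
    proof (cases "W \<le> X")
      case True
      then have "W powr (2 * s) \<le> X powr (2 * s)" using W s by (intro powr_mono2) auto
      moreover have "0 \<le> W ^ m * X powr (2 * s - real m)" using W by simp
      ultimately show ?thesis by linarith
    next
      case False
      have "W powr (2 * s) = W powr (real m + (2 * s - real m))" by simp
      also have "\<dots> = W ^ m * W powr (2 * s - real m)" using W by (simp only: powr_add) (simp add: powr_realpow)
      also have "\<dots> \<le> W ^ m * X powr (2 * s - real m)"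
        using False W X s by (intro mult_left_mono powr_mono2') auto
      finally have "W powr (2 * s) \<le> W ^ m * X powr (2 * s - real m)" .
      moreover have "0 \<le> X powr (2 * s)" by simp
      ultimately show ?thesis by linarith
    qed
    finally show ?thesis by (simp add: W_def)
  qed
  have "(\<Sum>n\<in>F. (1 + (of_int n)\<^sup>2) powr s * p n) \<le> (\<Sum>n\<in>F. ((1 + \<bar>of_int n\<bar>) ^ m * X powr (2 * s - real m) + X powr (2 * s)) * p n)"
    by (intro sum_mono mult_right_mono le p)
  also have "\<dots> = X powr (2 * s - real m) * (\<Sum>n\<in>F. (1 + \<bar>of_int n\<bar>) ^ m * p n) + X powr (2 * s) * (\<Sum>n\<in>F. p n)"
    unfolding sum_distrib_left sum.distrib[symmetric] by (rule sum.cong) (simp_all add: algebra_simps)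
  also have "\<dots> \<le> X powr (2 * s - real m) * X ^ m + X powr (2 * s) * 1"
    using p X by (intro add_mono mult_left_mono) auto
  also have "X powr (2 * s - real m) * X ^ m = X powr (2 * s)"
    using X by (simp add: powr_diff powr_realpow)
  finally show ?thesis by simp
qed

lemma real_analytic_entire:
  assumes "H holomorphic_on UNIV"
  shows "real_analytic (\<lambda>y. H (complex_of_real y))"
  unfolding real_analytic_def
proof
  fix x :: real
  have hol: "H holomorphic_on ball (of_real x) 1" using assms holomorphic_on_subset by blast
  have "(\<lambda>n. (deriv ^^ n) H (of_real x) / fact n * complex_of_real (y - x) ^ n) sums H (of_real y)" if "\<bar>y - x\<bar> < 1" for y
  proof -
    have "of_real y \<in> ball (complex_of_real x) 1"
      using that by (simp add: dist_norm norm_minus_commute flip: of_real_diff)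
    from holomorphic_power_series[OF hol this] show ?thesis by simp
  qed
  then show "\<exists>r>0. \<exists>a. \<forall>y. \<bar>y - x\<bar> < r \<longrightarrow> (\<lambda>n. a n * complex_of_real (y - x) ^ n) sums H (of_real y)"
    by (intro exI[of _ "1::real"] conjI exI[of _ "\<lambda>n. (deriv ^^ n) H (of_real x) / fact n"]) auto
qed

lemma entire_power_series:
  fixes a :: "nat \<Rightarrow> complex"
  assumes "\<And>r::real. r > 0 \<Longrightarrow> summable (\<lambda>n. cmod (a n) * r ^ n)"
  shows "(\<lambda>w. \<Sum>n. a n * w ^ n) holomorphic_on UNIV" and "summable (\<lambda>n. a n * w ^ n)"
proof -
  have sm: "summable (\<lambda>n. a n * w ^ n)" for w
  proof (rule summable_comparison_test'[OF assms[of "cmod w + 1"], of 0])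
    show "norm (a n * w ^ n) \<le> cmod (a n) * (cmod w + 1) ^ n" for n
      unfolding norm_mult norm_power by (intro mult_left_mono power_mono) auto
  qed (simp add: add_nonneg_pos)
  then show "summable (\<lambda>n. a n * w ^ n)" .
  have "(\<lambda>w. \<Sum>n. a n * w ^ n) holomorphic_on ball 0 r" for r
    by (rule power_series_holomorphic[where a = a]) (use sm in \<open>auto intro: summable_sums\<close>)
  then have "(\<lambda>w. \<Sum>n. a n * w ^ n) field_differentiable at w" for w
    by (rule holomorphic_on_imp_differentiable_at[where s = "ball 0 (cmod w + 1)"]) auto
  then show "(\<lambda>w. \<Sum>n. a n * w ^ n) holomorphic_on UNIV"
    by (simp add: holomorphic_on_def field_differentiable_at_within)
qed

text \<open>The Fourier series is the sum of a power series in \<open>e\<^sup>i\<^sup>\<theta>\<close> and one in \<open>e\<^sup>-\<^sup>i\<^sup>\<theta>\<close>.  Both have infinite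
  radius of convergence, so they extend to entire functions of \<open>\<theta>\<close>.\<close>

theorem L2T_real_analytic:
  assumes f: "f \<in> L2T"
    and decay: "\<And>r::real. r > 0 \<Longrightarrow> summable (\<lambda>j. (cmod (fourier_coeff f (int j)) + cmod (fourier_coeff f (- int j))) * r ^ j)"
  shows "\<exists>g. real_analytic g \<and> (AE \<theta> in lebesgue. f \<theta> = g \<theta>)"
proof -
  define c where "c = fourier_coeff f"
  define a where "a j = c (int j)" for j
  define b where "b j = (if j = 0 then 0 else c (- int j))" for j
  define d where "d j = cmod (c (int j)) + cmod (c (- int j))" for j
  have sa: "summable (\<lambda>j. cmod (a j) * r ^ j)" and sb: "summable (\<lambda>j. cmod (b j) * r ^ j)" if r: "r > 0" for r :: real
    by (rule summable_comparison_test'[OF decay[OF r], of 0];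
        use r in \<open>auto simp: a_def b_def c_def intro!: mult_right_mono\<close>)+
  define P where "P w = (\<Sum>j. a j * w ^ j)" for w
  define Q where "Q w = (\<Sum>j. b j * w ^ j)" for w
  have P: "P holomorphic_on UNIV" "summable (\<lambda>j. a j * w ^ j)"
    and Q: "Q holomorphic_on UNIV" "summable (\<lambda>j. b j * w ^ j)" for w
    using entire_power_series[of a] entire_power_series[of b] sa sb by (auto simp: P_def[abs_def] Q_def[abs_def])
  define H where "H z = P (exp (\<i> * z)) + Q (exp (- (\<i> * z)))" for z
  have Hh: "H holomorphic_on UNIV"
    unfolding H_def
    by (intro holomorphic_intros holomorphic_on_compose_gen[OF _ P(1), unfolded o_def] holomorphic_on_compose_gen[OF _ Q(1), unfolded o_def]) auto
  define g where "g \<theta> = H (complex_of_real \<theta>)" for \<theta>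
  have g_an: "real_analytic g" unfolding g_def by (rule real_analytic_entire[OF Hh])
  define h where "h j \<theta> = a j * cis \<theta> ^ j + b j * cis (- \<theta>) ^ j" for j \<theta>
  have g_eq: "g \<theta> = (\<Sum>j. h j \<theta>)" for \<theta>
  proof -
    have "g \<theta> = P (cis \<theta>) + Q (cis (- \<theta>))" by (simp add: g_def H_def cis_conv_exp)
    also have "\<dots> = (\<Sum>j. h j \<theta>)"
      unfolding P_def Q_def h_def by (rule suminf_add[OF P(2) Q(2)])
    finally show ?thesis .
  qed
  have hd: "cmod (h j \<theta>) \<le> d j" for j \<theta>
    unfolding h_def by (rule order_trans[OF norm_triangle_ineq]) (auto simp: norm_mult norm_power a_def b_def d_def)
  have sd: "summable d" using decay[of 1] by (simp add: d_def[abs_def] c_def)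
  have sh: "summable (\<lambda>j. h j \<theta>)" for \<theta>
    by (rule summable_comparison_test'[OF sd, of 0]) (rule hd)
  have s_eq: "(\<Sum>n\<in>{-int N..int N}. c n * cis (of_int n * \<theta>)) = (\<Sum>j<Suc N. h j \<theta>)" for N \<theta>
  proof (induction N)
    case 0
    then show ?case by (simp add: h_def a_def b_def)
  next
    case (Suc N)
    have set: "{- int (Suc N)..int (Suc N)} = insert (int (Suc N)) (insert (- int (Suc N)) {-int N..int N})" by auto
    have ps: "cis (real (Suc N) * \<theta>) = cis \<theta> ^ Suc N" "cis (- real (Suc N) * \<theta>) = cis (- \<theta>) ^ Suc N"
      unfolding Complex.DeMoivre by (simp_all add: algebra_simps)
    have "(\<Sum>n\<in>{- int (Suc N)..int (Suc N)}. c n * cis (of_int n * \<theta>))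
        = c (int (Suc N)) * cis (real (Suc N) * \<theta>) + (c (- int (Suc N)) * cis (- real (Suc N) * \<theta>) + (\<Sum>n\<in>{-int N..int N}. c n * cis (of_int n * \<theta>)))"
      unfolding set by (subst sum.insert, simp, simp, subst sum.insert) (simp_all del: of_nat_Suc)
    also have "\<dots> = (\<Sum>j<Suc (Suc N). h j \<theta>)"
      unfolding Suc.IH ps by (simp add: h_def a_def b_def del: of_nat_Suc power_Suc)
    finally show ?case .
  qed
  have gm: "g \<in> borel_measurable borel"
  proof (rule borel_measurable_continuous_onI)
    show "continuous_on UNIV g" unfolding g_def
      by (rule continuous_on_compose2[OF holomorphic_on_imp_continuous_on[OF Hh]]) (auto intro!: continuous_intros)
  qed
  have g_bd: "cmod (g \<theta>) \<le> suminf d" for \<theta>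
    unfolding g_eq by (rule norm_suminf_le[OF hd sd])
  have sqg: "sqint g"
    using sqint_mult_bounded[OF sqint_const[of 1] measurable_circI[OF gm] g_bd] by simp
  have gL: "g \<in> L2T"
  proof (rule L2T_I[OF gm _ sqg])
    have "cis (\<theta> + 2 * pi) = cis \<theta>" "cis (- (\<theta> + 2 * pi)) = cis (- \<theta>)" for \<theta>
      by (simp_all add: complex_eq_iff sin_diff cos_diff sin_add cos_add)
    then show "g (\<theta> + 2 * pi) = g \<theta>" for \<theta> unfolding g_eq h_def by simp
  qed
  have "(\<lambda>N. L2T_norm (\<lambda>\<theta>. g \<theta> - (\<Sum>n\<in>{-int N..int N}. c n * cis (of_int n * \<theta>)))) \<longlonglongrightarrow> 0"
  proof -
    define e where "e N = (\<Sum>j. d (j + Suc N))" for N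
    have e0: "e \<longlonglongrightarrow> 0"
    proof -
      have "(\<lambda>N. suminf d - (\<Sum>j<N. d j)) \<longlonglongrightarrow> suminf d - suminf d"
        by (intro tendsto_diff tendsto_const summable_LIMSEQ sd)
      then have "(\<lambda>N. suminf d - (\<Sum>j<N. d j)) \<longlonglongrightarrow> 0" by simp
      from LIMSEQ_Suc[OF this] have "(\<lambda>N. suminf d - (\<Sum>j<Suc N. d j)) \<longlonglongrightarrow> 0" .
      moreover have "suminf d - (\<Sum>j<Suc N. d j) = e N" for N
        unfolding e_def by (rule suminf_minus_initial_segment[OF sd, symmetric])
      ultimately show ?thesis by simp
    qed
    have bd: "cmod (g \<theta> - (\<Sum>n\<in>{-int N..int N}. c n * cis (of_int n * \<theta>))) \<le> e N" for N \<theta>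
    proof -
      have "g \<theta> - (\<Sum>n\<in>{-int N..int N}. c n * cis (of_int n * \<theta>)) = (\<Sum>j. h (j + Suc N) \<theta>)"
        unfolding g_eq s_eq by (rule suminf_minus_initial_segment[OF sh, symmetric])
      also have "cmod \<dots> \<le> e N"
        unfolding e_def by (rule norm_suminf_le[OF hd summable_ignore_initial_segment[OF sd]])
      finally show ?thesis .
    qed
    have le: "L2T_norm (\<lambda>\<theta>. g \<theta> - (\<Sum>n\<in>{-int N..int N}. c n * cis (of_int n * \<theta>))) \<le> sqrt (2 * pi) * e N" for N
    proof -
      let ?r = "\<lambda>\<theta>. g \<theta> - (\<Sum>n\<in>{-int N..int N}. c n * cis (of_int n * \<theta>))"
      have eN: "0 \<le> e N" using bd[of 0 N] norm_ge_zero order_trans by blast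
      have "(L2T_norm ?r)\<^sup>2 \<le> (LINT x|circ. (e N)\<^sup>2)"
        unfolding L2T_norm_sq
      proof (rule integral_mono)
        show "integrable circ (\<lambda>x. (cmod (?r x))\<^sup>2)"
        proof -
          have "sqint ?r" by (intro sqint_diff sqg sqint_sum sqint_cmult sqint_cis)
          then show ?thesis by (simp add: sqint_def)
        qed
        show "integrable circ (\<lambda>x. (e N)\<^sup>2)" by (rule finite_measure.integrable_const[OF finite_measure_circ])
        show "(cmod (?r x))\<^sup>2 \<le> (e N)\<^sup>2" for x by (intro power_mono bd) simp
      qed
      also have "\<dots> = (sqrt (2 * pi) * e N)\<^sup>2" using emeasure_circ by (simp add: measure_def power_mult_distrib)
      finally show ?thesis by (rule power2_le_imp_le) (use eN in simp)
    qed
    show ?thesis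
    proof (rule tendsto_sandwich[OF _ _ tendsto_const])
      show "(\<lambda>N. sqrt (2 * pi) * e N) \<longlonglongrightarrow> 0" by (rule tendsto_mult_right_zero[OF e0])
    qed (rule always_eventually, rule allI, rule L2T_norm_nonneg le)+
  qed
  then have "fourier_coeff g n = c n" for n by (rule fourier_coeff_of_limit[OF sqg])
  then have "AE \<theta> in lebesgue. f \<theta> = g \<theta>" by (intro L2T_eq_if_fourier_coeff_eq f gL) (simp add: c_def)
  with g_an show ?thesis by blast
qed

text \<open>The factorial decay of the coefficients beats every geometric growth.\<close>

lemma (in potential) coeff_decay_summable:
  assumes sys: "coeff_system q k c" and t: "t \<ge> 0" and r: "r > 0"
  shows "summable (\<lambda>j. (cmod (c (int j) t) + cmod (c (- int j) t)) * r ^ j)"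
proof -
  obtain B where B: "B \<ge> 0" "\<And>n s. s \<in> {0..t} \<Longrightarrow> cmod (c n s) \<le> B * A t ^ (nat \<bar>n\<bar> - 1) / fact (nat \<bar>n\<bar> - 1)"
    using coeff_decay[OF sys t] by blast
  have "(\<lambda>j. (A t * r) ^ j / fact j) sums exp (A t * r)"
    using exp_converges[of "A t * r"] by (simp add: divide_inverse mult.commute)
  then have "summable (\<lambda>j. 2 * B * r * ((A t * r) ^ j / fact j))" by (intro summable_mult sums_summable)
  moreover have "norm ((cmod (c (int (Suc j)) t) + cmod (c (- int (Suc j)) t)) * r ^ Suc j) \<le> 2 * B * r * ((A t * r) ^ j / fact j)" for j
  proof -
    have e: "nat \<bar>int (Suc j)\<bar> - 1 = j" "nat \<bar>- int (Suc j)\<bar> - 1 = j" by auto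
    have "cmod (c (int (Suc j)) t) + cmod (c (- int (Suc j)) t) \<le> B * A t ^ j / fact j + B * A t ^ j / fact j"
      using B(2)[of t "int (Suc j)"] B(2)[of t "- int (Suc j)"] t unfolding e by (intro add_mono) auto
    then have "(cmod (c (int (Suc j)) t) + cmod (c (- int (Suc j)) t)) * r ^ Suc j \<le> (B * A t ^ j / fact j + B * A t ^ j / fact j) * r ^ Suc j"
      using r by (intro mult_right_mono) auto
    also have "\<dots> = 2 * B * r * ((A t * r) ^ j / fact j)" by (simp add: power_mult_distrib field_simps)
    finally show ?thesis using r by simp
  qed
  ultimately have "summable (\<lambda>j. (cmod (c (int (Suc j)) t) + cmod (c (- int (Suc j)) t)) * r ^ Suc j)"
    by (rule summable_comparison_test'[of _ 0])
  then show ?thesis by (subst (asm) summable_Suc_iff[of "\<lambda>j. (cmod (c (int j) t) + cmod (c (- int j) t)) * r ^ j"])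
qed

section \<open>Uniform bounds of the Sobolev norms\<close>

lemma ennreal_le_if_le_on_positive_rationals:
  fixes \<phi> :: "real \<Rightarrow> real"
  assumes cont: "continuous_on UNIV \<phi>" and le: "\<And>r. r \<in> \<rat> \<Longrightarrow> r > 0 \<Longrightarrow> ennreal (\<phi> r) \<le> V" and t: "t > 0"
  shows "ennreal (\<phi> t) \<le> V"
proof (cases V)
  case (real v)
  have "\<exists>r\<in>\<rat>. t < r \<and> r < t + 1 / real (Suc n)" for n by (rule Rats_dense_in_real) simp
  then obtain r where r: "\<And>n. r n \<in> \<rat>" "\<And>n. t < r n" "\<And>n. r n < t + 1 / real (Suc n)" by metis
  have lim: "(\<lambda>n. t + 1 / real (Suc n)) \<longlonglongrightarrow> t"
    using tendsto_add[OF tendsto_const[of t] lim_1_over_n[THEN LIMSEQ_Suc]] by simp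
  have "r \<longlonglongrightarrow> t"
    by (rule tendsto_sandwich[OF _ _ tendsto_const lim]) (auto intro!: always_eventually less_imp_le r simp del: of_nat_Suc)
  then have "(\<lambda>n. \<phi> (r n)) \<longlonglongrightarrow> \<phi> t"
    using continuous_on_tendsto_compose[OF cont] by auto
  moreover have "\<phi> (r n) \<le> v" for n
  proof -
    have "r n > 0" using r(2)[of n] t by simp
    then have "ennreal (\<phi> (r n)) \<le> ennreal v" using le[OF r(1)] real by simp
    then show ?thesis using real by simp
  qed
  ultimately have "\<phi> t \<le> v" by (intro LIMSEQ_le_const2) auto
  then show ?thesis using real by (simp add: ennreal_leI)
qed simp

text \<open>Partial sums are continuous in time, so the uncountable supremum over times reduces to the rationals.\<close>

lemma (in potential) sobolev_sup_measurable:
  assumes sys: "\<And>k. coeff_system q k (c k)"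
  shows "(\<lambda>k. SUP t\<in>{0<..}. SUP F\<in>Collect finite. ennreal (\<Sum>n\<in>F. (1 + (of_int n)\<^sup>2) powr s * (cmod (c k n t))\<^sup>2))
    \<in> borel_measurable borel"
proof -
  define \<phi> where "\<phi> k F t = (\<Sum>n\<in>F. (1 + (real_of_int n)\<^sup>2) powr s * (cmod (c k n t))\<^sup>2)" for k F and t :: real
  have cont: "continuous_on UNIV (\<phi> k F)" for k F
    unfolding \<phi>_def using sys[of k] by (intro continuous_intros) (auto simp: coeff_system_def)
  have "(SUP t\<in>{0<..}. SUP F\<in>Collect finite. ennreal (\<phi> k F t))
      = (SUP t\<in>\<rat> \<inter> {0<..}. SUP F\<in>Collect finite. ennreal (\<phi> k F t))" (is "?L = ?R") for k
  proof (rule antisym)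
    show "?L \<le> ?R"
    proof (intro SUP_least)
      fix t :: real and F assume t: "t \<in> {0<..}" and F: "F \<in> Collect (finite :: int set \<Rightarrow> bool)"
      show "ennreal (\<phi> k F t) \<le> ?R"
      proof (rule ennreal_le_if_le_on_positive_rationals[OF cont])
        show "ennreal (\<phi> k F r) \<le> ?R" if "r \<in> \<rat>" "r > 0" for r
          by (rule SUP_upper2[of r], use that in simp, rule SUP_upper[OF F])
      qed (use t in simp)
    qed
    show "?R \<le> ?L" by (rule SUP_subset_mono) auto
  qed
  moreover have "(\<lambda>k. SUP t\<in>\<rat> \<inter> {0<..}. SUP F\<in>Collect finite. ennreal (\<phi> k F t)) \<in> borel_measurable borel"
  proof (intro borel_measurable_SUP)
    show "countable (\<rat> \<inter> {0<..} :: real set)" using countable_rat by blast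
    show "countable (Collect finite :: int set set)" by (rule countable_Collect_finite)
    fix t :: real and F :: "int set" assume "t \<in> \<rat> \<inter> {0<..}"
    then have [measurable]: "(\<lambda>k. c k n t) \<in> borel_measurable borel" for n
      by (intro coeff_measurable_k sys) simp
    show "(\<lambda>k. ennreal (\<phi> k F t)) \<in> borel_measurable borel" unfolding \<phi>_def by measurable
  qed
  ultimately show ?thesis unfolding \<phi>_def by simp
qed

lemma (in decaying_potential) uniform_sobolev_bound:
  assumes K: "K > 0" and m: "m \<ge> 1" and sys: "\<And>k. coeff_system q k (c k)"
  obtains Z where "Z \<in> borel_measurable borel" "(\<integral>\<^sup>+k. Z k \<partial>lborel) < \<infinity>"
    "\<And>k t s. k \<noteq> 0 \<Longrightarrow> \<bar>k\<bar> \<le> K \<Longrightarrow> Z k < \<infinity> \<Longrightarrow> t \<ge> 0 \<Longrightarrow> 0 \<le> s \<Longrightarrow> 2 * s \<le> real m \<Longrightarrow>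
      (SUP F\<in>Collect finite. ennreal (\<Sum>n\<in>F. (1 + (of_int n)\<^sup>2) powr s * (cmod (c k n t))\<^sup>2))
        \<le> ennreal (2 * (enn2real (Z k) + 1) powr s)"
proof -
  obtain Z where Z: "Z \<in> borel_measurable borel" "(\<integral>\<^sup>+k. Z k \<partial>lborel) < \<infinity>"
    "\<And>k t F. k \<noteq> 0 \<Longrightarrow> \<bar>k\<bar> \<le> K \<Longrightarrow> Z k < \<infinity> \<Longrightarrow> t \<ge> 0 \<Longrightarrow> finite F \<Longrightarrow>
      (\<Sum>n\<in>F. (1 + \<bar>of_int n\<bar>) ^ m * (cmod (c k n t))\<^sup>2) \<le> sqrt (enn2real (Z k) + 1) ^ m"
    using uniform_frequency_bound[OF K m sys] by blast
  have "(SUP F\<in>Collect finite. ennreal (\<Sum>n\<in>F. (1 + (of_int n)\<^sup>2) powr s * (cmod (c k n t))\<^sup>2))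
      \<le> ennreal (2 * (enn2real (Z k) + 1) powr s)"
    if h: "k \<noteq> 0" "\<bar>k\<bar> \<le> K" "Z k < \<infinity>" "t \<ge> 0" "0 \<le> s" "2 * s \<le> real m" for k t s
  proof (intro SUP_least ennreal_leI)
    fix F :: "int set" assume "F \<in> Collect finite"
    then have F: "finite F" by simp
    have z: "0 \<le> enn2real (Z k)" by simp
    have "(\<Sum>n\<in>F. (1 + (of_int n)\<^sup>2) powr s * (cmod (c k n t))\<^sup>2) \<le> 2 * sqrt (enn2real (Z k) + 1) powr (2 * s)"
      by (rule sobolev_partial_sum_le[OF F _ square_sum_le_1[OF sys h(4) F] _ Z(3)[OF h(1-4) F] h(5,6)]) (use z in auto)
    also have "sqrt (enn2real (Z k) + 1) powr (2 * s) = (enn2real (Z k) + 1) powr s"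
      using z by (simp add: powr_half_sqrt[symmetric] powr_powr)
    finally show "(\<Sum>n\<in>F. (1 + (of_int n)\<^sup>2) powr s * (cmod (c k n t))\<^sup>2) \<le> 2 * (enn2real (Z k) + 1) powr s" .
  qed
  with Z(1,2) show ?thesis by (rule that)
qed

text \<open>\<open>Z\<close> is integrable, hence finite almost everywhere; the exceptional sets for \<open>|k| \<le> i + 1\<close>, \<open>i\<close> and \<open>s\<close>
  natural numbers, have a null union.\<close>

lemma (in decaying_potential) sobolev_sum_bounded_AE:
  assumes sys: "\<And>k. coeff_system q k (c k)"
  shows "AE k in lborel. \<forall>s::nat. \<exists>B::real. \<forall>t\<ge>0.
    (SUP F\<in>Collect finite. ennreal (\<Sum>n\<in>F. (1 + (of_int n)\<^sup>2) powr (real s) * (cmod (c k n t))\<^sup>2)) \<le> ennreal B"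
proof -
  have "AE k in lborel. \<bar>k\<bar> \<le> real (Suc i) \<longrightarrow> (\<exists>B::real. \<forall>t\<ge>0.
    (SUP F\<in>Collect finite. ennreal (\<Sum>n\<in>F. (1 + (of_int n)\<^sup>2) powr (real s) * (cmod (c k n t))\<^sup>2)) \<le> ennreal B)" for i s :: nat
  proof -
    have K: "real (Suc i) > 0" and m: "Suc (2 * s) \<ge> 1" by auto
    obtain Z where Z: "Z \<in> borel_measurable borel" "(\<integral>\<^sup>+k. Z k \<partial>lborel) < \<infinity>"
      "\<And>k t r. k \<noteq> 0 \<Longrightarrow> \<bar>k\<bar> \<le> real (Suc i) \<Longrightarrow> Z k < \<infinity> \<Longrightarrow> t \<ge> 0 \<Longrightarrow> 0 \<le> r \<Longrightarrow> 2 * r \<le> real (Suc (2 * s)) \<Longrightarrow>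
        (SUP F\<in>Collect finite. ennreal (\<Sum>n\<in>F. (1 + (of_int n)\<^sup>2) powr r * (cmod (c k n t))\<^sup>2))
          \<le> ennreal (2 * (enn2real (Z k) + 1) powr r)"
      using uniform_sobolev_bound[OF K m sys] by blast
    have fin: "AE k in lborel. Z k \<noteq> \<infinity>"
      by (rule nn_integral_PInf_AE) (use Z(1,2) in \<open>auto simp: less_top\<close>)
    have nz: "AE k in lborel. k \<noteq> (0::real)" by (rule AE_lborel_singleton)
    from fin nz show ?thesis
    proof (eventually_elim, intro impI)
      fix k :: real assume k: "Z k \<noteq> \<infinity>" "k \<noteq> 0" "\<bar>k\<bar> \<le> real (Suc i)"
      then have k': "Z k < \<infinity>" by (simp add: less_top)
      have r: "0 \<le> real s" "2 * real s \<le> real (Suc (2 * s))" by simp_all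
      show "\<exists>B::real. \<forall>t\<ge>0. (SUP F\<in>Collect finite. ennreal (\<Sum>n\<in>F. (1 + (of_int n)\<^sup>2) powr (real s) * (cmod (c k n t))\<^sup>2)) \<le> ennreal B"
        using Z(3)[OF k(2,3) k' _ r] by blast
    qed
  qed
  then have "AE k in lborel. \<forall>i s. \<bar>k\<bar> \<le> real (Suc i) \<longrightarrow> (\<exists>B::real. \<forall>t\<ge>0.
    (SUP F\<in>Collect finite. ennreal (\<Sum>n\<in>F. (1 + (of_int n)\<^sup>2) powr (real s) * (cmod (c k n t))\<^sup>2)) \<le> ennreal B)"
    unfolding AE_all_countable by blast
  then show ?thesis
  proof eventually_elim
    case (elim k)
    obtain i where "\<bar>k\<bar> \<le> real i" using real_arch_simple by blast
    then have "\<bar>k\<bar> \<le> real (Suc i)" by simp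
    with elim show ?case by blast
  qed
qed

text \<open>The bound \<open>2 (Z + 1)\<^sup>s\<^sup>/\<^sup>2\<close> becomes linear in \<open>Z\<close> when raised to the power \<open>2/s\<close>.\<close>

lemma (in decaying_potential) sobolev_sup_Lp_finite:
  assumes sys: "\<And>k. coeff_system q k (c k)" and ab: "0 \<notin> {a<..<b}" and s: "s \<ge> 1"
  shows "Lp_norm (lebesgue_on {a<..<b}) (ennreal (2 / s))
    (\<lambda>k. SUP t\<in>{0<..}. SUP F\<in>Collect finite. ennreal (\<Sum>n\<in>F. (1 + (of_int n)\<^sup>2) powr (s / 2) * (cmod (c k n t))\<^sup>2)) < \<infinity>"
proof -
  define f where "f k = (SUP t\<in>{0<..}. SUP F\<in>Collect finite. ennreal (\<Sum>n\<in>F. (1 + (real_of_int n)\<^sup>2) powr (s / 2) * (cmod (c k n t))\<^sup>2))" for k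
  define K where "K = max \<bar>a\<bar> \<bar>b\<bar> + 1"
  define m where "m = nat \<lceil>s\<rceil>"
  have K: "K > 0" by (simp add: K_def)
  have m: "m \<ge> 1" "s \<le> real m" using s by (auto simp: m_def) linarith+
  obtain Z where Z: "Z \<in> borel_measurable borel" "(\<integral>\<^sup>+k. Z k \<partial>lborel) < \<infinity>"
    "\<And>k t r. k \<noteq> 0 \<Longrightarrow> \<bar>k\<bar> \<le> K \<Longrightarrow> Z k < \<infinity> \<Longrightarrow> t \<ge> 0 \<Longrightarrow> 0 \<le> r \<Longrightarrow> 2 * r \<le> real m \<Longrightarrow>
      (SUP F\<in>Collect finite. ennreal (\<Sum>n\<in>F. (1 + (of_int n)\<^sup>2) powr r * (cmod (c k n t))\<^sup>2))
        \<le> ennreal (2 * (enn2real (Z k) + 1) powr r)"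
    using uniform_sobolev_bound[OF K m(1) sys] by blast
  have fm: "f \<in> borel_measurable borel" unfolding f_def by (rule sobolev_sup_measurable[OF sys])
  then have "f \<in> borel_measurable lebesgue" by (intro measurable_completion) simp
  then have fm': "f \<in> borel_measurable (lebesgue_on {a<..<b})" by (rule measurable_restrict_space1)
  have le: "ennpow (f k) (2 / s) \<le> ennreal (2 powr (2 / s)) * (Z k + 1)" if k: "k \<in> {a<..<b}" for k
  proof (cases "Z k < \<infinity>")
    case True
    have "k \<noteq> 0" "\<bar>k\<bar> \<le> K" using k ab by (auto simp: K_def)
    then have "f k \<le> ennreal (2 * (enn2real (Z k) + 1) powr (s / 2))"
      unfolding f_def by (intro SUP_least Z(3)) (use True s m in auto)
    then have "ennpow (f k) (2 / s) \<le> ennpow (ennreal (2 * (enn2real (Z k) + 1) powr (s / 2))) (2 / s)"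
      by (rule ennpow_mono) (use s in simp)
    also have "\<dots> = ennreal ((2 * (enn2real (Z k) + 1) powr (s / 2)) powr (2 / s))"
      by (rule ennpow_ennreal) (use s in auto)
    also have "(2 * (enn2real (Z k) + 1) powr (s / 2)) powr (2 / s) = 2 powr (2 / s) * (enn2real (Z k) + 1)"
      using s by (simp add: powr_mult powr_powr add_nonneg_pos)
    also have "ennreal \<dots> = ennreal (2 powr (2 / s)) * (ennreal (enn2real (Z k)) + ennreal 1)"
      by (simp only: ennreal_mult' powr_ge_zero ennreal_plus enn2real_nonneg zero_le_one)
    also have "\<dots> = ennreal (2 powr (2 / s)) * (Z k + 1)" using True by simp
    finally show ?thesis .
  next
    case False
    then have "Z k = \<infinity>" by (simp flip: less_top)
    then show ?thesis by (simp add: ennreal_mult_top)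
  qed
  have "(\<integral>\<^sup>+k. ennpow (f k) (2 / s) \<partial>lebesgue_on {a<..<b}) = (\<integral>\<^sup>+k. ennpow (f k) (2 / s) * indicator {a<..<b} k \<partial>lebesgue)"
    by (rule nn_integral_restrict_space) simp
  also have "\<dots> = (\<integral>\<^sup>+k. ennpow (f k) (2 / s) * indicator {a<..<b} k \<partial>lborel)" by (rule nn_integral_completion)
  also have "\<dots> \<le> (\<integral>\<^sup>+k. ennreal (2 powr (2 / s)) * (Z k + indicator {a<..<b} k) \<partial>lborel)"
    by (rule nn_integral_mono) (use le in \<open>auto simp: indicator_def\<close>)
  also have "\<dots> = ennreal (2 powr (2 / s)) * ((\<integral>\<^sup>+k. Z k \<partial>lborel) + emeasure lborel {a<..<b})"
    using Z(1) by (simp add: nn_integral_cmult nn_integral_add)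
  also have "\<dots> < \<infinity>"
    using Z(2) emeasure_bounded_finite[OF bounded_Ioo, of a b] by (auto simp: ennreal_mult_less_top)
  finally have "(\<integral>\<^sup>+k. ennpow (f k) (2 / s) \<partial>lebesgue_on {a<..<b}) < \<infinity>" .
  from ennpow_less_top[OF this, of "1 / (2 / s)"]
  have "Lp_norm (lebesgue_on {a<..<b}) (ennreal (2 / s)) f < \<infinity>"
    using fm' s unfolding Lp_norm_def by simp
  then show ?thesis unfolding f_def .
qed

section \<open>The mass at high frequencies\<close>

lemma L2T_norm_high_freq_proj_le:
  assumes f: "f \<in> L2T"
    and le: "\<And>F. finite F \<Longrightarrow> (\<And>n. n \<in> F \<Longrightarrow> \<bar>n\<bar> \<ge> int N) \<Longrightarrow> (\<Sum>n\<in>F. (cmod (fourier_coeff f n))\<^sup>2) \<le> B"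
  shows "(L2T_norm (high_freq_proj N f))\<^sup>2 \<le> 2 * pi * B"
proof (rule LIMSEQ_le_const2[OF L2T_norm_high_freq_proj[OF f]], intro exI allI impI)
  fix M
  have "(\<Sum>n\<in>{-int M..int M}. if \<bar>n\<bar> \<ge> int N then (cmod (fourier_coeff f n))\<^sup>2 else 0)
      = (\<Sum>n\<in>{n \<in> {-int M..int M}. \<bar>n\<bar> \<ge> int N}. (cmod (fourier_coeff f n))\<^sup>2)"
    by (rule sum.inter_filter[symmetric]) simp
  also have "\<dots> \<le> B" by (rule le, rule finite_subset[of _ "{-int M..int M}"]) auto
  finally show "2 * pi * (\<Sum>n\<in>{-int M..int M}. if \<bar>n\<bar> \<ge> int N then (cmod (fourier_coeff f n))\<^sup>2 else 0) \<le> 2 * pi * B"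
    by (intro mult_left_mono) auto
qed

text \<open>\<open>S\<^sup>p \<le> a\<^sup>p\<^sup>-\<^sup>1 S\<close>: the log-convexity of \<open>L\<^sup>p\<close> norms between \<open>1\<close> and \<open>\<infinity>\<close>.\<close>

lemma nn_integral_powr_interpolation:
  assumes S [measurable]: "S \<in> borel_measurable M" and bd: "\<And>x. 0 \<le> S x" "\<And>x. S x \<le> a" and b: "(\<integral>\<^sup>+x. ennreal (S x) \<partial>M) \<le> ennreal b" and p: "p \<ge> 1"
  shows "(\<integral>\<^sup>+x. ennpow (ennreal (S x)) p \<partial>M) \<le> ennreal (a powr (p - 1) * b)"
proof -
  have "(\<integral>\<^sup>+x. ennpow (ennreal (S x)) p \<partial>M) \<le> (\<integral>\<^sup>+x. ennreal (a powr (p - 1)) * ennreal (S x) \<partial>M)"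
  proof (rule nn_integral_mono)
    fix x
    have e: "ennpow (ennreal (S x)) p = ennreal (S x powr p)" by (rule ennpow_ennreal) (use p bd in auto)
    have "S x powr p = S x powr (p - 1) * S x"
      using powr_add[of "S x" "p - 1" 1] bd(1)[of x] by (cases "S x = 0") auto
    also have "\<dots> \<le> a powr (p - 1) * S x" using bd p by (intro mult_right_mono powr_mono2) auto
    finally have "ennreal (S x powr p) \<le> ennreal (a powr (p - 1) * S x)" by (rule ennreal_leI)
    then show "ennpow (ennreal (S x)) p \<le> ennreal (a powr (p - 1)) * ennreal (S x)"
      by (simp only: e ennreal_mult' powr_ge_zero)
  qed
  also have "\<dots> = ennreal (a powr (p - 1)) * (\<integral>\<^sup>+x. ennreal (S x) \<partial>M)" by (rule nn_integral_cmult) simp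
  also have "\<dots> \<le> ennreal (a powr (p - 1)) * ennreal b" by (rule mult_left_mono[OF b]) simp
  finally show ?thesis by (simp only: ennreal_mult' powr_ge_zero)
qed

text \<open>The constants \<open>8 \<pi>\<close> and \<open>4 \<pi>\<^sup>2\<close> of the two endpoint bounds are merged into the larger one, which does
  not depend on \<open>r = 1/p\<close>.\<close>

lemma interpolation_constant:
  fixes N A I r :: real
  assumes "N > 0" "A \<ge> 0" "I \<ge> 0" "0 \<le> r" "r \<le> 1"
  shows "(8 * pi * A\<^sup>2 / N\<^sup>2) powr (1 - r) * (4 * pi\<^sup>2 * I) powr r
    \<le> 4 * pi\<^sup>2 * N powr (- 2 + 2 * r) * A powr (2 - 2 * r) * I powr r"
proof -
  have A2: "(A\<^sup>2) powr (1 - r) = A powr (2 - 2 * r)"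
    using assms(2) by (simp add: powr_powr algebra_simps flip: powr_numeral)
  have N2: "(1 / N\<^sup>2) powr (1 - r) = N powr (- 2 + 2 * r)"
    using assms(1) by (simp add: powr_divide powr_powr powr_minus_divide[symmetric] algebra_simps flip: powr_numeral)
  have "(8 * pi * A\<^sup>2 / N\<^sup>2) powr (1 - r) = (8 * pi) powr (1 - r) * A powr (2 - 2 * r) * N powr (- 2 + 2 * r)"
  proof -
    have "8 * pi * A\<^sup>2 / N\<^sup>2 = (8 * pi) * A\<^sup>2 * (1 / N\<^sup>2)" by simp
    then have "(8 * pi * A\<^sup>2 / N\<^sup>2) powr (1 - r) = (8 * pi) powr (1 - r) * (A\<^sup>2) powr (1 - r) * (1 / N\<^sup>2) powr (1 - r)"
      by (simp only: powr_mult)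
    then show ?thesis by (simp only: A2 N2)
  qed
  moreover have "(8 * pi) powr (1 - r) \<le> (4 * pi\<^sup>2) powr (1 - r)"
    using assms pi_ge_two by (intro powr_mono2) (auto simp: power2_eq_square)
  moreover have "(4 * pi\<^sup>2 * I) powr r = (4 * pi\<^sup>2) powr r * I powr r" by (simp add: powr_mult)
  ultimately have "(8 * pi * A\<^sup>2 / N\<^sup>2) powr (1 - r) * (4 * pi\<^sup>2 * I) powr r
      \<le> ((4 * pi\<^sup>2) powr (1 - r) * A powr (2 - 2 * r) * N powr (- 2 + 2 * r)) * ((4 * pi\<^sup>2) powr r * I powr r)"
    by (simp only:) (intro mult_right_mono, auto)
  also have "\<dots> = ((4 * pi\<^sup>2) powr (1 - r) * (4 * pi\<^sup>2) powr r) * N powr (- 2 + 2 * r) * A powr (2 - 2 * r) * I powr r"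
    by (simp only: mult_ac)
  also have "(4 * pi\<^sup>2) powr (1 - r) * (4 * pi\<^sup>2) powr r = 4 * pi\<^sup>2"
    by (simp flip: powr_add)
  finally show ?thesis .
qed

lemma (in potential) nn_integral_abs_q: "(\<integral>\<^sup>+t\<in>{0..T}. ennreal \<bar>q t\<bar> \<partial>lborel) = ennreal (A T)"
proof -
  have "integrable lborel (\<lambda>t. indicator {0..T} t * \<bar>q t\<bar>)"
    using q_abs_int[of T] by (simp add: set_integrable_def)
  then have "(\<integral>\<^sup>+t. ennreal (indicator {0..T} t * \<bar>q t\<bar>) \<partial>lborel) = ennreal (A T)"
    unfolding A_def set_lebesgue_integral_def by (subst nn_integral_eq_integral) auto
  moreover have "(\<integral>\<^sup>+t\<in>{0..T}. ennreal \<bar>q t\<bar> \<partial>lborel) = (\<integral>\<^sup>+t. ennreal (indicator {0..T} t * \<bar>q t\<bar>) \<partial>lborel)"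
    by (rule nn_integral_cong) (simp add: indicator_def)
  ultimately show ?thesis by simp
qed

text \<open>If \<open>q\<close> is not square integrable, the right-hand side of the following bound should be infinite; this
  excludes its being \<open>0 \<cdot> \<infinity> = 0\<close>.\<close>

lemma (in potential) square_integral_zero:
  assumes "A T = 0"
  shows "(\<integral>\<^sup>+t\<in>{0..T}. ennreal ((q t)\<^sup>2) \<partial>lborel) = 0"
proof -
  have "(\<integral>\<^sup>+t\<in>{0..T}. ennreal \<bar>q t\<bar> \<partial>lborel) = 0" using assms nn_integral_abs_q by simp
  then have "AE t in lborel. ennreal \<bar>q t\<bar> * indicator {0..T} t = 0"
    by (subst (asm) nn_integral_0_iff_AE) auto
  then have "AE t in lborel. ennreal ((q t)\<^sup>2) * indicator {0..T} t = 0"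
    by eventually_elim (auto simp: indicator_def split: if_splits)
  then show ?thesis by (subst nn_integral_0_iff_AE) auto
qed

text \<open>Interpolation between the pointwise bound \<open>8 \<pi> N\<^sup>-\<^sup>2 (\<integral>|q|)\<^sup>2\<close> and the integral bound \<open>4 \<pi>\<^sup>2 \<integral>q\<^sup>2\<close>.  The case
  \<open>p = \<infinity>\<close>, where \<open>r = 0\<close>, uses only the former.\<close>

theorem (in potential) high_freq_mass_Lp:
  assumes sys: "\<And>k. coeff_system q k (c k)" and u: "\<And>k. u k \<in> L2T" "\<And>k n. fourier_coeff (u k) n = c k n T"
    and N: "N \<ge> 1" and T: "T \<ge> 0" and p: "p \<ge> 2"
  defines "r \<equiv> enn2real (inverse p)"
  shows "Lp_norm lebesgue p (\<lambda>k. ennreal ((L2T_norm (high_freq_proj N (u k)))\<^sup>2))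
    \<le> ennreal (4 * pi\<^sup>2) * ennreal (real N powr (- 2 + 2 * r))
      * ennpow (\<integral>\<^sup>+t\<in>{0..T}. ennreal \<bar>q t\<bar> \<partial>lborel) (2 - 2 * r)
      * ennpow (\<integral>\<^sup>+t\<in>{0..T}. ennreal ((q t)\<^sup>2) \<partial>lborel) r"
proof -
  define S where "S k = (L2T_norm (high_freq_proj N (u k)))\<^sup>2" for k
  define a where "a = 8 * pi * (A T)\<^sup>2 / (real N)\<^sup>2"
  have Sm: "S \<in> borel_measurable borel"
    unfolding S_def
  proof (rule borel_measurable_LIMSEQ_metric[OF _ L2T_norm_high_freq_proj[OF u(1)]])
    have [measurable]: "(\<lambda>k. c k n T) \<in> borel_measurable borel" for n by (rule coeff_measurable_k[OF sys T])
    show "(\<lambda>k. 2 * pi * (\<Sum>n\<in>{-int M..int M}. if \<bar>n\<bar> \<ge> int N then (cmod (fourier_coeff (u k) n))\<^sup>2 else 0)) \<in> borel_measurable borel" for M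
      unfolding u(2) by measurable
  qed
  then have Sml: "S \<in> borel_measurable lebesgue" by (intro measurable_completion) simp
  have S0: "0 \<le> S k" for k by (simp add: S_def)
  have Sa: "S k \<le> a" for k
    using L2T_norm_high_freq_proj_le[OF u(1)[of k], of N "4 * (A T)\<^sup>2 / (real N)\<^sup>2"] high_freq_bound[OF sys T N]
    by (simp add: S_def a_def u(2))
  have A0: "0 \<le> A T" by (rule A_nonneg)
  have r: "0 \<le> r" "r \<le> 1 / 2"
  proof -
    show "r \<le> 1 / 2"
    proof (cases p)
      case (real x)
      then have "ennreal 2 \<le> ennreal x" using p by simp
      then have "x \<ge> 2" using real(1) by (simp only: ennreal_le_iff)
      then show ?thesis unfolding r_def real(2) by (simp add: inverse_ennreal field_simps)
    qed (simp add: r_def)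
  qed (simp add: r_def)
  have eA: "ennpow (\<integral>\<^sup>+t\<in>{0..T}. ennreal \<bar>q t\<bar> \<partial>lborel) (2 - 2 * r) = ennreal (A T powr (2 - 2 * r))"
    unfolding nn_integral_abs_q by (rule ennpow_ennreal) (use r A0 in auto)
  show ?thesis
  proof (cases "p = \<infinity>")
    case True
    then have r0: "r = 0" by (simp add: r_def)
    have "a \<le> 4 * pi\<^sup>2 * real N powr (- 2) * A T powr 2"
    proof -
      have "real N powr (- 2) = 1 / (real N)\<^sup>2" using N by (simp add: powr_minus_divide)
      moreover have "8 * pi * ((A T)\<^sup>2 / (real N)\<^sup>2) \<le> 4 * pi\<^sup>2 * ((A T)\<^sup>2 / (real N)\<^sup>2)"
        using pi_ge_two by (intro mult_right_mono) (auto simp: power2_eq_square)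
      ultimately show ?thesis using A0 by (simp add: a_def)
    qed
    then have "esssup lebesgue (\<lambda>k. ennreal (S k)) \<le> ennreal (4 * pi\<^sup>2 * real N powr (- 2) * A T powr 2)"
      using Sml by (intro esssup_I AE_I2 ennreal_leI order_trans[OF Sa]) auto
    then show ?thesis using Sml True unfolding eA unfolding Lp_norm_def S_def[symmetric]
      by (simp add: r0 ennpow_def ennreal_mult')
  next
    case False
    then obtain p' where p': "p = ennreal p'" "p' \<ge> 0" by (cases p) auto
    have p2: "p' \<ge> 2" using p p' by (simp add: numeral_le_ennreal_iff flip: ennreal_numeral)
    have rp: "r = 1 / p'" using p2 unfolding r_def p'(1) by (simp add: inverse_ennreal inverse_eq_divide)
    have r0: "r > 0" using p2 by (simp add: rp)
    have norm_eq: "Lp_norm lebesgue p (\<lambda>k. ennreal (S k)) = ennpow (\<integral>\<^sup>+k. ennpow (ennreal (S k)) p' \<partial>lborel) r"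
      using Sml False p'(2) by (simp add: Lp_norm_def p'(1) rp nn_integral_completion)
    show ?thesis
    proof (cases "(\<integral>\<^sup>+t\<in>{0..T}. ennreal ((q t)\<^sup>2) \<partial>lborel) = \<infinity>")
      case True
      have "A T > 0"
        using square_integral_zero[of T] True A0 by (cases "A T = 0") auto
      then have "ennreal (4 * pi\<^sup>2) * ennreal (real N powr (- 2 + 2 * r)) * ennreal (A T powr (2 - 2 * r)) \<noteq> 0"
        using N by auto
      then show ?thesis unfolding eA True using r0 by (simp add: ennpow_def ennreal_mult_top)
    next
      case False
      define I where "I = (LINT t:{0..T}|lborel. (q t)\<^sup>2)"
      have nn: "(\<integral>\<^sup>+t\<in>{0..T}. ennreal ((q t)\<^sup>2) \<partial>lborel) = (\<integral>\<^sup>+t. ennreal (indicator {0..T} t * (q t)\<^sup>2) \<partial>lborel)"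
        by (rule nn_integral_cong) (simp add: indicator_def)
      have q2: "set_integrable lborel {0..T} (\<lambda>t. (q t)\<^sup>2)"
        unfolding set_integrable_def using False nn
        by (intro integrableI_nonneg) (auto simp: less_top)
      have I0: "I \<ge> 0" unfolding I_def set_lebesgue_integral_def by (rule Bochner_Integration.integral_nonneg) simp
      have eI: "(\<integral>\<^sup>+t\<in>{0..T}. ennreal ((q t)\<^sup>2) \<partial>lborel) = ennreal I"
        unfolding nn I_def set_lebesgue_integral_def
        by (subst nn_integral_eq_integral) (use q2 in \<open>auto simp: set_integrable_def\<close>)
      have S1: "S k \<le> 4 * pi * (1 - Re (c k 0 T))" for k
      proof -
        have "(\<Sum>n\<in>F. (cmod (fourier_coeff (u k) n))\<^sup>2) \<le> 2 * (1 - Re (c k 0 T))"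
          if F: "finite F" "\<And>n. n \<in> F \<Longrightarrow> \<bar>n\<bar> \<ge> int N" for F
        proof -
          have "0 \<notin> F" using F(2)[of 0] N by auto
          from off_vacuum_mass_le[OF sys T F(1) this] show ?thesis by (simp add: u(2))
        qed
        then have "S k \<le> 2 * pi * (2 * (1 - Re (c k 0 T)))"
          unfolding S_def by (rule L2T_norm_high_freq_proj_le[OF u(1)])
        then show ?thesis by (simp add: algebra_simps)
      qed
      have [measurable]: "(\<lambda>k. c k 0 T) \<in> borel_measurable borel" by (rule coeff_measurable_k[OF sys T])
      have "(\<integral>\<^sup>+k. ennreal (S k) \<partial>lborel) \<le> (\<integral>\<^sup>+k. ennreal (4 * pi) * ennreal (1 - Re (c k 0 T)) \<partial>lborel)"
        by (intro nn_integral_mono) (simp add: S1 ennreal_leI flip: ennreal_mult')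
      also have "\<dots> = ennreal (4 * pi) * (\<integral>\<^sup>+k. ennreal (1 - Re (c k 0 T)) \<partial>lborel)"
        by (rule nn_integral_cmult) simp
      also have "\<dots> \<le> ennreal (4 * pi) * ennreal (pi * I)"
        unfolding I_def by (rule mult_left_mono[OF vacuum_L1[OF sys T q2]]) simp
      also have "\<dots> = ennreal (4 * pi * (pi * I))" by (rule ennreal_mult'[symmetric]) simp
      also have "4 * pi * (pi * I) = 4 * pi\<^sup>2 * I" by (simp add: power2_eq_square)
      finally have "(\<integral>\<^sup>+k. ennreal (S k) \<partial>lborel) \<le> ennreal (4 * pi\<^sup>2 * I)" .
      then have "(\<integral>\<^sup>+k. ennpow (ennreal (S k)) p' \<partial>lborel) \<le> ennreal (a powr (p' - 1) * (4 * pi\<^sup>2 * I))"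
        by (rule nn_integral_powr_interpolation[rotated 3]) (use Sm S0 Sa p2 in auto)
      then have "ennpow (\<integral>\<^sup>+k. ennpow (ennreal (S k)) p' \<partial>lborel) r \<le> ennpow (ennreal (a powr (p' - 1) * (4 * pi\<^sup>2 * I))) r"
        by (rule ennpow_mono[OF _ r(1)])
      also have "\<dots> = ennreal ((a powr (p' - 1) * (4 * pi\<^sup>2 * I)) powr r)"
        by (rule ennpow_ennreal) (use r0 I0 in auto)
      also have "(a powr (p' - 1) * (4 * pi\<^sup>2 * I)) powr r = a powr (1 - r) * (4 * pi\<^sup>2 * I) powr r"
      proof -
        have "(p' - 1) * r = 1 - r" using p2 by (simp add: rp field_simps)
        then show ?thesis using I0 by (simp only: powr_mult powr_powr)
      qed
      also have "\<dots> \<le> 4 * pi\<^sup>2 * real N powr (- 2 + 2 * r) * A T powr (2 - 2 * r) * I powr r"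
        unfolding a_def by (rule interpolation_constant) (use N A0 I0 r in auto)
      also have "ennreal \<dots> = ennreal (4 * pi\<^sup>2) * ennreal (real N powr (- 2 + 2 * r)) * ennreal (A T powr (2 - 2 * r)) * ennreal (I powr r)"
        by (simp add: ennreal_mult')
      also have "ennreal (I powr r) = ennpow (ennreal I) r" by (rule ennpow_ennreal[symmetric]) (use r0 I0 in auto)
      finally show ?thesis unfolding eA eI unfolding S_def[symmetric] norm_eq by (simp add: ennreal_leI)
    qed
  qed
qed


section \<open>Solutions with decaying potentials\<close>

theorem theorem5p4:
  fixes \<gamma> :: real and q :: "real \<Rightarrow> real" and \<psi> :: "real \<Rightarrow> real \<Rightarrow> real \<Rightarrow> complex"
  assumes gamma: "\<gamma> > 3 / 4"
    and q_loc: "\<And>T. T > 0 \<Longrightarrow> set_integrable lebesgue {0..T} q"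
    and q_decay: "\<exists>C. \<forall>t>0. \<bar>q t\<bar> \<le> C * t powr (- \<gamma>)"
    and sol: "\<And>k. mild_solution q k (\<lambda>t \<theta>. \<psi> t \<theta> k)"
  shows
    "(AE k in lebesgue.
        (\<forall>s::nat. s \<ge> 1 \<longrightarrow>
           (SUP t\<in>{0<..}. sobolev_norm (real s) (\<lambda>\<theta>. \<psi> t \<theta> k)) < \<infinity>) \<and>
        (\<forall>t\<ge>0. \<exists>g. real_analytic g \<and> (AE \<theta> in lebesgue. \<psi> t \<theta> k = g \<theta>)))
     \<and>
     (\<forall>a b s::real. 0 \<notin> {a<..<b} \<longrightarrow> s \<ge> 1 \<longrightarrow>
        Lp_norm (lebesgue_on {a<..<b}) (ennreal (2 / s))
          (\<lambda>k. SUP t\<in>{0<..}. (sobolev_norm (s / 2) (\<lambda>\<theta>. \<psi> t \<theta> k))\<^sup>2) < \<infinity>)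
     \<and>
     (\<forall>p::ennreal. p \<ge> 2 \<longrightarrow>
        (\<exists>C::real. C > 0 \<and>
          (\<forall>N::nat. \<forall>T::real. N > 1 \<longrightarrow> T > 0 \<longrightarrow>
             Lp_norm lebesgue p
               (\<lambda>k. ennreal ((L2T_norm (high_freq_proj N (\<lambda>\<theta>. \<psi> T \<theta> k)))\<^sup>2))
             \<le> ennreal C * ennreal (real N powr (- 2 + 2 * enn2real (inverse p)))
                * ennpow (\<integral>\<^sup>+t\<in>{0..T}. ennreal \<bar>q t\<bar> \<partial>lebesgue) (2 - 2 * enn2real (inverse p))
                * ennpow (\<integral>\<^sup>+t\<in>{0..T}. ennreal ((q t)\<^sup>2) \<partial>lebesgue) (enn2real (inverse p)))))"
proof -
  obtain q' where q': "q' \<in> borel_measurable borel" "AE t in lborel. t \<ge> 0 \<longrightarrow> q' t = q t"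
    "AE t in lebesgue. t \<ge> 0 \<longrightarrow> q' t = q t" "\<And>T. set_integrable lborel {0..T} q'"
    using borel_potential[OF q_loc] by blast
  obtain C where C: "\<And>t. t > 0 \<Longrightarrow> \<bar>q t\<bar> \<le> C * t powr (- \<gamma>)" using q_decay by blast
  have C0: "C \<ge> 0" using C[of 1] by simp
  \<comment> \<open>any exponent strictly between \<open>3/4\<close> and \<open>1\<close> serves for the second argument\<close>
  define \<gamma>' where "\<gamma>' = min \<gamma> (7 / 8)"
  interpret decaying_potential q' \<gamma>' C
  proof
    show "AE t in lborel. t \<ge> 1 \<longrightarrow> \<bar>q' t\<bar> \<le> C * t powr (- \<gamma>')"
      using q'(2)
    proof (eventually_elim, intro impI)
      fix t :: real assume t: "t \<ge> 0 \<longrightarrow> q' t = q t" "t \<ge> 1"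
      have "\<bar>q' t\<bar> \<le> C * t powr (- \<gamma>)" using C[of t] t by simp
      also have "\<dots> \<le> C * t powr (- \<gamma>')"
        using t(2) C0 by (intro mult_left_mono powr_mono) (auto simp: \<gamma>'_def)
      finally show "\<bar>q' t\<bar> \<le> C * t powr (- \<gamma>')" .
    qed
  qed (use q' C0 gamma in \<open>auto simp: \<gamma>'_def\<close>)
  define c where "c k n t = fourier_coeff (\<lambda>\<theta>. \<psi> (max 0 t) \<theta> k) n" for k n t
  have sys: "coeff_system q' k (c k)" for k
    unfolding c_def[abs_def] by (rule mild_solution_coeff_system[OF sol q'(1,3)])
  have L2: "(\<lambda>\<theta>. \<psi> t \<theta> k) \<in> L2T" if "t \<ge> 0" for t k
    using mild_solution_L2T[OF sol that] .
  have fc: "fourier_coeff (\<lambda>\<theta>. \<psi> t \<theta> k) n = c k n t" if "t \<ge> 0" for t k n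
    using that by (simp add: c_def max_absorb2)
  have sob: "sobolev_sum s (\<lambda>\<theta>. \<psi> t \<theta> k) = (SUP F\<in>Collect finite. ennreal (\<Sum>n\<in>F. (1 + (of_int n)\<^sup>2) powr s * (cmod (c k n t))\<^sup>2))"
    if "t > 0" for s t k
    using that by (simp add: sobolev_sum_def fc)
  have analytic: "\<exists>g. real_analytic g \<and> (AE \<theta> in lebesgue. \<psi> t \<theta> k = g \<theta>)" if t: "t \<ge> 0" for t k
  proof (rule L2T_real_analytic[OF L2[OF t]])
    fix r :: real assume "r > 0"
    then show "summable (\<lambda>j. (cmod (fourier_coeff (\<lambda>\<theta>. \<psi> t \<theta> k) (int j)) + cmod (fourier_coeff (\<lambda>\<theta>. \<psi> t \<theta> k) (- int j))) * r ^ j)"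
      unfolding fc[OF t] by (rule coeff_decay_summable[OF sys t])
  qed
  have bounded: "AE k in lebesgue. \<forall>s::nat. (SUP t\<in>{0<..}. sobolev_norm (real s) (\<lambda>\<theta>. \<psi> t \<theta> k)) < \<infinity>"
    using AE_completion[OF sobolev_sum_bounded_AE[OF sys]]
  proof (eventually_elim, intro allI)
    fix k :: real and s :: nat
    assume "\<forall>s::nat. \<exists>B::real. \<forall>t\<ge>0. (SUP F\<in>Collect finite. ennreal (\<Sum>n\<in>F. (1 + (of_int n)\<^sup>2) powr (real s) * (cmod (c k n t))\<^sup>2)) \<le> ennreal B"
    then obtain B :: real where B: "\<And>t. t \<ge> 0 \<Longrightarrow> (SUP F\<in>Collect finite. ennreal (\<Sum>n\<in>F. (1 + (of_int n)\<^sup>2) powr (real s) * (cmod (c k n t))\<^sup>2)) \<le> ennreal B"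
      by blast
    have "(SUP t\<in>{0<..}. sobolev_norm (real s) (\<lambda>\<theta>. \<psi> t \<theta> k)) \<le> ennpow (ennreal B) (1 / 2)"
    proof (rule SUP_least)
      fix t :: real assume "t \<in> {0<..}"
      then have t: "t > 0" by simp
      then show "sobolev_norm (real s) (\<lambda>\<theta>. \<psi> t \<theta> k) \<le> ennpow (ennreal B) (1 / 2)"
        unfolding sobolev_norm_eq sob[OF t] by (intro ennpow_mono B) simp_all
    qed
    also have "\<dots> < \<infinity>" by (rule ennpow_less_top) simp
    finally show "(SUP t\<in>{0<..}. sobolev_norm (real s) (\<lambda>\<theta>. \<psi> t \<theta> k)) < \<infinity>" .
  qed
  have integrable_k: "Lp_norm (lebesgue_on {a<..<b}) (ennreal (2 / s))
      (\<lambda>k. SUP t\<in>{0<..}. (sobolev_norm (s / 2) (\<lambda>\<theta>. \<psi> t \<theta> k))\<^sup>2) < \<infinity>"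
    if ab: "0 \<notin> {a<..<b}" and s: "s \<ge> 1" for a b s :: real
  proof -
    have "(SUP t\<in>{0<..}. (sobolev_norm (s / 2) (\<lambda>\<theta>. \<psi> t \<theta> k))\<^sup>2)
        = (SUP t\<in>{0<..}. SUP F\<in>Collect finite. ennreal (\<Sum>n\<in>F. (1 + (of_int n)\<^sup>2) powr (s / 2) * (cmod (c k n t))\<^sup>2))" for k
      unfolding sobolev_norm_eq ennpow_half_square by (intro SUP_cong refl sob) simp
    then show ?thesis using sobolev_sup_Lp_finite[OF sys ab s] by simp
  qed
  have Lq: "(\<integral>\<^sup>+t\<in>{0..T}. ennreal (h (q t)) \<partial>lebesgue) = (\<integral>\<^sup>+t\<in>{0..T}. ennreal (h (q' t)) \<partial>lborel)" for h :: "real \<Rightarrow> real" and T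
  proof -
    have "AE t in lebesgue. ennreal (h (q t)) * indicator {0..T} t = ennreal (h (q' t)) * indicator {0..T} t"
      using q'(3) by eventually_elim (auto simp: indicator_def)
    then have "(\<integral>\<^sup>+t\<in>{0..T}. ennreal (h (q t)) \<partial>lebesgue) = (\<integral>\<^sup>+t\<in>{0..T}. ennreal (h (q' t)) \<partial>lebesgue)"
      by (rule nn_integral_cong_AE)
    then show ?thesis by (simp add: nn_integral_completion)
  qed
  have high_freq: "Lp_norm lebesgue p (\<lambda>k. ennreal ((L2T_norm (high_freq_proj N (\<lambda>\<theta>. \<psi> T \<theta> k)))\<^sup>2))
      \<le> ennreal (4 * pi\<^sup>2) * ennreal (real N powr (- 2 + 2 * enn2real (inverse p)))
        * ennpow (\<integral>\<^sup>+t\<in>{0..T}. ennreal \<bar>q t\<bar> \<partial>lebesgue) (2 - 2 * enn2real (inverse p))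
        * ennpow (\<integral>\<^sup>+t\<in>{0..T}. ennreal ((q t)\<^sup>2) \<partial>lebesgue) (enn2real (inverse p))"
    if p: "p \<ge> 2" and N: "N > 1" and T: "T > 0" for p N T
    unfolding Lq[of abs] Lq[of "\<lambda>x. x\<^sup>2"]
    by (rule high_freq_mass_Lp[OF sys L2 fc _ _ p]) (use N T in auto)
  show ?thesis
  proof (intro conjI)
    show "AE k in lebesgue. (\<forall>s::nat. s \<ge> 1 \<longrightarrow> (SUP t\<in>{0<..}. sobolev_norm (real s) (\<lambda>\<theta>. \<psi> t \<theta> k)) < \<infinity>) \<and>
        (\<forall>t\<ge>0. \<exists>g. real_analytic g \<and> (AE \<theta> in lebesgue. \<psi> t \<theta> k = g \<theta>))"
      using bounded by eventually_elim (use analytic in blast)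
    show "\<forall>a b s::real. 0 \<notin> {a<..<b} \<longrightarrow> s \<ge> 1 \<longrightarrow> Lp_norm (lebesgue_on {a<..<b}) (ennreal (2 / s))
          (\<lambda>k. SUP t\<in>{0<..}. (sobolev_norm (s / 2) (\<lambda>\<theta>. \<psi> t \<theta> k))\<^sup>2) < \<infinity>"
      using integrable_k by blast
    have "4 * pi\<^sup>2 > 0" by simp
    then show "\<forall>p::ennreal. p \<ge> 2 \<longrightarrow> (\<exists>C::real. C > 0 \<and> (\<forall>N::nat. \<forall>T::real. N > 1 \<longrightarrow> T > 0 \<longrightarrow>
             Lp_norm lebesgue p (\<lambda>k. ennreal ((L2T_norm (high_freq_proj N (\<lambda>\<theta>. \<psi> T \<theta> k)))\<^sup>2))
             \<le> ennreal C * ennreal (real N powr (- 2 + 2 * enn2real (inverse p)))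
                * ennpow (\<integral>\<^sup>+t\<in>{0..T}. ennreal \<bar>q t\<bar> \<partial>lebesgue) (2 - 2 * enn2real (inverse p))
                * ennpow (\<integral>\<^sup>+t\<in>{0..T}. ennreal ((q t)\<^sup>2) \<partial>lebesgue) (enn2real (inverse p))))"
      using high_freq by blast
  qed
qed

end
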